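(* Let $(\mathcal A,M,\rho)$ be an anchored bundle over a connected paracompact smooth manifold $M$. (i) $(\mathcal A,M,\rho)$ is a foliated anchored bundle if and only if there exists an almost Lie bracket $[\,,\,]_{\mathcal A}$ on $(\mathcal A,M,\rho)$ such that $(\mathcal A,M,\rho,[\,,\,]_{\mathcal A})$ is a pre-Lie algebroid. (ii) Suppose $(\mathcal A,M,\rho)$ is a foliated anchored bundle and let $N$ be a leaf of the foliation defined by the integrable distribution $\rho(\mathcal A)$. Put $\mathcal A_N=\tau^{-1}(N)$ and $\mathcal K_N=\mathcal A_N\cap\ker\rho$. Then $\mathcal K_N$ is a subbundle of $\mathcal A_N$, and the restriction of $\rho$ to $\mathcal A_N$ induces a quotient morphism $\rho_N:\mathcal A_N/\mathcal K_N\to TM$ which is an isomorphism onto $TN$. Moreover, any almost Lie bracket $[\,,\,]_{\mathcal A}$ such that $(\mathcal A,M,\rho,[\,,\,]_{\mathcal A})$ is a pre-Lie algebroid induces (by restriction to $N$ and projection) a Lie bracket $[\,,\,]_N$ on the anchored bundle $(\mathcal A_N/\mathcal K_N,N,\rho_N)$, and $[\,,\,]_N$ does not depend on the choice of such an almost Lie bracket $[\,,\,]_{\mathcal A}$. In particular $\rho_N$ gives rise to an isomorphism between the Lie algebra of sections of $\mathcal A_N/\mathcal K_N$ with bracket $[\,,\,]_N$ and the Lie algebra of vector fields on $N$ with the usual Lie bracket.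
   Context: An anchored bundle $(\mathcal A,M,\rho)$ is a smooth vector bundle $\tau:\mathcal A\to M$ of finite rank with a vector bundle morphism $\rho:\mathcal A\to TM$ over the identity (the anchor). $\Xi(\mathcal A)$ denotes the $C^\infty(M)$-module of smooth sections. An almost Lie bracket on it is an $\mathbb R$-bilinear antisymmetric map $[\,,\,]:\Xi(\mathcal A)\times\Xi(\mathcal A)\to\Xi(\mathcal A)$ with $[X,fY]=f[X,Y]+df(\rho(X))Y$ for all $f\in C^\infty(M)$ (Jacobi is not required); it is a Lie bracket if it also satisfies the Jacobi identity. $(\mathcal A,M,\rho,[\,,\,]_{\mathcal A})$ is a pre-Lie algebroid if $[\,,\,]_{\mathcal A}$ is an almost Lie bracket and $\rho([X,Y]_{\mathcal A})=[\rho X,\rho Y]$ for all sections $X,Y$. The anchored bundle is called foliated if the module $\underline\rho(\Xi(\mathcal A))=\{\rho\circ s: s\in\Xi(\mathcal A)\}$ of vector fields is involutive, i.e. closed under the Lie bracket of vector fields. In that case the distribution $\rho(\mathcal A)$, $x\mapsto\rho(\mathcal A_x)\subset T_xM$, is integrable in the sense of Stefan–Sussmann; its leaves are its maximal integral manifolds, which are connected immersed submanifolds $N$ with $T_xN=\rho(\mathcal A_x)$ for $x\in N$. *)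

theory Defs
  imports "HOL-Analysis.Analysis"
begin

text \<open>Dimensions and ranks occurring below (leaves, kernels, quotients) depend on the leaf and may be
  zero, so they are natural numbers and \<open>\<real>\<^sup>n\<close> is the library space \<^const>\<open>Euclidean_space\<close>, whose
  points are the \<open>p :: nat \<Rightarrow> real\<close> with \<open>p i = 0\<close> for \<open>i \<ge> n\<close>.\<close>

subsection \<open>Smooth functions on open subsets of \<open>\<real>\<^sup>n\<close>\<close>

definition partial_deriv :: "nat \<Rightarrow> ((nat \<Rightarrow> real) \<Rightarrow> real) \<Rightarrow> (nat \<Rightarrow> real) \<Rightarrow> real" where
  "partial_deriv i f p = deriv (\<lambda>t. f (p(i := t))) (p i)"

primrec Ck_on :: "nat \<Rightarrow> nat \<Rightarrow> (nat \<Rightarrow> real) set \<Rightarrow> ((nat \<Rightarrow> real) \<Rightarrow> real) \<Rightarrow> bool" where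
  "Ck_on 0 n U f \<longleftrightarrow> continuous_map (subtopology (Euclidean_space n) U) euclideanreal f"
| "Ck_on (Suc k) n U f \<longleftrightarrow>
     continuous_map (subtopology (Euclidean_space n) U) euclideanreal f \<and>
     (\<forall>i<n. (\<forall>p\<in>U. (\<lambda>t. f (p(i := t))) field_differentiable at (p i)) \<and>
             Ck_on k n U (partial_deriv i f))"

definition smooth_on :: "nat \<Rightarrow> (nat \<Rightarrow> real) set \<Rightarrow> ((nat \<Rightarrow> real) \<Rightarrow> real) \<Rightarrow> bool" where
  "smooth_on n U f \<longleftrightarrow> openin (Euclidean_space n) U \<and> (\<forall>k. Ck_on k n U f)"


subsection \<open>Smooth manifolds\<close>

text \<open>A manifold carries its own topology on a subset of the type \<open>'a\<close>, so that a leaf can have a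
  topology finer than the induced one. The atlas need not be maximal.\<close>

record 'a manifold =
  mtop :: "'a topology"
  mdim :: nat
  mcharts :: "('a set \<times> ('a \<Rightarrow> nat \<Rightarrow> real)) set"

abbreviation mpoints :: "'a manifold \<Rightarrow> 'a set" where
  "mpoints M \<equiv> topspace (mtop M)"

definition smooth_manifold :: "'a manifold \<Rightarrow> bool" where
  "smooth_manifold M \<longleftrightarrow>
     Hausdorff_space (mtop M) \<and>
     (\<Union>(U, \<phi>)\<in>mcharts M. U) = mpoints M \<and>
     (\<forall>(U, \<phi>)\<in>mcharts M.
        openin (mtop M) U \<and> openin (Euclidean_space (mdim M)) (\<phi> ` U) \<and>
        homeomorphic_map (subtopology (mtop M) U)
          (subtopology (Euclidean_space (mdim M)) (\<phi> ` U)) \<phi>) \<and>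
     (\<forall>(U, \<phi>)\<in>mcharts M. \<forall>(V, \<psi>)\<in>mcharts M. \<forall>i<mdim M.
        smooth_on (mdim M) (\<phi> ` (U \<inter> V)) (\<lambda>p. \<psi> (inv_into U \<phi> p) i))"

definition paracompact_space :: "'a topology \<Rightarrow> bool" where
  "paracompact_space X \<longleftrightarrow>
     (\<forall>\<U>. (\<forall>U\<in>\<U>. openin X U) \<and> \<Union>\<U> = topspace X \<longrightarrow>
        (\<exists>\<V>. (\<forall>V\<in>\<V>. openin X V \<and> (\<exists>U\<in>\<U>. V \<subseteq> U)) \<and> \<Union>\<V> = topspace X \<and>
             locally_finite_in X \<V>))"

definition smooth_fun_on :: "'a manifold \<Rightarrow> 'a set \<Rightarrow> ('a \<Rightarrow> real) \<Rightarrow> bool" where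
  "smooth_fun_on M W f \<longleftrightarrow> openin (mtop M) W \<and>
     (\<forall>(U, \<phi>)\<in>mcharts M. smooth_on (mdim M) (\<phi> ` (U \<inter> W)) (\<lambda>p. f (inv_into U \<phi> p)))"

definition smooth_near :: "'a manifold \<Rightarrow> 'a \<Rightarrow> ('a \<Rightarrow> real) \<Rightarrow> bool" where
  "smooth_near M x f \<longleftrightarrow> (\<exists>W. x \<in> W \<and> smooth_fun_on M W f)"

definition smooth_map :: "'a manifold \<Rightarrow> 'c manifold \<Rightarrow> ('a \<Rightarrow> 'c) \<Rightarrow> bool" where
  "smooth_map M M' F \<longleftrightarrow> continuous_map (mtop M) (mtop M') F \<and>
     (\<forall>(V, \<psi>)\<in>mcharts M'. \<forall>i<mdim M'.
        smooth_fun_on M {x \<in> mpoints M. F x \<in> V} (\<lambda>x. \<psi> (F x) i))"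


subsection \<open>Smooth vector bundles\<close>

text \<open>A bundle is given by its total space, projection, fibrewise operations and a bundle atlas of
  local trivializations \<open>(U, \<psi>)\<close>, where \<open>\<psi>\<close> is the \<open>\<real>\<^sup>r\<close>-component of
  \<open>\<tau>\<inverse>(U) \<rightarrow> U \<times> \<real>\<^sup>r\<close>.\<close>

record ('a, 'b) vbundle =
  btotal :: "'b set"
  bproj :: "'b \<Rightarrow> 'a"
  badd :: "'b \<Rightarrow> 'b \<Rightarrow> 'b"
  bscale :: "real \<Rightarrow> 'b \<Rightarrow> 'b"
  brank :: nat
  btrivs :: "('a set \<times> ('b \<Rightarrow> nat \<Rightarrow> real)) set"

definition fibre :: "('a, 'b) vbundle \<Rightarrow> 'a \<Rightarrow> 'b set" where
  "fibre E x = {a \<in> btotal E. bproj E a = x}"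

definition bzero :: "('a, 'b) vbundle \<Rightarrow> 'a \<Rightarrow> 'b" where
  "bzero E x = (THE z. z \<in> fibre E x \<and> badd E z z = z)"

definition smooth_matrix_rep ::
  "'a manifold \<Rightarrow> ('a, 'b) vbundle \<Rightarrow> ('a, 'c) vbundle \<Rightarrow> ('b \<Rightarrow> 'c) \<Rightarrow>
   'a set \<times> ('b \<Rightarrow> nat \<Rightarrow> real) \<Rightarrow> 'a set \<times> ('c \<Rightarrow> nat \<Rightarrow> real) \<Rightarrow> bool" where
  "smooth_matrix_rep M E F h = (\<lambda>(U, \<psi>) (V, \<xi>).
     \<exists>m :: 'a \<Rightarrow> nat \<Rightarrow> nat \<Rightarrow> real.
       (\<forall>i<brank F. \<forall>j<brank E. smooth_fun_on M (U \<inter> V) (\<lambda>x. m x i j)) \<and>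
       (\<forall>x\<in>U \<inter> V. \<forall>a\<in>fibre E x. \<forall>i<brank F. \<xi> (h a) i = (\<Sum>j<brank E. m x i j * \<psi> a j)))"

text \<open>For a trivialization from the atlas itself, the last clause says that transition functions
  are smooth.\<close>

definition local_trivialization ::
  "'a manifold \<Rightarrow> ('a, 'b) vbundle \<Rightarrow> 'a set \<times> ('b \<Rightarrow> nat \<Rightarrow> real) \<Rightarrow> bool" where
  "local_trivialization M E = (\<lambda>(U, \<psi>).
     openin (mtop M) U \<and>
     (\<forall>x\<in>U. bij_betw \<psi> (fibre E x) (topspace (Euclidean_space (brank E))) \<and>
        (\<forall>a\<in>fibre E x. \<forall>b\<in>fibre E x. \<psi> (badd E a b) = (\<lambda>i. \<psi> a i + \<psi> b i)) \<and>
        (\<forall>c. \<forall>a\<in>fibre E x. \<psi> (bscale E c a) = (\<lambda>i. c * \<psi> a i))) \<and>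
     (\<forall>t\<in>btrivs E. smooth_matrix_rep M E E (\<lambda>a. a) (U, \<psi>) t \<and>
                    smooth_matrix_rep M E E (\<lambda>a. a) t (U, \<psi>)))"

text \<open>The vector space laws in the fibres need not be listed: they follow from the operation
  preserving bijections onto \<open>\<real>\<^sup>r\<close>.\<close>

definition vector_bundle :: "'a manifold \<Rightarrow> ('a, 'b) vbundle \<Rightarrow> bool" where
  "vector_bundle M E \<longleftrightarrow>
     bproj E ` btotal E \<subseteq> mpoints M \<and>
     (\<forall>x\<in>mpoints M. (\<forall>a\<in>fibre E x. \<forall>b\<in>fibre E x. badd E a b \<in> fibre E x) \<and>
        (\<forall>c. \<forall>a\<in>fibre E x. bscale E c a \<in> fibre E x)) \<and>
     (\<Union>(U, \<psi>)\<in>btrivs E. U) = mpoints M \<and>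
     (\<forall>t\<in>btrivs E. local_trivialization M E t)"

definition bundle_morphism ::
  "'a manifold \<Rightarrow> ('a, 'b) vbundle \<Rightarrow> ('a, 'c) vbundle \<Rightarrow> ('b \<Rightarrow> 'c) \<Rightarrow> bool" where
  "bundle_morphism M E F h \<longleftrightarrow>
     (\<forall>x\<in>mpoints M. (\<forall>a\<in>fibre E x. h a \<in> fibre F x) \<and>
        (\<forall>a\<in>fibre E x. \<forall>b\<in>fibre E x. h (badd E a b) = badd F (h a) (h b)) \<and>
        (\<forall>c. \<forall>a\<in>fibre E x. h (bscale E c a) = bscale F c (h a))) \<and>
     (\<forall>t\<in>btrivs E. \<forall>u\<in>btrivs F. smooth_matrix_rep M E F h t u)"

definition bundle_isomorphism ::
  "'a manifold \<Rightarrow> ('a, 'b) vbundle \<Rightarrow> ('a, 'c) vbundle \<Rightarrow> ('b \<Rightarrow> 'c) \<Rightarrow> bool" where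
  "bundle_isomorphism M E F h \<longleftrightarrow>
     bij_betw h (btotal E) (btotal F) \<and> bundle_morphism M E F h \<and>
     bundle_morphism M F E (inv_into (btotal E) h)"

definition morphism_kernel :: "('a, 'b) vbundle \<Rightarrow> ('a, 'c) vbundle \<Rightarrow> ('b \<Rightarrow> 'c) \<Rightarrow> 'b set" where
  "morphism_kernel E F h = {a \<in> btotal E. h a = bzero F (bproj E a)}"

text \<open>Restriction of a bundle over \<open>M\<close> to an immersed submanifold \<open>N\<close>, as a bundle over \<open>N\<close>
  (the pullback along the inclusion).\<close>

definition restrict_bundle :: "('a, 'b) vbundle \<Rightarrow> 'a manifold \<Rightarrow> ('a, 'b) vbundle" where
  "restrict_bundle E N =
     E\<lparr>btotal := {a \<in> btotal E. bproj E a \<in> mpoints N},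
       btrivs := (\<lambda>(U, \<psi>). (U \<inter> mpoints N, \<psi>)) ` btrivs E\<rparr>"


subsection \<open>Subbundles and quotient bundles\<close>

text \<open>An adapted trivialization identifies \<open>K\<close> with \<open>U \<times> (\<real>\<^sup>k \<times> {0}) \<subseteq> U \<times> \<real>\<^sup>r\<close>; in the present
  encoding \<open>\<real>\<^sup>k \<times> {0}\<close> is \<open>topspace (Euclidean_space k)\<close>.\<close>

definition adapted_trivialization ::
  "'a manifold \<Rightarrow> ('a, 'b) vbundle \<Rightarrow> 'b set \<Rightarrow> nat \<Rightarrow> 'a set \<times> ('b \<Rightarrow> nat \<Rightarrow> real) \<Rightarrow> bool" where
  "adapted_trivialization M E K k = (\<lambda>(U, \<psi>). local_trivialization M E (U, \<psi>) \<and>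
     (\<forall>x\<in>U. \<psi> ` (K \<inter> fibre E x) = topspace (Euclidean_space k)))"

definition subbundle_of_rank ::
  "'a manifold \<Rightarrow> ('a, 'b) vbundle \<Rightarrow> 'b set \<Rightarrow> nat \<Rightarrow> bool" where
  "subbundle_of_rank M E K k \<longleftrightarrow> vector_bundle M E \<and> K \<subseteq> btotal E \<and> k \<le> brank E \<and>
     (\<forall>x\<in>mpoints M. \<exists>U \<psi>. x \<in> U \<and> adapted_trivialization M E K k (U, \<psi>))"

definition subbundle :: "'a manifold \<Rightarrow> ('a, 'b) vbundle \<Rightarrow> 'b set \<Rightarrow> bool" where
  "subbundle M E K \<longleftrightarrow> (\<exists>k. subbundle_of_rank M E K k)"

definition subbundle_rank :: "'a manifold \<Rightarrow> ('a, 'b) vbundle \<Rightarrow> 'b set \<Rightarrow> nat" where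
  "subbundle_rank M E K = (THE k. subbundle_of_rank M E K k)"

definition bcoset :: "('a, 'b) vbundle \<Rightarrow> 'b set \<Rightarrow> 'b \<Rightarrow> 'b set" where
  "bcoset E K a = badd E a ` (K \<inter> fibre E (bproj E a))"

text \<open>Trivializations of the quotient are the last \<open>r - k\<close> coordinates of adapted ones. Here and
  below, \<open>the_elem (f ` C)\<close> is the common value of \<open>f\<close> on the coset \<open>C\<close>.\<close>

definition quotient_bundle ::
  "'a manifold \<Rightarrow> ('a, 'b) vbundle \<Rightarrow> 'b set \<Rightarrow> ('a, 'b set) vbundle" where
  "quotient_bundle M E K =
     \<lparr>btotal = bcoset E K ` btotal E,
      bproj = (\<lambda>C. the_elem (bproj E ` C)),
      badd = (\<lambda>C D. \<Union>a\<in>C. \<Union>b\<in>D. bcoset E K (badd E a b)),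
      bscale = (\<lambda>c C. \<Union>a\<in>C. bcoset E K (bscale E c a)),
      brank = brank E - subbundle_rank M E K,
      btrivs = (\<lambda>(U, \<psi>). (U, \<lambda>C i. the_elem ((\<lambda>a. \<psi> a (subbundle_rank M E K + i)) ` C))) `
        {t. adapted_trivialization M E K (subbundle_rank M E K) t}\<rparr>"

definition quotient_map_of :: "('b \<Rightarrow> 'c) \<Rightarrow> 'b set \<Rightarrow> 'c" where
  "quotient_map_of h C = the_elem (h ` C)"


subsection \<open>Tangent bundle\<close>

text \<open>Tangent vectors at \<open>x\<close> are the derivations of germs at \<open>x\<close> of smooth functions, extended by
  \<open>0\<close> to functions not smooth near \<open>x\<close>. Dependence on the germ only is automatic: if \<open>h\<close> vanishes on
  a neighbourhood \<open>W\<close> of \<open>x\<close>, then the Leibniz rule for \<open>h \<cdot> indicator W = 0\<close> gives \<open>v h = 0\<close>.\<close>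

definition tangent_space :: "'a manifold \<Rightarrow> 'a \<Rightarrow> (('a \<Rightarrow> real) \<Rightarrow> real) set" where
  "tangent_space M x = {v.
     (\<forall>f. \<not> smooth_near M x f \<longrightarrow> v f = 0) \<and>
     (\<forall>f g. smooth_near M x f \<and> smooth_near M x g \<longrightarrow>
        v (\<lambda>y. f y + g y) = v f + v g \<and>
        v (\<lambda>y. f y * g y) = f x * v g + g x * v f) \<and>
     (\<forall>c f. smooth_near M x f \<longrightarrow> v (\<lambda>y. c * f y) = c * v f)}"

text \<open>The trivialization over a chart \<open>(U, \<phi>)\<close> consists of the components \<open>v (\<phi>\<^sup>i)\<close>.\<close>

definition tangent_bundle :: "'a manifold \<Rightarrow> ('a, 'a \<times> (('a \<Rightarrow> real) \<Rightarrow> real)) vbundle" where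
  "tangent_bundle M =
     \<lparr>btotal = Sigma (mpoints M) (tangent_space M),
      bproj = fst,
      badd = (\<lambda>(x, v) (y, w). (x, \<lambda>f. v f + w f)),
      bscale = (\<lambda>c (x, v). (x, \<lambda>f. c * v f)),
      brank = mdim M,
      btrivs = (\<lambda>(U, \<phi>). (U, \<lambda>(x, v) i. if i < mdim M then v (\<lambda>y. \<phi> y i) else 0)) ` mcharts M\<rparr>"

definition tangent_map ::
  "'a manifold \<Rightarrow> 'c manifold \<Rightarrow> ('a \<Rightarrow> 'c) \<Rightarrow>
   'a \<times> (('a \<Rightarrow> real) \<Rightarrow> real) \<Rightarrow> 'c \<times> (('c \<Rightarrow> real) \<Rightarrow> real)" where
  "tangent_map M M' F =
     (\<lambda>(x, v). (F x, \<lambda>f. if smooth_near M' (F x) f then v (\<lambda>y. f (F y)) else 0))"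

definition immersion :: "'a manifold \<Rightarrow> 'c manifold \<Rightarrow> ('a \<Rightarrow> 'c) \<Rightarrow> bool" where
  "immersion M M' F \<longleftrightarrow> smooth_map M M' F \<and>
     (\<forall>x\<in>mpoints M. inj_on (tangent_map M M' F) (fibre (tangent_bundle M) x))"


subsection \<open>Sections and vector fields\<close>

text \<open>Sections are \<open>undefined\<close> outside the base, so that equality of sections is equality of
  functions.\<close>

definition sections :: "'a manifold \<Rightarrow> ('a, 'b) vbundle \<Rightarrow> ('a \<Rightarrow> 'b) set" where
  "sections M E = {s \<in> \<Pi>\<^sub>E x\<in>mpoints M. fibre E x.
     \<forall>(U, \<psi>)\<in>btrivs E. \<forall>i<brank E. smooth_fun_on M U (\<lambda>x. \<psi> (s x) i)}"

definition sec_add :: "'a manifold \<Rightarrow> ('a, 'b) vbundle \<Rightarrow> ('a \<Rightarrow> 'b) \<Rightarrow> ('a \<Rightarrow> 'b) \<Rightarrow> 'a \<Rightarrow> 'b" where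
  "sec_add M E X Y = (\<lambda>x\<in>mpoints M. badd E (X x) (Y x))"

definition sec_mult :: "'a manifold \<Rightarrow> ('a, 'b) vbundle \<Rightarrow> ('a \<Rightarrow> real) \<Rightarrow> ('a \<Rightarrow> 'b) \<Rightarrow> 'a \<Rightarrow> 'b" where
  "sec_mult M E f X = (\<lambda>x\<in>mpoints M. bscale E (f x) (X x))"

definition sec_zero :: "'a manifold \<Rightarrow> ('a, 'b) vbundle \<Rightarrow> 'a \<Rightarrow> 'b" where
  "sec_zero M E = (\<lambda>x\<in>mpoints M. bzero E x)"

definition sec_map :: "'a manifold \<Rightarrow> ('b \<Rightarrow> 'c) \<Rightarrow> ('a \<Rightarrow> 'b) \<Rightarrow> 'a \<Rightarrow> 'c" where
  "sec_map M h X = (\<lambda>x\<in>mpoints M. h (X x))"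

definition vf_bracket ::
  "'a manifold \<Rightarrow> ('a \<Rightarrow> 'a \<times> (('a \<Rightarrow> real) \<Rightarrow> real)) \<Rightarrow> ('a \<Rightarrow> 'a \<times> (('a \<Rightarrow> real) \<Rightarrow> real)) \<Rightarrow>
   'a \<Rightarrow> 'a \<times> (('a \<Rightarrow> real) \<Rightarrow> real)" where
  "vf_bracket M X Y = (\<lambda>x\<in>mpoints M. (x, \<lambda>f.
     if smooth_near M x f
     then snd (X x) (\<lambda>y. snd (Y y) f) - snd (Y x) (\<lambda>y. snd (X y) f) else 0))"


subsection \<open>Anchored bundles and brackets\<close>

definition anchored_bundle ::
  "'a manifold \<Rightarrow> ('a, 'b) vbundle \<Rightarrow> ('b \<Rightarrow> 'a \<times> (('a \<Rightarrow> real) \<Rightarrow> real)) \<Rightarrow> bool" where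
  "anchored_bundle M A \<rho> \<longleftrightarrow>
     smooth_manifold M \<and> vector_bundle M A \<and> bundle_morphism M A (tangent_bundle M) \<rho>"

definition almost_lie_bracket ::
  "'a manifold \<Rightarrow> ('a, 'b) vbundle \<Rightarrow> ('b \<Rightarrow> 'a \<times> (('a \<Rightarrow> real) \<Rightarrow> real)) \<Rightarrow>
   (('a \<Rightarrow> 'b) \<Rightarrow> ('a \<Rightarrow> 'b) \<Rightarrow> 'a \<Rightarrow> 'b) \<Rightarrow> bool" where
  "almost_lie_bracket M A \<rho> B \<longleftrightarrow>
     (\<forall>X\<in>sections M A. \<forall>Y\<in>sections M A. B X Y \<in> sections M A) \<and>
     (\<forall>X\<in>sections M A. \<forall>Y\<in>sections M A. \<forall>Z\<in>sections M A.
        B (sec_add M A X Y) Z = sec_add M A (B X Z) (B Y Z) \<and>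
        B X (sec_add M A Y Z) = sec_add M A (B X Y) (B X Z)) \<and>
     (\<forall>c::real. \<forall>X\<in>sections M A. \<forall>Y\<in>sections M A.
        B (sec_mult M A (\<lambda>_. c) X) Y = sec_mult M A (\<lambda>_. c) (B X Y) \<and>
        B X (sec_mult M A (\<lambda>_. c) Y) = sec_mult M A (\<lambda>_. c) (B X Y)) \<and>
     (\<forall>X\<in>sections M A. \<forall>Y\<in>sections M A. B X Y = sec_mult M A (\<lambda>_. - 1) (B Y X)) \<and>
     (\<forall>f. smooth_fun_on M (mpoints M) f \<longrightarrow>
        (\<forall>X\<in>sections M A. \<forall>Y\<in>sections M A.
           B X (sec_mult M A f Y) =
             sec_add M A (sec_mult M A f (B X Y)) (sec_mult M A (\<lambda>x. snd (\<rho> (X x)) f) Y)))"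

definition lie_bracket ::
  "'a manifold \<Rightarrow> ('a, 'b) vbundle \<Rightarrow> ('b \<Rightarrow> 'a \<times> (('a \<Rightarrow> real) \<Rightarrow> real)) \<Rightarrow>
   (('a \<Rightarrow> 'b) \<Rightarrow> ('a \<Rightarrow> 'b) \<Rightarrow> 'a \<Rightarrow> 'b) \<Rightarrow> bool" where
  "lie_bracket M A \<rho> B \<longleftrightarrow> almost_lie_bracket M A \<rho> B \<and>
     (\<forall>X\<in>sections M A. \<forall>Y\<in>sections M A. \<forall>Z\<in>sections M A.
        sec_add M A (B X (B Y Z)) (sec_add M A (B Y (B Z X)) (B Z (B X Y))) = sec_zero M A)"

definition pre_lie_algebroid ::
  "'a manifold \<Rightarrow> ('a, 'b) vbundle \<Rightarrow> ('b \<Rightarrow> 'a \<times> (('a \<Rightarrow> real) \<Rightarrow> real)) \<Rightarrow>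
   (('a \<Rightarrow> 'b) \<Rightarrow> ('a \<Rightarrow> 'b) \<Rightarrow> 'a \<Rightarrow> 'b) \<Rightarrow> bool" where
  "pre_lie_algebroid M A \<rho> B \<longleftrightarrow> anchored_bundle M A \<rho> \<and> almost_lie_bracket M A \<rho> B \<and>
     (\<forall>X\<in>sections M A. \<forall>Y\<in>sections M A.
        sec_map M \<rho> (B X Y) = vf_bracket M (sec_map M \<rho> X) (sec_map M \<rho> Y))"

definition foliated ::
  "'a manifold \<Rightarrow> ('a, 'b) vbundle \<Rightarrow> ('b \<Rightarrow> 'a \<times> (('a \<Rightarrow> real) \<Rightarrow> real)) \<Rightarrow> bool" where
  "foliated M A \<rho> \<longleftrightarrow> anchored_bundle M A \<rho> \<and>
     (\<forall>V\<in>sec_map M \<rho> ` sections M A. \<forall>W\<in>sec_map M \<rho> ` sections M A.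
        vf_bracket M V W \<in> sec_map M \<rho> ` sections M A)"

definition lie_algebra_isomorphism ::
  "'a manifold \<Rightarrow> ('a, 'b) vbundle \<Rightarrow> (('a \<Rightarrow> 'b) \<Rightarrow> ('a \<Rightarrow> 'b) \<Rightarrow> 'a \<Rightarrow> 'b) \<Rightarrow>
   ('a, 'c) vbundle \<Rightarrow> (('a \<Rightarrow> 'c) \<Rightarrow> ('a \<Rightarrow> 'c) \<Rightarrow> 'a \<Rightarrow> 'c) \<Rightarrow>
   (('a \<Rightarrow> 'b) \<Rightarrow> 'a \<Rightarrow> 'c) \<Rightarrow> bool" where
  "lie_algebra_isomorphism M E B F C \<Phi> \<longleftrightarrow>
     bij_betw \<Phi> (sections M E) (sections M F) \<and>
     (\<forall>X\<in>sections M E. \<forall>Y\<in>sections M E.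
        \<Phi> (sec_add M E X Y) = sec_add M F (\<Phi> X) (\<Phi> Y) \<and> \<Phi> (B X Y) = C (\<Phi> X) (\<Phi> Y)) \<and>
     (\<forall>c::real. \<forall>X\<in>sections M E. \<Phi> (sec_mult M E (\<lambda>_. c) X) = sec_mult M F (\<lambda>_. c) (\<Phi> X))"


subsection \<open>Leaves\<close>

definition anchor_distribution ::
  "('a, 'b) vbundle \<Rightarrow> ('b \<Rightarrow> 'a \<times> (('a \<Rightarrow> real) \<Rightarrow> real)) \<Rightarrow>
   'a \<Rightarrow> ('a \<times> (('a \<Rightarrow> real) \<Rightarrow> real)) set" where
  "anchor_distribution A \<rho> x = \<rho> ` fibre A x"

abbreviation tangent_inclusion ::
  "'a manifold \<Rightarrow> 'a manifold \<Rightarrow>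
   'a \<times> (('a \<Rightarrow> real) \<Rightarrow> real) \<Rightarrow> 'a \<times> (('a \<Rightarrow> real) \<Rightarrow> real)" where
  "tangent_inclusion N M \<equiv> tangent_map N M (\<lambda>x. x)"

definition integral_manifold ::
  "'a manifold \<Rightarrow> ('a \<Rightarrow> ('a \<times> (('a \<Rightarrow> real) \<Rightarrow> real)) set) \<Rightarrow> 'a manifold \<Rightarrow> bool" where
  "integral_manifold M D N \<longleftrightarrow>
     smooth_manifold N \<and> connected_space (mtop N) \<and> mpoints N \<noteq> {} \<and>
     mpoints N \<subseteq> mpoints M \<and> immersion N M (\<lambda>x. x) \<and>
     (\<forall>x\<in>mpoints N. tangent_inclusion N M ` fibre (tangent_bundle N) x = D x)"

definition leaf ::
  "'a manifold \<Rightarrow> ('a \<Rightarrow> ('a \<times> (('a \<Rightarrow> real) \<Rightarrow> real)) set) \<Rightarrow> 'a manifold \<Rightarrow> bool" where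
  "leaf M D N \<longleftrightarrow> integral_manifold M D N \<and>
     (\<forall>N'. integral_manifold M D N' \<and> mpoints N \<subseteq> mpoints N' \<longrightarrow> mpoints N' = mpoints N)"


subsection \<open>The data induced on a leaf\<close>

definition leaf_kernel ::
  "'a manifold \<Rightarrow> ('a, 'b) vbundle \<Rightarrow> ('b \<Rightarrow> 'a \<times> (('a \<Rightarrow> real) \<Rightarrow> real)) \<Rightarrow> 'a manifold \<Rightarrow> 'b set"
  where "leaf_kernel M A \<rho> N =
     btotal (restrict_bundle A N) \<inter> morphism_kernel A (tangent_bundle M) \<rho>"

definition leaf_quotient ::
  "'a manifold \<Rightarrow> ('a, 'b) vbundle \<Rightarrow> ('b \<Rightarrow> 'a \<times> (('a \<Rightarrow> real) \<Rightarrow> real)) \<Rightarrow> 'a manifold \<Rightarrow>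
   ('a, 'b set) vbundle"
  where "leaf_quotient M A \<rho> N =
     quotient_bundle N (restrict_bundle A N) (leaf_kernel M A \<rho> N)"

text \<open>\<open>quotient_map_of \<rho>\<close>, with values in \<open>TM\<close>, read as a map into \<open>TN\<close>: the tangent spaces of \<open>N\<close>
  are identified with subspaces of those of \<open>M\<close> via the differential of the inclusion.\<close>

definition leaf_anchor ::
  "'a manifold \<Rightarrow> ('b \<Rightarrow> 'a \<times> (('a \<Rightarrow> real) \<Rightarrow> real)) \<Rightarrow> 'a manifold \<Rightarrow>
   'b set \<Rightarrow> 'a \<times> (('a \<Rightarrow> real) \<Rightarrow> real)"
  where "leaf_anchor M \<rho> N C =
     inv_into (btotal (tangent_bundle N)) (tangent_inclusion N M) (quotient_map_of \<rho> C)"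

text \<open>\<open>B\<^sub>N\<close> is obtained from \<open>B\<close> by restriction and projection: wherever sections \<open>X, Y\<close> of the
  quotient are locally the projections of restrictions of sections \<open>X', Y'\<close> of \<open>A\<close>, the bracket
  \<open>B\<^sub>N X Y\<close> is the projection of \<open>B X' Y'\<close>. This has to be a local condition, since sections over
  an immersed submanifold need not extend to \<open>M\<close>.\<close>

definition induces_bracket ::
  "'a manifold \<Rightarrow> ('a, 'b) vbundle \<Rightarrow> ('b \<Rightarrow> 'a \<times> (('a \<Rightarrow> real) \<Rightarrow> real)) \<Rightarrow> 'a manifold \<Rightarrow>
   (('a \<Rightarrow> 'b) \<Rightarrow> ('a \<Rightarrow> 'b) \<Rightarrow> 'a \<Rightarrow> 'b) \<Rightarrow>
   (('a \<Rightarrow> 'b set) \<Rightarrow> ('a \<Rightarrow> 'b set) \<Rightarrow> 'a \<Rightarrow> 'b set) \<Rightarrow> bool" where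
  "induces_bracket M A \<rho> N B B\<^sub>N \<longleftrightarrow>
     (let q = bcoset (restrict_bundle A N) (leaf_kernel M A \<rho> N) in
      \<forall>X\<in>sections N (leaf_quotient M A \<rho> N). \<forall>Y\<in>sections N (leaf_quotient M A \<rho> N).
      \<forall>X'\<in>sections M A. \<forall>Y'\<in>sections M A. \<forall>W. openin (mtop N) W \<longrightarrow>
        (\<forall>x\<in>W. X x = q (X' x) \<and> Y x = q (Y' x)) \<longrightarrow>
        (\<forall>x\<in>W. B\<^sub>N X Y x = q (B X' Y' x)))"

end

theory Submission
  imports Defs "HOL-Homology.Invariance_of_Domain"
begin

text \<open>For (i), a partition of unity gives sections \<open>s\<^sub>k\<close> and linear maps \<open>l\<^sub>k\<close> with locally finite supports such
  that \<open>X = \<Sum>\<^sub>k l\<^sub>k X s\<^sub>k\<close> for every section \<open>X\<close>. Since the bundle is foliated, there are sections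
  \<open>S\<^sub>k\<^sub>m\<close>, antisymmetric in \<open>k\<close> and \<open>m\<close>, with \<open>\<rho> S\<^sub>k\<^sub>m = [\<rho> s\<^sub>k, \<rho> s\<^sub>m]\<close>. The bracket
  \<open>\<Sum>\<^sub>k\<^sub>m l\<^sub>k X l\<^sub>m Y S\<^sub>k\<^sub>m + \<Sum>\<^sub>m (\<rho> X (l\<^sub>m Y) - \<rho> Y (l\<^sub>m X)) s\<^sub>m\<close> is the required one.

  For (ii), composing \<open>\<rho>\<close> with the inverse of the inclusion of \<open>TN\<close> gives a fibrewise surjective
  \<open>\<sigma>\<close> from \<open>A\<^sub>N\<close> to \<open>TN\<close>. It is smooth because some of the coordinates of \<open>M\<close> are, near a given
  point, coordinates of the fibres of \<open>TN\<close>. By a Steinitz exchange the components of \<open>\<sigma>\<close> in a chart of \<open>N\<close>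
  can be completed to a trivialization of \<open>A\<^sub>N\<close>; the kernel is where they vanish, and they descend to
  coordinates of the quotient. The induced bracket is the bracket of vector fields on \<open>N\<close> transported
  along \<open>\<rho>\<^sub>N\<close>. An almost Lie bracket is determined near a point by its values on finitely many sections that
  generate all sections there; here the projections of sections over \<open>M\<close> generate, which gives uniqueness.\<close>

subsection \<open>Calculus on \<open>\<real>\<^sup>n\<close>\<close>

text \<open>Fibres are sets inside an arbitrary type, so sums, bases and linear maps in them have to
  be expressed indirectly. The tool throughout is a real function \<kappa> on the total space that
  is linear on fibres: two vectors of a fibre are equal when all such \<kappa> agree on them, and
  sections, morphisms and trivializations are tested for smoothness by smooth \<kappa>
  (\<open>smooth_functional\<close>).

  Calculus is needed because tangent vectors are derivations: that a derivation is determined by its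
  components in a chart is Hadamard's lemma.

  The bracket in (i) is what bilinearity and the Leibniz rule would give for X = \<Sum> l_k X s_k
  and Y = \<Sum> l_m Y s_m if [s_k, s_m] were S_km. The s_k need not be linearly independent, so
  this is no definition by values on a basis, and the bracket of s_k and s_m may differ from S_km;
  only the anchor of S_km matters.

  In (ii) functions and sections over N need not extend to M. Smoothness of \<sigma> and uniqueness
  of the induced bracket are therefore argued near one point at a time, over N.\<close>

abbreviation Rn :: "nat \<Rightarrow> (nat \<Rightarrow> real) set" where
  "Rn n \<equiv> topspace (Euclidean_space n)"

text \<open>Cubes rather than balls: they form a neighbourhood base and stay closed under replacing
  one coordinate by a value near that of the centre, which is what partial derivatives and the path
  in \<open>slope_decomposition\<close> do.\<close>

definition cube :: "nat \<Rightarrow> (nat \<Rightarrow> real) \<Rightarrow> real \<Rightarrow> (nat \<Rightarrow> real) set" where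
  "cube n p e = {q \<in> Rn n. \<forall>i<n. \<bar>q i - p i\<bar> < e}"

lemma Rn_iff: "p \<in> Rn n \<longleftrightarrow> (\<forall>i\<ge>n. p i = 0)"
  by (simp add: topspace_Euclidean_space)

lemma openin_Rn_iff: "openin (Euclidean_space n) U \<longleftrightarrow> (\<exists>T. open T \<and> U = Rn n \<inter> T)"
  by (auto simp: Euclidean_space_def euclidean_product_topology topspace_Euclidean_space openin_open)

lemma openin_subset_Rn: "openin (Euclidean_space n) U \<Longrightarrow> U \<subseteq> Rn n"
  by (rule openin_subset)

lemma continuous_on_coord: "continuous_on S (\<lambda>p::nat \<Rightarrow> real. p i)"
  by (rule continuous_on_product_then_coordinatewise[OF continuous_on_id])

lemma openin_cube: "openin (Euclidean_space n) (cube n p e)"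
proof -
  have "open (\<Inter>i\<in>{..<n}. {q. \<bar>q i - p i\<bar> < e})"
    by (intro open_INT finite_lessThan ballI open_Collect_less continuous_on_rabs continuous_on_diff
          continuous_on_coord continuous_on_const)
  moreover have "cube n p e = Rn n \<inter> (\<Inter>i\<in>{..<n}. {q. \<bar>q i - p i\<bar> < e})"
    by (auto simp: cube_def)
  ultimately show ?thesis
    unfolding openin_Rn_iff by blast
qed

lemma cube_center: "p \<in> Rn n \<Longrightarrow> 0 < e \<Longrightarrow> p \<in> cube n p e"
  by (simp add: cube_def)

lemma cube_mono: "d \<le> e \<Longrightarrow> cube n p d \<subseteq> cube n p e"
  by (force simp: cube_def)

text \<open>A basic open set of the infinite product constrains only finitely many coordinates, and
  the coordinates from n on are 0 at every point of \<open>Rn n\<close>. Hence one e > 0 can serve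
  all constraints at once.\<close>

lemma openin_contains_cube:
  assumes U: "openin (Euclidean_space n) U" and p: "p \<in> U"
  obtains e where "0 < e" "cube n p e \<subseteq> U"
proof -
  obtain T where T: "open T" "U = Rn n \<inter> T"
    using U unfolding openin_Rn_iff by auto
  have "openin (product_topology (\<lambda>i. euclidean) UNIV) T"
    using T by (simp add: euclidean_product_topology)
  from product_topology_open_contains_basis[OF this, of p] p T
  obtain X where X: "p \<in> (\<Pi>\<^sub>E i\<in>UNIV. X i)" "\<And>i. open (X i)" "(\<Pi>\<^sub>E i\<in>UNIV. X i) \<subseteq> T"
    "finite {i. X i \<noteq> UNIV}"
    by auto
  have pX: "p i \<in> X i" for i using X(1) by auto
  have "\<forall>\<^sub>F e in at_right 0. \<forall>i\<in>{i. X i \<noteq> UNIV}. \<forall>y. \<bar>y - p i\<bar> < e \<longrightarrow> y \<in> X i"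
  proof (rule eventually_ball_finite[OF X(4)], rule ballI)
    fix i
    obtain d where d: "d > 0" "\<And>y. dist y (p i) < d \<Longrightarrow> y \<in> X i"
      using X(2)[of i] pX[of i] unfolding open_dist by meson
    show "\<forall>\<^sub>F e in at_right 0. \<forall>y. \<bar>y - p i\<bar> < e \<longrightarrow> y \<in> X i"
      using eventually_at_right_less[of "0::real"] eventually_at_right_real[OF d(1)]
      by eventually_elim (use d(2) in \<open>auto simp: dist_real_def\<close>)
  qed
  moreover have "\<forall>\<^sub>F e in at_right (0::real). e > 0" by (rule eventually_at_right_less)
  ultimately have "\<forall>\<^sub>F e in at_right 0. e > 0 \<and> (\<forall>i\<in>{i. X i \<noteq> UNIV}. \<forall>y. \<bar>y - p i\<bar> < e \<longrightarrow> y \<in> X i)"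
    by eventually_elim auto
  then obtain e where e: "e > 0" "\<And>i y. X i \<noteq> UNIV \<Longrightarrow> \<bar>y - p i\<bar> < e \<Longrightarrow> y \<in> X i"
    using eventually_happens'[OF trivial_limit_at_right_real] by blast
  have "q i \<in> X i" if "q \<in> cube n p e" for q i
  proof (cases "i < n")
    case True
    then show ?thesis using e(2)[of i "q i"] that by (auto simp: cube_def)
  next
    case False
    then have "q i = p i" using that p T by (auto simp: cube_def Rn_iff)
    then show ?thesis using pX by simp
  qed
  then have "cube n p e \<subseteq> U" using X(3) T by (auto simp: cube_def PiE_def Pi_def subset_iff)
  then show ?thesis using that e(1) by blast
qed

lemma fun_upd_mem_cube:
  assumes "q \<in> cube n p e" "i < n" "\<bar>t - p i\<bar> < e"
  shows "q(i := t) \<in> cube n p e"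
  using assms by (auto simp: cube_def Rn_iff)

lemma eventually_line_mem:
  assumes "openin (Euclidean_space n) U" "p \<in> U" "i < n"
  shows "\<forall>\<^sub>F t in nhds (p i). p(i := t) \<in> U"
proof -
  obtain e where e: "e > 0" "cube n p e \<subseteq> U"
    using openin_contains_cube assms by metis
  have "p \<in> cube n p e" using cube_center assms openin_subset_Rn e by blast
  then show ?thesis
    unfolding eventually_nhds_metric dist_real_def
    using e fun_upd_mem_cube[OF _ assms(3)] by (metis subsetD)
qed

lemma continuous_map_sub_iff:
  "U \<subseteq> Rn n \<Longrightarrow> continuous_map (subtopology (Euclidean_space n) U) euclideanreal f \<longleftrightarrow> continuous_on U f"
  by (simp add: Euclidean_space_def euclidean_product_topology subtopology_subtopology inf.absorb2)

lemma continuous_on_near_cube: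
  fixes f :: "(nat \<Rightarrow> real) \<Rightarrow> real"
  assumes U: "openin (Euclidean_space n) U" "p \<in> U" and f: "continuous_on U f" and e: "0 < e"
  obtains d where "0 < d" "cube n p d \<subseteq> U" "\<And>q. q \<in> cube n p d \<Longrightarrow> \<bar>f q - f p\<bar> < e"
proof -
  have "continuous_map (subtopology (Euclidean_space n) U) euclideanreal f"
    using continuous_map_sub_iff openin_subset_Rn U f by blast
  from openin_continuous_map_preimage[OF this, of "ball (f p) e"]
  have "openin (Euclidean_space n) {x \<in> U. f x \<in> ball (f p) e}"
    using U openin_subset_Rn[OF U(1)]
    by (auto simp: openin_open_subtopology Int_absorb1)
  moreover have "p \<in> {x \<in> U. f x \<in> ball (f p) e}" using U e by simp
  ultimately obtain d where "0 < d" "cube n p d \<subseteq> {x \<in> U. f x \<in> ball (f p) e}"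
    using openin_contains_cube by metis
  then show ?thesis using that by (force simp: dist_real_def)
qed

lemma continuous_on_cover_openin:
  fixes f :: "(nat \<Rightarrow> real) \<Rightarrow> real"
  assumes "\<And>x. x \<in> U \<Longrightarrow> \<exists>V. openin (Euclidean_space n) V \<and> x \<in> V \<and> V \<subseteq> U \<and> continuous_on V f"
  shows "continuous_on U f"
proof -
  define \<V> where "\<V> = {V. openin (Euclidean_space n) V \<and> V \<subseteq> U \<and> continuous_on V f}"
  have eq: "(\<Union>V\<in>\<V>. V) = U" using assms by (auto simp: \<V>_def)
  have "U \<subseteq> Rn n" using assms openin_subset_Rn by blast
  have "openin (top_of_set U) V" if "V \<in> \<V>" for V
  proof -
    have V: "openin (Euclidean_space n) V" "V \<subseteq> U" using that by (simp_all add: \<V>_def)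
    from V(1)[unfolded openin_Rn_iff] obtain T where "open T" "V = Rn n \<inter> T" by (elim exE conjE)
    then have "V = U \<inter> T" using \<open>U \<subseteq> Rn n\<close> V(2) by auto
    then show ?thesis using \<open>open T\<close> by (auto simp: openin_open)
  qed
  moreover have "continuous_map (subtopology (top_of_set U) V) euclidean f" if "V \<in> \<V>" for V
    using that by (simp add: \<V>_def subtopology_subtopology inf.absorb2)
  ultimately have "continuous_map (top_of_set U) euclidean f"
    by (rule pasting_lemma[of \<V> _ "\<lambda>V. V" _ "\<lambda>_. f"]) (use eq in auto)
  then show ?thesis by simp
qed

lemma MVT_sym:
  fixes f :: "real \<Rightarrow> real"
  assumes ne: "a \<noteq> b" and d: "\<And>t. min a b \<le> t \<Longrightarrow> t \<le> max a b \<Longrightarrow> (f has_real_derivative f' t) (at t)"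
  obtains z where "min a b \<le> z" "z \<le> max a b" "f b - f a = (b - a) * f' z"
proof (cases "a < b")
  case True
  then obtain z where "a < z" "z < b" "f b - f a = (b - a) * f' z"
    using MVT2[of a b f f'] d by force
  then show ?thesis using that[of z] True by simp
next
  case False
  with ne have "b < a" by simp
  then obtain z where "b < z" "z < a" "f a - f b = (a - b) * f' z"
    using MVT2[of b a f f'] d by force
  then show ?thesis using that[of z] \<open>b < a\<close> by (simp add: algebra_simps)
qed

text \<open>Caratheodory form of total differentiability, obtained by changing the coordinates of \<open>p\<close> into those
  of \<open>q\<close> one at a time.\<close>

lemma slope_decomposition:
  assumes U: "openin (Euclidean_space n) U" "p \<in> U"
    and d: "\<And>i q. i < n \<Longrightarrow> q \<in> U \<Longrightarrow> ((\<lambda>t. f (q(i := t))) has_real_derivative g i q) (at (q i))"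
    and c: "\<And>i. i < n \<Longrightarrow> continuous_on U (g i)"
  obtains e D where "0 < e" "cube n p e \<subseteq> U"
    "\<And>q. q \<in> cube n p e \<Longrightarrow> f q - f p = (\<Sum>j<n. D j q * (q j - p j))"
    "\<And>j \<epsilon>. j < n \<Longrightarrow> 0 < \<epsilon> \<Longrightarrow>
       \<exists>\<delta>>0. cube n p \<delta> \<subseteq> cube n p e \<and> (\<forall>q\<in>cube n p \<delta>. \<bar>D j q - g j p\<bar> < (\<epsilon>::real))"
proof -
  obtain e where e: "0 < e" "cube n p e \<subseteq> U"
    using openin_contains_cube U by metis
  have pR: "p \<in> Rn n" using U openin_subset_Rn by blast
  define h where "h j q = (\<lambda>i. if i < j then q i else p i)" for j :: nat and q :: "nat \<Rightarrow> real"
  \<comment> \<open>The points \<open>h 0 q\<close>, ..., \<open>h n q\<close> lead from p to q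
    along the edges of a box, and \<open>D j q\<close> is the slope of f along the j-th edge. On an
    edge of length 0 the value \<open>g j p\<close> is chosen so that the slopes still tend to
    \<open>g j p\<close> as q tends to p.\<close>
  define D where "D j q = (if q j = p j then g j p else (f (h (Suc j) q) - f (h j q)) / (q j - p j))" for j q
  have hcube: "(h j q)(j := t) \<in> cube n p r"
    if "q \<in> cube n p r" "j < n" "min (p j) (q j) \<le> t" "t \<le> max (p j) (q j)" for j q t r
  proof -
    have "\<bar>q j - p j\<bar> < r" using that by (simp add: cube_def)
    then have "\<bar>t - p j\<bar> < r" using that by linarith
    then show ?thesis using that pR by (auto simp: cube_def h_def Rn_iff)
  qed
  have slope: "\<exists>z\<in>cube n p r. D j q = g j z" if q: "q \<in> cube n p r" "r \<le> e" and j: "j < n" for q r j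
  proof (cases "q j = p j")
    case True
    have "p \<in> cube n p r" using q j pR by (auto simp: cube_def)
    then show ?thesis using True by (auto simp: D_def)
  next
    case False
    have "((\<lambda>t. f ((h j q)(j := t))) has_real_derivative g j ((h j q)(j := t))) (at t)"
      if "min (p j) (q j) \<le> t" "t \<le> max (p j) (q j)" for t
      using d[OF j, of "(h j q)(j := t)"] hcube[OF q(1) j that] e(2) cube_mono[OF q(2)] by auto
    then obtain z where z: "min (p j) (q j) \<le> z" "z \<le> max (p j) (q j)"
      "f ((h j q)(j := q j)) - f ((h j q)(j := p j)) = (q j - p j) * g j ((h j q)(j := z))"
      using MVT_sym[of "p j" "q j" "\<lambda>t. f ((h j q)(j := t))" "\<lambda>t. g j ((h j q)(j := t))"] False by metis
    have "(h j q)(j := q j) = h (Suc j) q" "(h j q)(j := p j) = h j q"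
      by (auto simp: h_def less_Suc_eq)
    then have "D j q = g j ((h j q)(j := z))" using z(3) False by (simp add: D_def)
    then show ?thesis using hcube[OF q(1) j z(1,2)] by blast
  qed
  show thesis
  proof (rule that[OF e, of D])
    fix q assume q: "q \<in> cube n p e"
    have "h 0 q = p" "h n q = q" using q pR by (auto simp: h_def cube_def Rn_iff not_less)
    then have "f q - f p = (\<Sum>j<n. f (h (Suc j) q) - f (h j q))"
      using sum_lessThan_telescope[of "\<lambda>j. f (h j q)" n] by simp
    also have "\<dots> = (\<Sum>j<n. D j q * (q j - p j))"
    proof (rule sum.cong)
      fix j assume "j \<in> {..<n}"
      have "h (Suc j) q = h j q" if "q j = p j" using that by (auto simp: h_def less_Suc_eq)
      then show "f (h (Suc j) q) - f (h j q) = D j q * (q j - p j)" by (auto simp: D_def)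
    qed simp
    finally show "f q - f p = (\<Sum>j<n. D j q * (q j - p j))" .
  next
    fix j :: nat and \<epsilon> :: real assume j: "j < n" "0 < \<epsilon>"
    obtain d where d: "0 < d" "\<And>q. q \<in> cube n p d \<Longrightarrow> \<bar>g j q - g j p\<bar> < \<epsilon>"
      using continuous_on_near_cube[OF U c[OF j(1)] j(2)] by metis
    have "\<bar>D j q - g j p\<bar> < \<epsilon>" if q: "q \<in> cube n p (min d e)" for q
      using slope[OF q _ j(1)] d(2) cube_mono[of "min d e" d n p] by fastforce
    then show "\<exists>\<delta>>0. cube n p \<delta> \<subseteq> cube n p e \<and> (\<forall>q\<in>cube n p \<delta>. \<bar>D j q - g j p\<bar> < \<epsilon>)"
      using d(1) e(1) cube_mono[of "min d e" e n p] by (intro exI[of _ "min d e"]) simp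
  qed
qed

text \<open>With the slopes of \<open>slope_decomposition\<close> the difference quotient of f along
  \<gamma> is a sum of products, each of a slope and of a difference quotient of one coordinate of
  \<gamma>; both factors converge. The assumption R keeps \<gamma> inside \<open>Rn n\<close>,
  without which its values could not lie in a cube.\<close>

lemma DERIV_along_curve:
  assumes U: "openin (Euclidean_space n) U" "\<gamma> t0 \<in> U"
    and d: "\<And>i q. i < n \<Longrightarrow> q \<in> U \<Longrightarrow> ((\<lambda>t. f (q(i := t))) has_real_derivative g i q) (at (q i))"
    and c: "\<And>i. i < n \<Longrightarrow> continuous_on U (g i)"
    and R: "\<forall>\<^sub>F t in at t0. \<gamma> t \<in> Rn n"
    and \<gamma>: "\<And>i. i < n \<Longrightarrow> ((\<lambda>t. \<gamma> t i) has_real_derivative d' i) (at t0)"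
  shows "((\<lambda>t. f (\<gamma> t)) has_real_derivative (\<Sum>i<n. g i (\<gamma> t0) * d' i)) (at t0)"
proof -
  let ?p = "\<gamma> t0"
  obtain e D where e: "0 < e" "cube n ?p e \<subseteq> U"
    and D1: "\<And>q. q \<in> cube n ?p e \<Longrightarrow> f q - f ?p = (\<Sum>j<n. D j q * (q j - ?p j))"
    and D2: "\<And>j \<epsilon>. j < n \<Longrightarrow> 0 < \<epsilon> \<Longrightarrow>
       \<exists>\<delta>>0. cube n ?p \<delta> \<subseteq> cube n ?p e \<and> (\<forall>q\<in>cube n ?p \<delta>. \<bar>D j q - g j ?p\<bar> < (\<epsilon>::real))"
    using slope_decomposition[OF U d c] by blast
  have ev: "\<forall>\<^sub>F t in at t0. \<gamma> t \<in> cube n ?p r" if r: "r > 0" for r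
  proof -
    have "\<forall>\<^sub>F t in at t0. \<bar>\<gamma> t i - ?p i\<bar> < r" if i: "i < n" for i
    proof -
      have "isCont (\<lambda>t. \<gamma> t i) t0" using \<gamma>[OF i] DERIV_isCont by blast
      then have "((\<lambda>t. \<gamma> t i) \<longlongrightarrow> ?p i) (at t0)" by (simp add: isCont_def)
      from tendstoD[OF this r] show ?thesis by (simp add: dist_real_def)
    qed
    then have "\<forall>\<^sub>F t in at t0. \<forall>i\<in>{..<n}. \<bar>\<gamma> t i - ?p i\<bar> < r"
      by (intro eventually_ball_finite) auto
    with R show ?thesis by eventually_elim (auto simp: cube_def)
  qed
  have lim: "((\<lambda>t. D j (\<gamma> t)) \<longlongrightarrow> g j ?p) (at t0)" if j: "j < n" for j
  proof (rule tendstoI)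
    fix \<epsilon> :: real assume "0 < \<epsilon>"
    then obtain \<delta> where \<delta>: "\<delta> > 0" "\<forall>q\<in>cube n ?p \<delta>. \<bar>D j q - g j ?p\<bar> < \<epsilon>" using D2 j by blast
    show "\<forall>\<^sub>F t in at t0. dist (D j (\<gamma> t)) (g j ?p) < \<epsilon>"
      using ev[OF \<delta>(1)] by eventually_elim (use \<delta>(2) in \<open>auto simp: dist_real_def\<close>)
  qed
  have "((\<lambda>t. \<Sum>j<n. D j (\<gamma> t) * ((\<gamma> t j - ?p j) / (t - t0))) \<longlongrightarrow> (\<Sum>i<n. g i ?p * d' i)) (at t0)"
    by (intro tendsto_sum tendsto_mult lim) (use \<gamma> in \<open>auto simp: has_field_derivative_iff\<close>)
  moreover have "\<forall>\<^sub>F t in at t0. (\<Sum>j<n. D j (\<gamma> t) * ((\<gamma> t j - ?p j) / (t - t0)))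
      = (f (\<gamma> t) - f ?p) / (t - t0)"
    using ev[OF e(1)] by eventually_elim (simp add: D1 sum_divide_distrib)
  ultimately show ?thesis
    unfolding has_field_derivative_iff by (rule Lim_transform_eventually)
qed

subsection \<open>Closure properties of \<open>C\<^sup>k\<close> functions\<close>

lemma Ck_on_SucD:
  assumes "Ck_on (Suc k) n U f" "openin (Euclidean_space n) U"
  shows "continuous_on U f"
    "\<And>i p. i < n \<Longrightarrow> p \<in> U \<Longrightarrow> ((\<lambda>t. f (p(i := t))) has_real_derivative partial_deriv i f p) (at (p i))"
    "\<And>i. i < n \<Longrightarrow> Ck_on k n U (partial_deriv i f)"
  using assms continuous_map_sub_iff[OF openin_subset_Rn[OF assms(2)]]
  by (auto simp: partial_deriv_def DERIV_deriv_iff_field_differentiable)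

lemma Ck_on_continuous: "Ck_on k n U f \<Longrightarrow> openin (Euclidean_space n) U \<Longrightarrow> continuous_on U f"
  using continuous_map_sub_iff[OF openin_subset_Rn, of n U f] by (cases k) auto

lemma DERIV_line_cong:
  assumes U: "openin (Euclidean_space n) U" "\<And>p. p \<in> U \<Longrightarrow> f p = g p" and "i < n" "p \<in> U"
  shows "((\<lambda>t. f (p(i := t))) has_real_derivative d) (at (p i)) \<longleftrightarrow>
         ((\<lambda>t. g (p(i := t))) has_real_derivative d) (at (p i))"
proof (rule DERIV_cong_ev)
  show "\<forall>\<^sub>F t in nhds (p i). f (p(i := t)) = g (p(i := t))"
    using eventually_line_mem[OF U(1) \<open>p \<in> U\<close> \<open>i < n\<close>] by eventually_elim (rule U(2))
qed auto

lemma Ck_on_cong: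
  assumes "openin (Euclidean_space n) U" "\<And>p. p \<in> U \<Longrightarrow> f p = g p" "Ck_on k n U f"
  shows "Ck_on k n U g"
  using assms(2,3)
proof (induction k arbitrary: f g)
  case 0
  then show ?case
    using continuous_map_sub_iff[OF openin_subset_Rn[OF assms(1)]] continuous_on_cong[of U U f g] by simp
next
  case (Suc k)
  note f = Ck_on_SucD[OF Suc.prems(2) assms(1)]
  have d: "((\<lambda>t. g (p(i := t))) has_real_derivative partial_deriv i f p) (at (p i))"
    if "i < n" "p \<in> U" for i p
    using f(2)[OF that] DERIV_line_cong[of n U f g i p, OF assms(1) Suc.prems(1) that] by blast
  then have eq: "partial_deriv i f p = partial_deriv i g p" if "i < n" "p \<in> U" for i p
    using that DERIV_imp_deriv[OF d[OF that]] by (simp add: partial_deriv_def)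
  show ?case
    using d Suc.IH[OF eq f(3)] f(1) Suc.prems(1)
      continuous_map_sub_iff[OF openin_subset_Rn[OF assms(1)]] continuous_on_cong[of U U f g]
    by (auto simp: field_differentiable_def)
qed

text \<open>Allows the derivative to be given by any formula g instead of the term
  \<open>partial_deriv i f\<close>. The two are known to agree on U only, hence the passage through
  \<open>Ck_on_cong\<close>.\<close>

lemma Ck_on_SucI:
  assumes U: "openin (Euclidean_space n) U" and "continuous_on U f"
    and d: "\<And>i p. i < n \<Longrightarrow> p \<in> U \<Longrightarrow> ((\<lambda>t. f (p(i := t))) has_real_derivative g i p) (at (p i))"
    and g: "\<And>i. i < n \<Longrightarrow> Ck_on k n U (g i)"
  shows "Ck_on (Suc k) n U f"
proof -
  have "g i p = partial_deriv i f p" if "i < n" "p \<in> U" for i p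
    using DERIV_imp_deriv[OF d[OF that]] by (simp add: partial_deriv_def)
  then have "Ck_on k n U (partial_deriv i f)" if "i < n" for i
    using Ck_on_cong[OF U _ g[OF that]] that by blast
  then show ?thesis
    using assms continuous_map_sub_iff[OF openin_subset_Rn[OF U]] by (auto simp: field_differentiable_def)
qed

lemma Ck_on_le_Suc: "openin (Euclidean_space n) U \<Longrightarrow> Ck_on (Suc k) n U f \<Longrightarrow> Ck_on k n U f"
proof (induction k arbitrary: f)
  case (Suc k)
  show ?case
    by (rule Ck_on_SucI[OF Suc.prems(1) Ck_on_SucD(1)[OF Suc.prems(2,1)] Ck_on_SucD(2)[OF Suc.prems(2,1)]])
      (use Suc.IH[OF Suc.prems(1) Ck_on_SucD(3)[OF Suc.prems(2,1)]] in auto)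
qed simp

lemma Ck_on_subset:
  assumes "openin (Euclidean_space n) U" "openin (Euclidean_space n) V" "V \<subseteq> U" "Ck_on k n U f"
  shows "Ck_on k n V f"
  using assms(4)
proof (induction k arbitrary: f)
  case 0
  then show ?case using assms(3) continuous_on_subset
    continuous_map_sub_iff[OF openin_subset_Rn] assms(1,2) by (metis Ck_on.simps(1))
next
  case (Suc k)
  note f = Ck_on_SucD[OF Suc.prems assms(1)]
  show ?case
    by (rule Ck_on_SucI[OF assms(2) continuous_on_subset[OF f(1) assms(3)] f(2) Suc.IH[OF f(3)]])
      (use assms(3) in auto)
qed

text \<open>The function \<open>partial_deriv i f\<close> does not depend on the neighbourhood V
  chosen at a point, so the induction hypothesis applies to it with the same neighbourhoods.\<close>

lemma Ck_on_local:
  assumes U: "openin (Euclidean_space n) U"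
    and loc: "\<And>x. x \<in> U \<Longrightarrow> \<exists>V. openin (Euclidean_space n) V \<and> x \<in> V \<and> V \<subseteq> U \<and> Ck_on k n V f"
  shows "Ck_on k n U f"
proof -
  have cont: "continuous_on U f"
    if "\<And>x. x \<in> U \<Longrightarrow> \<exists>V. openin (Euclidean_space n) V \<and> x \<in> V \<and> V \<subseteq> U \<and> Ck_on k n V f" for k f
    by (rule continuous_on_cover_openin[of U n]) (meson that Ck_on_continuous)
  show ?thesis
    using loc
  proof (induction k arbitrary: f)
    case 0
    show ?case using cont[OF 0] continuous_map_sub_iff[OF openin_subset_Rn[OF U]] by simp
  next
    case (Suc k)
    show ?case
    proof (rule Ck_on_SucI[OF U cont[OF Suc.prems]])
      fix i p assume ip: "i < n" "p \<in> U"
      obtain V where V: "openin (Euclidean_space n) V" "p \<in> V" "Ck_on (Suc k) n V f"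
        using Suc.prems[OF ip(2)] by auto
      show "((\<lambda>t. f (p(i := t))) has_real_derivative partial_deriv i f p) (at (p i))"
        by (rule Ck_on_SucD(2)[OF V(3,1) ip(1) V(2)])
    next
      fix i assume i: "i < n"
      show "Ck_on k n U (partial_deriv i f)"
      proof (rule Suc.IH)
        fix x assume "x \<in> U"
        then obtain V where V: "openin (Euclidean_space n) V" "x \<in> V" "V \<subseteq> U" "Ck_on (Suc k) n V f"
          using Suc.prems by meson
        then show "\<exists>V. openin (Euclidean_space n) V \<and> x \<in> V \<and> V \<subseteq> U \<and> Ck_on k n V (partial_deriv i f)"
          using Ck_on_SucD(3)[OF V(4,1) i] by auto
      qed
    qed
  qed
qed

lemma Ck_on_const: "openin (Euclidean_space n) U \<Longrightarrow> Ck_on k n U (\<lambda>_. c)"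
proof (induction k arbitrary: c)
  case (Suc k)
  show ?case
    by (rule Ck_on_SucI[OF Suc.prems, where g = "\<lambda>_ _. 0"]) (use Suc in auto)
qed simp

lemma Ck_on_coord: "openin (Euclidean_space n) U \<Longrightarrow> Ck_on k n U (\<lambda>p. p i)"
proof (induction k)
  case 0
  then show ?case using continuous_map_sub_iff[OF openin_subset_Rn[OF 0]]
    by (simp add: continuous_on_coord)
next
  case (Suc k)
  show ?case
    by (rule Ck_on_SucI[OF Suc.prems, where g = "\<lambda>j _. if i = j then 1 else 0"])
      (auto simp: continuous_on_coord Ck_on_const[OF Suc.prems])
qed

lemma Ck_on_add:
  assumes U: "openin (Euclidean_space n) U"
  shows "Ck_on k n U f \<Longrightarrow> Ck_on k n U g \<Longrightarrow> Ck_on k n U (\<lambda>p. f p + g p)"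
proof (induction k arbitrary: f g)
  case 0
  then show ?case using continuous_map_sub_iff[OF openin_subset_Rn[OF U]] by (auto intro: continuous_on_add)
next
  case (Suc k)
  note f = Ck_on_SucD[OF Suc.prems(1) U] and g = Ck_on_SucD[OF Suc.prems(2) U]
  show ?case
    by (rule Ck_on_SucI[OF U continuous_on_add[OF f(1) g(1)] DERIV_add[OF f(2) g(2)] Suc.IH[OF f(3) g(3)]])
qed

lemma Ck_on_mult:
  assumes U: "openin (Euclidean_space n) U"
  shows "Ck_on k n U f \<Longrightarrow> Ck_on k n U g \<Longrightarrow> Ck_on k n U (\<lambda>p. f p * g p)"
proof (induction k arbitrary: f g)
  case 0
  then show ?case using continuous_map_sub_iff[OF openin_subset_Rn[OF U]] by (auto intro: continuous_on_mult)
next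
  case (Suc k)
  note f = Ck_on_SucD[OF Suc.prems(1) U] and g = Ck_on_SucD[OF Suc.prems(2) U]
  show ?case
  proof (rule Ck_on_SucI[OF U continuous_on_mult[OF f(1) g(1)]])
    show "((\<lambda>t. f (p(i := t)) * g (p(i := t))) has_real_derivative
       partial_deriv i f p * g p + partial_deriv i g p * f p) (at (p i))" if "i < n" "p \<in> U" for i p
      by (rule DERIV_cong[OF DERIV_mult[OF f(2)[OF that] g(2)[OF that]]]) simp
    show "Ck_on k n U (\<lambda>p. partial_deriv i f p * g p + partial_deriv i g p * f p)" if "i < n" for i
      by (intro Ck_on_add[OF U] Suc.IH f(3) g(3) that Ck_on_le_Suc[OF U Suc.prems(1)]
            Ck_on_le_Suc[OF U Suc.prems(2)])
  qed
qed

lemma Ck_on_sum: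
  assumes U: "openin (Euclidean_space n) U" and "\<And>j. j \<in> J \<Longrightarrow> Ck_on k n U (f j)"
  shows "Ck_on k n U (\<lambda>p. \<Sum>j\<in>J. f j p)"
  using assms(2)
  by (induction J rule: infinite_finite_induct) (auto intro: Ck_on_const[OF U] Ck_on_add[OF U])

text \<open>The derivative is built from 1/f and the derivative of f by products, so the induction
  hypothesis for the same f closes the step.\<close>

lemma Ck_on_inverse:
  assumes U: "openin (Euclidean_space n) U" and nz: "\<And>p. p \<in> U \<Longrightarrow> f p \<noteq> 0"
  shows "Ck_on k n U f \<Longrightarrow> Ck_on k n U (\<lambda>p. inverse (f p))"
proof (induction k)
  case 0
  then show ?case using continuous_map_sub_iff[OF openin_subset_Rn[OF U]] nz by (auto intro: continuous_on_inverse)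
next
  case (Suc k)
  note f = Ck_on_SucD[OF Suc.prems(1) U]
  show ?case
  proof (rule Ck_on_SucI[OF U continuous_on_inverse[OF f(1)]])
    show "((\<lambda>t. inverse (f (p(i := t)))) has_real_derivative
       (- 1) * (inverse (f p) * inverse (f p)) * partial_deriv i f p) (at (p i))" if "i < n" "p \<in> U" for i p
      by (rule DERIV_cong[OF DERIV_inverse'[OF f(2)[OF that]]]) (use nz[OF that(2)] in \<open>simp_all add: mult_ac\<close>)
    show "Ck_on k n U (\<lambda>p. (- 1) * (inverse (f p) * inverse (f p)) * partial_deriv i f p)" if "i < n" for i
      by (intro Ck_on_mult[OF U] Ck_on_const[OF U] f(3)[OF that] Suc.IH Ck_on_le_Suc[OF U Suc.prems])
  qed (use nz in auto)
qed

text \<open>The induction varies f and keeps G. The chain rule gives a sum of products of a partial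
  derivative of f after G, which is \<open>Ck_on k\<close> by the induction hypothesis, and of a
  partial derivative of a component of G, which is so by assumption.\<close>

lemma Ck_on_compose:
  assumes U: "openin (Euclidean_space m) U" and V: "openin (Euclidean_space n) V"
    and G: "\<And>p. p \<in> U \<Longrightarrow> G p \<in> V"
  shows "Ck_on k n V f \<Longrightarrow> (\<And>i. i < n \<Longrightarrow> Ck_on k m U (\<lambda>p. G p i)) \<Longrightarrow> Ck_on k m U (\<lambda>p. f (G p))"
proof (induction k arbitrary: f)
  \<comment> \<open>Continuity into the product needs all coordinates; those from n on vanish
    because G maps into \<open>Rn n\<close>.\<close>
  have contG: "continuous_on U G" if "\<And>i. i < n \<Longrightarrow> continuous_on U (\<lambda>p. G p i)"
  proof (rule continuous_on_coordinatewise_then_product)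
    fix i show "continuous_on U (\<lambda>p. G p i)"
    proof (cases "i < n")
      case False
      then have "G p i = 0" if "p \<in> U" for p using G[OF that] openin_subset_Rn[OF V] by (auto simp: Rn_iff)
      then show ?thesis by (simp cong: continuous_on_cong)
    qed (rule that)
  qed
  have cont: "continuous_on U (\<lambda>p. f (G p))"
    if "\<And>i. i < n \<Longrightarrow> Ck_on k m U (\<lambda>p. G p i)" "Ck_on k n V f" for k f
    using continuous_on_compose2[OF Ck_on_continuous[OF that(2) V] contG] Ck_on_continuous[OF that(1) U] G
    by (metis image_subset_iff)
  {
    case 0
    show ?case using cont[OF 0(2,1)] continuous_map_sub_iff[OF openin_subset_Rn[OF U]] by simp
  next
    case (Suc k)
    note f = Ck_on_SucD[OF Suc.prems(1) V] and g = Ck_on_SucD[OF Suc.prems(2) U]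
    show ?case
    proof (rule Ck_on_SucI[OF U cont[OF Suc.prems(2,1)]])
      fix j p assume jp: "j < m" "p \<in> U"
      have *: "((\<lambda>t. G (p(j := t)) i) has_real_derivative partial_deriv j (\<lambda>p. G p i) p) (at (p j))"
        if "i < n" for i
        using g(2)[OF that jp] .
      have R: "\<forall>\<^sub>F t in at (p j). G (p(j := t)) \<in> Rn n"
      proof -
        have "\<forall>\<^sub>F t in at (p j). p(j := t) \<in> U"
          using eventually_line_mem[OF U jp(2,1)] unfolding eventually_at_filter by eventually_elim auto
        then show ?thesis by eventually_elim (use G openin_subset_Rn[OF V] in blast)
      qed
      have "((\<lambda>t. f (G (p(j := t)))) has_real_derivative
        (\<Sum>i<n. partial_deriv i f (G (p(j := p j))) * partial_deriv j (\<lambda>p. G p i) p)) (at (p j))"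
        using DERIV_along_curve[OF V, of "\<lambda>t. G (p(j := t))" "p j", OF _ f(2) Ck_on_continuous[OF f(3) V] R *]
          G[OF jp(2)] by simp
      then show "((\<lambda>t. f (G (p(j := t)))) has_real_derivative
        (\<Sum>i<n. partial_deriv i f (G p) * partial_deriv j (\<lambda>p. G p i) p)) (at (p j))" by simp
    next
      fix j assume j: "j < m"
      show "Ck_on k m U (\<lambda>p. \<Sum>i<n. partial_deriv i f (G p) * partial_deriv j (\<lambda>p. G p i) p)"
      proof (intro Ck_on_sum[OF U] Ck_on_mult[OF U])
        fix i assume "i \<in> {..<n}"
        then have i: "i < n" by simp
        show "Ck_on k m U (partial_deriv j (\<lambda>p. G p i))" by (rule g(3)[OF i j])
        show "Ck_on k m U (\<lambda>p. partial_deriv i f (G p))"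
          by (rule Suc.IH[OF f(3)[OF i] Ck_on_le_Suc[OF U Suc.prems(2)]])
      qed
    qed
  }
qed

subsection \<open>Hadamard's lemma and bump functions\<close>

lemma smooth_onD: "smooth_on n U f \<Longrightarrow> openin (Euclidean_space n) U" "smooth_on n U f \<Longrightarrow> Ck_on k n U f"
  by (auto simp: smooth_on_def)

lemma segment_mem_cube:
  assumes "q \<in> cube n p e" "p \<in> Rn n" "0 \<le> t" "t \<le> 1"
  shows "(\<lambda>i. p i + t * (q i - p i)) \<in> cube n p e"
proof -
  have "\<bar>t * (q i - p i)\<bar> < e" if "i < n" for i
  proof -
    have "\<bar>t * (q i - p i)\<bar> \<le> 1 * \<bar>q i - p i\<bar>"
      unfolding abs_mult using assms(3,4) by (intro mult_right_mono) auto
    then show ?thesis using assms(1) that by (auto simp: cube_def)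
  qed
  then show ?thesis using assms by (auto simp: cube_def Rn_iff)
qed

text \<open>The map h lets one statement serve three times: h the identity for continuity of the
  integral in its endpoint, h constant for integrability at a fixed endpoint, and h a coordinate
  line for differentiation under the integral.\<close>

lemma continuous_on_segment_integrand:
  assumes c: "continuous_on (cube n p e) F" and p: "p \<in> Rn n"
    and h: "continuous_on A h" and A: "\<And>x. x \<in> A \<Longrightarrow> h x \<in> cube n p e"
  shows "continuous_on (A \<times> cbox 0 1) (\<lambda>(x, t::real). t ^ l * F (\<lambda>i. p i + t * (h x i - p i)))"
  unfolding split_beta
proof (intro continuous_on_mult continuous_on_power continuous_on_snd continuous_on_id
    continuous_on_compose2[OF c])
  show "continuous_on (A \<times> cbox 0 1) (\<lambda>x i. p i + snd x * (h (fst x) i - p i))"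
    by (intro continuous_on_coordinatewise_then_product continuous_on_add continuous_on_mult
        continuous_on_diff continuous_on_const continuous_on_snd continuous_on_id
        continuous_on_product_then_coordinatewise[OF continuous_on_compose2[OF h continuous_on_fst[OF continuous_on_id]]])
      auto
  show "(\<lambda>x i. p i + snd x * (h (fst x) i - p i)) ` (A \<times> cbox 0 1) \<subseteq> cube n p e"
    using segment_mem_cube[OF A p] by auto
qed

lemma continuous_on_segment_integrand_at:
  assumes c: "continuous_on (cube n p e) F" and p: "p \<in> Rn n" and q: "q \<in> cube n p e"
  shows "continuous_on (cbox 0 1) (\<lambda>t::real. t ^ l * F (\<lambda>i. p i + t * (q i - p i)))"
proof -
  \<comment> \<open>The singleton is a dummy parameter space: the endpoint q is fixed, and the
    two-variable statement is specialized to it.\<close>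
  have "continuous_on ({0::real} \<times> cbox 0 1) (\<lambda>(x, t). t ^ l * F (\<lambda>i. p i + t * (q i - p i)))"
    by (rule continuous_on_segment_integrand[OF c p continuous_on_const]) (rule q)
  then have "continuous_on (cbox 0 1) ((\<lambda>(x, t). t ^ l * F (\<lambda>i. p i + t * (q i - p i))) \<circ> Pair (0::real))"
    by (intro continuous_on_compose) (auto intro!: continuous_intros elim: continuous_on_subset)
  then show ?thesis by (simp add: o_def)
qed

text \<open>Differentiating the integrand with respect to a coordinate of q produces a factor t. The
  power \<open>t ^ l\<close> absorbs it, which is why l is generalized in the induction.\<close>

lemma Ck_on_segment_integral:
  assumes p: "p \<in> Rn n"
  shows "Ck_on k n (cube n p e) F \<Longrightarrow>
    Ck_on k n (cube n p e) (\<lambda>q. integral {0..1} (\<lambda>t. t ^ l * F (\<lambda>i. p i + t * (q i - p i))))"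
proof (induction k arbitrary: F l)
  case 0
  have "continuous_on (cube n p e) F" by (rule Ck_on_continuous[OF 0 openin_cube])
  from integral_continuous_on_param[OF continuous_on_segment_integrand[OF this p continuous_on_id]]
  show ?case by (simp add: continuous_map_sub_iff[OF openin_subset_Rn[OF openin_cube]])
next
  case (Suc k)
  note F = Ck_on_SucD[OF Suc.prems openin_cube]
  show ?case
  proof (rule Ck_on_SucI[OF openin_cube])
    from integral_continuous_on_param[OF continuous_on_segment_integrand[OF F(1) p continuous_on_id]]
    show "continuous_on (cube n p e) (\<lambda>q. integral {0..1} (\<lambda>t. t ^ l * F (\<lambda>i. p i + t * (q i - p i))))"
      by simp
  next
    fix j assume j: "j < n"
    show "Ck_on k n (cube n p e) (\<lambda>q. integral {0..1} (\<lambda>t. t ^ Suc l * partial_deriv j F (\<lambda>i. p i + t * (q i - p i))))"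
      by (rule Suc.IH[OF F(3)[OF j]])
  next
    fix j q assume j: "j < n" and q: "q \<in> cube n p e"
    define S where "S = {p j - e<..<p j + e}"
    have qS: "q j \<in> S" using q j by (auto simp: S_def cube_def abs_less_iff)
    have upd: "q(j := s) \<in> cube n p e" if "s \<in> S" for s
      using fun_upd_mem_cube[OF q j] that by (auto simp: S_def abs_less_iff)
    have cupd: "continuous_on S (\<lambda>s. q(j := s))"
    proof (rule continuous_on_coordinatewise_then_product)
      show "continuous_on S (\<lambda>s. (q(j := s)) i)" for i by (cases "i = j") simp_all
    qed
    have "((\<lambda>s. integral (cbox 0 1) (\<lambda>t. t ^ l * F (\<lambda>i. p i + t * ((q(j := s)) i - p i))))
      has_real_derivative integral (cbox 0 1) (\<lambda>t. t ^ Suc l *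
        partial_deriv j F (\<lambda>i. p i + t * ((q(j := q j)) i - p i)))) (at (q j) within S)"
    proof (rule leibniz_rule_field_derivative)
      fix s t :: real assume s: "s \<in> S" and t: "t \<in> cbox 0 1"
      let ?z = "\<lambda>i. p i + t * ((q(j := s)) i - p i)"
      have z: "?z \<in> cube n p e" using segment_mem_cube[OF upd[OF s] p] t by simp
      have zj: "?z j = p j + t * (s - p j)" by simp
      have "((\<lambda>s. p j + t * (s - p j)) has_real_derivative t) (at s)"
        by (auto intro!: derivative_eq_intros)
      note D = DERIV_chain2[OF F(2)[OF j z, unfolded zj] this]
      have eq: "?z(j := p j + t * (x - p j)) = (\<lambda>i. p i + t * ((q(j := x)) i - p i))" for x
        by auto
      have "((\<lambda>x. F (\<lambda>i. p i + t * ((q(j := x)) i - p i))) has_real_derivative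
          partial_deriv j F ?z * t) (at s within S)"
        by (rule has_field_derivative_at_within[OF D[unfolded eq]])
      from DERIV_cmult[OF this, of "t ^ l"]
      show "((\<lambda>x. t ^ l * F (\<lambda>i. p i + t * ((q(j := x)) i - p i))) has_real_derivative
          t ^ Suc l * partial_deriv j F ?z) (at s within S)"
        by (simp add: mult_ac)
    next
      fix s assume s: "s \<in> S"
      have "continuous_on (cbox 0 1) (\<lambda>t. t ^ l * F (\<lambda>i. p i + t * ((q(j := s)) i - p i)))"
        by (rule continuous_on_segment_integrand_at[OF F(1) p upd[OF s]])
      then show "(\<lambda>t. t ^ l * F (\<lambda>i. p i + t * ((q(j := s)) i - p i))) integrable_on cbox 0 1"
        by (rule integrable_continuous)
    next
      show "continuous_on (S \<times> cbox 0 1) (\<lambda>(s, t). t ^ Suc l *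
          partial_deriv j F (\<lambda>i. p i + t * ((q(j := s)) i - p i)))"
        by (rule continuous_on_segment_integrand[OF Ck_on_continuous[OF F(3)[OF j] openin_cube] p cupd upd])
    qed (use qS in \<open>auto simp: S_def\<close>)
    moreover have "at (q j) within S = at (q j)"
      using qS by (intro at_within_open) (auto simp: S_def)
    ultimately show "((\<lambda>s. integral {0..1} (\<lambda>t. t ^ l * F (\<lambda>i. p i + t * ((q(j := s)) i - p i))))
      has_real_derivative integral {0..1} (\<lambda>t. t ^ Suc l *
        partial_deriv j F (\<lambda>i. p i + t * (q i - p i)))) (at (q j))"
      by simp
  qed
qed

text \<open>Integrating the derivative of f along the segment from p to q gives the g i as averages
  of partial derivatives over that segment. They are smooth by \<open>Ck_on_segment_integral\<close>
  with l = 0; the factor \<open>t ^ 0\<close> in their definition only matches its form.\<close>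

lemma hadamard:
  assumes p: "p \<in> Rn n" and f: "smooth_on n (cube n p e) f" and e: "0 < e"
  obtains g where "\<And>i. i < n \<Longrightarrow> smooth_on n (cube n p e) (g i)"
    "\<And>q. q \<in> cube n p e \<Longrightarrow> f q = f p + (\<Sum>i<n. (q i - p i) * g i q)"
    "\<And>i. i < n \<Longrightarrow> g i p = partial_deriv i f p"
proof -
  let ?C = "cube n p e"
  define g where "g i q = integral {0..1} (\<lambda>t. t ^ 0 * partial_deriv i f (\<lambda>j. p j + t * (q j - p j)))" for i q
  have pC: "Ck_on k n ?C (partial_deriv i f)" if "i < n" for i k
    using Ck_on_SucD(3)[OF smooth_onD(2)[OF f, of "Suc k"] openin_cube that] .
  have c: "continuous_on ?C (partial_deriv i f)" if "i < n" for i
    using Ck_on_continuous[OF pC[OF that] openin_cube] .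
  show thesis
  proof
    show "smooth_on n ?C (g i)" if "i < n" for i
      unfolding g_def smooth_on_def using Ck_on_segment_integral[OF p pC[OF that]] openin_cube by blast
    show "g i p = partial_deriv i f p" if "i < n" for i
      by (simp add: g_def)
    fix q assume q: "q \<in> ?C"
    let ?\<gamma> = "\<lambda>t j. p j + t * (q j - p j)"
    have \<gamma>R: "?\<gamma> t \<in> Rn n" for t using p q by (auto simp: cube_def Rn_iff)
    have d: "((\<lambda>t. f (?\<gamma> t)) has_real_derivative (\<Sum>i<n. partial_deriv i f (?\<gamma> t) * (q i - p i))) (at t)"
      if "t \<in> {0..1}" for t
      by (rule DERIV_along_curve[OF openin_cube[of n p e] _ Ck_on_SucD(2)[OF smooth_onD(2)[OF f, of "Suc 0"] openin_cube] c])
        (use segment_mem_cube[OF q p] that \<gamma>R in \<open>auto intro!: derivative_eq_intros\<close>)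
    have "((\<lambda>t. \<Sum>i<n. partial_deriv i f (?\<gamma> t) * (q i - p i)) has_integral f (?\<gamma> 1) - f (?\<gamma> 0)) {0..1}"
      by (rule fundamental_theorem_of_calculus)
        (use d in \<open>auto simp: has_real_derivative_iff_has_vector_derivative[symmetric] intro: has_field_derivative_at_within\<close>)
    then have "f q - f p = integral {0..1} (\<lambda>t. \<Sum>i<n. partial_deriv i f (?\<gamma> t) * (q i - p i))"
      by (simp add: integral_unique)
    also have "\<dots> = (\<Sum>i<n. integral {0..1} (\<lambda>t. partial_deriv i f (?\<gamma> t) * (q i - p i)))"
    proof (rule integral_sum)
      fix i assume "i \<in> {..<n}"
      then have i: "i < n" by simp
      have "continuous_on (cbox 0 1) (\<lambda>t. t ^ 0 * partial_deriv i f (?\<gamma> t))"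
        by (rule continuous_on_segment_integrand_at[OF c[OF i] p q])
      then have "continuous_on {0..1} (\<lambda>t. partial_deriv i f (?\<gamma> t) * (q i - p i))"
        by (intro continuous_on_mult continuous_on_const) simp
      then show "(\<lambda>t. partial_deriv i f (?\<gamma> t) * (q i - p i)) integrable_on {0..1}"
        by (rule integrable_continuous_real)
    qed simp
    also have "\<dots> = (\<Sum>i<n. (q i - p i) * g i q)"
      by (simp add: g_def mult.commute)
    finally show "f q = f p + (\<Sum>i<n. (q i - p i) * g i q)" by simp
  qed
qed

text \<open>The derivatives of \<open>exp (-1/t)\<close> are combinations of the functions \<open>flat k\<close>.\<close>

definition flat :: "nat \<Rightarrow> real \<Rightarrow> real" where
  "flat k t = (if 0 < t then inverse t ^ k * exp (- inverse t) else 0)"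

text \<open>On the right of 0, put s = 1/t: then s^k / exp s tends to 0 as s tends to infinity. On
  the left the function is 0.\<close>

lemma flat_tendsto_0: "(flat k \<longlongrightarrow> 0) (at 0)"
proof -
  have "((\<lambda>t. inverse t ^ k / exp (inverse t)) \<longlongrightarrow> 0) (at_right (0::real))"
    by (rule filterlim_compose[OF tendsto_power_div_exp_0 filterlim_inverse_at_top_right])
  moreover have "\<forall>\<^sub>F t in at_right 0. inverse t ^ k / exp (inverse t) = flat k t"
    using eventually_at_right_less[of "0::real"]
    by eventually_elim (simp add: flat_def exp_minus divide_inverse)
  ultimately have "(flat k \<longlongrightarrow> 0) (at_right 0)" by (rule Lim_transform_eventually)
  moreover have "(flat k \<longlongrightarrow> 0) (at_left 0)"
  proof (rule Lim_transform_eventually[OF tendsto_const])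
    show "\<forall>\<^sub>F t in at_left 0. 0 = flat k t"
      by (auto simp: flat_def eventually_at_filter)
  qed
  ultimately show ?thesis by (simp add: filterlim_split_at)
qed

lemma DERIV_flat: "(flat k has_real_derivative flat (k + 2) t - real k * flat (k + 1) t) (at t)"
proof (cases t "0::real" rule: linorder_cases)
  case greater
  have d: "((\<lambda>t. inverse t) has_real_derivative - (inverse t * inverse t)) (at t)"
    using greater by (auto intro!: derivative_eq_intros simp: power2_eq_square)
  have "((\<lambda>t. inverse t ^ k * exp (- inverse t)) has_real_derivative
      real k * inverse t ^ (k - 1) * - (inverse t * inverse t) * exp (- inverse t)
      + exp (- inverse t) * (inverse t * inverse t) * inverse t ^ k) (at t)"
    by (rule DERIV_cong[OF DERIV_mult[OF DERIV_power[OF d] DERIV_chain2[OF DERIV_exp DERIV_minus[OF d]]]])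
      (simp add: mult_ac)
  moreover have "real k * inverse t ^ (k - 1) * (inverse t * inverse t) = real k * inverse t ^ (k + 1)"
    by (cases k) auto
  then have "real k * inverse t ^ (k - 1) * - (inverse t * inverse t) * exp (- inverse t)
      + exp (- inverse t) * (inverse t * inverse t) * inverse t ^ k = flat (k + 2) t - real k * flat (k + 1) t"
    using greater by (simp add: flat_def left_diff_distrib mult_ac)
  ultimately have "((\<lambda>t. inverse t ^ k * exp (- inverse t)) has_real_derivative
      flat (k + 2) t - real k * flat (k + 1) t) (at t)" by simp
  moreover have "\<forall>\<^sub>F s in nhds t. inverse s ^ k * exp (- inverse s) = flat k s"
    using eventually_nhds_in_open[of "{0<..}" t] greater by (auto simp: flat_def elim: eventually_mono)
  ultimately show ?thesis by (subst (asm) DERIV_cong_ev[OF refl _ refl])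
next
  case less
  have "\<forall>\<^sub>F s in nhds t. 0 = flat k s"
    using eventually_nhds_in_open[of "{..<0}" t] less by (auto simp: flat_def elim: eventually_mono)
  moreover have "((\<lambda>_. 0) has_real_derivative flat (k + 2) t - real k * flat (k + 1) t) (at t)"
    using less by (simp add: flat_def)
  ultimately show ?thesis by (subst (asm) DERIV_cong_ev[OF refl _ refl])
next
  case equal
  \<comment> \<open>At 0 the difference quotient of \<open>flat k\<close> is
    \<open>flat (Suc k)\<close>, so differentiability there is again a limit already
    computed.\<close>
  have "((\<lambda>s. (flat k s - flat k 0) / (s - 0)) \<longlongrightarrow> 0) (at 0)"
    by (rule Lim_transform_eventually[OF flat_tendsto_0[of "Suc k"]])
      (simp add: flat_def divide_inverse)
  then show ?thesis using equal by (simp add: has_field_derivative_iff flat_def)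
qed

lemma Ck_on_flat:
  assumes U: "openin (Euclidean_space n) U"
  shows "Ck_on k n U f \<Longrightarrow> Ck_on k n U (\<lambda>p. flat j (f p))"
proof (induction k arbitrary: j)
  case 0
  have "continuous_on UNIV (flat j)"
    using DERIV_flat DERIV_isCont continuous_at_imp_continuous_on by blast
  then show ?case using Ck_on_continuous[OF 0 U] continuous_map_sub_iff[OF openin_subset_Rn[OF U]]
    by (auto intro: continuous_on_compose2)
next
  case (Suc k)
  note f = Ck_on_SucD[OF Suc.prems(1) U]
  have cont: "continuous_on UNIV (flat j)"
    using DERIV_flat DERIV_isCont continuous_at_imp_continuous_on by blast
  show ?case
  proof (rule Ck_on_SucI[OF U])
    show "continuous_on U (\<lambda>p. flat j (f p))"
      using f(1) cont by (auto intro: continuous_on_compose2)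
    show "((\<lambda>t. flat j (f (p(i := t)))) has_real_derivative
       (flat (j + 2) (f p) + (- real j) * flat (j + 1) (f p)) * partial_deriv i f p) (at (p i))"
      if "i < n" "p \<in> U" for i p
      by (rule DERIV_cong[OF DERIV_chain2[OF DERIV_flat f(2)[OF that]]]) simp
    show "Ck_on k n U (\<lambda>p. (flat (j + 2) (f p) + (- real j) * flat (j + 1) (f p)) * partial_deriv i f p)"
      if "i < n" for i
      by (intro Ck_on_mult[OF U] Ck_on_add[OF U] Ck_on_const[OF U] f(3)[OF that]
          Suc.IH[OF Ck_on_le_Suc[OF U Suc.prems]])
  qed
qed

section \<open>Smooth cutoff functions on \<open>Rn n\<close>\<close>

definition smooth_step :: "real \<Rightarrow> real" where
  "smooth_step t = flat 0 t * inverse (flat 0 t + flat 0 (1 - t))"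

lemma flat_0_nonneg: "0 \<le> flat 0 t" and flat_0_pos: "0 < t \<Longrightarrow> 0 < flat 0 t"
  by (auto simp: flat_def)

text \<open>At least one of t and 1 - t is positive. This is what makes the quotient defining
  \<open>smooth_step\<close> smooth everywhere.\<close>

lemma flat_sum_pos: "0 < flat 0 t + flat 0 (1 - t)"
proof (cases "0 < t")
  case True then show ?thesis using flat_0_pos[of t] flat_0_nonneg[of "1 - t"] by linarith
next
  case False then show ?thesis using flat_0_pos[of "1 - t"] flat_0_nonneg[of t] by linarith
qed

lemma smooth_step_0: "t \<le> 0 \<Longrightarrow> smooth_step t = 0"
  and smooth_step_1: "1 \<le> t \<Longrightarrow> smooth_step t = 1"
  and smooth_step_nonneg: "0 \<le> smooth_step t"
  using flat_0_nonneg flat_sum_pos[of t] flat_0_pos[of t]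
  by (auto simp: smooth_step_def flat_def)

lemma Ck_on_smooth_step:
  assumes U: "openin (Euclidean_space n) U" and f: "Ck_on k n U f"
  shows "Ck_on k n U (\<lambda>p. smooth_step (f p))"
proof -
  have "Ck_on k n U (\<lambda>p. 1 + (- 1) * f p)"
    by (intro Ck_on_add[OF U] Ck_on_mult[OF U] Ck_on_const[OF U] f)
  then have g: "Ck_on k n U (\<lambda>p. flat 0 (1 - f p))" using Ck_on_flat[OF U, of k "\<lambda>p. 1 - f p"] by simp
  show ?thesis
    unfolding smooth_step_def
    by (intro Ck_on_mult[OF U] Ck_on_inverse[OF U] Ck_on_add[OF U] Ck_on_flat[OF U] f g)
      (use flat_sum_pos in \<open>auto simp: less_imp_neq[THEN not_sym]\<close>)
qed

lemma Ck_on_prod: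
  assumes U: "openin (Euclidean_space n) U" and "\<And>j. j \<in> J \<Longrightarrow> Ck_on k n U (f j)"
  shows "Ck_on k n U (\<lambda>p. \<Prod>j\<in>J. f j p)"
  using assms(2)
  by (induction J rule: infinite_finite_induct) (auto intro: Ck_on_const[OF U] Ck_on_mult[OF U])

definition closed_cube :: "nat \<Rightarrow> (nat \<Rightarrow> real) \<Rightarrow> real \<Rightarrow> (nat \<Rightarrow> real) set" where
  "closed_cube n p e = {q \<in> Rn n. \<forall>i<n. \<bar>q i - p i\<bar> \<le> e}"

text \<open>In the full product space this set is itself a product, of compact intervals in the
  first n coordinates and of the singleton {0} in all others, so Tychonoff's theorem
  applies.\<close>

lemma compactin_closed_cube: "compactin (Euclidean_space n) (closed_cube n p e)"
proof -
  have "closed_cube n p e = (\<Pi>\<^sub>E i\<in>UNIV. if i < n then {p i - e..p i + e} else {0})"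
  proof (intro Set.set_eqI iffI)
    fix q assume "q \<in> closed_cube n p e"
    then have "q i \<in> (if i < n then {p i - e..p i + e} else {0})" for i
      by (auto simp: closed_cube_def Rn_iff abs_le_iff not_less algebra_simps)
    then show "q \<in> (\<Pi>\<^sub>E i\<in>UNIV. if i < n then {p i - e..p i + e} else {0})" by auto
  next
    fix q assume "q \<in> (\<Pi>\<^sub>E i\<in>UNIV. if i < n then {p i - e..p i + e} else {0})"
    then have "q i \<in> (if i < n then {p i - e..p i + e} else {0})" for i
      by (rule PiE_mem) simp
    then have "(i < n \<longrightarrow> p i - e \<le> q i \<and> q i \<le> p i + e) \<and> (\<not> i < n \<longrightarrow> q i = 0)" for i
      by (metis atLeastAtMost_iff singletonD)
    then have "i < n \<Longrightarrow> \<bar>q i - p i\<bar> \<le> e" "n \<le> i \<Longrightarrow> q i = 0" for i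
      by (smt (verit), metis not_le)
    then show "q \<in> closed_cube n p e" by (simp add: closed_cube_def Rn_iff)
  qed
  moreover have "compactin (powertop_real UNIV) (\<Pi>\<^sub>E i\<in>UNIV. if i < n then {p i - e..p i + e} else {0})"
    by (subst compactin_PiE) auto
  ultimately have "compactin (powertop_real UNIV) (closed_cube n p e)" by simp
  then show ?thesis
    unfolding Euclidean_space_def compactin_subtopology by (auto simp: closed_cube_def Rn_iff)
qed

lemma Rn_bump:
  assumes e: "0 < e" and p: "p \<in> Rn n"
  obtains b where "smooth_on n (Rn n) b" "\<And>q. q \<in> cube n p e \<Longrightarrow> b q = 1"
    "\<And>q. q \<in> Rn n \<Longrightarrow> q \<notin> closed_cube n p (2 * e) \<Longrightarrow> b q = 0" "\<And>q. 0 \<le> (b q :: real)"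
proof
  \<comment> \<open>With d = q i - p i this is (4 e^2 - d^2) / (3 e^2), which is at least 1 for |d|
    \<le> e and at most 0 for |d| \<ge> 2 e. Squaring avoids the absolute value, which is not
    smooth.\<close>
  define u where "u i q = (4 * e\<^sup>2 + (- 1) * ((q i + - p i) * (q i + - p i))) * inverse (3 * e\<^sup>2)" for i and q :: "nat \<Rightarrow> real"
  let ?b = "\<lambda>q. \<Prod>i<n. smooth_step (u i q)"
  have U: "openin (Euclidean_space n) (Rn n)" by simp
  show "smooth_on n (Rn n) ?b"
    unfolding smooth_on_def u_def
    by (intro conjI allI U Ck_on_prod[OF U] Ck_on_smooth_step[OF U] Ck_on_mult[OF U] Ck_on_add[OF U]
        Ck_on_const[OF U] Ck_on_coord[OF U])
  show "?b q = 1" if "q \<in> cube n p e" for q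
  proof (intro prod.neutral ballI smooth_step_1)
    fix i assume "i \<in> {..<n}"
    then have "\<bar>q i - p i\<bar> \<le> e" using that by (auto simp: cube_def intro: less_imp_le)
    then have "(q i - p i)\<^sup>2 \<le> e\<^sup>2" by (metis abs_ge_zero power2_abs power_mono)
    then show "1 \<le> u i q" using e by (simp add: u_def field_simps power2_eq_square)
  qed
  show "?b q = 0" if q: "q \<in> Rn n" "q \<notin> closed_cube n p (2 * e)" for q
  proof -
    obtain i where i: "i < n" "2 * e < \<bar>q i - p i\<bar>" using q by (auto simp: closed_cube_def not_le)
    then have "(2 * e)\<^sup>2 \<le> \<bar>q i - p i\<bar>\<^sup>2" using e by (intro power_mono) auto
    then have "u i q \<le> 0" using e by (simp add: u_def field_simps power2_eq_square mult_le_0_iff)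
    then show ?thesis using i(1) by (intro prod_zero bexI[of _ i]) (simp_all add: smooth_step_0)
  qed
  show "0 \<le> ?b q" for q by (intro prod_nonneg) (simp add: smooth_step_nonneg)
qed

subsection \<open>Smooth functions on manifolds\<close>

lemma chartD:
  assumes "smooth_manifold M" "(U, \<phi>) \<in> mcharts M"
  shows "openin (mtop M) U" "openin (Euclidean_space (mdim M)) (\<phi> ` U)"
    "homeomorphic_map (subtopology (mtop M) U) (subtopology (Euclidean_space (mdim M)) (\<phi> ` U)) \<phi>"
    "inj_on \<phi> U" "U \<subseteq> mpoints M" "\<And>x. x \<in> U \<Longrightarrow> \<phi> x \<in> Rn (mdim M)"
proof -
  show U: "openin (mtop M) U" and o: "openin (Euclidean_space (mdim M)) (\<phi> ` U)"
    and h: "homeomorphic_map (subtopology (mtop M) U) (subtopology (Euclidean_space (mdim M)) (\<phi> ` U)) \<phi>"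
    using assms unfolding smooth_manifold_def by fast+
  show s: "U \<subseteq> mpoints M" by (rule openin_subset[OF U])
  show "inj_on \<phi> U"
    using homeomorphic_imp_injective_map[OF h] s by (simp add: Int_absorb1)
  show "\<And>x. x \<in> U \<Longrightarrow> \<phi> x \<in> Rn (mdim M)" using openin_subset_Rn[OF o] by auto
qed

lemma chart_cover:
  assumes "smooth_manifold M" "x \<in> mpoints M"
  obtains U \<phi> where "(U, \<phi>) \<in> mcharts M" "x \<in> U"
  using assms unfolding smooth_manifold_def by blast

lemma chart_image_open:
  assumes M: "smooth_manifold M" "(U, \<phi>) \<in> mcharts M" and W: "openin (mtop M) W" "W \<subseteq> U"
  shows "openin (Euclidean_space (mdim M)) (\<phi> ` W)"
proof -
  note c = chartD[OF M]
  have "openin (subtopology (mtop M) U) W" using W c(1) by (simp add: openin_open_subtopology)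
  moreover have "W \<subseteq> topspace (subtopology (mtop M) U)" using W c(5) by auto
  ultimately have "openin (subtopology (Euclidean_space (mdim M)) (\<phi> ` U)) (\<phi> ` W)"
    using homeomorphic_map_openness[OF c(3)] by blast
  then show ?thesis using openin_open_subtopology[OF c(2)] by blast
qed

lemma chart_preimage_open:
  assumes M: "smooth_manifold M" "(U, \<phi>) \<in> mcharts M" and V: "openin (Euclidean_space (mdim M)) V"
  shows "openin (mtop M) {x \<in> U. \<phi> x \<in> V}"
proof -
  note c = chartD[OF M]
  have "continuous_map (subtopology (mtop M) U) (Euclidean_space (mdim M)) \<phi>"
    using homeomorphic_imp_continuous_map[OF c(3)] by (simp add: continuous_map_in_subtopology)
  from openin_continuous_map_preimage[OF this V]
  have "openin (subtopology (mtop M) U) {x \<in> U. \<phi> x \<in> V}" using c(5) by (simp add: Int_absorb1)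
  then show ?thesis using openin_open_subtopology[OF c(1)] by blast
qed

lemma smooth_on_cong: "smooth_on n U f \<Longrightarrow> (\<And>p. p \<in> U \<Longrightarrow> f p = g p) \<Longrightarrow> smooth_on n U g"
  unfolding smooth_on_def using Ck_on_cong by blast

lemma smooth_on_subset: "smooth_on n U f \<Longrightarrow> openin (Euclidean_space n) V \<Longrightarrow> V \<subseteq> U \<Longrightarrow> smooth_on n V f"
  unfolding smooth_on_def using Ck_on_subset by blast

lemma smooth_on_partial_deriv: "smooth_on n U f \<Longrightarrow> i < n \<Longrightarrow> smooth_on n U (partial_deriv i f)"
  unfolding smooth_on_def using Ck_on_SucD(3) by blast

lemma smooth_on_compose:
  assumes "smooth_on n V f" "openin (Euclidean_space m) U" "\<And>p. p \<in> U \<Longrightarrow> G p \<in> V"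
    "\<And>i. i < n \<Longrightarrow> smooth_on m U (\<lambda>p. G p i)"
  shows "smooth_on m U (\<lambda>p. f (G p))"
  using assms Ck_on_compose[of m U n V G] unfolding smooth_on_def by blast

lemma smooth_fun_on_open: "smooth_fun_on M W f \<Longrightarrow> openin (mtop M) W"
  by (simp add: smooth_fun_on_def)

lemma smooth_fun_on_chartD:
  "smooth_fun_on M W f \<Longrightarrow> (U, \<phi>) \<in> mcharts M \<Longrightarrow>
   smooth_on (mdim M) (\<phi> ` (U \<inter> W)) (\<lambda>p. f (inv_into U \<phi> p))"
  unfolding smooth_fun_on_def by blast

lemma smooth_fun_onI:
  "openin (mtop M) W \<Longrightarrow> (\<And>U \<phi>. (U, \<phi>) \<in> mcharts M \<Longrightarrow>
   smooth_on (mdim M) (\<phi> ` (U \<inter> W)) (\<lambda>p. f (inv_into U \<phi> p))) \<Longrightarrow> smooth_fun_on M W f"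
  unfolding smooth_fun_on_def by blast

lemma chart_image_Int_open:
  assumes "smooth_manifold M" "(U, \<phi>) \<in> mcharts M" "openin (mtop M) W"
  shows "openin (Euclidean_space (mdim M)) (\<phi> ` (U \<inter> W))"
  by (intro chart_image_open[OF assms(1,2)] openin_Int chartD(1)[OF assms(1,2)] assms(3)) auto

lemma smooth_fun_on_cong:
  assumes "smooth_manifold M" "smooth_fun_on M W f" "\<And>x. x \<in> W \<Longrightarrow> f x = g x"
  shows "smooth_fun_on M W g"
proof (rule smooth_fun_onI[OF smooth_fun_on_open[OF assms(2)]])
  fix U \<phi> assume c: "(U, \<phi>) \<in> mcharts M"
  show "smooth_on (mdim M) (\<phi> ` (U \<inter> W)) (\<lambda>p. g (inv_into U \<phi> p))"
    by (rule smooth_on_cong[OF smooth_fun_on_chartD[OF assms(2) c]])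
      (use assms(3) chartD(4)[OF assms(1) c] in auto)
qed

lemma smooth_fun_on_subset:
  assumes M: "smooth_manifold M" and f: "smooth_fun_on M W f" and V: "openin (mtop M) V" "V \<subseteq> W"
  shows "smooth_fun_on M V f"
proof (rule smooth_fun_onI[OF V(1)])
  fix U \<phi> assume c: "(U, \<phi>) \<in> mcharts M"
  show "smooth_on (mdim M) (\<phi> ` (U \<inter> V)) (\<lambda>p. f (inv_into U \<phi> p))"
    by (rule smooth_on_subset[OF smooth_fun_on_chartD[OF f c] chart_image_Int_open[OF M c V(1)]])
      (use V(2) in auto)
qed

lemma smooth_fun_on_local:
  assumes M: "smooth_manifold M"
    and loc: "\<And>x. x \<in> W \<Longrightarrow> \<exists>V. x \<in> V \<and> V \<subseteq> W \<and> smooth_fun_on M V f"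
  shows "smooth_fun_on M W f"
proof (rule smooth_fun_onI)
  show W: "openin (mtop M) W"
    using loc smooth_fun_on_open openin_subopen by metis
  fix U \<phi> assume c: "(U, \<phi>) \<in> mcharts M"
  have o: "openin (Euclidean_space (mdim M)) (\<phi> ` (U \<inter> W))" by (rule chart_image_Int_open[OF M c W])
  show "smooth_on (mdim M) (\<phi> ` (U \<inter> W)) (\<lambda>p. f (inv_into U \<phi> p))"
    unfolding smooth_on_def
  proof (intro conjI allI o Ck_on_local)
    fix k p assume "p \<in> \<phi> ` (U \<inter> W)"
    then obtain x where x: "x \<in> U" "x \<in> W" "p = \<phi> x" by auto
    then obtain V where V: "x \<in> V" "V \<subseteq> W" "smooth_fun_on M V f" using loc by blast
    have "smooth_on (mdim M) (\<phi> ` (U \<inter> V)) (\<lambda>p. f (inv_into U \<phi> p))"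
      by (rule smooth_fun_on_chartD[OF V(3) c])
    then show "\<exists>V. openin (Euclidean_space (mdim M)) V \<and> p \<in> V \<and> V \<subseteq> \<phi> ` (U \<inter> W) \<and>
        Ck_on k (mdim M) V (\<lambda>p. f (inv_into U \<phi> p))"
      using x V by (intro exI[of _ "\<phi> ` (U \<inter> V)"]) (auto simp: smooth_on_def)
  qed
qed

lemma smooth_fun_on_const:
  assumes "smooth_manifold M" "openin (mtop M) W"
  shows "smooth_fun_on M W (\<lambda>_. c)"
  using assms by (intro smooth_fun_onI) (auto simp: smooth_on_def chart_image_Int_open intro!: Ck_on_const)

lemma smooth_fun_on_add:
  assumes "smooth_manifold M" "smooth_fun_on M W f" "smooth_fun_on M W g"
  shows "smooth_fun_on M W (\<lambda>x. f x + g x)"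
  using assms smooth_fun_on_open[OF assms(2)] smooth_fun_on_chartD[OF assms(2)] smooth_fun_on_chartD[OF assms(3)]
  by (intro smooth_fun_onI) (auto simp: smooth_on_def intro!: Ck_on_add)

lemma smooth_fun_on_mult:
  assumes "smooth_manifold M" "smooth_fun_on M W f" "smooth_fun_on M W g"
  shows "smooth_fun_on M W (\<lambda>x. f x * g x)"
  using assms smooth_fun_on_open[OF assms(2)] smooth_fun_on_chartD[OF assms(2)] smooth_fun_on_chartD[OF assms(3)]
  by (intro smooth_fun_onI) (auto simp: smooth_on_def intro!: Ck_on_mult)

lemma smooth_fun_on_diff:
  assumes "smooth_manifold M" "smooth_fun_on M W f" "smooth_fun_on M W g"
  shows "smooth_fun_on M W (\<lambda>x. f x - g x)"
  using smooth_fun_on_add[OF assms(1,2) smooth_fun_on_mult[OF assms(1)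
      smooth_fun_on_const[OF assms(1) smooth_fun_on_open[OF assms(2)], of "- 1"] assms(3)]] by simp

lemma smooth_fun_on_sum:
  assumes "smooth_manifold M" "openin (mtop M) W" "\<And>j. j \<in> J \<Longrightarrow> smooth_fun_on M W (f j)"
  shows "smooth_fun_on M W (\<lambda>x. \<Sum>j\<in>J. f j x)"
  using assms(3)
  by (induction J rule: infinite_finite_induct)
    (auto intro: smooth_fun_on_const[OF assms(1,2)] smooth_fun_on_add[OF assms(1)])

lemma smooth_fun_on_inverse:
  assumes M: "smooth_manifold M" and f: "smooth_fun_on M W f" and nz: "\<And>x. x \<in> W \<Longrightarrow> f x \<noteq> 0"
  shows "smooth_fun_on M W (\<lambda>x. inverse (f x))"
proof (rule smooth_fun_onI[OF smooth_fun_on_open[OF f]])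
  fix U \<phi> assume c: "(U, \<phi>) \<in> mcharts M"
  have "inv_into U \<phi> p \<in> W" if "p \<in> \<phi> ` (U \<inter> W)" for p
    using that chartD(4)[OF M c] by auto
  then show "smooth_on (mdim M) (\<phi> ` (U \<inter> W)) (\<lambda>p. inverse (f (inv_into U \<phi> p)))"
    using smooth_fun_on_chartD[OF f c] nz by (auto simp: smooth_on_def intro!: Ck_on_inverse)
qed

lemma smooth_fun_on_compose:
  assumes M: "smooth_manifold M" and F: "smooth_on n V F" and W: "openin (mtop M) W"
    and G: "\<And>x. x \<in> W \<Longrightarrow> G x \<in> V" "\<And>i. i < n \<Longrightarrow> smooth_fun_on M W (\<lambda>x. G x i)"
  shows "smooth_fun_on M W (\<lambda>x. F (G x))"
proof (rule smooth_fun_onI[OF W])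
  fix U \<phi> assume c: "(U, \<phi>) \<in> mcharts M"
  show "smooth_on (mdim M) (\<phi> ` (U \<inter> W)) (\<lambda>p. F (G (inv_into U \<phi> p)))"
    by (rule smooth_on_compose[OF F chart_image_Int_open[OF M c W]])
      (use G smooth_fun_on_chartD[OF G(2) c] chartD(4)[OF M c] in auto)
qed

lemma smooth_fun_on_chart_coord:
  assumes M: "smooth_manifold M" and c: "(U, \<phi>) \<in> mcharts M"
  shows "smooth_fun_on M U (\<lambda>x. \<phi> x i)"
proof (cases "i < mdim M")
  case True
  show ?thesis
  proof (rule smooth_fun_onI[OF chartD(1)[OF M c]])
    fix V \<psi> assume "(V, \<psi>) \<in> mcharts M"
    then show "smooth_on (mdim M) (\<psi> ` (V \<inter> U)) (\<lambda>p. \<phi> (inv_into V \<psi> p) i)"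
      using M c True unfolding smooth_manifold_def by fast
  qed
next
  case False
  show ?thesis
    by (rule smooth_fun_on_cong[OF M smooth_fun_on_const[OF M chartD(1)[OF M c], of 0]])
      (use chartD(6)[OF M c] False in \<open>auto simp: Rn_iff not_less\<close>)
qed

lemma smooth_fun_on_chart_compose:
  assumes M: "smooth_manifold M" and c: "(U, \<phi>) \<in> mcharts M" and W: "openin (mtop M) W" "W \<subseteq> U"
    and F: "smooth_on (mdim M) V F" "\<phi> ` W \<subseteq> V"
  shows "smooth_fun_on M W (\<lambda>x. F (\<phi> x))"
  using smooth_fun_on_subset[OF M smooth_fun_on_chart_coord[OF M c] W] F(2)
  by (intro smooth_fun_on_compose[OF M F(1) W(1)]) auto

lemma smooth_fun_on_pullback:
  assumes M: "smooth_manifold M" and M': "smooth_manifold M'" and F: "smooth_map M M' F"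
    and f: "smooth_fun_on M' W f"
  shows "smooth_fun_on M {x \<in> mpoints M. F x \<in> W} (\<lambda>x. f (F x))"
proof (rule smooth_fun_on_local[OF M])
  fix x assume x: "x \<in> {x \<in> mpoints M. F x \<in> W}"
  have W: "openin (mtop M') W" by (rule smooth_fun_on_open[OF f])
  then have "F x \<in> mpoints M'" using x openin_subset by blast
  then obtain V \<psi> where c: "(V, \<psi>) \<in> mcharts M'" "F x \<in> V" using chart_cover[OF M'] by metis
  define P where "P = {x \<in> mpoints M. F x \<in> V \<inter> W}"
  have VW: "openin (mtop M') (V \<inter> W)" using chartD(1)[OF M' c(1)] W by blast
  have P: "openin (mtop M) P"
    unfolding P_def using openin_continuous_map_preimage[OF _ VW] F unfolding smooth_map_def by blast
  have "smooth_fun_on M P (\<lambda>x. f (inv_into V \<psi> (\<psi> (F x))))"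
  proof (rule smooth_fun_on_compose[OF M smooth_fun_on_chartD[OF f c(1)] P])
    show "\<psi> (F x) \<in> \<psi> ` (V \<inter> W)" if "x \<in> P" for x using that by (auto simp: P_def)
    fix i assume "i < mdim M'"
    then have "smooth_fun_on M {x \<in> mpoints M. F x \<in> V} (\<lambda>x. \<psi> (F x) i)"
      using F c(1) unfolding smooth_map_def by fast
    then show "smooth_fun_on M P (\<lambda>x. \<psi> (F x) i)"
      by (rule smooth_fun_on_subset[OF M _ P]) (auto simp: P_def)
  qed
  then have "smooth_fun_on M P (\<lambda>x. f (F x))"
    by (rule smooth_fun_on_cong[OF M]) (use chartD(4)[OF M' c(1)] in \<open>auto simp: P_def\<close>)
  then show "\<exists>V. x \<in> V \<and> V \<subseteq> {x \<in> mpoints M. F x \<in> W} \<and> smooth_fun_on M V (\<lambda>x. f (F x))"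
    using x c(2) by (intro exI[of _ P]) (auto simp: P_def)
qed

text \<open>The open sets U and the complement of C cover M; on the first the extension is f, on the
  second it is 0.\<close>

lemma smooth_fun_extend:
  assumes M: "smooth_manifold M" and f: "smooth_fun_on M U f" and C: "closedin (mtop M) C" "C \<subseteq> U"
    and z: "\<And>x. x \<in> U \<Longrightarrow> x \<notin> C \<Longrightarrow> f x = 0"
  shows "smooth_fun_on M (mpoints M) (\<lambda>x. if x \<in> U then f x else 0)"
proof (rule smooth_fun_on_local[OF M])
  fix x assume x: "x \<in> mpoints M"
  have 1: "smooth_fun_on M U (\<lambda>x. if x \<in> U then f x else 0)"
    by (rule smooth_fun_on_cong[OF M f]) auto
  have "openin (mtop M) (mpoints M - C)" using C(1) by (simp add: openin_diff)
  then have 2: "smooth_fun_on M (mpoints M - C) (\<lambda>x. if x \<in> U then f x else 0)"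
    by (rule smooth_fun_on_cong[OF M smooth_fun_on_const[OF M, of _ 0]]) (use z in auto)
  show "\<exists>V. x \<in> V \<and> V \<subseteq> mpoints M \<and> smooth_fun_on M V (\<lambda>x. if x \<in> U then f x else 0)"
  proof (cases "x \<in> U")
    case True
    then show ?thesis using 1 openin_subset[OF smooth_fun_on_open[OF f]] by blast
  next
    case False
    then show ?thesis using 2 x C(2) by blast
  qed
qed

text \<open>The support C is the chart preimage of a compact cube, hence compact in M. The Hausdorff
  property makes it closed in M and not merely in the chart domain, and extension by 0 requires
  that.\<close>

lemma manifold_bump:
  assumes M: "smooth_manifold M" and W: "openin (mtop M) W" "x \<in> W"
  obtains b C V where "smooth_fun_on M (mpoints M) b" "compactin (mtop M) C" "closedin (mtop M) C"
    "C \<subseteq> W" "\<And>y. y \<notin> C \<Longrightarrow> b y = 0" "openin (mtop M) V" "x \<in> V" "V \<subseteq> C" "\<And>y. y \<in> V \<Longrightarrow> b y = 1"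
    "\<And>y. 0 \<le> (b y :: real)"
proof -
  obtain U \<phi> where c: "(U, \<phi>) \<in> mcharts M" "x \<in> U"
    using chart_cover[OF M] W openin_subset by (metis subsetD)
  let ?n = "mdim M" and ?p = "\<phi> x"
  note cD = chartD[OF M c(1)]
  obtain r where r: "0 < r" "cube ?n ?p r \<subseteq> \<phi> ` (U \<inter> W)"
    using openin_contains_cube[OF chart_image_Int_open[OF M c(1) W(1)], of ?p] c(2) W(2) by auto
  \<comment> \<open>Chosen so that the closed cube of radius 2 e, off which b vanishes, lies inside
    the open cube of radius r.\<close>
  define e where "e = r / 4"
  have e: "0 < e" "2 * e < r" using r(1) by (auto simp: e_def)
  have pR: "?p \<in> Rn ?n" using cD(6) c(2) by blast
  obtain b where b: "smooth_on ?n (Rn ?n) b" "\<And>q. q \<in> cube ?n ?p e \<Longrightarrow> b q = 1"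
    "\<And>q. q \<in> Rn ?n \<Longrightarrow> q \<notin> closed_cube ?n ?p (2 * e) \<Longrightarrow> b q = 0" "\<And>q. 0 \<le> (b q :: real)"
    using Rn_bump[OF e(1) pR] by metis
  define C where "C = {y \<in> U. \<phi> y \<in> closed_cube ?n ?p (2 * e)}"
  define V where "V = {y \<in> U. \<phi> y \<in> cube ?n ?p e}"
  have sub: "closed_cube ?n ?p (2 * e) \<subseteq> cube ?n ?p r"
    using e by (fastforce simp: closed_cube_def cube_def)
  have CW: "C \<subseteq> W"
  proof
    fix y assume y: "y \<in> C"
    then have "\<phi> y \<in> \<phi> ` (U \<inter> W)" using sub r(2) by (auto simp: C_def)
    then show "y \<in> W" using y cD(4) by (auto simp: C_def inj_on_def)
  qed
  have CU: "C \<subseteq> U" by (auto simp: C_def)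
  have img: "\<phi> ` C = closed_cube ?n ?p (2 * e)"
    using sub r(2) unfolding C_def by fastforce
  have "compactin (subtopology (Euclidean_space ?n) (\<phi> ` U)) (\<phi> ` C)"
    using compactin_closed_cube[of ?n ?p "2 * e"] CU unfolding img[symmetric] by (auto simp: compactin_subtopology)
  then have "compactin (subtopology (mtop M) U) C"
    using homeomorphic_map_compactness[OF cD(3), of C] CU cD(5) by (simp add: Int_absorb1)
  then have comp: "compactin (mtop M) C" by (simp add: compactin_subtopology)
  have "Hausdorff_space (mtop M)" using M by (simp add: smooth_manifold_def)
  then have cl: "closedin (mtop M) C" using comp compactin_imp_closedin by blast
  define B where "B y = (if y \<in> U then b (\<phi> y) else 0)" for y
  have "smooth_fun_on M U (\<lambda>y. b (\<phi> y))"
    by (rule smooth_fun_on_chart_compose[OF M c(1) cD(1) order_refl b(1)]) (use cD(6) in auto)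
  then have "smooth_fun_on M (mpoints M) B"
    unfolding B_def by (rule smooth_fun_extend[OF M _ cl CU]) (use b(3) cD(6) in \<open>auto simp: C_def\<close>)
  moreover have "openin (mtop M) V"
    unfolding V_def by (rule chart_preimage_open[OF M c(1) openin_cube])
  moreover have "x \<in> V" using c(2) cube_center[OF pR e(1)] by (simp add: V_def)
  moreover have "V \<subseteq> C" using e by (fastforce simp: V_def C_def cube_def closed_cube_def)
  ultimately show ?thesis
    using comp cl CW b cD(6) by (intro that[of B C V]) (auto simp: B_def C_def V_def)
qed

lemma smooth_nearI: "smooth_fun_on M W f \<Longrightarrow> x \<in> W \<Longrightarrow> smooth_near M x f"
  by (auto simp: smooth_near_def)

lemma smooth_near_obtain:
  assumes "smooth_near M x f"
  obtains W where "x \<in> W" "smooth_fun_on M W f" "openin (mtop M) W"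
  using assms smooth_fun_on_open by (auto simp: smooth_near_def)

lemma smooth_near_obtain2:
  assumes M: "smooth_manifold M" and "smooth_near M x f" "smooth_near M x g"
  obtains W where "x \<in> W" "smooth_fun_on M W f" "smooth_fun_on M W g" "openin (mtop M) W"
proof -
  obtain V W where "x \<in> V" "smooth_fun_on M V f" "openin (mtop M) V" "x \<in> W" "smooth_fun_on M W g" "openin (mtop M) W"
    using smooth_near_obtain assms by metis
  then show ?thesis
    using smooth_fun_on_subset[OF M] by (intro that[of "V \<inter> W"]) (auto intro!: openin_Int)
qed

lemma smooth_near_add:
  "smooth_manifold M \<Longrightarrow> smooth_near M x f \<Longrightarrow> smooth_near M x g \<Longrightarrow> smooth_near M x (\<lambda>y. f y + g y)"
  by (metis smooth_near_obtain2 smooth_nearI smooth_fun_on_add)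

lemma smooth_near_mult:
  "smooth_manifold M \<Longrightarrow> smooth_near M x f \<Longrightarrow> smooth_near M x g \<Longrightarrow> smooth_near M x (\<lambda>y. f y * g y)"
  by (metis smooth_near_obtain2 smooth_nearI smooth_fun_on_mult)

lemma smooth_near_const: "smooth_manifold M \<Longrightarrow> x \<in> mpoints M \<Longrightarrow> smooth_near M x (\<lambda>_. c)"
  by (rule smooth_nearI[OF smooth_fun_on_const]) auto

lemma smooth_near_cong:
  assumes M: "smooth_manifold M" and f: "smooth_near M x f" and V: "openin (mtop M) V" "x \<in> V"
    and eq: "\<And>y. y \<in> V \<Longrightarrow> f y = g y"
  shows "smooth_near M x g"
proof -
  obtain W where W: "x \<in> W" "smooth_fun_on M W f" "openin (mtop M) W" using smooth_near_obtain[OF f] .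
  have "smooth_fun_on M (W \<inter> V) g"
    by (rule smooth_fun_on_cong[OF M smooth_fun_on_subset[OF M W(2)]]) (use W V eq in auto)
  then show ?thesis using W V by (auto intro: smooth_nearI)
qed

subsection \<open>Frames and smooth fibrewise linear functionals\<close>

definition unit_vec :: "nat \<Rightarrow> nat \<Rightarrow> real" where
  "unit_vec j = (\<lambda>i. if i = j then 1 else 0)"

lemma unit_vec_Rn: "j < n \<Longrightarrow> unit_vec j \<in> Rn n"
  by (auto simp: unit_vec_def Rn_iff)

lemma sum_unit_vec: "(\<Sum>i<n. (unit_vec j i :: real) * f i) = (if j < n then f j else 0)"
  "(\<Sum>i<n. f i * (unit_vec j i :: real)) = (if j < n then f j else 0)"
  "(\<Sum>i<n. (unit_vec i j :: real) * f i) = (if j < n then f j else 0)"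
  "(\<Sum>i<n. f i * (unit_vec i j :: real)) = (if j < n then f j else 0)"
  by (simp_all add: unit_vec_def if_distrib if_distribR cong: if_cong)

text \<open>Additivity and homogeneity are given on \<open>Rn n\<close> only, so p is built up
  through its truncations, which all lie in \<open>Rn n\<close>.\<close>

lemma linear_on_Rn:
  assumes add: "\<And>p q. p \<in> Rn n \<Longrightarrow> q \<in> Rn n \<Longrightarrow> L (\<lambda>i. p i + q i) = L p + L q"
    and scale: "\<And>c p. p \<in> Rn n \<Longrightarrow> L (\<lambda>i. c * p i) = c * (L p :: real)"
    and p: "p \<in> Rn n"
  shows "L p = (\<Sum>j<n. p j * L (unit_vec j))"
proof -
  have "m \<le> n \<Longrightarrow> L (\<lambda>i. if i < m then p i else 0) = (\<Sum>j<m. p j * L (unit_vec j))" for m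
  proof (induction m)
    case 0
    have "L (\<lambda>i. 0 * p i) = 0 * L p" by (rule scale[OF p])
    then show ?case by simp
  next
    case (Suc m)
    have eq: "(\<lambda>i. if i < Suc m then p i else 0) = (\<lambda>i. (if i < m then p i else 0) + p m * unit_vec m i)"
      by (rule ext) (auto simp: unit_vec_def less_Suc_eq)
    have "(\<lambda>i. if i < m then p i else 0) \<in> Rn n" "(\<lambda>i. p m * unit_vec m i) \<in> Rn n"
      using p Suc.prems by (auto simp: Rn_iff unit_vec_def)
    then show ?case using Suc scale[OF unit_vec_Rn, of m "p m"] by (simp add: eq add)
  qed
  from this[of n] have "L (\<lambda>i. if i < n then p i else 0) = (\<Sum>j<n. p j * L (unit_vec j))" by simp
  moreover have "(\<lambda>i. if i < n then p i else 0) = p" using p by (auto simp: Rn_iff)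
  ultimately show ?thesis by simp
qed

text \<open>A covector at x, represented by a function on the whole type of which only the values on
  the fibre matter. Linear identities in a fibre are stated below as identities under all such
  functions.\<close>

definition fibre_linear :: "('a, 'b) vbundle \<Rightarrow> 'a \<Rightarrow> ('b \<Rightarrow> real) \<Rightarrow> bool" where
  "fibre_linear E x \<kappa> \<longleftrightarrow>
     (\<forall>a\<in>fibre E x. \<forall>b\<in>fibre E x. \<kappa> (badd E a b) = \<kappa> a + \<kappa> b) \<and>
     (\<forall>c. \<forall>a\<in>fibre E x. \<kappa> (bscale E c a) = c * \<kappa> a)"

definition fibre_iso :: "('a, 'b) vbundle \<Rightarrow> 'a \<Rightarrow> ('b \<Rightarrow> nat \<Rightarrow> real) \<Rightarrow> bool" where
  "fibre_iso E x \<psi> \<longleftrightarrow> bij_betw \<psi> (fibre E x) (Rn (brank E)) \<and>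
     (\<forall>a\<in>fibre E x. \<forall>b\<in>fibre E x. badd E a b \<in> fibre E x \<and> \<psi> (badd E a b) = (\<lambda>i. \<psi> a i + \<psi> b i)) \<and>
     (\<forall>c. \<forall>a\<in>fibre E x. bscale E c a \<in> fibre E x \<and> \<psi> (bscale E c a) = (\<lambda>i. c * \<psi> a i))"

definition frame :: "('a, 'b) vbundle \<Rightarrow> ('b \<Rightarrow> nat \<Rightarrow> real) \<Rightarrow> nat \<Rightarrow> 'a \<Rightarrow> 'b" where
  "frame E \<psi> j x = inv_into (fibre E x) \<psi> (unit_vec j)"

lemma fibre_iso_coord_linear: "fibre_iso E x \<psi> \<Longrightarrow> fibre_linear E x (\<lambda>a. \<psi> a i)"
  by (simp add: fibre_iso_def fibre_linear_def)

lemma fibre_iso_Rn: "fibre_iso E x \<psi> \<Longrightarrow> a \<in> fibre E x \<Longrightarrow> \<psi> a \<in> Rn (brank E)"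
  unfolding fibre_iso_def bij_betw_def by blast

lemma fibre_iso_coord_0: "fibre_iso E x \<psi> \<Longrightarrow> a \<in> fibre E x \<Longrightarrow> brank E \<le> i \<Longrightarrow> \<psi> a i = 0"
  using fibre_iso_Rn by (fastforce simp: Rn_iff)

lemma fibre_iso_obtain:
  assumes "fibre_iso E x \<psi>" "p \<in> Rn (brank E)"
  obtains a where "a \<in> fibre E x" "\<psi> a = p"
proof -
  have "p \<in> \<psi> ` fibre E x" using assms by (simp add: fibre_iso_def bij_betw_def)
  then show ?thesis using that by auto
qed

lemma fibre_iso_eqI:
  assumes "fibre_iso E x \<psi>" "a \<in> fibre E x" "b \<in> fibre E x" "\<And>i. i < brank E \<Longrightarrow> \<psi> a i = \<psi> b i"
  shows "a = b"
proof -
  have "\<psi> a = \<psi> b"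
    using assms(4) fibre_iso_coord_0[OF assms(1,2)] fibre_iso_coord_0[OF assms(1,3)]
    by (metis ext not_le)
  then show ?thesis using assms(1-3) unfolding fibre_iso_def bij_betw_def inj_on_def by blast
qed

lemma fibre_iso_inv:
  assumes "fibre_iso E x \<psi>" "p \<in> Rn (brank E)"
  shows "inv_into (fibre E x) \<psi> p \<in> fibre E x" "\<psi> (inv_into (fibre E x) \<psi> p) = p"
proof -
  have "p \<in> \<psi> ` fibre E x" using assms by (simp add: fibre_iso_def bij_betw_def)
  then show "inv_into (fibre E x) \<psi> p \<in> fibre E x" "\<psi> (inv_into (fibre E x) \<psi> p) = p"
    by (rule inv_into_into, rule f_inv_into_f)
qed

lemma frame_mem: "fibre_iso E x \<psi> \<Longrightarrow> j < brank E \<Longrightarrow> frame E \<psi> j x \<in> fibre E x"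
  and coord_frame: "fibre_iso E x \<psi> \<Longrightarrow> j < brank E \<Longrightarrow> \<psi> (frame E \<psi> j x) = unit_vec j"
  unfolding frame_def by (auto intro: fibre_iso_inv unit_vec_Rn)

text \<open>The expansion of a covector in the basis dual to the frame: \<open>linear_on_Rn\<close>
  transported along the inverse of \<open>\<psi>\<close>. Nearly every smoothness proof for bundles
  multiplies out such an expansion.\<close>

lemma fibre_linear_expand:
  assumes iso: "fibre_iso E x \<psi>" and l: "fibre_linear E x \<kappa>" and a: "a \<in> fibre E x"
  shows "\<kappa> a = (\<Sum>j<brank E. \<psi> a j * \<kappa> (frame E \<psi> j x))"
proof -
  let ?i = "inv_into (fibre E x) \<psi>"
  note inv = fibre_iso_inv[OF iso]
  have "\<kappa> (?i (\<psi> a)) = (\<Sum>j<brank E. \<psi> a j * \<kappa> (?i (unit_vec j)))"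
  proof (rule linear_on_Rn[where L = "\<lambda>p. \<kappa> (?i p)"])
    fix p q assume p: "p \<in> Rn (brank E)" and q: "q \<in> Rn (brank E)"
    then have pq: "(\<lambda>i. p i + q i) \<in> Rn (brank E)" by (simp add: Rn_iff)
    have "?i (\<lambda>i. p i + q i) = badd E (?i p) (?i q)"
      using iso inv[OF p] inv[OF q] inv[OF pq] by (intro fibre_iso_eqI[OF iso]) (auto simp: fibre_iso_def)
    then show "\<kappa> (?i (\<lambda>i. p i + q i)) = \<kappa> (?i p) + \<kappa> (?i q)"
      using l inv[OF p] inv[OF q] by (simp add: fibre_linear_def)
  next
    fix c p assume p: "p \<in> Rn (brank E)"
    then have cp: "(\<lambda>i. c * p i) \<in> Rn (brank E)" by (simp add: Rn_iff)
    have "?i (\<lambda>i. c * p i) = bscale E c (?i p)"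
      using iso inv[OF p] inv[OF cp] by (intro fibre_iso_eqI[OF iso]) (auto simp: fibre_iso_def)
    then show "\<kappa> (?i (\<lambda>i. c * p i)) = c * \<kappa> (?i p)"
      using l inv[OF p] by (simp add: fibre_linear_def)
  qed (rule fibre_iso_Rn[OF iso a])
  moreover have "?i (\<psi> a) = a"
    using iso a unfolding fibre_iso_def bij_betw_def by (simp add: inv_into_f_f)
  ultimately show ?thesis by (simp add: frame_def)
qed

text \<open>A smooth section of the dual bundle over W, tested on the frames of the atlas.
  Smoothness of sections, morphisms and trivializations is reduced to this notion.\<close>

definition smooth_functional :: "'a manifold \<Rightarrow> ('a, 'b) vbundle \<Rightarrow> 'a set \<Rightarrow> ('b \<Rightarrow> real) \<Rightarrow> bool" where
  "smooth_functional M E W \<kappa> \<longleftrightarrow> openin (mtop M) W \<and> (\<forall>x\<in>W. fibre_linear E x \<kappa>) \<and>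
     (\<forall>(U, \<psi>)\<in>btrivs E. \<forall>j<brank E. smooth_fun_on M (U \<inter> W) (\<lambda>x. \<kappa> (frame E \<psi> j x)))"

lemma smooth_functionalD:
  assumes "smooth_functional M E W \<kappa>"
  shows "openin (mtop M) W" "\<And>x. x \<in> W \<Longrightarrow> fibre_linear E x \<kappa>"
    "\<And>U \<psi> j. (U, \<psi>) \<in> btrivs E \<Longrightarrow> j < brank E \<Longrightarrow> smooth_fun_on M (U \<inter> W) (\<lambda>x. \<kappa> (frame E \<psi> j x))"
  using assms unfolding smooth_functional_def by blast+

lemma smooth_functionalI:
  assumes "openin (mtop M) W" "\<And>x. x \<in> W \<Longrightarrow> fibre_linear E x \<kappa>"
    "\<And>U \<psi> j. (U, \<psi>) \<in> btrivs E \<Longrightarrow> j < brank E \<Longrightarrow> smooth_fun_on M (U \<inter> W) (\<lambda>x. \<kappa> (frame E \<psi> j x))"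
  shows "smooth_functional M E W \<kappa>"
  using assms unfolding smooth_functional_def by blast

text \<open>The matrix is forced: its columns are the components of the images of the frame vectors.
  This removes the existential quantifier from \<open>smooth_matrix_rep\<close>.\<close>

lemma smooth_matrix_rep_iff:
  assumes M: "smooth_manifold M"
    and iso: "\<And>x. x \<in> U \<inter> V \<Longrightarrow> fibre_iso E x \<psi>"
    and lin: "\<And>x i. x \<in> U \<inter> V \<Longrightarrow> i < brank F \<Longrightarrow> fibre_linear E x (\<lambda>a. \<xi> (h a) i)"
  shows "smooth_matrix_rep M E F h (U, \<psi>) (V, \<xi>) \<longleftrightarrow>
    (\<forall>i<brank F. \<forall>j<brank E. smooth_fun_on M (U \<inter> V) (\<lambda>x. \<xi> (h (frame E \<psi> j x)) i))"
proof
  assume "smooth_matrix_rep M E F h (U, \<psi>) (V, \<xi>)"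
  then obtain m where
    "(\<forall>i<brank F. \<forall>j<brank E. smooth_fun_on M (U \<inter> V) (\<lambda>x. m x i j)) \<and>
     (\<forall>x\<in>U \<inter> V. \<forall>a\<in>fibre E x. \<forall>i<brank F. \<xi> (h a) i = (\<Sum>j<brank E. m x i j * \<psi> a j))"
    unfolding smooth_matrix_rep_def prod.case by (elim exE) (rule that)
  then have m: "\<And>i j. i < brank F \<Longrightarrow> j < brank E \<Longrightarrow> smooth_fun_on M (U \<inter> V) (\<lambda>x. m x i j)"
    "\<And>x a i. x \<in> U \<inter> V \<Longrightarrow> a \<in> fibre E x \<Longrightarrow> i < brank F \<Longrightarrow> \<xi> (h a) i = (\<Sum>j<brank E. m x i j * \<psi> a j)"
    by blast+
  have "smooth_fun_on M (U \<inter> V) (\<lambda>x. \<xi> (h (frame E \<psi> j x)) i)" if "i < brank F" "j < brank E" for i j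
    by (rule smooth_fun_on_cong[OF M m(1)[OF that]])
      (use that in \<open>simp add: m(2)[OF _ frame_mem[OF iso]] coord_frame[OF iso] sum_unit_vec\<close>)
  then show "\<forall>i<brank F. \<forall>j<brank E. smooth_fun_on M (U \<inter> V) (\<lambda>x. \<xi> (h (frame E \<psi> j x)) i)" by blast
next
  assume s: "\<forall>i<brank F. \<forall>j<brank E. smooth_fun_on M (U \<inter> V) (\<lambda>x. \<xi> (h (frame E \<psi> j x)) i)"
  have "\<xi> (h a) i = (\<Sum>j<brank E. \<xi> (h (frame E \<psi> j x)) i * \<psi> a j)"
    if "x \<in> U \<inter> V" "a \<in> fibre E x" "i < brank F" for x a i
    using fibre_linear_expand[OF iso lin] that by (simp add: mult.commute)
  then show "smooth_matrix_rep M E F h (U, \<psi>) (V, \<xi>)"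
    using s unfolding smooth_matrix_rep_def split
    by (intro exI[of _ "\<lambda>x i j. \<xi> (h (frame E \<psi> j x)) i"]) blast
qed

lemma smooth_fun_on_open_nonzero:
  assumes M: "smooth_manifold M" and f: "smooth_fun_on M W f"
  shows "openin (mtop M) {x \<in> W. f x \<noteq> 0}"
proof -
  have "\<exists>T. openin (mtop M) T \<and> x \<in> T \<and> T \<subseteq> {x \<in> W. f x \<noteq> 0}" if x: "x \<in> W" "f x \<noteq> 0" for x
  proof -
    obtain V \<phi> where v: "(V, \<phi>) \<in> mcharts M" "x \<in> V"
      using chart_cover[OF M] smooth_fun_on_open[OF f] openin_subset x(1) by (metis subsetD)
    let ?P = "\<phi> ` (V \<inter> W)" and ?f = "\<lambda>p. f (inv_into V \<phi> p)" and ?c = "cube (mdim M) (\<phi> x)"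
    note inj = chartD(4)[OF M v(1)]
    have sm: "smooth_on (mdim M) ?P ?f" by (rule smooth_fun_on_chartD[OF f v(1)])
    have fx: "?f (\<phi> x) = f x" using v inj by simp
    have "\<phi> x \<in> ?P" "0 < \<bar>f x\<bar>" using v x by auto
    from continuous_on_near_cube[OF smooth_onD(1)[OF sm] this(1)
        Ck_on_continuous[OF smooth_onD(2)[OF sm, of 0] smooth_onD(1)[OF sm]] this(2)]
    obtain d where d: "0 < d" "?c d \<subseteq> ?P" "\<And>p. p \<in> ?c d \<Longrightarrow> \<bar>?f p - f x\<bar> < \<bar>f x\<bar>"
      unfolding fx by blast
    let ?T = "{y \<in> V. \<phi> y \<in> ?c d}"
    have "?T \<subseteq> {x \<in> W. f x \<noteq> 0}"
    proof
      fix y assume y: "y \<in> ?T"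
      then have "\<phi> y \<in> ?P" using d(2) by auto
      then have "y \<in> W" using y inj by (auto simp: inj_on_def)
      moreover have "f y \<noteq> 0" using d(3)[of "\<phi> y"] y inj by auto
      ultimately show "y \<in> {x \<in> W. f x \<noteq> 0}" by simp
    qed
    moreover have "x \<in> ?T" using v cube_center[OF chartD(6)[OF M v(1)] d(1)] by simp
    moreover have "openin (mtop M) ?T" by (rule chart_preimage_open[OF M v(1) openin_cube])
    ultimately show ?thesis by blast
  qed
  then show ?thesis by (subst openin_subopen) blast
qed

locale smooth_vbundle =
  fixes M :: "'a manifold" and E :: "('a, 'b) vbundle"
  assumes M: "smooth_manifold M" and E: "vector_bundle M E"
begin

lemma triv_cover:
  assumes "x \<in> mpoints M"
  obtains U \<psi> where "(U, \<psi>) \<in> btrivs E" "x \<in> U"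
  using assms E unfolding vector_bundle_def by blast

lemma triv_local: "(U, \<psi>) \<in> btrivs E \<Longrightarrow> local_trivialization M E (U, \<psi>)"
  using E unfolding vector_bundle_def by blast

lemma lt_open: "local_trivialization M E (U, \<psi>) \<Longrightarrow> openin (mtop M) U"
  by (simp add: local_trivialization_def)

lemma lt_iso:
  assumes "local_trivialization M E (U, \<psi>)" "x \<in> U"
  shows "fibre_iso E x \<psi>"
proof -
  have "x \<in> mpoints M" using lt_open[OF assms(1)] openin_subset assms(2) by blast
  then show ?thesis using assms E by (simp add: local_trivialization_def fibre_iso_def vector_bundle_def)
qed

lemma lt_smooth:
  assumes "local_trivialization M E (U, \<psi>)" "(V, \<xi>) \<in> btrivs E" "i < brank E" "j < brank E"
  shows "smooth_fun_on M (U \<inter> V) (\<lambda>x. \<psi> (frame E \<xi> j x) i)"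
    "smooth_fun_on M (U \<inter> V) (\<lambda>x. \<xi> (frame E \<psi> j x) i)"
proof -
  note iso = lt_iso[OF assms(1)] lt_iso[OF triv_local[OF assms(2)]]
  have *: "smooth_matrix_rep M E E (\<lambda>a. a) (U, \<psi>) (V, \<xi>)" "smooth_matrix_rep M E E (\<lambda>a. a) (V, \<xi>) (U, \<psi>)"
    using assms(1,2) unfolding local_trivialization_def by auto
  show "smooth_fun_on M (U \<inter> V) (\<lambda>x. \<psi> (frame E \<xi> j x) i)"
    using *(2) assms(3,4) iso by (subst (asm) smooth_matrix_rep_iff[OF M])
      (auto intro: fibre_iso_coord_linear simp: Int_commute)
  show "smooth_fun_on M (U \<inter> V) (\<lambda>x. \<xi> (frame E \<psi> j x) i)"
    using *(1) assms(3,4) iso by (subst (asm) smooth_matrix_rep_iff[OF M])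
      (auto intro: fibre_iso_coord_linear simp: Int_commute)
qed

lemma ltI:
  assumes U: "openin (mtop M) U" and iso: "\<And>x. x \<in> U \<Longrightarrow> fibre_iso E x \<psi>"
    and s: "\<And>V \<xi> i j. (V, \<xi>) \<in> btrivs E \<Longrightarrow> i < brank E \<Longrightarrow> j < brank E \<Longrightarrow>
       smooth_fun_on M (U \<inter> V) (\<lambda>x. \<psi> (frame E \<xi> j x) i) \<and>
       smooth_fun_on M (U \<inter> V) (\<lambda>x. \<xi> (frame E \<psi> j x) i)"
  shows "local_trivialization M E (U, \<psi>)"
proof -
  have "smooth_matrix_rep M E E (\<lambda>a. a) (U, \<psi>) (V, \<xi>) \<and> smooth_matrix_rep M E E (\<lambda>a. a) (V, \<xi>) (U, \<psi>)"
    if "(V, \<xi>) \<in> btrivs E" for V \<xi>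
    using s[OF that] iso lt_iso[OF triv_local[OF that]]
    by (subst (1 2) smooth_matrix_rep_iff[OF M]) (auto intro: fibre_iso_coord_linear simp: Int_commute)
  then show ?thesis using U iso unfolding local_trivialization_def fibre_iso_def by auto
qed

lemma sf_open_sub: "smooth_functional M E W \<kappa> \<Longrightarrow> W \<subseteq> mpoints M"
  using smooth_functionalD(1) openin_subset by blast

text \<open>The definition tests frames of the atlas; a frame vector of another compatible
  trivialization is a combination of those with smooth coefficients, by
  \<open>lt_smooth\<close>.\<close>

lemma sf_frame:
  assumes l: "smooth_functional M E W \<kappa>" and t: "local_trivialization M E (U, \<psi>)" and j: "j < brank E"
  shows "smooth_fun_on M (U \<inter> W) (\<lambda>x. \<kappa> (frame E \<psi> j x))"
proof (rule smooth_fun_on_local[OF M])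
  fix x assume x: "x \<in> U \<inter> W"
  then obtain V \<xi> where v: "(V, \<xi>) \<in> btrivs E" "x \<in> V" using triv_cover sf_open_sub[OF l] by blast
  let ?O = "U \<inter> V \<inter> W"
  have o: "openin (mtop M) ?O"
    using smooth_functionalD(1)[OF l] lt_open[OF t] lt_open[OF triv_local[OF v(1)]] by (intro openin_Int)
  have "smooth_fun_on M ?O (\<lambda>x. \<Sum>i<brank E. \<xi> (frame E \<psi> j x) i * \<kappa> (frame E \<xi> i x))"
    using j by (intro smooth_fun_on_sum[OF M o] smooth_fun_on_mult[OF M]
        smooth_fun_on_subset[OF M lt_smooth(2)[OF t v(1)] o]
        smooth_fun_on_subset[OF M smooth_functionalD(3)[OF l v(1)] o]) auto
  then have "smooth_fun_on M ?O (\<lambda>x. \<kappa> (frame E \<psi> j x))"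
  proof (rule smooth_fun_on_cong[OF M])
    fix y assume y: "y \<in> ?O"
    then show "(\<Sum>i<brank E. \<xi> (frame E \<psi> j y) i * \<kappa> (frame E \<xi> i y)) = \<kappa> (frame E \<psi> j y)"
      using fibre_linear_expand[OF lt_iso[OF triv_local[OF v(1)]] smooth_functionalD(2)[OF l]
          frame_mem[OF lt_iso[OF t] j]] by auto
  qed
  then show "\<exists>V. x \<in> V \<and> V \<subseteq> U \<inter> W \<and> smooth_fun_on M V (\<lambda>x. \<kappa> (frame E \<psi> j x))"
    using x v(2) by (intro exI[of _ ?O]) auto
qed

lemma sf_coord:
  assumes "local_trivialization M E (U, \<psi>)" "i < brank E"
  shows "smooth_functional M E U (\<lambda>a. \<psi> a i)"
  using lt_open[OF assms(1)] fibre_iso_coord_linear[OF lt_iso[OF assms(1)]] lt_smooth(1)[OF assms(1) _ assms(2)]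
  by (intro smooth_functionalI) (auto simp: Int_commute)

lemma sf_subset:
  assumes "smooth_functional M E W \<kappa>" "openin (mtop M) V" "V \<subseteq> W"
  shows "smooth_functional M E V \<kappa>"
proof (rule smooth_functionalI[OF assms(2)])
  fix U \<psi> j assume u: "(U, \<psi>) \<in> btrivs E" "j < brank E"
  have "openin (mtop M) (U \<inter> V)" using lt_open[OF triv_local[OF u(1)]] assms(2) by blast
  then show "smooth_fun_on M (U \<inter> V) (\<lambda>x. \<kappa> (frame E \<psi> j x))"
    by (rule smooth_fun_on_subset[OF M smooth_functionalD(3)[OF assms(1) u]]) (use assms(3) in auto)
qed (use smooth_functionalD(2)[OF assms(1)] assms(3) in auto)

lemma sf_local:
  assumes "\<And>x. x \<in> W \<Longrightarrow> \<exists>V. x \<in> V \<and> V \<subseteq> W \<and> smooth_functional M E V \<kappa>"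
  shows "smooth_functional M E W \<kappa>"
proof (rule smooth_functionalI)
  have "\<exists>T. openin (mtop M) T \<and> x \<in> T \<and> T \<subseteq> W" if "x \<in> W" for x
    using assms[OF that] smooth_functionalD(1) by blast
  then show "openin (mtop M) W" by (subst openin_subopen) blast
  show "fibre_linear E x \<kappa>" if x: "x \<in> W" for x
  proof -
    from assms[OF x] obtain V where V: "x \<in> V" "smooth_functional M E V \<kappa>" by blast
    show ?thesis by (rule smooth_functionalD(2)[OF V(2,1)])
  qed
  fix U \<psi> j assume u: "(U, \<psi>) \<in> btrivs E" "j < brank E"
  show "smooth_fun_on M (U \<inter> W) (\<lambda>x. \<kappa> (frame E \<psi> j x))"
  proof (rule smooth_fun_on_local[OF M])
    fix x assume "x \<in> U \<inter> W"
    then have x: "x \<in> U" "x \<in> W" by auto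
    from assms[OF x(2)] obtain V where "x \<in> V" "V \<subseteq> W" "smooth_functional M E V \<kappa>" by blast
    with x(1) show "\<exists>V. x \<in> V \<and> V \<subseteq> U \<inter> W \<and> smooth_fun_on M V (\<lambda>x. \<kappa> (frame E \<psi> j x))"
      using smooth_functionalD(3)[OF _ u] by (intro exI[of _ "U \<inter> V"]) auto
  qed
qed

lemma fibre_closed:
  assumes "x \<in> mpoints M" "a \<in> fibre E x"
  shows "b \<in> fibre E x \<Longrightarrow> badd E a b \<in> fibre E x" "bscale E c a \<in> fibre E x"
  using assms E by (auto simp: vector_bundle_def)

lemma sf_cong:
  assumes l: "smooth_functional M E W \<kappa>" and eq: "\<And>x a. x \<in> W \<Longrightarrow> a \<in> fibre E x \<Longrightarrow> \<kappa> a = \<mu> a"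
  shows "smooth_functional M E W \<mu>"
proof (rule smooth_functionalI[OF smooth_functionalD(1)[OF l]])
  fix x assume x: "x \<in> W"
  then have "x \<in> mpoints M" using sf_open_sub[OF l] by blast
  then show "fibre_linear E x \<mu>"
    using smooth_functionalD(2)[OF l x] eq[OF x] fibre_closed unfolding fibre_linear_def by metis
next
  fix U \<psi> j assume u: "(U, \<psi>) \<in> btrivs E" "j < brank E"
  show "smooth_fun_on M (U \<inter> W) (\<lambda>x. \<mu> (frame E \<psi> j x))"
    by (rule smooth_fun_on_cong[OF M smooth_functionalD(3)[OF l u]])
      (use eq frame_mem[OF lt_iso[OF triv_local[OF u(1)]] u(2)] in auto)
qed

lemma sf_add:
  assumes "smooth_functional M E W \<kappa>" "smooth_functional M E W \<mu>"
  shows "smooth_functional M E W (\<lambda>a. \<kappa> a + \<mu> a)"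
proof (rule smooth_functionalI[OF smooth_functionalD(1)[OF assms(1)]])
  show "fibre_linear E x (\<lambda>a. \<kappa> a + \<mu> a)" if "x \<in> W" for x
    using smooth_functionalD(2)[OF assms(1) that] smooth_functionalD(2)[OF assms(2) that]
    by (simp add: fibre_linear_def algebra_simps)
qed (intro smooth_fun_on_add[OF M] smooth_functionalD(3)[OF assms(1)] smooth_functionalD(3)[OF assms(2)])

lemma bproj_fibre: "a \<in> fibre E x \<Longrightarrow> bproj E a = x"
  by (simp add: fibre_def)

lemma sf_fun_mult:
  assumes f: "smooth_fun_on M W f" and l: "smooth_functional M E W \<kappa>"
  shows "smooth_functional M E W (\<lambda>a. f (bproj E a) * \<kappa> a)"
proof (rule smooth_functionalI[OF smooth_functionalD(1)[OF l]])
  fix x assume x: "x \<in> W"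
  then have xm: "x \<in> mpoints M" using sf_open_sub[OF l] by blast
  show "fibre_linear E x (\<lambda>a. f (bproj E a) * \<kappa> a)"
    using smooth_functionalD(2)[OF l x] fibre_closed[OF xm]
    by (simp add: fibre_linear_def bproj_fibre[of _ x] algebra_simps)
next
  fix U \<psi> j assume u: "(U, \<psi>) \<in> btrivs E" "j < brank E"
  note t = triv_local[OF u(1)]
  have o: "openin (mtop M) (U \<inter> W)" using lt_open[OF t] smooth_functionalD(1)[OF l] by blast
  have "smooth_fun_on M (U \<inter> W) (\<lambda>x. f x * \<kappa> (frame E \<psi> j x))"
    by (intro smooth_fun_on_mult[OF M] smooth_fun_on_subset[OF M f o] smooth_functionalD(3)[OF l u]) auto
  then show "smooth_fun_on M (U \<inter> W) (\<lambda>x. f (bproj E (frame E \<psi> j x)) * \<kappa> (frame E \<psi> j x))"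
    by (rule smooth_fun_on_cong[OF M]) (use bproj_fibre[OF frame_mem[OF lt_iso[OF t] u(2)]] in auto)
qed

lemma sf_zero: "openin (mtop M) W \<Longrightarrow> smooth_functional M E W (\<lambda>_. 0)"
  by (rule smooth_functionalI)
    (auto simp: fibre_linear_def intro!: smooth_fun_on_const[OF M] openin_Int dest: triv_local lt_open)

lemma sf_sum:
  assumes "openin (mtop M) W" "\<And>i. i \<in> I \<Longrightarrow> smooth_functional M E W (\<kappa> i)"
  shows "smooth_functional M E W (\<lambda>a. \<Sum>i\<in>I. \<kappa> i a)"
  using assms(2)
  by (induction I rule: infinite_finite_induct) (auto intro: sf_zero[OF assms(1)] sf_add)

text \<open>Comparing \<open>\<psi>'\<close> with one known trivialization \<open>\<psi>\<close> is
  enough for the inverse direction: the change from \<open>\<psi>'\<close> to any member of the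
  atlas passes through \<open>\<psi>\<close>, whose own changes are smooth.\<close>

lemma lt_refine:
  assumes t: "local_trivialization M E (U, \<psi>)" and U': "openin (mtop M) U'" "U' \<subseteq> U"
    and iso: "\<And>x. x \<in> U' \<Longrightarrow> fibre_iso E x \<psi>'"
    and s: "\<And>i. i < brank E \<Longrightarrow> smooth_functional M E U' (\<lambda>a. \<psi>' a i)"
    and inv: "\<And>i j. i < brank E \<Longrightarrow> j < brank E \<Longrightarrow> smooth_fun_on M U' (\<lambda>x. \<psi> (frame E \<psi>' j x) i)"
  shows "local_trivialization M E (U', \<psi>')"
proof (rule ltI[OF U'(1) iso])
  fix V \<xi> i j assume v: "(V, \<xi>) \<in> btrivs E" and ij: "i < brank E" "j < brank E"
  let ?O = "U' \<inter> V"
  have o: "openin (mtop M) ?O" using lt_open[OF triv_local[OF v]] U' by blast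
  have "smooth_fun_on M ?O (\<lambda>x. \<Sum>l<brank E. \<psi> (frame E \<psi>' j x) l * \<xi> (frame E \<psi> l x) i)"
    using ij U'(2) by (intro smooth_fun_on_sum[OF M o] smooth_fun_on_mult[OF M]
        smooth_fun_on_subset[OF M inv o] smooth_fun_on_subset[OF M lt_smooth(2)[OF t v] o]) auto
  then have "smooth_fun_on M ?O (\<lambda>x. \<xi> (frame E \<psi>' j x) i)"
  proof (rule smooth_fun_on_cong[OF M])
    fix x assume x: "x \<in> ?O"
    then show "(\<Sum>l<brank E. \<psi> (frame E \<psi>' j x) l * \<xi> (frame E \<psi> l x) i) = \<xi> (frame E \<psi>' j x) i"
      using fibre_linear_expand[OF lt_iso[OF t] fibre_iso_coord_linear[OF lt_iso[OF triv_local[OF v]]]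
          frame_mem[OF iso ij(2)]] U'(2) by auto
  qed
  moreover have "smooth_fun_on M ?O (\<lambda>x. \<psi>' (frame E \<xi> j x) i)"
    using smooth_functionalD(3)[OF s[OF ij(1)] v ij(2)] by (simp add: Int_commute)
  ultimately show "smooth_fun_on M ?O (\<lambda>x. \<psi>' (frame E \<xi> j x) i) \<and> smooth_fun_on M ?O (\<lambda>x. \<xi> (frame E \<psi>' j x) i)"
    by simp
qed

subsection \<open>Exchanging coordinates of a trivialization\<close>

text \<open>The functional \<kappa> takes slot p, the old coordinate p moves to slot q, and the old
  coordinate q is given up. It can be recovered where the coefficient of \<kappa> at the q-th frame
  vector is nonzero, an open condition. Keeping p and q separate allows \<kappa> to be put into a
  prescribed slot although the nonzero coefficient is found elsewhere.\<close>

lemma exchange_coordinate: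
  assumes t: "local_trivialization M E (U, \<psi>)" and l: "smooth_functional M E W \<kappa>"
    and x0: "x0 \<in> U" "x0 \<in> W" and pq: "p < brank E" "q < brank E"
    and nz: "\<kappa> (frame E \<psi> q x0) \<noteq> 0"
  obtains U' \<psi>' where "local_trivialization M E (U', \<psi>')" "x0 \<in> U'" "U' \<subseteq> U \<inter> W"
    "\<And>a. \<psi>' a p = \<kappa> a" "\<And>a i. i \<noteq> p \<Longrightarrow> i \<noteq> q \<Longrightarrow> \<psi>' a i = \<psi> a i"
proof -
  let ?r = "brank E"
  define c where "c j x = \<kappa> (frame E \<psi> j x)" for j x
  define U' where "U' = {x \<in> U \<inter> W. c q x \<noteq> 0}"
  define \<psi>' where "\<psi>' a = (\<lambda>i. if i = p then \<kappa> a else if i = q then \<psi> a p else \<psi> a i)" for a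
  have cs: "smooth_fun_on M (U \<inter> W) (\<lambda>x. c j x)" if "j < ?r" for j
    unfolding c_def by (rule sf_frame[OF l t that])
  have U': "openin (mtop M) U'"
  proof -
    have "openin (mtop M) {x \<in> U \<inter> W. c q x \<noteq> 0}" by (rule smooth_fun_on_open_nonzero[OF M cs[OF pq(2)]])
    then show ?thesis by (simp add: U'_def)
  qed
  have U'sub: "U' \<subseteq> U" "U' \<subseteq> W" by (auto simp: U'_def)
  have expand: "\<kappa> a = c q x * \<psi> a q + (\<Sum>j\<in>{..<?r} - {q}. c j x * \<psi> a j)" if "x \<in> U'" "a \<in> fibre E x" for x a
  proof -
    have "\<kappa> a = (\<Sum>j<?r. c j x * \<psi> a j)"
      using fibre_linear_expand[OF lt_iso[OF t] smooth_functionalD(2)[OF l] that(2)] that(1) U'sub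
      by (auto simp: c_def mult.commute)
    then show ?thesis using sum.remove[of "{..<?r}" q] pq(2) by simp
  qed
  \<comment> \<open>\<open>w y\<close> reads the old coordinates other than q off the new
    coordinates y: the old coordinate p is now found in slot q.\<close>
  define w where "w y i = (if i = p then y q else y i)" for y :: "nat \<Rightarrow> real" and i
  have \<psi>i: "\<psi> a i = w (\<psi>' a) i" if "i \<noteq> q" for a i using that by (auto simp: w_def \<psi>'_def)
  have \<psi>q: "\<psi> a q = (\<psi>' a p + (- 1) * (\<Sum>j\<in>{..<?r} - {q}. c j x * w (\<psi>' a) j)) * inverse (c q x)"
    if x: "x \<in> U'" "a \<in> fibre E x" for x a
  proof -
    have "(\<Sum>j\<in>{..<?r} - {q}. c j x * \<psi> a j) = (\<Sum>j\<in>{..<?r} - {q}. c j x * w (\<psi>' a) j)"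
      by (rule sum.cong) (auto simp: \<psi>i)
    then show ?thesis using expand[OF x] x(1) by (simp add: U'_def \<psi>'_def field_simps)
  qed
  have iso: "fibre_iso E x \<psi>'" if x: "x \<in> U'" for x
  proof -
    have i: "fibre_iso E x \<psi>" using lt_iso[OF t] x U'sub by blast
    have lin: "fibre_linear E x \<kappa>" using smooth_functionalD(2)[OF l] x U'sub by blast
    have "\<psi>' a \<in> Rn ?r" if "a \<in> fibre E x" for a
      using fibre_iso_coord_0[OF i that] pq by (auto simp: Rn_iff \<psi>'_def)
    moreover have "inj_on \<psi>' (fibre E x)"
    proof (rule inj_onI)
      fix a b assume ab: "a \<in> fibre E x" "b \<in> fibre E x" "\<psi>' a = \<psi>' b"
      have "\<psi> a i = \<psi> b i" for i
        using \<psi>i[of i a] \<psi>i[of i b] \<psi>q[OF x ab(1)] \<psi>q[OF x ab(2)] ab(3) by (cases "i = q") auto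
      then show "a = b" using fibre_iso_eqI[OF i ab(1,2)] by blast
    qed
    moreover have "\<exists>a\<in>fibre E x. \<psi>' a = y" if y: "y \<in> Rn ?r" for y
    proof -
      \<comment> \<open>The old coordinates of the preimage of y: slot q is obtained by solving the
        expansion of \<kappa> for it, as in \<open>\<psi>q\<close>.\<close>
      define z where "z i = (if i = q then (y p + (- 1) * (\<Sum>j\<in>{..<?r} - {q}. c j x * w y j)) * inverse (c q x) else w y i)" for i
      have "z \<in> Rn ?r" using y pq by (auto simp: z_def w_def Rn_iff)
      then obtain a where a: "a \<in> fibre E x" "\<psi> a = z" using fibre_iso_obtain[OF i] by metis
      have "(\<Sum>j\<in>{..<?r} - {q}. c j x * \<psi> a j) = (\<Sum>j\<in>{..<?r} - {q}. c j x * w y j)"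
        by (rule sum.cong) (auto simp: a z_def)
      then have "\<kappa> a = y p" using expand[OF x a(1)] x by (simp add: a(2) z_def U'_def field_simps)
      then have "\<psi>' a = y" by (auto simp: \<psi>'_def a(2) z_def w_def)
      then show ?thesis using a(1) by blast
    qed
    ultimately have "bij_betw \<psi>' (fibre E x) (Rn ?r)" by (auto simp: bij_betw_def)
    then show ?thesis using i lin unfolding fibre_iso_def fibre_linear_def by (auto simp: \<psi>'_def)
  qed
  have "local_trivialization M E (U', \<psi>')"
  proof (rule lt_refine[OF t U' U'sub(1) iso])
    fix i assume i: "i < ?r"
    have co: "smooth_functional M E U' (\<lambda>a. \<psi> a k)" if "k < ?r" for k
      by (rule sf_subset[OF sf_coord[OF t that] U' U'sub(1)])
    consider "i = p" | "i \<noteq> p" "i = q" | "i \<noteq> p" "i \<noteq> q" by blast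
    then show "smooth_functional M E U' (\<lambda>a. \<psi>' a i)"
    proof cases
      case 1
      then have "(\<lambda>a. \<psi>' a i) = \<kappa>" by (simp add: \<psi>'_def)
      then show ?thesis using sf_subset[OF l U' U'sub(2)] by simp
    next
      case 2
      then have "(\<lambda>a. \<psi>' a i) = (\<lambda>a. \<psi> a p)" by (simp add: \<psi>'_def)
      then show ?thesis using co[OF pq(1)] by simp
    next
      case 3
      then have "(\<lambda>a. \<psi>' a i) = (\<lambda>a. \<psi> a i)" by (simp add: \<psi>'_def)
      then show ?thesis using co[OF i] by simp
    qed
  next
    fix i j assume ij: "i < ?r" "j < ?r"
    have co: "\<psi>' (frame E \<psi>' j x) = unit_vec j" if "x \<in> U'" for x by (rule coord_frame[OF iso[OF that] ij(2)])
    show "smooth_fun_on M U' (\<lambda>x. \<psi> (frame E \<psi>' j x) i)"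
    proof (cases "i = q")
      case False
      show ?thesis
        by (rule smooth_fun_on_cong[OF M smooth_fun_on_const[OF M U', of "w (unit_vec j) i"]])
          (simp only: \<psi>i[OF False] co)
    next
      case True
      have "smooth_fun_on M U' (\<lambda>x. (unit_vec j p + (- 1) * (\<Sum>l\<in>{..<?r} - {q}. c l x * w (unit_vec j) l)) * inverse (c q x))"
      proof (intro smooth_fun_on_mult[OF M] smooth_fun_on_add[OF M] smooth_fun_on_const[OF M U']
            smooth_fun_on_sum[OF M U'] smooth_fun_on_inverse[OF M])
        show "smooth_fun_on M U' (\<lambda>x. c q x)"
          by (rule smooth_fun_on_subset[OF M cs[OF pq(2)] U']) (auto simp: U'_def)
        show "smooth_fun_on M U' (\<lambda>x. c l x)" if "l \<in> {..<?r} - {q}" for l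
          by (rule smooth_fun_on_subset[OF M cs U']) (use that in \<open>auto simp: U'_def\<close>)
      qed (simp add: U'_def)
      then show ?thesis
      proof (rule smooth_fun_on_cong[OF M])
        fix x assume x: "x \<in> U'"
        show "(unit_vec j p + (- 1) * (\<Sum>l\<in>{..<?r} - {q}. c l x * w (unit_vec j) l)) * inverse (c q x) = \<psi> (frame E \<psi>' j x) i"
          unfolding True \<psi>q[OF x frame_mem[OF iso[OF x] ij(2)]] co[OF x] ..
      qed
    qed
  qed
  moreover have "x0 \<in> U'" using x0 nz by (simp add: U'_def c_def)
  ultimately show thesis by (rule that[of U' \<psi>']) (simp_all add: U'_def \<psi>'_def subset_iff)
qed

text \<open>Slots are filled one after the other. As \<Lambda> separates the s-th frame vector from
  zero, some member of \<Lambda> is nonzero on it and may take slot s; with p = q = s the exchange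
  leaves the other coordinates, in particular those already placed, unchanged.\<close>

lemma exchange_separating:
  assumes x0: "x0 \<in> mpoints M"
    and sf: "\<And>\<kappa>. \<kappa> \<in> \<Lambda> \<Longrightarrow> smooth_functional M E W \<kappa>" "x0 \<in> W"
    and sep: "\<And>a b. a \<in> fibre E x0 \<Longrightarrow> b \<in> fibre E x0 \<Longrightarrow> (\<And>\<kappa>. \<kappa> \<in> \<Lambda> \<Longrightarrow> \<kappa> a = \<kappa> b) \<Longrightarrow> a = b"
  obtains U \<psi> where "local_trivialization M E (U, \<psi>)" "x0 \<in> U" "\<And>i. i < brank E \<Longrightarrow> (\<lambda>a. \<psi> a i) \<in> \<Lambda>"
proof -
  have "s \<le> brank E \<Longrightarrow> \<exists>U \<psi>. local_trivialization M E (U, \<psi>) \<and> x0 \<in> U \<and> (\<forall>i<s. (\<lambda>a. \<psi> a i) \<in> \<Lambda>)" for s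
  proof (induction s)
    case 0
    then show ?case using triv_cover[OF x0] triv_local by (metis not_less0)
  next
    case (Suc s)
    then obtain U \<psi> where t: "local_trivialization M E (U, \<psi>)" "x0 \<in> U" "\<And>i. i < s \<Longrightarrow> (\<lambda>a. \<psi> a i) \<in> \<Lambda>"
      by auto
    have s: "s < brank E" using Suc.prems by simp
    note iso = lt_iso[OF t(1,2)]
    \<comment> \<open>The zero vector is written as a multiple of the frame vector, so that
      linearity gives \<open>\<kappa> ?z = 0\<close> at once.\<close>
    let ?e = "frame E \<psi> s x0" and ?z = "bscale E 0 (frame E \<psi> s x0)"
    have e: "?e \<in> fibre E x0" by (rule frame_mem[OF iso s])
    then have z: "?z \<in> fibre E x0" using fibre_closed(2)[OF x0] by blast
    have "\<psi> ?e s \<noteq> \<psi> ?z s"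
      using fibre_iso_coord_linear[OF iso, of s] e by (simp add: fibre_linear_def coord_frame[OF iso s] unit_vec_def)
    then obtain \<kappa> where l: "\<kappa> \<in> \<Lambda>" "\<kappa> ?e \<noteq> \<kappa> ?z" using sep[OF e z] by metis
    have "\<kappa> ?z = 0" using smooth_functionalD(2)[OF sf(1)[OF l(1)] sf(2)] e by (simp add: fibre_linear_def)
    then have "\<kappa> ?e \<noteq> 0" using l(2) by simp
    from exchange_coordinate[OF t(1) sf(1)[OF l(1)] t(2) sf(2) s s this]
    obtain U' \<psi>' where t': "local_trivialization M E (U', \<psi>')" "x0 \<in> U'"
      "\<And>a. \<psi>' a s = \<kappa> a" "\<And>a i. i \<noteq> s \<Longrightarrow> i \<noteq> s \<Longrightarrow> \<psi>' a i = \<psi> a i" by metis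
    have "(\<lambda>a. \<psi>' a i) \<in> \<Lambda>" if "i < Suc s" for i
      using that t(3)[of i] l(1) t'(3,4) by (cases "i = s") auto
    then show ?case using t'(1,2) by blast
  qed
  from this[OF order_refl] obtain U \<psi> where "local_trivialization M E (U, \<psi>)" "x0 \<in> U"
    "\<forall>i<brank E. (\<lambda>a. \<psi> a i) \<in> \<Lambda>" by (elim exE conjE)
  then show ?thesis by (intro that[of U \<psi>]) simp_all
qed

text \<open>Slots are filled from the last one downwards because adapted trivializations put the
  subbundle into the first coordinates; functionals that cut out the subbundle must therefore become
  the last ones. The assumption \<open>surj\<close> expresses linear independence at x0 by vectors
  dual to the functionals.\<close>

lemma exchange_independent:
  assumes x0: "x0 \<in> mpoints M"
    and sf: "\<And>i. i < n \<Longrightarrow> smooth_functional M E W (\<kappa> i)" and W: "x0 \<in> W" "openin (mtop M) W"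
    and surj: "\<And>s. s < n \<Longrightarrow> \<exists>a\<in>fibre E x0. \<forall>i<n. \<kappa> i a = unit_vec s i"
  obtains U \<psi> where "n \<le> brank E" "local_trivialization M E (U, \<psi>)" "x0 \<in> U" "U \<subseteq> W"
    "\<And>i a. i < n \<Longrightarrow> \<psi> a (brank E - 1 - i) = \<kappa> i a"
proof -
  let ?r = "brank E"
  have "s \<le> n \<Longrightarrow> \<exists>U \<psi>. s \<le> ?r \<and> local_trivialization M E (U, \<psi>) \<and> x0 \<in> U \<and> U \<subseteq> W \<and>
      (\<forall>i<s. \<forall>a. \<psi> a (?r - 1 - i) = \<kappa> i a)" for s
  proof (induction s)
    case 0
    obtain U \<psi> where t: "(U, \<psi>) \<in> btrivs E" "x0 \<in> U" using triv_cover[OF x0] .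
    note lt = triv_local[OF t(1)]
    have o: "openin (mtop M) (U \<inter> W)" using lt_open[OF lt] W(2) by blast
    have "local_trivialization M E (U \<inter> W, \<psi>)"
    proof (rule lt_refine[OF lt o])
      show "smooth_fun_on M (U \<inter> W) (\<lambda>x. \<psi> (frame E \<psi> j x) i)" if "i < ?r" "j < ?r" for i j
        by (rule smooth_fun_on_cong[OF M smooth_fun_on_const[OF M o, of "unit_vec j i"]])
          (use that coord_frame[OF lt_iso[OF lt]] in auto)
    qed (use lt_iso[OF lt] sf_subset[OF sf_coord[OF lt] o] in auto)
    then show ?case using t W by auto
  next
    case (Suc s)
    then obtain U \<psi> where t: "local_trivialization M E (U, \<psi>)" "x0 \<in> U" "U \<subseteq> W" "s \<le> ?r"
      "\<And>i a. i < s \<Longrightarrow> \<psi> a (?r - 1 - i) = \<kappa> i a" by auto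
    have s: "s < n" using Suc.prems by simp
    note iso = lt_iso[OF t(1,2)]
    obtain a where a: "a \<in> fibre E x0" "\<And>i. i < n \<Longrightarrow> \<kappa> i a = unit_vec s i" using surj[OF s] by auto
    \<comment> \<open>Otherwise \<kappa> s would be, at x0, a combination of the coordinates in the
      last s slots, that is, of the functionals already placed. All of these vanish on a, whereas
      \<kappa> s takes the value 1 there. Restricting q to q < r - s keeps the exchange away from
      the slots already filled.\<close>
    have "\<exists>q<?r - s. \<kappa> s (frame E \<psi> q x0) \<noteq> 0"
    proof (rule ccontr)
      assume "\<not> (\<exists>q<?r - s. \<kappa> s (frame E \<psi> q x0) \<noteq> 0)"
      then have z: "\<kappa> s (frame E \<psi> q x0) = 0" if "q < ?r - s" for q using that by blast
      have "\<psi> a j * \<kappa> s (frame E \<psi> j x0) = 0" if j: "j < ?r" for j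
      proof (cases "j < ?r - s")
        case False
        then have "?r - 1 - j < s" "?r - 1 - (?r - 1 - j) = j" using j by auto
        then have "\<psi> a j = unit_vec s (?r - 1 - j)" using t(5)[of "?r - 1 - j" a] a(2) s by simp
        then show ?thesis using \<open>?r - 1 - j < s\<close> by (simp add: unit_vec_def)
      qed (simp add: z)
      then have "\<kappa> s a = 0"
        unfolding fibre_linear_expand[OF iso smooth_functionalD(2)[OF sf[OF s] W(1)] a(1)]
        by (intro sum.neutral) simp
      then show False using a(2)[OF s] by (simp add: unit_vec_def)
    qed
    then obtain q where q: "q < ?r - s" "\<kappa> s (frame E \<psi> q x0) \<noteq> 0" by blast
    then have p: "?r - 1 - s < ?r" "q < ?r" by auto
    from exchange_coordinate[OF t(1) sf[OF s] t(2) W(1) p q(2)]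
    obtain U' \<psi>' where t': "local_trivialization M E (U', \<psi>')" "x0 \<in> U'" "U' \<subseteq> U \<inter> W"
      "\<And>a. \<psi>' a (?r - 1 - s) = \<kappa> s a" "\<And>a i. i \<noteq> ?r - 1 - s \<Longrightarrow> i \<noteq> q \<Longrightarrow> \<psi>' a i = \<psi> a i"
      by blast
    have "\<psi>' a (?r - 1 - i) = \<kappa> i a" if "i < Suc s" for i a
      using that t(5)[of i a] t'(4) t'(5)[of "?r - 1 - i" a] q(1) by (cases "i = s") auto
    then show ?case using t' q(1) by (intro exI[of _ U'] exI[of _ \<psi>']) auto
  qed
  from this[OF order_refl] obtain U \<psi> where "n \<le> ?r" "local_trivialization M E (U, \<psi>)" "x0 \<in> U" "U \<subseteq> W"
    "\<forall>i<n. \<forall>a. \<psi> a (?r - 1 - i) = \<kappa> i a" by (elim exE conjE)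
  then show ?thesis by (intro that[of U \<psi>]) simp_all
qed

end

subsection \<open>Sections and bundle morphisms\<close>

text \<open>The equation z + z = z in \<open>bzero\<close> singles out the zero vector, since each
  coordinate t of a solution satisfies t + t = t.\<close>

lemma fibre_iso_bzero:
  assumes iso: "fibre_iso E x \<psi>"
  shows "bzero E x \<in> fibre E x" "\<psi> (bzero E x) = (\<lambda>_. 0)"
proof -
  obtain z where z: "z \<in> fibre E x" "\<psi> z = (\<lambda>_. 0)"
    using fibre_iso_obtain[OF iso, of "\<lambda>_. 0"] by (auto simp: Rn_iff)
  have "bzero E x = z"
    unfolding bzero_def
  proof (rule the_equality)
    show "z \<in> fibre E x \<and> badd E z z = z"
      using iso z by (auto simp: fibre_iso_def intro!: fibre_iso_eqI[OF iso])
    fix w assume w: "w \<in> fibre E x \<and> badd E w w = w"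
    then have eq: "\<psi> w = (\<lambda>i. \<psi> w i + \<psi> w i)" using iso by (metis fibre_iso_def)
    have "\<psi> w i = 0" for i using fun_cong[OF eq, of i] by simp
    then show "w = z" using w z by (intro fibre_iso_eqI[OF iso]) auto
  qed
  then show "bzero E x \<in> fibre E x" "\<psi> (bzero E x) = (\<lambda>_. 0)" using z by auto
qed

lemma fibre_linear_bzero:
  assumes "fibre_iso E x \<psi>" "fibre_linear E x \<kappa>"
  shows "\<kappa> (bzero E x) = 0"
  using fibre_linear_expand[OF assms fibre_iso_bzero(1)[OF assms(1)]] fibre_iso_bzero(2)[OF assms(1)] by simp

text \<open>A linear combination of vectors of a fibre, specified by its values under all
  functionals; the vector itself is the one with the right coordinates.\<close>

lemma fibre_lincomb:
  assumes iso: "fibre_iso E x \<psi>" and v: "\<And>i. i \<in> I \<Longrightarrow> v i \<in> fibre E x"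
  obtains w where "w \<in> fibre E x"
    "\<And>\<kappa>. fibre_linear E x \<kappa> \<Longrightarrow> \<kappa> w = (\<Sum>i\<in>I. c i * \<kappa> (v i) :: real)"
proof -
  let ?p = "\<lambda>k. \<Sum>i\<in>I. c i * \<psi> (v i) k"
  have "?p \<in> Rn (brank E)"
    using fibre_iso_coord_0[OF iso v] by (simp add: Rn_iff)
  then obtain w where w: "w \<in> fibre E x" "\<psi> w = ?p" using fibre_iso_obtain[OF iso] by metis
  have "\<kappa> w = (\<Sum>i\<in>I. c i * \<kappa> (v i))" if l: "fibre_linear E x \<kappa>" for \<kappa>
  proof -
    have "\<kappa> w = (\<Sum>j<brank E. (\<Sum>i\<in>I. c i * \<psi> (v i) j) * \<kappa> (frame E \<psi> j x))"
      using fibre_linear_expand[OF iso l w(1)] w(2) by simp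
    also have "\<dots> = (\<Sum>i\<in>I. \<Sum>j<brank E. c i * \<psi> (v i) j * \<kappa> (frame E \<psi> j x))"
      by (subst sum.swap) (simp add: sum_distrib_right)
    also have "\<dots> = (\<Sum>i\<in>I. c i * \<kappa> (v i))"
      by (rule sum.cong) (simp_all add: fibre_linear_expand[OF iso l v] sum_distrib_left mult.assoc)
    finally show ?thesis .
  qed
  then show ?thesis using that w(1) by blast
qed

section \<open>Sections of a smooth bundle\<close>

context smooth_vbundle
begin

lemma fibre_iso_ex:
  assumes "x \<in> mpoints M"
  obtains \<psi> where "fibre_iso E x \<psi>"
proof -
  obtain U \<psi> where "(U, \<psi>) \<in> btrivs E" "x \<in> U" using triv_cover[OF assms] .
  then show ?thesis using that lt_iso[OF triv_local] by blast
qed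

lemma fibre_nonempty_base: "a \<in> fibre E x \<Longrightarrow> x \<in> mpoints M"
  using E by (auto simp: fibre_def vector_bundle_def)

lemma section_fibre: "s \<in> sections M E \<Longrightarrow> x \<in> mpoints M \<Longrightarrow> s x \<in> fibre E x"
  by (auto simp: sections_def)

lemma section_eqI:
  assumes "s \<in> sections M E" "t \<in> sections M E" "\<And>x. x \<in> mpoints M \<Longrightarrow> s x = t x"
  shows "s = t"
  using assms unfolding sections_def by (blast intro: PiE_ext)

lemma sf_section:
  assumes s: "s \<in> sections M E" and l: "smooth_functional M E W \<kappa>"
  shows "smooth_fun_on M W (\<lambda>x. \<kappa> (s x))"
proof (rule smooth_fun_on_local[OF M])
  fix x assume x: "x \<in> W"
  then have xm: "x \<in> mpoints M" using sf_open_sub[OF l] by blast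
  then obtain U \<psi> where u: "(U, \<psi>) \<in> btrivs E" "x \<in> U" using triv_cover by blast
  note t = triv_local[OF u(1)]
  have o: "openin (mtop M) (U \<inter> W)" using lt_open[OF t] smooth_functionalD(1)[OF l] by blast
  have "smooth_fun_on M U (\<lambda>x. \<psi> (s x) i)" if "i < brank E" for i
    using s u(1) that unfolding sections_def by fast
  then have "smooth_fun_on M (U \<inter> W) (\<lambda>x. \<Sum>j<brank E. \<psi> (s x) j * \<kappa> (frame E \<psi> j x))"
    by (intro smooth_fun_on_sum[OF M o] smooth_fun_on_mult[OF M] smooth_functionalD(3)[OF l u(1)]
        smooth_fun_on_subset[OF M _ o]) auto
  then have "smooth_fun_on M (U \<inter> W) (\<lambda>x. \<kappa> (s x))"
  proof (rule smooth_fun_on_cong[OF M])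
    fix y assume y: "y \<in> U \<inter> W"
    then have ym: "y \<in> mpoints M" using sf_open_sub[OF l] by blast
    show "(\<Sum>j<brank E. \<psi> (s y) j * \<kappa> (frame E \<psi> j y)) = \<kappa> (s y)"
      using fibre_linear_expand[OF lt_iso[OF t] smooth_functionalD(2)[OF l] section_fibre[OF s ym]] y by simp
  qed
  then show "\<exists>V. x \<in> V \<and> V \<subseteq> W \<and> smooth_fun_on M V (\<lambda>x. \<kappa> (s x))"
    using x u(2) by (intro exI[of _ "U \<inter> W"]) auto
qed

text \<open>The definition asks for smooth components in every member of the atlas on its full
  domain; here any one compatible trivialization near each point, on an open set V of one's choice,
  suffices, by a change of frames.\<close>

lemma sectionI:
  assumes f: "\<And>x. x \<in> mpoints M \<Longrightarrow> s x \<in> fibre E x" "\<And>x. x \<notin> mpoints M \<Longrightarrow> s x = undefined"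
    and loc: "\<And>x. x \<in> mpoints M \<Longrightarrow> \<exists>U \<psi> V. local_trivialization M E (U, \<psi>) \<and> x \<in> V \<and> V \<subseteq> U \<and>
       openin (mtop M) V \<and> (\<forall>i<brank E. smooth_fun_on M V (\<lambda>x. \<psi> (s x) i))"
  shows "s \<in> sections M E"
proof -
  have "smooth_fun_on M V (\<lambda>x. \<xi> (s x) i)" if v: "(V, \<xi>) \<in> btrivs E" and i: "i < brank E" for V \<xi> i
  proof (rule smooth_fun_on_local[OF M])
    fix x assume x: "x \<in> V"
    note vt = triv_local[OF v]
    have xm: "x \<in> mpoints M" using x lt_open[OF vt] openin_subset by blast
    from loc[OF xm] obtain U \<psi> V' where t: "local_trivialization M E (U, \<psi>)" "x \<in> V'" "V' \<subseteq> U"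
      "openin (mtop M) V'" "\<And>i. i < brank E \<Longrightarrow> smooth_fun_on M V' (\<lambda>x. \<psi> (s x) i)" by (elim exE conjE) blast
    let ?O = "V' \<inter> V"
    have o: "openin (mtop M) ?O" using t(4) lt_open[OF vt] by blast
    have "smooth_fun_on M ?O (\<lambda>x. \<Sum>j<brank E. \<psi> (s x) j * \<xi> (frame E \<psi> j x) i)"
      using t(3) by (intro smooth_fun_on_sum[OF M o] smooth_fun_on_mult[OF M] smooth_fun_on_subset[OF M t(5) o]
          smooth_fun_on_subset[OF M lt_smooth(2)[OF t(1) v i] o]) auto
    then have "smooth_fun_on M ?O (\<lambda>x. \<xi> (s x) i)"
    proof (rule smooth_fun_on_cong[OF M])
      fix y assume y: "y \<in> ?O"
      then have y': "y \<in> U" "y \<in> V" "y \<in> mpoints M" using t(3,4) openin_subset by blast+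
      show "(\<Sum>j<brank E. \<psi> (s y) j * \<xi> (frame E \<psi> j y) i) = \<xi> (s y) i"
        using fibre_linear_expand[OF lt_iso[OF t(1) y'(1)] fibre_iso_coord_linear[OF lt_iso[OF vt y'(2)]] f(1)[OF y'(3)]]
        by simp
    qed
    then show "\<exists>W. x \<in> W \<and> W \<subseteq> V \<and> smooth_fun_on M W (\<lambda>x. \<xi> (s x) i)"
      using x t(2) by (intro exI[of _ ?O]) auto
  qed
  then show ?thesis using f unfolding sections_def by (auto simp: PiE_iff extensional_def)
qed

text \<open>The index type \<open>'i\<close> is left open so that it can be fitted to the
  construction: two-element for sums, one-element for multiples, and an empty index set for the zero
  section.\<close>

lemma section_of_local_combinations:
  assumes f: "\<And>x. x \<in> mpoints M \<Longrightarrow> w x \<in> fibre E x" "\<And>x. x \<notin> mpoints M \<Longrightarrow> w x = undefined"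
    and loc: "\<And>x. x \<in> mpoints M \<Longrightarrow> \<exists>V (I :: 'i set) g s. openin (mtop M) V \<and> x \<in> V \<and>
       (\<forall>i\<in>I. smooth_fun_on M V (g i) \<and> s i \<in> sections M E) \<and>
       (\<forall>y\<in>V. \<forall>\<kappa>. fibre_linear E y \<kappa> \<longrightarrow> \<kappa> (w y) = (\<Sum>i\<in>I. g i y * \<kappa> (s i y)))"
  shows "w \<in> sections M E"
proof (rule sectionI[OF f])
  fix x assume x: "x \<in> mpoints M"
  from loc[OF x] obtain V g s and I :: "'i set" where V: "openin (mtop M) V" "x \<in> V"
    "\<And>i. i \<in> I \<Longrightarrow> smooth_fun_on M V (g i)" "\<And>i. i \<in> I \<Longrightarrow> s i \<in> sections M E"
    "\<And>y \<kappa>. y \<in> V \<Longrightarrow> fibre_linear E y \<kappa> \<Longrightarrow> \<kappa> (w y) = (\<Sum>i\<in>I. g i y * \<kappa> (s i y))"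
    by (elim exE conjE) blast
  obtain U \<psi> where u: "(U, \<psi>) \<in> btrivs E" "x \<in> U" using triv_cover[OF x] .
  note t = triv_local[OF u(1)]
  let ?O = "U \<inter> V"
  have o: "openin (mtop M) ?O" using lt_open[OF t] V(1) by blast
  have "smooth_fun_on M ?O (\<lambda>x. \<psi> (w x) k)" if k: "k < brank E" for k
  proof (rule smooth_fun_on_cong[OF M])
    show "smooth_fun_on M ?O (\<lambda>y. \<Sum>i\<in>I. g i y * \<psi> (s i y) k)"
      by (intro smooth_fun_on_sum[OF M o] smooth_fun_on_mult[OF M] smooth_fun_on_subset[OF M V(3) o]
          smooth_fun_on_subset[OF M sf_section[OF V(4) sf_coord[OF t k]] o]) auto
    show "(\<Sum>i\<in>I. g i y * \<psi> (s i y) k) = \<psi> (w y) k" if "y \<in> ?O" for y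
      using V(5)[OF _ fibre_iso_coord_linear[OF lt_iso[OF t, of y]], of k] that by simp
  qed
  then show "\<exists>U \<psi> V. local_trivialization M E (U, \<psi>) \<and> x \<in> V \<and> V \<subseteq> U \<and>
       openin (mtop M) V \<and> (\<forall>i<brank E. smooth_fun_on M V (\<lambda>x. \<psi> (w x) i))"
    using t u V o by (intro exI[of _ U] exI[of _ \<psi>] exI[of _ ?O]) auto
qed

lemma sec_add_section:
  assumes "X \<in> sections M E" "Y \<in> sections M E"
  shows "sec_add M E X Y \<in> sections M E"
proof (rule section_of_local_combinations[where 'i = bool])
  fix x assume x: "x \<in> mpoints M"
  show "\<exists>V (I :: bool set) g s. openin (mtop M) V \<and> x \<in> V \<and>
       (\<forall>i\<in>I. smooth_fun_on M V (g i) \<and> s i \<in> sections M E) \<and>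
       (\<forall>y\<in>V. \<forall>\<kappa>. fibre_linear E y \<kappa> \<longrightarrow> \<kappa> (sec_add M E X Y y) = (\<Sum>i\<in>I. g i y * \<kappa> (s i y)))"
    using x assms by (intro exI[of _ "mpoints M"] exI[of _ UNIV] exI[of _ "\<lambda>_ _. 1"] exI[of _ "\<lambda>b. if b then X else Y"])
      (auto simp: UNIV_bool sec_add_def fibre_linear_def section_fibre intro!: smooth_fun_on_const[OF M])
qed (use assms in \<open>auto simp: sec_add_def section_fibre fibre_closed\<close>)

lemma sec_mult_section:
  assumes f: "smooth_fun_on M (mpoints M) f" and "X \<in> sections M E"
  shows "sec_mult M E f X \<in> sections M E"
proof (rule section_of_local_combinations[where 'i = unit])
  fix x assume x: "x \<in> mpoints M"
  show "\<exists>V (I :: unit set) g s. openin (mtop M) V \<and> x \<in> V \<and>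
       (\<forall>i\<in>I. smooth_fun_on M V (g i) \<and> s i \<in> sections M E) \<and>
       (\<forall>y\<in>V. \<forall>\<kappa>. fibre_linear E y \<kappa> \<longrightarrow> \<kappa> (sec_mult M E f X y) = (\<Sum>i\<in>I. g i y * \<kappa> (s i y)))"
    using x assms by (intro exI[of _ "mpoints M"] exI[of _ UNIV] exI[of _ "\<lambda>_. f"] exI[of _ "\<lambda>_. X"])
      (auto simp: UNIV_unit sec_mult_def fibre_linear_def section_fibre)
qed (use assms in \<open>auto simp: sec_mult_def section_fibre fibre_closed\<close>)

lemma sec_const_mult_section: "X \<in> sections M E \<Longrightarrow> sec_mult M E (\<lambda>_. c) X \<in> sections M E"
  by (rule sec_mult_section[OF smooth_fun_on_const[OF M]]) auto

lemma linear_sec_add: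
  "X \<in> sections M E \<Longrightarrow> Y \<in> sections M E \<Longrightarrow> x \<in> mpoints M \<Longrightarrow> fibre_linear E x \<kappa> \<Longrightarrow>
    \<kappa> (sec_add M E X Y x) = \<kappa> (X x) + \<kappa> (Y x)"
  and linear_sec_mult:
  "X \<in> sections M E \<Longrightarrow> x \<in> mpoints M \<Longrightarrow> fibre_linear E x \<kappa> \<Longrightarrow>
    \<kappa> (sec_mult M E f X x) = f x * \<kappa> (X x)"
  by (simp_all add: sec_add_def sec_mult_def fibre_linear_def section_fibre)

lemma section_eq_linearI:
  assumes s: "s \<in> sections M E" "t \<in> sections M E"
    and eq: "\<And>x \<kappa>. x \<in> mpoints M \<Longrightarrow> fibre_linear E x \<kappa> \<Longrightarrow> \<kappa> (s x) = \<kappa> (t x)"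
  shows "s = t"
proof (rule section_eqI[OF s])
  fix x assume x: "x \<in> mpoints M"
  obtain \<psi> where iso: "fibre_iso E x \<psi>" using fibre_iso_ex[OF x] .
  show "s x = t x"
    by (rule fibre_iso_eqI[OF iso section_fibre[OF s(1) x] section_fibre[OF s(2) x]])
      (rule eq[OF x fibre_iso_coord_linear[OF iso]])
qed

text \<open>A frame vector field lives over U only. Multiplied by b it extends by zero, because b
  vanishes off C, which is closed in M and contained in U.\<close>

lemma frame_section:
  assumes t: "local_trivialization M E (U, \<psi>)" and j: "j < brank E"
    and b: "smooth_fun_on M (mpoints M) b" "closedin (mtop M) C" "C \<subseteq> U" "\<And>y. y \<notin> C \<Longrightarrow> b y = 0"
  obtains s where "s \<in> sections M E"
    "\<And>x \<kappa>. x \<in> U \<Longrightarrow> fibre_linear E x \<kappa> \<Longrightarrow> \<kappa> (s x) = b x * \<kappa> (frame E \<psi> j x)"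
    "\<And>x \<kappa>. x \<in> mpoints M \<Longrightarrow> x \<notin> C \<Longrightarrow> fibre_linear E x \<kappa> \<Longrightarrow> \<kappa> (s x) = 0"
proof -
  define s where "s = (\<lambda>x\<in>mpoints M. if x \<in> U then bscale E (b x) (frame E \<psi> j x) else bzero E x)"
  have Um: "U \<subseteq> mpoints M" using lt_open[OF t] openin_subset by blast
  have fib: "frame E \<psi> j x \<in> fibre E x" if "x \<in> U" for x by (rule frame_mem[OF lt_iso[OF t that] j])
  have 1: "\<kappa> (s x) = b x * \<kappa> (frame E \<psi> j x)" if "x \<in> U" "fibre_linear E x \<kappa>" for x \<kappa>
    using that Um fib[OF that(1)] by (auto simp: s_def fibre_linear_def)
  have 2: "\<kappa> (s x) = 0" if x: "x \<in> mpoints M" "x \<notin> C" and l: "fibre_linear E x \<kappa>" for x \<kappa>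
  proof (cases "x \<in> U")
    case True
    then show ?thesis using 1[OF True l] b(4)[OF x(2)] by simp
  next
    case False
    obtain \<phi> where "fibre_iso E x \<phi>" using fibre_iso_ex[OF x(1)] .
    then show ?thesis using False x fibre_linear_bzero[OF _ l] by (simp add: s_def)
  qed
  have "s \<in> sections M E"
  proof (rule sectionI)
    fix x assume x: "x \<in> mpoints M"
    show "s x \<in> fibre E x"
    proof -
      obtain \<phi> where "fibre_iso E x \<phi>" using fibre_iso_ex[OF x] .
      then show ?thesis using fibre_iso_bzero fib fibre_closed[OF x] x by (auto simp: s_def)
    qed
    show "\<exists>U \<psi> V. local_trivialization M E (U, \<psi>) \<and> x \<in> V \<and> V \<subseteq> U \<and>
       openin (mtop M) V \<and> (\<forall>i<brank E. smooth_fun_on M V (\<lambda>x. \<psi> (s x) i))"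
    proof (cases "x \<in> U")
      case True
      have "smooth_fun_on M U (\<lambda>x. \<psi> (s x) i)" for i
      proof (rule smooth_fun_on_cong[OF M])
        show "smooth_fun_on M U (\<lambda>x. b x * unit_vec j i)"
          by (intro smooth_fun_on_mult[OF M] smooth_fun_on_const[OF M] lt_open[OF t]
              smooth_fun_on_subset[OF M b(1) lt_open[OF t] Um])
        show "b x * unit_vec j i = \<psi> (s x) i" if "x \<in> U" for x
          using 1[OF that fibre_iso_coord_linear[OF lt_iso[OF t that]]] coord_frame[OF lt_iso[OF t that] j] by simp
      qed
      then show ?thesis using t True lt_open[OF t] by blast
    next
      case False
      obtain V \<xi> where v: "(V, \<xi>) \<in> btrivs E" "x \<in> V" using triv_cover[OF x] .
      note vt = triv_local[OF v(1)]
      have o: "openin (mtop M) (V - C)" using lt_open[OF vt] b(2) by (rule openin_diff)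
      have "smooth_fun_on M (V - C) (\<lambda>x. \<xi> (s x) i)" for i
      proof (rule smooth_fun_on_cong[OF M smooth_fun_on_const[OF M o, of 0]])
        fix y assume y: "y \<in> V - C"
        then have "y \<in> mpoints M" using o openin_subset by blast
        then show "0 = \<xi> (s y) i" using 2[OF _ _ fibre_iso_coord_linear[OF lt_iso[OF vt]]] y by auto
      qed
      then show ?thesis using vt o v(2) False b(3) by (intro exI[of _ V] exI[of _ \<xi>] exI[of _ "V - C"]) auto
    qed
  qed (simp add: s_def)
  then show ?thesis using that 1 2 by blast
qed

end

text \<open>The pullback of a covector field along h. The components of h need to be smooth only in
  some trivialization near each point, which may be chosen to suit h; this is what makes the lemma
  usable for \<open>\<sigma>\<close>, for the coset map and for the inverse of the anchor.\<close>

lemma sf_pull: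
  assumes E: "smooth_vbundle M E" and F: "smooth_vbundle M F"
    and k: "smooth_functional M E W \<kappa>"
    and h: "\<And>x a. x \<in> W \<Longrightarrow> a \<in> fibre F x \<Longrightarrow> h a \<in> fibre E x"
    and loc: "\<And>x. x \<in> W \<Longrightarrow> \<exists>U \<psi> V. local_trivialization M E (U, \<psi>) \<and> x \<in> U \<and> x \<in> V \<and>
       openin (mtop M) V \<and> (\<forall>i<brank E. smooth_functional M F V (\<lambda>a. \<psi> (h a) i))"
  shows "smooth_functional M F W (\<lambda>a. \<kappa> (h a))"
proof -
  interpret E: smooth_vbundle M E by (rule E)
  interpret F: smooth_vbundle M F by (rule F)
  show ?thesis
  proof (rule F.sf_local)
    fix x assume x: "x \<in> W"
    from loc[OF x] obtain U \<psi> V where t: "local_trivialization M E (U, \<psi>)" "x \<in> U" "x \<in> V" "openin (mtop M) V"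
      "\<And>i. i < brank E \<Longrightarrow> smooth_functional M F V (\<lambda>a. \<psi> (h a) i)" by (elim exE conjE) blast
    let ?O = "U \<inter> V \<inter> W"
    have o: "openin (mtop M) ?O"
      using E.lt_open[OF t(1)] t(4) smooth_functionalD(1)[OF k] by (intro openin_Int)
    have "smooth_functional M F ?O (\<lambda>a. \<Sum>i<brank E. \<kappa> (frame E \<psi> i (bproj F a)) * \<psi> (h a) i)"
    proof (intro F.sf_sum[OF o] F.sf_fun_mult)
      fix i assume "i \<in> {..<brank E}"
      then have i: "i < brank E" by simp
      show "smooth_fun_on M ?O (\<lambda>x. \<kappa> (frame E \<psi> i x))"
        by (rule smooth_fun_on_subset[OF E.M E.sf_frame[OF k t(1) i] o]) auto
      show "smooth_functional M F ?O (\<lambda>a. \<psi> (h a) i)"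
        by (rule F.sf_subset[OF t(5)[OF i] o]) auto
    qed
    then have "smooth_functional M F ?O (\<lambda>a. \<kappa> (h a))"
    proof (rule F.sf_cong)
      fix y a assume y: "y \<in> ?O" and a: "a \<in> fibre F y"
      then have y': "y \<in> U" "y \<in> W" by auto
      show "(\<Sum>i<brank E. \<kappa> (frame E \<psi> i (bproj F a)) * \<psi> (h a) i) = \<kappa> (h a)"
        using fibre_linear_expand[OF E.lt_iso[OF t(1) y'(1)] smooth_functionalD(2)[OF k y'(2)] h[OF y'(2) a]]
        by (simp add: F.bproj_fibre[OF a] mult.commute)
    qed
    then show "\<exists>V. x \<in> V \<and> V \<subseteq> W \<and> smooth_functional M F V (\<lambda>a. \<kappa> (h a))"
      using x t by (intro exI[of _ ?O]) auto
  qed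
qed

text \<open>Linearity of h on fibres comes with the assumption on components, as
  \<open>smooth_functional\<close> contains \<open>fibre_linear\<close> and the coordinates separate
  points of a fibre.\<close>

lemma bundle_morphismI:
  assumes E: "smooth_vbundle M E" and F: "smooth_vbundle M F"
    and h: "\<And>x a. x \<in> mpoints M \<Longrightarrow> a \<in> fibre F x \<Longrightarrow> h a \<in> fibre E x"
    and s: "\<And>V \<xi> i. (V, \<xi>) \<in> btrivs E \<Longrightarrow> i < brank E \<Longrightarrow> smooth_functional M F V (\<lambda>a. \<xi> (h a) i)"
  shows "bundle_morphism M F E h"
proof -
  interpret E: smooth_vbundle M E by (rule E)
  interpret F: smooth_vbundle M F by (rule F)
  have add: "h (badd F a b) = badd E (h a) (h b)" and scale: "h (bscale F c a) = bscale E c (h a)"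
    if x: "x \<in> mpoints M" and ab: "a \<in> fibre F x" "b \<in> fibre F x" for x a b c
  proof -
    obtain V \<xi> where v: "(V, \<xi>) \<in> btrivs E" "x \<in> V" using E.triv_cover[OF x] .
    note iso = E.lt_iso[OF E.triv_local[OF v(1)] v(2)]
    have lin: "fibre_linear F x (\<lambda>a. \<xi> (h a) i)" if "i < brank E" for i
      using smooth_functionalD(2)[OF s[OF v(1) that] v(2)] .
    have lin': "fibre_linear E x (\<lambda>a. \<xi> a i)" for i by (rule fibre_iso_coord_linear[OF iso])
    note cl = F.fibre_closed[OF x] E.fibre_closed[OF x]
    show "h (badd F a b) = badd E (h a) (h b)"
      using lin lin' ab h[OF x] by (intro fibre_iso_eqI[OF iso]) (auto simp: cl fibre_linear_def)
    show "h (bscale F c a) = bscale E c (h a)"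
      using lin lin' ab h[OF x] by (intro fibre_iso_eqI[OF iso]) (auto simp: cl fibre_linear_def)
  qed
  have rep: "smooth_matrix_rep M F E h (U, \<psi>) (V, \<xi>)"
    if u: "(U, \<psi>) \<in> btrivs F" and v: "(V, \<xi>) \<in> btrivs E" for U \<psi> V \<xi>
  proof (subst smooth_matrix_rep_iff[OF E.M])
    show "fibre_iso F x \<psi>" if "x \<in> U \<inter> V" for x using F.lt_iso[OF F.triv_local[OF u]] that by blast
    show "fibre_linear F x (\<lambda>a. \<xi> (h a) i)" if "x \<in> U \<inter> V" "i < brank E" for x i
      using smooth_functionalD(2)[OF s[OF v that(2)]] that by blast
    show "\<forall>i<brank E. \<forall>j<brank F. smooth_fun_on M (U \<inter> V) (\<lambda>x. \<xi> (h (frame F \<psi> j x)) i)"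
      using smooth_functionalD(3)[OF s[OF v] u] by blast
  qed
  then show ?thesis
    unfolding bundle_morphism_def using h add scale by auto
qed

lemma bundle_morphismD:
  assumes "bundle_morphism M F E h"
  shows "\<And>x a. x \<in> mpoints M \<Longrightarrow> a \<in> fibre F x \<Longrightarrow> h a \<in> fibre E x"
    "\<And>x a b. x \<in> mpoints M \<Longrightarrow> a \<in> fibre F x \<Longrightarrow> b \<in> fibre F x \<Longrightarrow> h (badd F a b) = badd E (h a) (h b)"
    "\<And>x a c. x \<in> mpoints M \<Longrightarrow> a \<in> fibre F x \<Longrightarrow> h (bscale F c a) = bscale E c (h a)"
  using assms unfolding bundle_morphism_def by blast+

lemma fibre_linear_compose:
  assumes h: "bundle_morphism M F E h" and x: "x \<in> mpoints M" and k: "fibre_linear E x \<kappa>"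
  shows "fibre_linear F x (\<lambda>a. \<kappa> (h a))"
  using k bundle_morphismD[OF h] x by (simp add: fibre_linear_def)

lemma sf_morphism:
  assumes E: "smooth_vbundle M E" and F: "smooth_vbundle M F" and h: "bundle_morphism M F E h"
    and k: "smooth_functional M E W \<kappa>"
  shows "smooth_functional M F W (\<lambda>a. \<kappa> (h a))"
proof -
  interpret E: smooth_vbundle M E by (rule E)
  interpret F: smooth_vbundle M F by (rule F)
  have W: "W \<subseteq> mpoints M" by (rule E.sf_open_sub[OF k])
  show ?thesis
  proof (rule sf_pull[OF E F k])
    show "h a \<in> fibre E x" if "x \<in> W" "a \<in> fibre F x" for x a
      using bundle_morphismD(1)[OF h] that W by blast
    fix x assume x: "x \<in> W"
    then obtain V \<xi> where v: "(V, \<xi>) \<in> btrivs E" "x \<in> V" using E.triv_cover W by blast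
    note t = E.triv_local[OF v(1)]
    have Vm: "V \<subseteq> mpoints M" using E.lt_open[OF t] openin_subset by blast
    have lin: "fibre_linear F y (\<lambda>a. \<xi> (h a) i)" if "y \<in> V" for y i
      using fibre_linear_compose[OF h _ fibre_iso_coord_linear[OF E.lt_iso[OF t that]]] that Vm by blast
    have "smooth_functional M F V (\<lambda>a. \<xi> (h a) i)" if i: "i < brank E" for i
    proof (rule smooth_functionalI[OF E.lt_open[OF t] lin])
      fix U \<psi> j assume u: "(U, \<psi>) \<in> btrivs F" and j: "j < brank F"
      have "smooth_matrix_rep M F E h (U, \<psi>) (V, \<xi>)" using h u v(1) unfolding bundle_morphism_def by blast
      then show "smooth_fun_on M (U \<inter> V) (\<lambda>x. \<xi> (h (frame F \<psi> j x)) i)"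
        using i j F.lt_iso[OF F.triv_local[OF u]] lin by (subst (asm) smooth_matrix_rep_iff[OF E.M]) auto
    qed
    then show "\<exists>U \<psi> V. local_trivialization M E (U, \<psi>) \<and> x \<in> U \<and> x \<in> V \<and>
       openin (mtop M) V \<and> (\<forall>i<brank E. smooth_functional M F V (\<lambda>a. \<psi> (h a) i))"
      using t v(2) E.lt_open[OF t] by blast
  qed
qed

lemma sec_map_section:
  assumes E: "smooth_vbundle M E" and F: "smooth_vbundle M F" and h: "bundle_morphism M F E h"
    and X: "X \<in> sections M F"
  shows "sec_map M h X \<in> sections M E"
proof -
  interpret E: smooth_vbundle M E by (rule E)
  interpret F: smooth_vbundle M F by (rule F)
  show ?thesis
  proof (rule E.sectionI)
    fix x assume x: "x \<in> mpoints M"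
    show "sec_map M h X x \<in> fibre E x"
      using x bundle_morphismD(1)[OF h x F.section_fibre[OF X x]] by (simp add: sec_map_def)
    obtain V \<xi> where v: "(V, \<xi>) \<in> btrivs E" "x \<in> V" using E.triv_cover[OF x] .
    note t = E.triv_local[OF v(1)]
    have Vm: "V \<subseteq> mpoints M" using E.lt_open[OF t] openin_subset by blast
    have "smooth_fun_on M V (\<lambda>x. \<xi> (sec_map M h X x) i)" if "i < brank E" for i
      by (rule smooth_fun_on_cong[OF E.M F.sf_section[OF X sf_morphism[OF E F h E.sf_coord[OF t that]]]])
        (use Vm in \<open>auto simp: sec_map_def\<close>)
    then show "\<exists>U \<psi> V. local_trivialization M E (U, \<psi>) \<and> x \<in> V \<and> V \<subseteq> U \<and>
       openin (mtop M) V \<and> (\<forall>i<brank E. smooth_fun_on M V (\<lambda>x. \<psi> (sec_map M h X x) i))"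
      using t v(2) E.lt_open[OF t] by blast
  qed (simp add: sec_map_def)
qed

subsection \<open>Tangent vectors\<close>

lemma tangentD:
  assumes "v \<in> tangent_space M x"
  shows "\<not> smooth_near M x f \<Longrightarrow> v f = 0"
    "smooth_near M x f \<Longrightarrow> smooth_near M x g \<Longrightarrow> v (\<lambda>y. f y + g y) = v f + v g"
    "smooth_near M x f \<Longrightarrow> smooth_near M x g \<Longrightarrow> v (\<lambda>y. f y * g y) = f x * v g + g x * v f"
    "smooth_near M x f \<Longrightarrow> v (\<lambda>y. c * f y) = c * v f"
  using assms by (simp_all add: tangent_space_def)

lemma tangent_const:
  assumes M: "smooth_manifold M" and x: "x \<in> mpoints M" and v: "v \<in> tangent_space M x"
  shows "v (\<lambda>_. c) = 0"
proof -
  note s = smooth_near_const[OF M x]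
  have "v (\<lambda>_. 1 * 1) = 1 * v (\<lambda>_. 1) + 1 * v (\<lambda>_. 1)"
    by (rule tangentD(3)[OF v s s])
  then have "v (\<lambda>_. 1) = 0" by simp
  then show ?thesis using tangentD(4)[OF v s[of 1], of c] by simp
qed

text \<open>Let b be a bump function at x supported in V. The product of f - g and b is 0
  everywhere, f - g vanishes at x and b is 1 there, so the Leibniz rule leaves v (f - g) =
  0.\<close>

lemma tangent_germ:
  assumes M: "smooth_manifold M" and v: "v \<in> tangent_space M x"
    and f: "smooth_near M x f" and V: "openin (mtop M) V" "x \<in> V"
    and eq: "\<And>y. y \<in> V \<Longrightarrow> f y = g y"
  shows "v f = v g"
proof -
  have x: "x \<in> mpoints M" using V openin_subset by blast
  have g: "smooth_near M x g" by (rule smooth_near_cong[OF M f V eq])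
  obtain b C V' where b: "smooth_fun_on M (mpoints M) b" "C \<subseteq> V" "\<And>y. y \<notin> C \<Longrightarrow> b y = 0"
    "x \<in> V'" "\<And>y. y \<in> V' \<Longrightarrow> b y = (1::real)"
    using manifold_bump[OF M V] by metis
  have bs: "smooth_near M x b" by (rule smooth_nearI[OF b(1) x])
  let ?h = "\<lambda>y. f y + (- 1) * g y"
  have g': "smooth_near M x (\<lambda>y. (- 1) * g y)"
    by (rule smooth_near_mult[OF M smooth_near_const[OF M x] g])
  have h: "smooth_near M x ?h" by (rule smooth_near_add[OF M f g'])
  have "?h y * b y = 0" for y using eq[of y] b(2,3) by (cases "y \<in> V") auto
  then have h0: "(\<lambda>y. ?h y * b y) = (\<lambda>_. 0)" by (rule ext)
  have "v (\<lambda>_. 0) = v (\<lambda>y. ?h y * b y)" by (simp only: h0)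
  also have "\<dots> = ?h x * v b + b x * v ?h" by (rule tangentD(3)[OF v h bs])
  also have "\<dots> = v ?h" using eq[OF V(2)] b(4,5) by simp
  also have "\<dots> = v f + (- 1) * v g"
    using tangentD(2)[OF v f g'] tangentD(4)[OF v g, of "- 1"] by simp
  finally show ?thesis using tangent_const[OF M x v] by simp
qed

lemma smooth_near_sum:
  assumes "smooth_manifold M" "x \<in> mpoints M" "\<And>i. i \<in> I \<Longrightarrow> smooth_near M x (f i)"
  shows "smooth_near M x (\<lambda>y. \<Sum>i\<in>I. f i y)"
  using assms(3) by (induction I rule: infinite_finite_induct)
    (auto intro: smooth_near_const[OF assms(1,2)] smooth_near_add[OF assms(1)])

lemma tangent_sum:
  assumes M: "smooth_manifold M" and x: "x \<in> mpoints M" and v: "v \<in> tangent_space M x"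
    and f: "\<And>i. i \<in> I \<Longrightarrow> smooth_near M x (f i)"
  shows "v (\<lambda>y. \<Sum>i\<in>I. f i y) = (\<Sum>i\<in>I. v (f i))"
  using f
proof (induction I rule: infinite_finite_induct)
  case (insert i I)
  have "v (\<lambda>y. f i y + (\<Sum>i\<in>I. f i y)) = v (f i) + v (\<lambda>y. \<Sum>i\<in>I. f i y)"
    using insert.prems by (intro tangentD(2)[OF v] smooth_near_sum[OF M x]) auto
  then show ?case using insert by simp
qed (use tangent_const[OF M x v] in auto)

lemma smooth_near_chart_coord:
  "smooth_manifold M \<Longrightarrow> (U, \<phi>) \<in> mcharts M \<Longrightarrow> x \<in> U \<Longrightarrow> smooth_near M x (\<lambda>y. \<phi> y i)"
  by (rule smooth_nearI[OF smooth_fun_on_chart_coord])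

text \<open>By Hadamard's lemma f equals, near x, the constant f x plus a sum of products of
  \<open>\<phi> y i - \<phi> x i\<close> and smooth functions. The derivation kills the constant,
  and in each product the Leibniz rule retains only the term in which the first factor, zero at x,
  is differentiated.\<close>

lemma tangent_chart_expansion:
  assumes M: "smooth_manifold M" and v: "v \<in> tangent_space M x"
    and c: "(U, \<phi>) \<in> mcharts M" "x \<in> U" and f: "smooth_near M x f"
  shows "v f = (\<Sum>i<mdim M. v (\<lambda>y. \<phi> y i) * partial_deriv i (\<lambda>p. f (inv_into U \<phi> p)) (\<phi> x))"
proof -
  let ?n = "mdim M" and ?p = "\<phi> x" and ?F = "\<lambda>p. f (inv_into U \<phi> p)"
  note cD = chartD[OF M c(1)]
  have x: "x \<in> mpoints M" using cD(5) c(2) by blast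
  obtain W where W: "x \<in> W" "smooth_fun_on M W f" "openin (mtop M) W" using smooth_near_obtain[OF f] .
  have sm: "smooth_on ?n (\<phi> ` (U \<inter> W)) ?F" by (rule smooth_fun_on_chartD[OF W(2) c(1)])
  obtain e where e: "0 < e" "cube ?n ?p e \<subseteq> \<phi> ` (U \<inter> W)"
    using openin_contains_cube[OF smooth_onD(1)[OF sm], of ?p] c(2) W(1) by auto
  have pR: "?p \<in> Rn ?n" using cD(6) c(2) by blast
  obtain g where g: "\<And>i. i < ?n \<Longrightarrow> smooth_on ?n (cube ?n ?p e) (g i)"
    "\<And>q. q \<in> cube ?n ?p e \<Longrightarrow> ?F q = ?F ?p + (\<Sum>i<?n. (q i - ?p i) * g i q)"
    "\<And>i. i < ?n \<Longrightarrow> g i ?p = partial_deriv i ?F ?p"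
    by (rule hadamard[OF pR smooth_on_subset[OF sm openin_cube e(2)] e(1)]) (rule that)
  define V where "V = {y \<in> U. \<phi> y \<in> cube ?n ?p e}"
  have V: "openin (mtop M) V" "x \<in> V" "V \<subseteq> U"
    unfolding V_def using chart_preimage_open[OF M c(1) openin_cube] c(2) cube_center[OF pR e(1)] by auto
  have gs: "smooth_near M x (\<lambda>y. g i (\<phi> y))" if "i < ?n" for i
    by (rule smooth_nearI[OF smooth_fun_on_chart_compose[OF M c(1) V(1,3) g(1)[OF that]] V(2)])
      (auto simp: V_def)
  have cs: "smooth_near M x (\<lambda>y. \<phi> y i + - ?p i)" for i
    by (intro smooth_near_add[OF M] smooth_near_chart_coord[OF M c] smooth_near_const[OF M x])
  have "v f = v (\<lambda>y. f x + (\<Sum>i<?n. (\<phi> y i + - ?p i) * g i (\<phi> y)))"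
  proof (rule tangent_germ[OF M v f V(1,2)])
    fix y assume "y \<in> V"
    then show "f y = f x + (\<Sum>i<?n. (\<phi> y i + - ?p i) * g i (\<phi> y))"
      using g(2)[of "\<phi> y"] cD(4) c(2) by (simp add: V_def)
  qed
  also have "\<dots> = v (\<lambda>_. f x) + v (\<lambda>y. \<Sum>i<?n. (\<phi> y i + - ?p i) * g i (\<phi> y))"
    by (intro tangentD(2)[OF v] smooth_near_const[OF M x] smooth_near_sum[OF M x] smooth_near_mult[OF M] cs gs) auto
  also have "\<dots> = (\<Sum>i<?n. v (\<lambda>y. (\<phi> y i + - ?p i) * g i (\<phi> y)))"
  proof -
    have "v (\<lambda>y. \<Sum>i<?n. (\<phi> y i + - ?p i) * g i (\<phi> y)) = (\<Sum>i<?n. v (\<lambda>y. (\<phi> y i + - ?p i) * g i (\<phi> y)))"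
      by (rule tangent_sum[OF M x v]) (intro smooth_near_mult[OF M] cs gs, simp)
    then show ?thesis by (simp only: tangent_const[OF M x v] add_0)
  qed
  also have "\<dots> = (\<Sum>i<?n. v (\<lambda>y. \<phi> y i) * partial_deriv i ?F ?p)"
  proof (rule sum.cong)
    fix i assume "i \<in> {..<?n}"
    then have i: "i < ?n" by simp
    have "v (\<lambda>y. (\<phi> y i + - ?p i) * g i (\<phi> y)) = (\<phi> x i + - ?p i) * v (\<lambda>y. g i (\<phi> y)) + g i ?p * v (\<lambda>y. \<phi> y i + - ?p i)"
      by (rule tangentD(3)[OF v cs gs[OF i]])
    also have "v (\<lambda>y. \<phi> y i + - ?p i) = v (\<lambda>y. \<phi> y i) + v (\<lambda>_. - ?p i)"
      by (rule tangentD(2)[OF v smooth_near_chart_coord[OF M c] smooth_near_const[OF M x]])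
    finally show "v (\<lambda>y. (\<phi> y i + - ?p i) * g i (\<phi> y)) = v (\<lambda>y. \<phi> y i) * partial_deriv i ?F ?p"
      by (simp add: tangent_const[OF M x v] g(3)[OF i])
  qed simp
  finally show ?thesis .
qed

text \<open>The combination of the coordinate derivations at x with coefficients c. Functions that
  are not smooth near x get the value 0 because \<open>tangent_space\<close> demands it.\<close>

definition coord_vector ::
  "'a manifold \<Rightarrow> 'a set \<Rightarrow> ('a \<Rightarrow> nat \<Rightarrow> real) \<Rightarrow> 'a \<Rightarrow> (nat \<Rightarrow> real) \<Rightarrow> ('a \<Rightarrow> real) \<Rightarrow> real" where
  "coord_vector M U \<phi> x c = (\<lambda>f. if smooth_near M x f
     then \<Sum>i<mdim M. c i * partial_deriv i (\<lambda>p. f (inv_into U \<phi> p)) (\<phi> x) else 0)"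

lemma smooth_near_DERIV_chart:
  assumes M: "smooth_manifold M" and c: "(U, \<phi>) \<in> mcharts M" "x \<in> U" and f: "smooth_near M x f"
    and i: "i < mdim M"
  shows "((\<lambda>t. f (inv_into U \<phi> ((\<phi> x)(i := t)))) has_real_derivative
    partial_deriv i (\<lambda>p. f (inv_into U \<phi> p)) (\<phi> x)) (at (\<phi> x i))"
proof -
  obtain W where W: "x \<in> W" "smooth_fun_on M W f" using smooth_near_obtain[OF f] .
  have sm: "smooth_on (mdim M) (\<phi> ` (U \<inter> W)) (\<lambda>p. f (inv_into U \<phi> p))"
    by (rule smooth_fun_on_chartD[OF W(2) c(1)])
  show ?thesis
    by (rule Ck_on_SucD(2)[OF smooth_onD(2)[OF sm, of "Suc 0"] smooth_onD(1)[OF sm] i]) (use W c in auto)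
qed

lemma coord_vector_tangent:
  assumes M: "smooth_manifold M" and c: "(U, \<phi>) \<in> mcharts M" "x \<in> U"
  shows "coord_vector M U \<phi> x k \<in> tangent_space M x"
proof -
  note d = smooth_near_DERIV_chart[OF M c]
  have x: "x \<in> mpoints M" using chartD(5)[OF M c(1)] c(2) by blast
  have inv: "inv_into U \<phi> (\<phi> x) = x" using chartD(4)[OF M c(1)] c(2) by simp
  let ?D = "\<lambda>i f. partial_deriv i (\<lambda>p. f (inv_into U \<phi> p)) (\<phi> x)"
  have add: "?D i (\<lambda>y. f y + g y) = ?D i f + ?D i g"
    and mult: "?D i (\<lambda>y. f y * g y) = f x * ?D i g + g x * ?D i f"
    if "smooth_near M x f" "smooth_near M x g" "i < mdim M" for f g i
    using DERIV_imp_deriv[OF DERIV_add[OF d[OF that(1,3)] d[OF that(2,3)]]]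
      DERIV_imp_deriv[OF DERIV_mult[OF d[OF that(1,3)] d[OF that(2,3)]]]
    by (simp_all add: partial_deriv_def inv mult.commute)
  have scale: "?D i (\<lambda>y. a * f y) = a * ?D i f"
    if "smooth_near M x f" "i < mdim M" for f i a
    using DERIV_imp_deriv[OF DERIV_cmult[OF d[OF that], of a]] by (simp add: partial_deriv_def)
  have sc: "smooth_near M x (\<lambda>y. a * f y)" if "smooth_near M x f" for f a
    by (rule smooth_near_mult[OF M smooth_near_const[OF M x] that])
  have 1: "coord_vector M U \<phi> x k (\<lambda>y. f y + g y) = coord_vector M U \<phi> x k f + coord_vector M U \<phi> x k g"
    and 2: "coord_vector M U \<phi> x k (\<lambda>y. f y * g y) = f x * coord_vector M U \<phi> x k g + g x * coord_vector M U \<phi> x k f"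
    if fg: "smooth_near M x f" "smooth_near M x g" for f g
    using fg smooth_near_add[OF M fg] smooth_near_mult[OF M fg]
    by (simp_all add: coord_vector_def add mult sum.distrib[symmetric] sum_distrib_left algebra_simps)
  have 3: "coord_vector M U \<phi> x k (\<lambda>y. a * f y) = a * coord_vector M U \<phi> x k f"
    if "smooth_near M x f" for f a
    using that sc[OF that] by (simp add: coord_vector_def scale sum_distrib_left algebra_simps)
  have 4: "coord_vector M U \<phi> x k f = 0" if "\<not> smooth_near M x f" for f
    using that by (simp add: coord_vector_def)
  show ?thesis unfolding tangent_space_def using 1 2 3 4 by blast
qed

lemma partial_deriv_chart_coord:
  assumes M: "smooth_manifold M" and c: "(U, \<phi>) \<in> mcharts M" "x \<in> U" and i: "i < mdim M"
  shows "partial_deriv i (\<lambda>p. \<phi> (inv_into U \<phi> p) j) (\<phi> x) = unit_vec j i"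
proof -
  note cD = chartD[OF M c(1)]
  have "((\<lambda>t. ((\<phi> x)(i := t)) j) has_real_derivative unit_vec j i) (at (\<phi> x i))"
    by (cases "i = j") (auto simp: unit_vec_def)
  then have "((\<lambda>t. \<phi> (inv_into U \<phi> ((\<phi> x)(i := t))) j) has_real_derivative unit_vec j i) (at (\<phi> x i))"
    by (subst DERIV_line_cong[OF cD(2) _ i, where g = "\<lambda>p. p j"]) (use c(2) in \<open>auto simp: f_inv_into_f\<close>)
  then show ?thesis unfolding partial_deriv_def by (rule DERIV_imp_deriv)
qed

lemma coord_vector_coord:
  assumes M: "smooth_manifold M" and c: "(U, \<phi>) \<in> mcharts M" "x \<in> U" and j: "j < mdim M"
  shows "coord_vector M U \<phi> x k (\<lambda>y. \<phi> y j) = k j"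
proof -
  have "(\<Sum>i<mdim M. k i * partial_deriv i (\<lambda>p. \<phi> (inv_into U \<phi> p) j) (\<phi> x)) = (\<Sum>i<mdim M. k i * unit_vec j i)"
    by (rule sum.cong) (simp_all add: partial_deriv_chart_coord[OF M c])
  then show ?thesis
    using j by (simp add: coord_vector_def smooth_near_chart_coord[OF M c] sum_unit_vec)
qed

lemma coord_vector_components:
  assumes M: "smooth_manifold M" and c: "(U, \<phi>) \<in> mcharts M" "x \<in> U" and v: "v \<in> tangent_space M x"
  shows "coord_vector M U \<phi> x (\<lambda>i. v (\<lambda>y. \<phi> y i)) = v"
proof
  fix f show "coord_vector M U \<phi> x (\<lambda>i. v (\<lambda>y. \<phi> y i)) f = v f"
    using tangent_chart_expansion[OF M v c] tangentD(1)[OF v] by (auto simp: coord_vector_def)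
qed

subsection \<open>The tangent bundle\<close>

definition tangent_triv :: "'a manifold \<Rightarrow> ('a \<Rightarrow> nat \<Rightarrow> real) \<Rightarrow> 'a \<times> (('a \<Rightarrow> real) \<Rightarrow> real) \<Rightarrow> nat \<Rightarrow> real" where
  "tangent_triv M \<phi> = (\<lambda>(x, v) i. if i < mdim M then v (\<lambda>y. \<phi> y i) else 0)"

lemma fibre_tangent_bundle:
  "fibre (tangent_bundle M) x = (if x \<in> mpoints M then {x} \<times> tangent_space M x else {})"
  by (auto simp: fibre_def tangent_bundle_def)

lemma tangent_bundle_simps:
  "brank (tangent_bundle M) = mdim M" "bproj (tangent_bundle M) = fst"
  "badd (tangent_bundle M) a b = (fst a, \<lambda>f. snd a f + snd b f)"
  "bscale (tangent_bundle M) c a = (fst a, \<lambda>f. c * snd a f)"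
  "btotal (tangent_bundle M) = Sigma (mpoints M) (tangent_space M)"
  by (auto simp: tangent_bundle_def split: prod.splits)

lemma btrivs_tangent_bundle: "btrivs (tangent_bundle M) = (\<lambda>(U, \<phi>). (U, tangent_triv M \<phi>)) ` mcharts M"
  by (simp add: tangent_bundle_def tangent_triv_def)

lemma tangent_space_add:
  assumes M: "smooth_manifold M" and "v \<in> tangent_space M x" "w \<in> tangent_space M x"
  shows "(\<lambda>f. v f + w f) \<in> tangent_space M x"
  using assms(2,3) by (simp add: tangent_space_def algebra_simps)

lemma tangent_space_scale:
  assumes "v \<in> tangent_space M x"
  shows "(\<lambda>f. c * v f) \<in> tangent_space M x"
  using assms by (simp add: tangent_space_def algebra_simps)

text \<open>Injective since components determine a derivation
  (\<open>tangent_chart_expansion\<close>), surjective since \<open>coord_vector\<close> realizes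
  any components.\<close>

lemma fibre_iso_tangent_triv:
  assumes M: "smooth_manifold M" and c: "(U, \<phi>) \<in> mcharts M" "x \<in> U"
  shows "fibre_iso (tangent_bundle M) x (tangent_triv M \<phi>)"
proof -
  let ?T = "tangent_bundle M" and ?\<psi> = "tangent_triv M \<phi>"
  have x: "x \<in> mpoints M" using chartD(5)[OF M c(1)] c(2) by blast
  have fib: "fibre ?T x = {x} \<times> tangent_space M x" using x by (simp add: fibre_tangent_bundle)
  have "inj_on ?\<psi> (fibre ?T x)"
  proof (rule inj_onI)
    fix a b assume a: "a \<in> fibre ?T x" and b: "b \<in> fibre ?T x" and eq: "?\<psi> a = ?\<psi> b"
    obtain v w where vw: "a = (x, v)" "b = (x, w)" "v \<in> tangent_space M x" "w \<in> tangent_space M x"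
      using a b fib by auto
    have "v (\<lambda>y. \<phi> y i) = w (\<lambda>y. \<phi> y i)" if "i < mdim M" for i
      using fun_cong[OF eq, of i] that by (simp add: vw tangent_triv_def)
    then have "coord_vector M U \<phi> x (\<lambda>i. v (\<lambda>y. \<phi> y i)) = coord_vector M U \<phi> x (\<lambda>i. w (\<lambda>y. \<phi> y i))"
      by (auto simp: coord_vector_def)
    then show "a = b" using coord_vector_components[OF M c] vw by simp
  qed
  moreover have "?\<psi> ` fibre ?T x = Rn (mdim M)"
  proof
    show "?\<psi> ` fibre ?T x \<subseteq> Rn (mdim M)" by (auto simp: tangent_triv_def Rn_iff)
    show "Rn (mdim M) \<subseteq> ?\<psi> ` fibre ?T x"
    proof
      fix p assume p: "p \<in> Rn (mdim M)"
      let ?v = "coord_vector M U \<phi> x p"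
      have "?\<psi> (x, ?v) = p"
        using p coord_vector_coord[OF M c] by (auto simp: tangent_triv_def Rn_iff)
      moreover have "(x, ?v) \<in> fibre ?T x" using coord_vector_tangent[OF M c] by (simp add: fib)
      ultimately show "p \<in> ?\<psi> ` fibre ?T x" by (metis imageI)
    qed
  qed
  ultimately show ?thesis
    unfolding fibre_iso_def bij_betw_def
    using tangent_space_add[OF M] tangent_space_scale
    by (auto simp: fib tangent_bundle_simps tangent_triv_def)
qed

lemma frame_tangent_triv:
  assumes M: "smooth_manifold M" and c: "(U, \<phi>) \<in> mcharts M" "x \<in> U" and j: "j < mdim M"
  shows "frame (tangent_bundle M) (tangent_triv M \<phi>) j x = (x, coord_vector M U \<phi> x (unit_vec j))"
proof -
  let ?T = "tangent_bundle M"
  note iso = fibre_iso_tangent_triv[OF M c]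
  have x: "x \<in> mpoints M" using chartD(5)[OF M c(1)] c(2) by blast
  have j': "j < brank ?T" using j by (simp add: tangent_bundle_simps)
  show ?thesis
  proof (rule fibre_iso_eqI[OF iso frame_mem[OF iso j']])
    show "(x, coord_vector M U \<phi> x (unit_vec j)) \<in> fibre ?T x"
      using x coord_vector_tangent[OF M c] by (simp add: fibre_tangent_bundle)
    show "tangent_triv M \<phi> (frame ?T (tangent_triv M \<phi>) j x) i =
      tangent_triv M \<phi> (x, coord_vector M U \<phi> x (unit_vec j)) i" if "i < brank ?T" for i
      using that coord_vector_coord[OF M c]
      by (subst coord_frame[OF iso j']) (simp add: tangent_triv_def tangent_bundle_simps)
  qed
qed

text \<open>The differential of f as a covector field; its values on a chart frame are the partial
  derivatives in that chart. Applied to chart coordinates it yields the smooth transition functions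
  of the tangent bundle.\<close>

lemma sf_differential:
  assumes M: "smooth_manifold M" and f: "smooth_fun_on M W f"
  shows "smooth_functional M (tangent_bundle M) W (\<lambda>a. snd a f)"
proof (rule smooth_functionalI)
  show W: "openin (mtop M) W" by (rule smooth_fun_on_open[OF f])
  show "fibre_linear (tangent_bundle M) x (\<lambda>a. snd a f)" for x
    by (simp add: fibre_linear_def tangent_bundle_simps)
  fix U \<psi> j assume "(U, \<psi>) \<in> btrivs (tangent_bundle M)" and j: "j < brank (tangent_bundle M)"
  then obtain \<phi> where c: "(U, \<phi>) \<in> mcharts M" and \<psi>: "\<psi> = tangent_triv M \<phi>"
    by (auto simp: btrivs_tangent_bundle)
  have j: "j < mdim M" using j by (simp add: tangent_bundle_simps)
  let ?F = "\<lambda>p. f (inv_into U \<phi> p)"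
  have o: "openin (mtop M) (U \<inter> W)" using chartD(1)[OF M c] W by blast
  have "smooth_fun_on M (U \<inter> W) (\<lambda>x. partial_deriv j ?F (\<phi> x))"
    by (rule smooth_fun_on_chart_compose[OF M c o _ smooth_on_partial_deriv[OF smooth_fun_on_chartD[OF f c] j]]) auto
  then show "smooth_fun_on M (U \<inter> W) (\<lambda>x. snd (frame (tangent_bundle M) \<psi> j x) f)"
  proof (rule smooth_fun_on_cong[OF M])
    fix x assume "x \<in> U \<inter> W"
    then show "partial_deriv j ?F (\<phi> x) = snd (frame (tangent_bundle M) \<psi> j x) f"
      using j smooth_nearI[OF f, of x]
      by (simp add: \<psi> frame_tangent_triv[OF M c] coord_vector_def sum_unit_vec)
  qed
qed

lemma vbundle_tangent:
  assumes M: "smooth_manifold M"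
  shows "smooth_vbundle M (tangent_bundle M)"
proof (unfold_locales, rule M)
  let ?T = "tangent_bundle M"
  have "local_trivialization M ?T (U, tangent_triv M \<phi>)" if c: "(U, \<phi>) \<in> mcharts M" for U \<phi>
  proof -
    note iso = fibre_iso_tangent_triv[OF M]
    have rep: "smooth_matrix_rep M ?T ?T (\<lambda>a. a) (V, tangent_triv M \<theta>) (V', tangent_triv M \<theta>')"
      if v: "(V, \<theta>) \<in> mcharts M" "(V', \<theta>') \<in> mcharts M" for V \<theta> V' \<theta>'
    proof (subst smooth_matrix_rep_iff[OF M])
      show "fibre_iso ?T x (tangent_triv M \<theta>)" if "x \<in> V \<inter> V'" for x using iso[OF v(1)] that by blast
      show "fibre_linear ?T x (\<lambda>a. tangent_triv M \<theta>' a i)" if "x \<in> V \<inter> V'" for x i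
        using fibre_iso_coord_linear[OF iso[OF v(2)]] that by blast
      show "\<forall>i<brank ?T. \<forall>j<brank ?T. smooth_fun_on M (V \<inter> V')
          (\<lambda>x. tangent_triv M \<theta>' (frame ?T (tangent_triv M \<theta>) j x) i)"
      proof (intro allI impI)
        fix i j assume ij: "i < brank ?T" "j < brank ?T"
        have "smooth_fun_on M (V \<inter> V') (\<lambda>x. snd (frame ?T (tangent_triv M \<theta>) j x) (\<lambda>y. \<theta>' y i))"
          by (rule smooth_functionalD(3)[OF sf_differential[OF M smooth_fun_on_chart_coord[OF M v(2)]] _ ij(2)])
            (use v in \<open>auto simp: btrivs_tangent_bundle\<close>)
        then show "smooth_fun_on M (V \<inter> V') (\<lambda>x. tangent_triv M \<theta>' (frame ?T (tangent_triv M \<theta>) j x) i)"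
          using ij by (simp add: tangent_triv_def split_beta tangent_bundle_simps)
      qed
    qed
    show ?thesis
      using iso[OF c] chartD(1)[OF M c] rep[OF c] rep[OF _ c]
      by (auto simp: local_trivialization_def fibre_iso_def btrivs_tangent_bundle)
  qed
  moreover have "(\<Union>(U, \<psi>)\<in>btrivs ?T. U) = mpoints M"
    using M by (auto simp: btrivs_tangent_bundle smooth_manifold_def)
  ultimately show "vector_bundle M ?T"
    unfolding vector_bundle_def using tangent_space_add[OF M] tangent_space_scale
    by (auto simp: btrivs_tangent_bundle fibre_tangent_bundle) (auto simp: tangent_bundle_simps)
qed

subsection \<open>Vector fields\<close>

lemma vf_tangent: "X \<in> sections M (tangent_bundle M) \<Longrightarrow> x \<in> mpoints M \<Longrightarrow> fst (X x) = x \<and> snd (X x) \<in> tangent_space M x"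
  by (force simp: sections_def fibre_tangent_bundle)

lemma vf_smooth:
  assumes M: "smooth_manifold M" and X: "X \<in> sections M (tangent_bundle M)" and f: "smooth_fun_on M W f"
  shows "smooth_fun_on M W (\<lambda>y. snd (X y) f)"
  using smooth_vbundle.sf_section[OF vbundle_tangent[OF M] X sf_differential[OF M f]] .

lemma vf_smooth_near:
  "smooth_manifold M \<Longrightarrow> X \<in> sections M (tangent_bundle M) \<Longrightarrow> smooth_near M x f \<Longrightarrow> smooth_near M x (\<lambda>y. snd (X y) f)"
  by (auto simp: smooth_near_def intro: vf_smooth)

lemma vf_eqI:
  assumes "X \<in> sections M (tangent_bundle M)" "Y \<in> sections M (tangent_bundle M)"
    and "\<And>x f. x \<in> mpoints M \<Longrightarrow> smooth_near M x f \<Longrightarrow> snd (X x) f = snd (Y x) f"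
  shows "X = Y"
proof
  fix x show "X x = Y x"
  proof (cases "x \<in> mpoints M")
    case True
    have "snd (X x) f = snd (Y x) f" for f
    proof (cases "smooth_near M x f")
      case False
      then show ?thesis
        using tangentD(1)[OF conjunct2[OF vf_tangent[OF assms(1) True]]]
          tangentD(1)[OF conjunct2[OF vf_tangent[OF assms(2) True]]] by simp
    qed (rule assms(3)[OF True])
    then show ?thesis
      using vf_tangent[OF assms(1) True] vf_tangent[OF assms(2) True] by (simp add: prod_eq_iff ext)
  next
    case False
    then show ?thesis using assms(1,2) by (auto simp: sections_def PiE_iff extensional_def)
  qed
qed

lemma vf_bracket_apply:
  "x \<in> mpoints M \<Longrightarrow> smooth_near M x f \<Longrightarrow>
    snd (vf_bracket M X Y x) f = snd (X x) (\<lambda>y. snd (Y y) f) - snd (Y x) (\<lambda>y. snd (X y) f)"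
  by (simp add: vf_bracket_def)

text \<open>In iterated derivatives the rules for the inner vector field hold only at points near
  which the function is smooth. So inner expressions can be rewritten on a neighbourhood of x only,
  and this lemma lets the outer field ignore the rest.\<close>

lemma vf_apply_cong:
  assumes M: "smooth_manifold M" and X: "X \<in> sections M (tangent_bundle M)"
    and x: "x \<in> mpoints M" and f: "smooth_near M x f" and V: "openin (mtop M) V" "x \<in> V"
    and eq: "\<And>y. y \<in> V \<Longrightarrow> f y = g y"
  shows "snd (X x) f = snd (X x) g"
  using tangent_germ[OF M _ f V eq] vf_tangent[OF X x] by blast

lemma vf_apply_add:
  assumes M: "smooth_manifold M" and X: "X \<in> sections M (tangent_bundle M)" and x: "x \<in> mpoints M"
    and "smooth_near M x f" "smooth_near M x g"
  shows "snd (X x) (\<lambda>y. f y + g y) = snd (X x) f + snd (X x) g"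
    "snd (X x) (\<lambda>y. f y - g y) = snd (X x) f - snd (X x) g"
    "snd (X x) (\<lambda>y. f y * g y) = f x * snd (X x) g + g x * snd (X x) f"
    "snd (X x) (\<lambda>y. c * f y) = c * snd (X x) f"
proof -
  have v: "snd (X x) \<in> tangent_space M x" using vf_tangent[OF X x] by blast
  note t = tangentD[OF v]
  show "snd (X x) (\<lambda>y. f y + g y) = snd (X x) f + snd (X x) g"
    "snd (X x) (\<lambda>y. f y * g y) = f x * snd (X x) g + g x * snd (X x) f"
    "snd (X x) (\<lambda>y. c * f y) = c * snd (X x) f"
    by (rule t(2)[OF assms(4,5)], rule t(3)[OF assms(4,5)], rule t(4)[OF assms(4)])
  have g': "smooth_near M x (\<lambda>y. (- 1) * g y)"
    by (rule smooth_near_mult[OF M smooth_near_const[OF M x] assms(5)])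
  show "snd (X x) (\<lambda>y. f y - g y) = snd (X x) f - snd (X x) g"
    using t(2)[OF assms(4) g'] t(4)[OF assms(5), of "- 1"] by simp
qed

lemma vf_bracket_section:
  assumes M: "smooth_manifold M" and X: "X \<in> sections M (tangent_bundle M)" and Y: "Y \<in> sections M (tangent_bundle M)"
  shows "vf_bracket M X Y \<in> sections M (tangent_bundle M)"
proof -
  interpret T: smooth_vbundle M "tangent_bundle M" by (rule vbundle_tangent[OF M])
  show ?thesis
  proof (rule T.sectionI)
    fix x assume x: "x \<in> mpoints M"
    note nX = vf_smooth_near[OF M X] and nY = vf_smooth_near[OF M Y]
    let ?v = "snd (vf_bracket M X Y x)"
    have add: "?v (\<lambda>y. f y + g y) = ?v f + ?v g" and mult: "?v (\<lambda>y. f y * g y) = f x * ?v g + g x * ?v f"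
      if fg: "smooth_near M x f" "smooth_near M x g" for f g
    proof -
      obtain W where W: "x \<in> W" "smooth_fun_on M W f" "smooth_fun_on M W g" "openin (mtop M) W"
        using smooth_near_obtain2[OF M fg] .
      have n: "smooth_near M y f" "smooth_near M y g" "y \<in> mpoints M" if "y \<in> W" for y
        using that smooth_nearI[OF W(2) that] smooth_nearI[OF W(3) that] openin_subset[OF W(4)] by auto
      have "snd (X x) (\<lambda>y. snd (Y y) (\<lambda>z. f z + g z)) = snd (X x) (\<lambda>y. snd (Y y) f + snd (Y y) g)"
        if "X \<in> sections M (tangent_bundle M)" "Y \<in> sections M (tangent_bundle M)" for X Y
        by (rule vf_apply_cong[OF M that(1) x vf_smooth_near[OF M that(2) smooth_near_add[OF M fg]] W(4,1)])
          (use vf_apply_add(1)[OF M that(2)] n in auto)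
      from this[OF X Y] this[OF Y X] show "?v (\<lambda>y. f y + g y) = ?v f + ?v g"
        using vf_apply_add(1)[OF M X x nY[OF fg(1)] nY[OF fg(2)]] vf_apply_add(1)[OF M Y x nX[OF fg(1)] nX[OF fg(2)]]
        by (simp add: vf_bracket_apply x fg smooth_near_add[OF M fg])
      have "snd (X x) (\<lambda>y. snd (Y y) (\<lambda>z. f z * g z)) = snd (X x) (\<lambda>y. f y * snd (Y y) g + g y * snd (Y y) f)"
        if "X \<in> sections M (tangent_bundle M)" "Y \<in> sections M (tangent_bundle M)" for X Y
        by (rule vf_apply_cong[OF M that(1) x vf_smooth_near[OF M that(2) smooth_near_mult[OF M fg]] W(4,1)])
          (use vf_apply_add(3)[OF M that(2)] n in auto)
      \<comment> \<open>The two mixed terms, in which X and Y differentiate different factors, are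
        interchanged with each other when X and Y are swapped, so they cancel in the
        bracket.\<close>
      moreover have "snd (X x) (\<lambda>y. f y * snd (Y y) g + g y * snd (Y y) f) =
          f x * snd (X x) (\<lambda>y. snd (Y y) g) + snd (Y x) g * snd (X x) f
          + (g x * snd (X x) (\<lambda>y. snd (Y y) f) + snd (Y x) f * snd (X x) g)"
        if "X \<in> sections M (tangent_bundle M)" "Y \<in> sections M (tangent_bundle M)" for X Y
        using vf_smooth_near[OF M that(2) fg(1)] vf_smooth_near[OF M that(2) fg(2)] fg
        by (simp add: vf_apply_add[OF M that(1) x] smooth_near_mult[OF M])
      ultimately show "?v (\<lambda>y. f y * g y) = f x * ?v g + g x * ?v f"
        using X Y by (simp add: vf_bracket_apply x fg smooth_near_mult[OF M fg] algebra_simps)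
    qed
    \<comment> \<open>Homogeneity is the Leibniz rule with a constant factor, once the bracket is
      seen to kill constants.\<close>
    have scale: "?v (\<lambda>y. c * f y) = c * ?v f" if f: "smooth_near M x f" for f c
    proof -
      have c: "smooth_near M x (\<lambda>_. c)" by (rule smooth_near_const[OF M x])
      have "?v (\<lambda>_. c) = 0"
      proof -
        have "smooth_fun_on M (mpoints M) (\<lambda>_. 0)" by (rule smooth_fun_on_const[OF M]) simp
        then have 0: "smooth_near M x (\<lambda>_. 0)" using x by (rule smooth_nearI)
        have "snd (X x) (\<lambda>y. snd (Y y) (\<lambda>_. c)) = 0"
          if "X \<in> sections M (tangent_bundle M)" "Y \<in> sections M (tangent_bundle M)" for X Y
        proof -
          have "snd (X x) (\<lambda>_. 0) = snd (X x) (\<lambda>y. snd (Y y) (\<lambda>_. c))"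
            by (rule vf_apply_cong[OF M that(1) x 0 openin_topspace x])
              (use tangent_const[OF M] vf_tangent[OF that(2)] in auto)
          then show ?thesis using tangent_const[OF M x] vf_tangent[OF that(1) x] by metis
        qed
        then show ?thesis using X Y by (simp add: vf_bracket_apply x c)
      qed
      then show ?thesis using mult[OF c f] by simp
    qed
    have "?v \<in> tangent_space M x"
      unfolding tangent_space_def using add mult scale x by (auto simp: vf_bracket_def)
    then show "vf_bracket M X Y x \<in> fibre (tangent_bundle M) x"
      using x by (simp add: fibre_tangent_bundle vf_bracket_def)
    obtain U \<phi> where c: "(U, \<phi>) \<in> mcharts M" "x \<in> U" using chart_cover[OF M x] .
    have t: "local_trivialization M (tangent_bundle M) (U, tangent_triv M \<phi>)"
      by (rule T.triv_local) (use c in \<open>auto simp: btrivs_tangent_bundle\<close>)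
    have "smooth_fun_on M U (\<lambda>x. tangent_triv M \<phi> (vf_bracket M X Y x) i)" if i: "i < mdim M" for i
    proof (rule smooth_fun_on_cong[OF M])
      note s = smooth_fun_on_chart_coord[OF M c(1), of i]
      show "smooth_fun_on M U (\<lambda>x. snd (X x) (\<lambda>y. snd (Y y) (\<lambda>z. \<phi> z i)) - snd (Y x) (\<lambda>y. snd (X y) (\<lambda>z. \<phi> z i)))"
        by (intro smooth_fun_on_diff[OF M] vf_smooth[OF M X] vf_smooth[OF M Y] s)
      fix y assume y: "y \<in> U"
      then have "y \<in> mpoints M" using chartD(5)[OF M c(1)] by blast
      then show "snd (X y) (\<lambda>y. snd (Y y) (\<lambda>z. \<phi> z i)) - snd (Y y) (\<lambda>y. snd (X y) (\<lambda>z. \<phi> z i)) =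
          tangent_triv M \<phi> (vf_bracket M X Y y) i"
        using i by (simp add: tangent_triv_def split_beta vf_bracket_apply[OF _ smooth_near_chart_coord[OF M c(1) y]])
    qed
    then show "\<exists>U \<psi> V. local_trivialization M (tangent_bundle M) (U, \<psi>) \<and> x \<in> V \<and> V \<subseteq> U \<and>
       openin (mtop M) V \<and> (\<forall>i<brank (tangent_bundle M). smooth_fun_on M V (\<lambda>x. \<psi> (vf_bracket M X Y x) i))"
      using t c chartD(1)[OF M c(1)] by (auto simp: tangent_bundle_simps)
  qed (simp add: vf_bracket_def)
qed

subsection \<open>The Lie algebra of vector fields\<close>

abbreviation vector_fields :: "'a manifold \<Rightarrow> ('a \<Rightarrow> 'a \<times> (('a \<Rightarrow> real) \<Rightarrow> real)) set" where
  "vector_fields M \<equiv> sections M (tangent_bundle M)"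

lemma snd_sec_add_tangent:
  "x \<in> mpoints M \<Longrightarrow> snd (sec_add M (tangent_bundle M) X Y x) f = snd (X x) f + snd (Y x) f"
  and snd_sec_mult_tangent:
  "x \<in> mpoints M \<Longrightarrow> snd (sec_mult M (tangent_bundle M) g X x) f = g x * snd (X x) f"
  by (simp_all add: sec_add_def sec_mult_def tangent_bundle_simps)

lemma snd_sec_zero_tangent:
  assumes M: "smooth_manifold M" and x: "x \<in> mpoints M"
  shows "snd (sec_zero M (tangent_bundle M) x) f = 0"
proof -
  interpret T: smooth_vbundle M "tangent_bundle M" by (rule vbundle_tangent[OF M])
  obtain \<psi> where iso: "fibre_iso (tangent_bundle M) x \<psi>" using T.fibre_iso_ex[OF x] .
  have "fibre_linear (tangent_bundle M) x (\<lambda>a. snd a f)"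
    by (simp add: fibre_linear_def tangent_bundle_simps)
  from fibre_linear_bzero[OF iso this] show ?thesis using x by (simp add: sec_zero_def)
qed

lemma sec_zero_section:
  assumes "smooth_vbundle M E"
  shows "sec_zero M E \<in> sections M E"
proof -
  interpret smooth_vbundle M E by (rule assms)
  show ?thesis
  proof (rule section_of_local_combinations[where 'i = nat])
    fix x assume x: "x \<in> mpoints M"
    obtain \<psi> where iso: "fibre_iso E x \<psi>" using fibre_iso_ex[OF x] .
    show "sec_zero M E x \<in> fibre E x" using fibre_iso_bzero(1)[OF iso] x by (simp add: sec_zero_def)
    have "\<kappa> (sec_zero M E y) = (\<Sum>i\<in>{}. undefined i * (\<kappa> (undefined i y)))"
      if y: "y \<in> mpoints M" "fibre_linear E y \<kappa>" for y \<kappa>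
    proof -
      obtain \<psi> where "fibre_iso E y \<psi>" by (rule fibre_iso_ex[OF y(1)])
      from fibre_linear_bzero[OF this y(2)] show ?thesis using y(1) by (simp add: sec_zero_def)
    qed
    then show "\<exists>V (I :: nat set) g s. openin (mtop M) V \<and> x \<in> V \<and>
       (\<forall>i\<in>I. smooth_fun_on M V (g i) \<and> s i \<in> sections M E) \<and>
       (\<forall>y\<in>V. \<forall>\<kappa>. fibre_linear E y \<kappa> \<longrightarrow> \<kappa> (sec_zero M E y) = (\<Sum>i\<in>I. g i y * \<kappa> (s i y)))"
      using x by (intro exI[of _ "mpoints M"] exI[of _ "{}"]) auto
  qed (simp add: sec_zero_def)
qed

text \<open>Off M the sections are \<open>undefined\<close>, so functions formed from them can be
  compared on \<open>mpoints M\<close> only. This lemma absorbs that difference.\<close>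

lemma vf_apply_global_cong:
  assumes M: "smooth_manifold M" and X: "X \<in> vector_fields M"
    and x: "x \<in> mpoints M" and f: "smooth_near M x f" and eq: "\<And>y. y \<in> mpoints M \<Longrightarrow> f y = g y"
  shows "snd (X x) g = snd (X x) f"
  using vf_apply_cong[OF M X x f openin_topspace x eq] by simp

lemma vf_bracket_antisym:
  assumes M: "smooth_manifold M" and X: "X \<in> vector_fields M" and Y: "Y \<in> vector_fields M"
  shows "vf_bracket M X Y = sec_mult M (tangent_bundle M) (\<lambda>_. - 1) (vf_bracket M Y X)"
proof (rule vf_eqI)
  interpret T: smooth_vbundle M "tangent_bundle M" by (rule vbundle_tangent[OF M])
  show "vf_bracket M X Y \<in> vector_fields M" by (rule vf_bracket_section[OF M X Y])
  show "sec_mult M (tangent_bundle M) (\<lambda>_. - 1) (vf_bracket M Y X) \<in> vector_fields M"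
    by (rule T.sec_const_mult_section[OF vf_bracket_section[OF M Y X]])
qed (simp add: snd_sec_mult_tangent vf_bracket_apply)

lemma vf_bracket_add_right:
  assumes M: "smooth_manifold M" and X: "X \<in> vector_fields M" and Y: "Y \<in> vector_fields M" and Z: "Z \<in> vector_fields M"
  shows "vf_bracket M X (sec_add M (tangent_bundle M) Y Z)
    = sec_add M (tangent_bundle M) (vf_bracket M X Y) (vf_bracket M X Z)"
proof (rule vf_eqI)
  interpret T: smooth_vbundle M "tangent_bundle M" by (rule vbundle_tangent[OF M])
  show "vf_bracket M X (sec_add M (tangent_bundle M) Y Z) \<in> vector_fields M"
    by (intro vf_bracket_section[OF M] T.sec_add_section X Y Z)
  show "sec_add M (tangent_bundle M) (vf_bracket M X Y) (vf_bracket M X Z) \<in> vector_fields M"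
    by (intro vf_bracket_section[OF M] T.sec_add_section X Y Z)
  fix x f assume x: "x \<in> mpoints M" and f: "smooth_near M x f"
  note n = vf_smooth_near[OF M _ f]
  have "snd (X x) (\<lambda>y. snd (sec_add M (tangent_bundle M) Y Z y) f) = snd (X x) (\<lambda>y. snd (Y y) f + snd (Z y) f)"
    by (rule vf_apply_global_cong[OF M X x]) (auto simp: snd_sec_add_tangent intro!: smooth_near_add[OF M] n Y Z)
  then show "snd (vf_bracket M X (sec_add M (tangent_bundle M) Y Z) x) f
      = snd (sec_add M (tangent_bundle M) (vf_bracket M X Y) (vf_bracket M X Z) x) f"
    using vf_apply_add(1)[OF M X x n[OF Y] n[OF Z]]
    by (simp add: snd_sec_add_tangent x vf_bracket_apply f)
qed

lemma vf_bracket_leibniz: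
  assumes M: "smooth_manifold M" and X: "X \<in> vector_fields M" and Y: "Y \<in> vector_fields M"
    and g: "smooth_fun_on M (mpoints M) g"
  shows "vf_bracket M X (sec_mult M (tangent_bundle M) g Y)
    = sec_add M (tangent_bundle M) (sec_mult M (tangent_bundle M) g (vf_bracket M X Y))
        (sec_mult M (tangent_bundle M) (\<lambda>x. snd (X x) g) Y)"
proof (rule vf_eqI)
  interpret T: smooth_vbundle M "tangent_bundle M" by (rule vbundle_tangent[OF M])
  show "vf_bracket M X (sec_mult M (tangent_bundle M) g Y) \<in> vector_fields M"
    by (intro vf_bracket_section[OF M] T.sec_mult_section X Y g)
  show "sec_add M (tangent_bundle M) (sec_mult M (tangent_bundle M) g (vf_bracket M X Y))
        (sec_mult M (tangent_bundle M) (\<lambda>x. snd (X x) g) Y) \<in> vector_fields M"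
    by (intro vf_bracket_section[OF M] T.sec_add_section T.sec_mult_section X Y g vf_smooth[OF M X])
  fix x f assume x: "x \<in> mpoints M" and f: "smooth_near M x f"
  note n = vf_smooth_near[OF M _ f]
  have gn: "smooth_near M x g" by (rule smooth_nearI[OF g x])
  have "snd (X x) (\<lambda>y. snd (sec_mult M (tangent_bundle M) g Y y) f) = snd (X x) (\<lambda>y. g y * snd (Y y) f)"
    by (rule vf_apply_global_cong[OF M X x]) (auto simp: snd_sec_mult_tangent intro!: smooth_near_mult[OF M] n Y gn)
  then show "snd (vf_bracket M X (sec_mult M (tangent_bundle M) g Y) x) f
      = snd (sec_add M (tangent_bundle M) (sec_mult M (tangent_bundle M) g (vf_bracket M X Y))
        (sec_mult M (tangent_bundle M) (\<lambda>x. snd (X x) g) Y) x) f"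
    using vf_apply_add(3)[OF M X x gn n[OF Y]]
    by (simp add: snd_sec_add_tangent snd_sec_mult_tangent x vf_bracket_apply f algebra_simps)
qed

text \<open>Each double bracket splits into four third-order terms, and the twelve terms of the
  cyclic sum cancel in pairs.\<close>

lemma vf_bracket_jacobi:
  assumes M: "smooth_manifold M" and X: "X \<in> vector_fields M" and Y: "Y \<in> vector_fields M" and Z: "Z \<in> vector_fields M"
  shows "sec_add M (tangent_bundle M) (vf_bracket M X (vf_bracket M Y Z))
    (sec_add M (tangent_bundle M) (vf_bracket M Y (vf_bracket M Z X)) (vf_bracket M Z (vf_bracket M X Y)))
    = sec_zero M (tangent_bundle M)"
proof (rule vf_eqI)
  interpret T: smooth_vbundle M "tangent_bundle M" by (rule vbundle_tangent[OF M])
  show "sec_add M (tangent_bundle M) (vf_bracket M X (vf_bracket M Y Z))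
    (sec_add M (tangent_bundle M) (vf_bracket M Y (vf_bracket M Z X)) (vf_bracket M Z (vf_bracket M X Y))) \<in> vector_fields M"
    by (intro vf_bracket_section[OF M] T.sec_add_section X Y Z)
  show "sec_zero M (tangent_bundle M) \<in> vector_fields M"
    by (rule sec_zero_section[OF T.smooth_vbundle_axioms])
  fix x f assume x: "x \<in> mpoints M" and f: "smooth_near M x f"
  have "snd (vf_bracket M X (vf_bracket M Y Z) x) f =
      snd (X x) (\<lambda>y. snd (Y y) (\<lambda>z. snd (Z z) f)) - snd (X x) (\<lambda>y. snd (Z y) (\<lambda>z. snd (Y z) f))
      - (snd (Y x) (\<lambda>y. snd (Z y) (\<lambda>z. snd (X z) f)) - snd (Z x) (\<lambda>y. snd (Y y) (\<lambda>z. snd (X z) f)))"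
    if X: "X \<in> vector_fields M" and Y: "Y \<in> vector_fields M" and Z: "Z \<in> vector_fields M" for X Y Z
  proof -
    note n = vf_smooth_near[OF M]
    obtain W where W: "x \<in> W" "smooth_fun_on M W f" "openin (mtop M) W" using smooth_near_obtain[OF f] .
    have "snd (X x) (\<lambda>y. snd (Y y) (\<lambda>z. snd (Z z) f) - snd (Z y) (\<lambda>z. snd (Y z) f))
      = snd (X x) (\<lambda>y. snd (vf_bracket M Y Z y) f)"
    proof (rule vf_apply_cong[OF M X x _ W(3,1)])
      show "smooth_near M x (\<lambda>y. snd (Y y) (\<lambda>z. snd (Z z) f) - snd (Z y) (\<lambda>z. snd (Y z) f))"
        by (rule smooth_nearI[OF smooth_fun_on_diff[OF M] W(1)]) (intro vf_smooth[OF M] X Y Z W(2))+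
      show "snd (Y y) (\<lambda>z. snd (Z z) f) - snd (Z y) (\<lambda>z. snd (Y z) f) = snd (vf_bracket M Y Z y) f" if "y \<in> W" for y
        using vf_bracket_apply[OF _ smooth_nearI[OF W(2) that]] that openin_subset[OF W(3)] by auto
    qed
    then show ?thesis
      using vf_apply_add(2)[OF M X x n[OF Y n[OF Z f]] n[OF Z n[OF Y f]]] n[OF X f]
      by (simp add: vf_bracket_apply x f)
  qed
  from this[OF X Y Z] this[OF Y Z X] this[OF Z X Y]
  show "snd (sec_add M (tangent_bundle M) (vf_bracket M X (vf_bracket M Y Z))
    (sec_add M (tangent_bundle M) (vf_bracket M Y (vf_bracket M Z X)) (vf_bracket M Z (vf_bracket M X Y))) x) f
    = snd (sec_zero M (tangent_bundle M) x) f"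
    by (simp add: snd_sec_add_tangent snd_sec_zero_tangent[OF M] x)
qed

subsection \<open>Partitions of unity\<close>

lemma paracompact_refine:
  assumes pc: "paracompact_space X" and c: "\<And>x. x \<in> topspace X \<Longrightarrow> openin X (V x) \<and> x \<in> V x"
  obtains \<V> where "\<And>P. P \<in> \<V> \<Longrightarrow> openin X P" "\<And>P. P \<in> \<V> \<Longrightarrow> \<exists>x\<in>topspace X. P \<subseteq> V x"
    "\<Union>\<V> = topspace X" "locally_finite_in X \<V>"
proof -
  have 1: "\<forall>S\<in>V ` topspace X. openin X S" using c by blast
  have 2: "\<Union>(V ` topspace X) = topspace X"
  proof
    show "\<Union>(V ` topspace X) \<subseteq> topspace X" using c openin_subset by (metis UN_least)
    show "topspace X \<subseteq> \<Union>(V ` topspace X)" using c by blast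
  qed
  from pc[unfolded paracompact_space_def, rule_format, OF conjI[OF 1 2]]
  obtain \<V> where \<V>: "\<forall>P\<in>\<V>. openin X P \<and> (\<exists>U\<in>V ` topspace X. P \<subseteq> U)"
    "\<Union>\<V> = topspace X" "locally_finite_in X \<V>" by (elim exE conjE)
  show ?thesis by (rule that[OF _ _ \<V>(2,3)]) (use \<V>(1) in auto)
qed

lemma locally_finite_meets_compact:
  assumes \<W>: "locally_finite_in X \<W>" and K: "compactin X K"
  shows "finite {W \<in> \<W>. W \<inter> K \<noteq> {}}"
proof -
  have KX: "K \<subseteq> topspace X" using K compactin_subset_topspace by blast
  have "\<exists>V. openin X V \<and> x \<in> V \<and> finite {U \<in> \<W>. U \<inter> V \<noteq> {}}" if "x \<in> K" for x
    using \<W> that KX unfolding locally_finite_in_def by blast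
  then obtain V where V: "\<And>x. x \<in> K \<Longrightarrow> openin X (V x)" "\<And>x. x \<in> K \<Longrightarrow> x \<in> V x"
    "\<And>x. x \<in> K \<Longrightarrow> finite {U \<in> \<W>. U \<inter> V x \<noteq> {}}" by metis
  have "(\<forall>U\<in>V ` K. openin X U) \<and> K \<subseteq> \<Union>(V ` K)" using V(1,2) by auto
  then obtain \<F> where \<F>: "finite \<F>" "\<F> \<subseteq> V ` K" "K \<subseteq> \<Union>\<F>"
    using K unfolding compactin_def by meson
  then obtain F where F: "finite F" "F \<subseteq> K" "\<F> = V ` F" by (meson finite_subset_image)
  have "{W \<in> \<W>. W \<inter> K \<noteq> {}} \<subseteq> (\<Union>x\<in>F. {U \<in> \<W>. U \<inter> V x \<noteq> {}})"
    using F(3) \<F>(3) by blast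
  moreover have "finite (\<Union>x\<in>F. {U \<in> \<W>. U \<inter> V x \<noteq> {}})" using F V(3) by blast
  ultimately show ?thesis by (rule finite_subset)
qed

text \<open>Paracompactness is used twice: the second refinement consists of sets on which bump functions
  supported in the (relatively compact) members of the first one are equal to 1.\<close>

lemma locally_finite_bumps:
  fixes M :: "'a manifold" and U :: "'i \<Rightarrow> 'a set"
  assumes M: "smooth_manifold M" and pc: "paracompact_space (mtop M)"
    and cover: "\<And>x. x \<in> mpoints M \<Longrightarrow> \<exists>i. openin (mtop M) (U i) \<and> x \<in> U i"
  obtains I :: "'a set set" and C \<iota> b where
    "\<And>i. i \<in> I \<Longrightarrow> openin (mtop M) (U (\<iota> i)) \<and> closedin (mtop M) (C i) \<and> C i \<subseteq> U (\<iota> i)"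
    "\<And>i. i \<in> I \<Longrightarrow> smooth_fun_on M (mpoints M) (b i)" "\<And>i y. i \<in> I \<Longrightarrow> y \<notin> C i \<Longrightarrow> b i y = 0"
    "\<And>i y. i \<in> I \<Longrightarrow> 0 \<le> (b i y :: real)" "\<And>x. x \<in> mpoints M \<Longrightarrow> \<exists>i\<in>I. 0 < b i x"
    "\<And>x. x \<in> mpoints M \<Longrightarrow> \<exists>V. openin (mtop M) V \<and> x \<in> V \<and> finite {i \<in> I. C i \<inter> V \<noteq> {}}"
proof -
  have "\<forall>x\<in>mpoints M. \<exists>i K V. openin (mtop M) (U i) \<and> compactin (mtop M) K \<and> K \<subseteq> U i \<and>
      openin (mtop M) V \<and> x \<in> V \<and> V \<subseteq> K"
  proof
    fix x assume x: "x \<in> mpoints M"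
    obtain i where i: "openin (mtop M) (U i)" "x \<in> U i" using cover[OF x] by blast
    obtain b :: "'a \<Rightarrow> real" and C V where "compactin (mtop M) C" "C \<subseteq> U i" "openin (mtop M) V" "x \<in> V" "V \<subseteq> C"
      by (rule manifold_bump[OF M i]) (rule that)
    then show "\<exists>i K V. openin (mtop M) (U i) \<and> compactin (mtop M) K \<and> K \<subseteq> U i \<and>
      openin (mtop M) V \<and> x \<in> V \<and> V \<subseteq> K" using i by blast
  qed
  then obtain i K V where "\<forall>x\<in>mpoints M. openin (mtop M) (U (i x)) \<and> compactin (mtop M) (K x) \<and> K x \<subseteq> U (i x) \<and>
      openin (mtop M) (V x) \<and> x \<in> V x \<and> V x \<subseteq> K x"
    unfolding bchoice_iff by blast
  then have V: "\<And>x. x \<in> mpoints M \<Longrightarrow> openin (mtop M) (U (i x))"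
    "\<And>x. x \<in> mpoints M \<Longrightarrow> compactin (mtop M) (K x)" "\<And>x. x \<in> mpoints M \<Longrightarrow> K x \<subseteq> U (i x)"
    "\<And>x. x \<in> mpoints M \<Longrightarrow> openin (mtop M) (V x)" "\<And>x. x \<in> mpoints M \<Longrightarrow> x \<in> V x"
    "\<And>x. x \<in> mpoints M \<Longrightarrow> V x \<subseteq> K x" by blast+
  have cV: "\<And>x. x \<in> mpoints M \<Longrightarrow> openin (mtop M) (V x) \<and> x \<in> V x" using V(4,5) by blast
  obtain \<V> where \<V>: "\<And>P. P \<in> \<V> \<Longrightarrow> openin (mtop M) P" "\<And>P. P \<in> \<V> \<Longrightarrow> \<exists>x\<in>mpoints M. P \<subseteq> V x"
    "\<Union>\<V> = mpoints M" "locally_finite_in (mtop M) \<V>"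
    by (rule paracompact_refine[OF pc cV]) (assumption, rule that)
  have "\<forall>x\<in>mpoints M. \<exists>P b C W. P \<in> \<V> \<and> smooth_fun_on M (mpoints M) b \<and> closedin (mtop M) C \<and> C \<subseteq> P \<and>
      (\<forall>y. y \<notin> C \<longrightarrow> b y = 0) \<and> openin (mtop M) W \<and> x \<in> W \<and> W \<subseteq> C \<and> (\<forall>y\<in>W. b y = 1) \<and> (\<forall>y. 0 \<le> (b y :: real))"
  proof
    fix x assume x: "x \<in> mpoints M"
    obtain P where P: "P \<in> \<V>" "x \<in> P" using \<V>(3) x by blast
    obtain b :: "'a \<Rightarrow> real" and C V where "smooth_fun_on M (mpoints M) b" "closedin (mtop M) C"
      "C \<subseteq> P" "\<And>y. y \<notin> C \<Longrightarrow> b y = 0" "openin (mtop M) V" "x \<in> V" "V \<subseteq> C" "\<And>y. y \<in> V \<Longrightarrow> b y = 1"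
      "\<And>y. 0 \<le> b y"
      by (rule manifold_bump[OF M \<V>(1)[OF P(1)] P(2)]) (rule that)
    then show "\<exists>P b C W. P \<in> \<V> \<and> smooth_fun_on M (mpoints M) b \<and> closedin (mtop M) C \<and> C \<subseteq> P \<and>
      (\<forall>y. y \<notin> C \<longrightarrow> b y = 0) \<and> openin (mtop M) W \<and> x \<in> W \<and> W \<subseteq> C \<and> (\<forall>y\<in>W. b y = 1) \<and> (\<forall>y. 0 \<le> (b y :: real))"
      using P(1) by (intro exI[of _ P] exI[of _ b] exI[of _ C] exI[of _ V]) simp
  qed
  then obtain P C W and b :: "'a \<Rightarrow> 'a \<Rightarrow> real" where "\<forall>x\<in>mpoints M. P x \<in> \<V> \<and> smooth_fun_on M (mpoints M) (b x) \<and>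
      closedin (mtop M) (C x) \<and> C x \<subseteq> P x \<and> (\<forall>y. y \<notin> C x \<longrightarrow> b x y = 0) \<and> openin (mtop M) (W x) \<and>
      x \<in> W x \<and> W x \<subseteq> C x \<and> (\<forall>y\<in>W x. b x y = 1) \<and> (\<forall>y. 0 \<le> b x y)"
    unfolding bchoice_iff by blast
  then have P: "\<And>x. x \<in> mpoints M \<Longrightarrow> P x \<in> \<V>"
    and b: "\<And>x. x \<in> mpoints M \<Longrightarrow> smooth_fun_on M (mpoints M) (b x)"
    and C: "\<And>x. x \<in> mpoints M \<Longrightarrow> closedin (mtop M) (C x)" "\<And>x. x \<in> mpoints M \<Longrightarrow> C x \<subseteq> P x"
    and b0: "\<And>x y. x \<in> mpoints M \<Longrightarrow> y \<notin> C x \<Longrightarrow> b x y = 0"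
    and W: "\<And>x. x \<in> mpoints M \<Longrightarrow> openin (mtop M) (W x)" "\<And>x. x \<in> mpoints M \<Longrightarrow> x \<in> W x"
      "\<And>x. x \<in> mpoints M \<Longrightarrow> W x \<subseteq> C x" "\<And>x y. x \<in> mpoints M \<Longrightarrow> y \<in> W x \<Longrightarrow> b x y = 1"
    and bp: "\<And>x y. x \<in> mpoints M \<Longrightarrow> 0 \<le> b x y" by blast+
  have cW: "\<And>x. x \<in> mpoints M \<Longrightarrow> openin (mtop M) (W x) \<and> x \<in> W x" using W(1,2) by blast
  obtain \<W> where \<W>: "\<And>S. S \<in> \<W> \<Longrightarrow> \<exists>x\<in>mpoints M. S \<subseteq> W x" "\<Union>\<W> = mpoints M" "locally_finite_in (mtop M) \<W>"
    by (rule paracompact_refine[OF pc cW]) (assumption, rule that)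
  obtain z where z: "\<And>S. S \<in> \<W> \<Longrightarrow> z S \<in> mpoints M" "\<And>S. S \<in> \<W> \<Longrightarrow> S \<subseteq> W (z S)" using \<W>(1) by metis
  obtain q where q: "\<And>P. P \<in> \<V> \<Longrightarrow> q P \<in> mpoints M" "\<And>P. P \<in> \<V> \<Longrightarrow> P \<subseteq> V (q P)" using \<V>(2) by metis
  \<comment> \<open>The argument for local finiteness turns the inclusion of S in a compact set into
    an intersection with it, which fails for the empty set.\<close>
  let ?I = "\<W> - {{}}"
  show thesis
  proof (rule that[of ?I "\<lambda>S. i (q (P (z S)))" "\<lambda>S. C (z S)" "\<lambda>S. b (z S)"])
    fix S assume S: "S \<in> ?I"
    then have zS: "z S \<in> mpoints M" using z by blast
    have qm: "q (P (z S)) \<in> mpoints M" by (rule q(1)[OF P[OF zS]])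
    have "C (z S) \<subseteq> V (q (P (z S)))" using C(2)[OF zS] q(2)[OF P[OF zS]] by blast
    also have "\<dots> \<subseteq> U (i (q (P (z S))))" using V(3,6)[OF qm] by blast
    finally show "openin (mtop M) (U (i (q (P (z S))))) \<and> closedin (mtop M) (C (z S)) \<and> C (z S) \<subseteq> U (i (q (P (z S))))"
      using V(1)[OF qm] C(1)[OF zS] by blast
    show "smooth_fun_on M (mpoints M) (b (z S))" by (rule b[OF zS])
    show "b (z S) y = 0" if "y \<notin> C (z S)" for y by (rule b0[OF zS that])
    show "0 \<le> b (z S) y" for y by (rule bp[OF zS])
  next
    fix x assume x: "x \<in> mpoints M"
    then obtain S where S: "S \<in> \<W>" "x \<in> S" using \<W>(2) by blast
    then have "b (z S) x = 1" using W(4)[OF z(1)[OF S(1)]] z(2)[OF S(1)] by blast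
    then show "\<exists>S\<in>?I. 0 < b (z S) x" using S by (intro bexI[of _ S]) auto
    obtain O' where O': "openin (mtop M) O'" "x \<in> O'" "finite {P \<in> \<V>. P \<inter> O' \<noteq> {}}"
      using \<V>(4) x unfolding locally_finite_in_def by blast
    \<comment> \<open>If \<open>C (z S)\<close> meets O', then so does P (z S), one of finitely many
      members of the first refinement; and S lies in the compact set attached to that member. Each
      such compact set meets only finitely many members of the second refinement.\<close>
    have "{S \<in> ?I. C (z S) \<inter> O' \<noteq> {}} \<subseteq> (\<Union>P\<in>{P \<in> \<V>. P \<inter> O' \<noteq> {}}. {S \<in> \<W>. S \<inter> K (q P) \<noteq> {}})"
    proof
      fix S assume S: "S \<in> {S \<in> ?I. C (z S) \<inter> O' \<noteq> {}}"
      then have zS: "z S \<in> mpoints M" and SW: "S \<in> \<W>" using z by blast+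
      have "S \<subseteq> W (z S)" by (rule z(2)[OF SW])
      also have "\<dots> \<subseteq> C (z S)" by (rule W(3)[OF zS])
      also have "\<dots> \<subseteq> P (z S)" by (rule C(2)[OF zS])
      also have "\<dots> \<subseteq> V (q (P (z S)))" by (rule q(2)[OF P[OF zS]])
      also have "\<dots> \<subseteq> K (q (P (z S)))" by (rule V(6)[OF q(1)[OF P[OF zS]]])
      finally have "S \<inter> K (q (P (z S))) \<noteq> {}" using S by blast
      moreover have "P (z S) \<inter> O' \<noteq> {}" using S C(2)[OF zS] by blast
      ultimately show "S \<in> (\<Union>P\<in>{P \<in> \<V>. P \<inter> O' \<noteq> {}}. {S \<in> \<W>. S \<inter> K (q P) \<noteq> {}})"
        using P[OF zS] SW by blast
    qed
    moreover have "finite (\<Union>P\<in>{P \<in> \<V>. P \<inter> O' \<noteq> {}}. {S \<in> \<W>. S \<inter> K (q P) \<noteq> {}})"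
      using O'(3) locally_finite_meets_compact[OF \<W>(3)] V(2) q(1) by blast
    ultimately have "finite {S \<in> ?I. C (z S) \<inter> O' \<noteq> {}}" by (rule finite_subset)
    then show "\<exists>V. openin (mtop M) V \<and> x \<in> V \<and> finite {i \<in> ?I. C (z i) \<inter> V \<noteq> {}}" using O' by blast
  qed
qed

subsection \<open>Almost Lie brackets from partitions of unity\<close>

text \<open>With k = (i, j), the section s k is b i times the j-th frame vector and l k is b i /
  \<sigma> times the j-th coordinate. Both have to vanish off C i in order to extend to M, so b i
  enters twice and the normalization is \<sigma> = sum of the squares of the b i. The last claim
  admits every finite F containing the active indices, so that one F can be kept fixed while x
  varies.\<close>

lemma (in smooth_vbundle) locally_finite_frame:
  assumes pc: "paracompact_space (mtop M)"
  obtains K :: "('a set \<times> nat) set" and C s l where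
    "\<And>k. k \<in> K \<Longrightarrow> closedin (mtop M) (C k)" "\<And>k. k \<in> K \<Longrightarrow> s k \<in> sections M E"
    "\<And>k X. k \<in> K \<Longrightarrow> X \<in> sections M E \<Longrightarrow> smooth_fun_on M (mpoints M) (l k X)"
    "\<And>k X x. k \<in> K \<Longrightarrow> x \<notin> C k \<Longrightarrow> l k X x = (0 :: real)"
    "\<And>k X Y x. k \<in> K \<Longrightarrow> x \<in> mpoints M \<Longrightarrow> X \<in> sections M E \<Longrightarrow> Y \<in> sections M E \<Longrightarrow>
       l k (sec_add M E X Y) x = l k X x + l k Y x"
    "\<And>k f X x. k \<in> K \<Longrightarrow> x \<in> mpoints M \<Longrightarrow> X \<in> sections M E \<Longrightarrow> l k (sec_mult M E f X) x = f x * l k X x"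
    "\<And>x. x \<in> mpoints M \<Longrightarrow> \<exists>V. openin (mtop M) V \<and> x \<in> V \<and> finite {k \<in> K. C k \<inter> V \<noteq> {}}"
    "\<And>x X \<kappa> F. x \<in> mpoints M \<Longrightarrow> X \<in> sections M E \<Longrightarrow> fibre_linear E x \<kappa> \<Longrightarrow> finite F \<Longrightarrow> F \<subseteq> K \<Longrightarrow>
       {k \<in> K. x \<in> C k} \<subseteq> F \<Longrightarrow> \<kappa> (X x) = (\<Sum>k\<in>F. l k X x * \<kappa> (s k x))"
proof -
  \<comment> \<open>The indices run through a whole type; pairs outside the atlas are given the
    empty set and so cover nothing.\<close>
  define U where "U t = (if t \<in> btrivs E then fst t else {})" for t
  have cov: "\<exists>t. openin (mtop M) (U t) \<and> x \<in> U t" if "x \<in> mpoints M" for x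
  proof -
    obtain V \<psi> where "(V, \<psi>) \<in> btrivs E" "x \<in> V" using triv_cover[OF \<open>x \<in> mpoints M\<close>] .
    then show ?thesis using lt_open[OF triv_local] by (intro exI[of _ "(V, \<psi>)"]) (auto simp: U_def)
  qed
  obtain I :: "'a set set" and C \<iota> b where
    I: "\<And>i. i \<in> I \<Longrightarrow> openin (mtop M) (U (\<iota> i)) \<and> closedin (mtop M) (C i) \<and> C i \<subseteq> U (\<iota> i)"
    and b: "\<And>i. i \<in> I \<Longrightarrow> smooth_fun_on M (mpoints M) (b i)" and b0: "\<And>i y. i \<in> I \<Longrightarrow> y \<notin> C i \<Longrightarrow> b i y = 0"
    and bn: "\<And>i y. i \<in> I \<Longrightarrow> 0 \<le> (b i y :: real)" and bp: "\<And>x. x \<in> mpoints M \<Longrightarrow> \<exists>i\<in>I. 0 < b i x"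
    and lf: "\<And>x. x \<in> mpoints M \<Longrightarrow> \<exists>V. openin (mtop M) V \<and> x \<in> V \<and> finite {i \<in> I. C i \<inter> V \<noteq> {}}"
    by (rule locally_finite_bumps[OF M pc cov]) (assumption, rule that)
  \<comment> \<open>An index with \<iota> i outside the atlas has an empty set
    \<open>U (\<iota> i)\<close>, hence an empty C i and b i = 0; dropping it loses nothing.\<close>
  define J where "J = {i \<in> I. \<iota> i \<in> btrivs E}"
  define \<psi> where "\<psi> i = snd (\<iota> i)" for i
  have lt: "local_trivialization M E (U (\<iota> i), \<psi> i)" if "i \<in> J" for i
    using that triv_local[of "fst (\<iota> i)" "snd (\<iota> i)"] by (simp add: J_def U_def \<psi>_def)
  have JI: "i \<in> J \<Longrightarrow> i \<in> I" for i by (simp add: J_def)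
  have bJ: "i \<in> J" if "i \<in> I" "0 < b i x" for i x
  proof -
    have "x \<in> C i" using b0[OF that(1), of x] that(2) by auto
    then have "x \<in> U (\<iota> i)" using I[OF that(1)] by blast
    then show ?thesis using that(1) by (auto simp: J_def U_def split: if_splits)
  qed
  define Jx where "Jx x = {i \<in> J. x \<in> C i}" for x
  define \<sigma> where "\<sigma> x = (\<Sum>i\<in>Jx x. b i x * b i x)" for x
  have lfJ: "\<exists>V. openin (mtop M) V \<and> x \<in> V \<and> finite {i \<in> J. C i \<inter> V \<noteq> {}}" if x: "x \<in> mpoints M" for x
  proof -
    obtain V where V: "openin (mtop M) V" "x \<in> V" "finite {i \<in> I. C i \<inter> V \<noteq> {}}" using lf[OF x] by blast
    have "{i \<in> J. C i \<inter> V \<noteq> {}} \<subseteq> {i \<in> I. C i \<inter> V \<noteq> {}}" using JI by blast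
    then show ?thesis using V finite_subset by blast
  qed
  have finJ: "finite (Jx x)" if x: "x \<in> mpoints M" for x
  proof -
    obtain V where V: "x \<in> V" "finite {i \<in> J. C i \<inter> V \<noteq> {}}" using lfJ[OF x] by blast
    have "Jx x \<subseteq> {i \<in> J. C i \<inter> V \<noteq> {}}" using V(1) by (auto simp: Jx_def)
    then show ?thesis using V(2) finite_subset by blast
  qed
  have \<sigma>pos: "0 < \<sigma> x" if x: "x \<in> mpoints M" for x
  proof -
    obtain i where i: "i \<in> I" "0 < b i x" using bp[OF x] by blast
    have "x \<in> C i" using b0[OF i(1), of x] i(2) by auto
    then have iJ: "i \<in> Jx x" using bJ[OF i] by (simp add: Jx_def)
    have "0 < b i x * b i x" using i(2) by simp
    also have "\<dots> \<le> \<sigma> x"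
      unfolding \<sigma>_def by (rule member_le_sum[OF iJ _ finJ[OF x]]) simp
    finally show ?thesis .
  qed
  have \<sigma>s: "smooth_fun_on M (mpoints M) \<sigma>"
  proof (rule smooth_fun_on_local[OF M])
    fix x assume x: "x \<in> mpoints M"
    obtain V where V: "openin (mtop M) V" "x \<in> V" "finite {i \<in> J. C i \<inter> V \<noteq> {}}" using lfJ[OF x] by blast
    have Vm: "V \<subseteq> mpoints M" by (rule openin_subset[OF V(1)])
    let ?F = "{i \<in> J. C i \<inter> V \<noteq> {}}"
    have "smooth_fun_on M V (\<lambda>x. \<Sum>i\<in>?F. b i x * b i x)"
      using JI by (intro smooth_fun_on_sum[OF M V(1)] smooth_fun_on_mult[OF M]
          smooth_fun_on_subset[OF M b V(1) Vm]) auto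
    then have "smooth_fun_on M V \<sigma>"
    proof (rule smooth_fun_on_cong[OF M])
      fix y assume y: "y \<in> V"
      show "(\<Sum>i\<in>?F. b i y * b i y) = \<sigma> y"
        unfolding \<sigma>_def by (rule sum.mono_neutral_right[OF V(3)]) (use y b0 JI in \<open>auto simp: Jx_def\<close>)
    qed
    then show "\<exists>V. x \<in> V \<and> V \<subseteq> mpoints M \<and> smooth_fun_on M V \<sigma>" using V(2) Vm by blast
  qed
  define K where "K = J \<times> {..<brank E}"
  have "\<exists>s. s \<in> sections M E \<and>
      (\<forall>x \<kappa>. x \<in> U (\<iota> (fst k)) \<longrightarrow> fibre_linear E x \<kappa> \<longrightarrow> \<kappa> (s x) = b (fst k) x * \<kappa> (frame E (\<psi> (fst k)) (snd k) x))"
    if k: "k \<in> K" for k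
  proof -
    have i: "fst k \<in> J" "snd k < brank E" using k by (auto simp: K_def)
    note II = I[OF JI[OF i(1)]]
    obtain s where "s \<in> sections M E"
      "\<And>x \<kappa>. x \<in> U (\<iota> (fst k)) \<Longrightarrow> fibre_linear E x \<kappa> \<Longrightarrow> \<kappa> (s x) = b (fst k) x * \<kappa> (frame E (\<psi> (fst k)) (snd k) x)"
      by (rule frame_section[OF lt[OF i(1)] i(2) b[OF JI[OF i(1)]] _ _ b0[OF JI[OF i(1)]]])
        (use II that in auto)
    then show ?thesis by blast
  qed
  then have "\<forall>k\<in>K. \<exists>s. s \<in> sections M E \<and>
      (\<forall>x \<kappa>. x \<in> U (\<iota> (fst k)) \<longrightarrow> fibre_linear E x \<kappa> \<longrightarrow> \<kappa> (s x) = b (fst k) x * \<kappa> (frame E (\<psi> (fst k)) (snd k) x))"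
    by blast
  from bchoice[OF this] obtain s where s: "\<And>k. k \<in> K \<Longrightarrow> s k \<in> sections M E"
    "\<And>k x \<kappa>. k \<in> K \<Longrightarrow> x \<in> U (\<iota> (fst k)) \<Longrightarrow> fibre_linear E x \<kappa> \<Longrightarrow>
       \<kappa> (s k x) = b (fst k) x * \<kappa> (frame E (\<psi> (fst k)) (snd k) x)" by blast
  define l where "l k X x = (if x \<in> U (\<iota> (fst k)) then b (fst k) x * inverse (\<sigma> x) * \<psi> (fst k) (X x) (snd k) else 0)"
    for k X x
  show thesis
  proof (rule that[of K "\<lambda>k. C (fst k)" s l])
    fix k assume k: "k \<in> K"
    have i: "fst k \<in> J" "snd k < brank E" using k by (auto simp: K_def)
    note II = I[OF JI[OF i(1)]]
    have Um: "U (\<iota> (fst k)) \<subseteq> mpoints M" using II openin_subset by blast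
    show "closedin (mtop M) (C (fst k))" using II by blast
    show "s k \<in> sections M E" by (rule s(1)[OF k])
    show "l k X x = 0" if "x \<notin> C (fst k)" for X x
      using b0[OF JI[OF i(1)] that] by (simp add: l_def)
    show "smooth_fun_on M (mpoints M) (l k X)" if X: "X \<in> sections M E" for X
      unfolding l_def
    proof (rule smooth_fun_extend[OF M])
      show "smooth_fun_on M (U (\<iota> (fst k))) (\<lambda>x. b (fst k) x * inverse (\<sigma> x) * \<psi> (fst k) (X x) (snd k))"
      proof (intro smooth_fun_on_mult[OF M] smooth_fun_on_inverse[OF M])
        show "smooth_fun_on M (U (\<iota> (fst k))) (b (fst k))"
          by (rule smooth_fun_on_subset[OF M b[OF JI[OF i(1)]] lt_open[OF lt[OF i(1)]] Um])
        show "smooth_fun_on M (U (\<iota> (fst k))) \<sigma>"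
          by (rule smooth_fun_on_subset[OF M \<sigma>s lt_open[OF lt[OF i(1)]] Um])
        show "\<sigma> x \<noteq> 0" if "x \<in> U (\<iota> (fst k))" for x using \<sigma>pos[of x] that Um by auto
        show "smooth_fun_on M (U (\<iota> (fst k))) (\<lambda>x. \<psi> (fst k) (X x) (snd k))"
          by (rule sf_section[OF X sf_coord[OF lt[OF i(1)] i(2)]])
      qed
      show "closedin (mtop M) (C (fst k))" "C (fst k) \<subseteq> U (\<iota> (fst k))" using II by blast+
    qed (simp add: b0[OF JI[OF i(1)]])
    show "l k (sec_add M E X Y) x = l k X x + l k Y x"
      if "x \<in> mpoints M" "X \<in> sections M E" "Y \<in> sections M E" for X Y x
      using linear_sec_add[OF that(2,3,1) fibre_iso_coord_linear[OF lt_iso[OF lt[OF i(1)]]]]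
      by (simp add: l_def distrib_left)
    show "l k (sec_mult M E f X) x = f x * l k X x"
      if "x \<in> mpoints M" "X \<in> sections M E" for f X x
      using linear_sec_mult[OF that(2,1) fibre_iso_coord_linear[OF lt_iso[OF lt[OF i(1)]]]]
      by (simp add: l_def)
  next
    fix x assume x: "x \<in> mpoints M"
    obtain V where V: "openin (mtop M) V" "x \<in> V" "finite {i \<in> J. C i \<inter> V \<noteq> {}}" using lfJ[OF x] by blast
    have "{k \<in> K. C (fst k) \<inter> V \<noteq> {}} \<subseteq> {i \<in> J. C i \<inter> V \<noteq> {}} \<times> {..<brank E}" by (auto simp: K_def)
    then have "finite {k \<in> K. C (fst k) \<inter> V \<noteq> {}}" using V(3) by (meson finite_SigmaI finite_lessThan finite_subset)
    then show "\<exists>V. openin (mtop M) V \<and> x \<in> V \<and> finite {k \<in> K. C (fst k) \<inter> V \<noteq> {}}" using V by blast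
  next
    fix x X \<kappa> F
    assume x: "x \<in> mpoints M" and X: "X \<in> sections M E" and k: "fibre_linear E x \<kappa>"
      and F: "finite F" "F \<subseteq> K" "{k \<in> K. x \<in> C (fst k)} \<subseteq> F"
    have eq: "{k \<in> K. x \<in> C (fst k)} = Jx x \<times> {..<brank E}" by (auto simp: K_def Jx_def)
    have "(\<Sum>k\<in>F. l k X x * \<kappa> (s k x)) = (\<Sum>k\<in>Jx x \<times> {..<brank E}. l k X x * \<kappa> (s k x))"
      unfolding eq[symmetric]
    proof (rule sum.mono_neutral_right[OF F(1,3)], rule ballI)
      fix k assume "k \<in> F - {k \<in> K. x \<in> C (fst k)}"
      then have "fst k \<in> J" "x \<notin> C (fst k)" using F(2) by (auto simp: K_def)
      then show "l k X x * \<kappa> (s k x) = 0" using b0[OF JI] by (simp add: l_def)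
    qed
    also have "\<dots> = (\<Sum>i\<in>Jx x. \<Sum>j<brank E. l (i, j) X x * \<kappa> (s (i, j) x))"
      by (simp add: sum.cartesian_product)
    also have "\<dots> = (\<Sum>i\<in>Jx x. b i x * b i x * inverse (\<sigma> x) * \<kappa> (X x))"
    proof (rule sum.cong[OF refl])
      fix i assume i: "i \<in> Jx x"
      then have iJ: "i \<in> J" and xU: "x \<in> U (\<iota> i)" using I[OF JI] by (auto simp: Jx_def)
      have "(\<Sum>j<brank E. l (i, j) X x * \<kappa> (s (i, j) x))
        = (\<Sum>j<brank E. b i x * b i x * inverse (\<sigma> x) * (\<psi> i (X x) j * \<kappa> (frame E (\<psi> i) j x)))"
      proof (rule sum.cong[OF refl])
        fix j assume "j \<in> {..<brank E}"
        then have "(i, j) \<in> K" using iJ by (simp add: K_def)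
        from s(2)[OF this, of x \<kappa>] show "l (i, j) X x * \<kappa> (s (i, j) x)
          = b i x * b i x * inverse (\<sigma> x) * (\<psi> i (X x) j * \<kappa> (frame E (\<psi> i) j x))"
          using xU k by (simp add: l_def)
      qed
      also have "\<dots> = b i x * b i x * inverse (\<sigma> x) * \<kappa> (X x)"
        using fibre_linear_expand[OF lt_iso[OF lt[OF iJ] xU] k section_fibre[OF X x]] by (simp add: sum_distrib_left)
      finally show "(\<Sum>j<brank E. l (i, j) X x * \<kappa> (s (i, j) x)) = b i x * b i x * inverse (\<sigma> x) * \<kappa> (X x)" .
    qed
    also have "\<dots> = (\<Sum>i\<in>Jx x. b i x * b i x) * (inverse (\<sigma> x) * \<kappa> (X x))"
      by (simp add: sum_distrib_right mult.assoc)
    also have "\<dots> = \<sigma> x * (inverse (\<sigma> x) * \<kappa> (X x))" by (simp only: \<sigma>_def)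
    also have "\<dots> = \<kappa> (X x)" using \<sigma>pos[OF x] by simp
    finally show "\<kappa> (X x) = (\<Sum>k\<in>F. l k X x * \<kappa> (s k x))" by simp
  qed
qed

text \<open>Homogeneity on the right is the Leibniz rule for constant functions, which every
  anchored vector kills; both rules for the left argument are carried over from the right by
  antisymmetry.\<close>

lemma almost_lie_bracketI:
  assumes E: "smooth_vbundle M E" and \<rho>: "bundle_morphism M E (tangent_bundle M) \<rho>"
    and cl: "\<And>X Y. X \<in> sections M E \<Longrightarrow> Y \<in> sections M E \<Longrightarrow> B X Y \<in> sections M E"
    and anti: "\<And>X Y. X \<in> sections M E \<Longrightarrow> Y \<in> sections M E \<Longrightarrow> B X Y = sec_mult M E (\<lambda>_. - 1) (B Y X)"
    and add: "\<And>X Y Z. X \<in> sections M E \<Longrightarrow> Y \<in> sections M E \<Longrightarrow> Z \<in> sections M E \<Longrightarrow>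
      B X (sec_add M E Y Z) = sec_add M E (B X Y) (B X Z)"
    and leib: "\<And>f X Y. smooth_fun_on M (mpoints M) f \<Longrightarrow> X \<in> sections M E \<Longrightarrow> Y \<in> sections M E \<Longrightarrow>
      B X (sec_mult M E f Y) = sec_add M E (sec_mult M E f (B X Y)) (sec_mult M E (\<lambda>x. snd (\<rho> (X x)) f) Y)"
  shows "almost_lie_bracket M E \<rho> B"
proof -
  interpret smooth_vbundle M E by (rule E)
  interpret T: smooth_vbundle M "tangent_bundle M" by (rule vbundle_tangent[OF M])
  have neg: "\<kappa> (B X Y x) = - \<kappa> (B Y X x)"
    if "X \<in> sections M E" "Y \<in> sections M E" "x \<in> mpoints M" "fibre_linear E x \<kappa>" for X Y x \<kappa>
    using linear_sec_mult[OF cl[OF that(2,1)] that(3,4), of "\<lambda>_. - 1"] anti[OF that(1,2)] by simp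
  have mult: "B X (sec_mult M E (\<lambda>_. c) Y) = sec_mult M E (\<lambda>_. c) (B X Y)"
    if X: "X \<in> sections M E" and Y: "Y \<in> sections M E" for X Y c
  proof (rule section_eq_linearI)
    show "B X (sec_mult M E (\<lambda>_. c) Y) \<in> sections M E" "sec_mult M E (\<lambda>_. c) (B X Y) \<in> sections M E"
      by (intro cl sec_const_mult_section X Y)+
    fix x \<kappa> assume x: "x \<in> mpoints M" and k: "fibre_linear E x \<kappa>"
    have c: "smooth_fun_on M (mpoints M) (\<lambda>_. c)" by (rule smooth_fun_on_const[OF M]) simp
    have Xc: "snd (\<rho> (X y)) (\<lambda>_. c) = 0" if "y \<in> mpoints M" for y
      using tangent_const[OF M that] bundle_morphismD(1)[OF \<rho> that section_fibre[OF X that]] that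
      by (auto simp: fibre_tangent_bundle)
    have "smooth_fun_on M (mpoints M) (\<lambda>y. snd (\<rho> (X y)) (\<lambda>_. c))"
      by (rule smooth_fun_on_cong[OF M smooth_fun_on_const[OF M, of _ 0]]) (use Xc in auto)
    then have "\<kappa> (B X (sec_mult M E (\<lambda>_. c) Y) x) = c * \<kappa> (B X Y x) + snd (\<rho> (X x)) (\<lambda>_. c) * \<kappa> (Y x)"
      unfolding leib[OF c X Y]
      using linear_sec_add[OF sec_mult_section[OF c cl[OF X Y]] sec_mult_section[OF _ Y] x k]
        linear_sec_mult[OF cl[OF X Y] x k] linear_sec_mult[OF Y x k] by simp
    then show "\<kappa> (B X (sec_mult M E (\<lambda>_. c) Y) x) = \<kappa> (sec_mult M E (\<lambda>_. c) (B X Y) x)"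
      using Xc[OF x] linear_sec_mult[OF cl[OF X Y] x k] by simp
  qed
  have add': "B (sec_add M E X Y) Z = sec_add M E (B X Z) (B Y Z)"
    if X: "X \<in> sections M E" and Y: "Y \<in> sections M E" and Z: "Z \<in> sections M E" for X Y Z
  proof (rule section_eq_linearI)
    show "B (sec_add M E X Y) Z \<in> sections M E" "sec_add M E (B X Z) (B Y Z) \<in> sections M E"
      by (intro cl sec_add_section X Y Z)+
    fix x \<kappa> assume x: "x \<in> mpoints M" and k: "fibre_linear E x \<kappa>"
    show "\<kappa> (B (sec_add M E X Y) Z x) = \<kappa> (sec_add M E (B X Z) (B Y Z) x)"
      using neg[OF sec_add_section[OF X Y] Z x k] neg[OF X Z x k] neg[OF Y Z x k] add[OF Z X Y]
        linear_sec_add[OF cl[OF Z X] cl[OF Z Y] x k] linear_sec_add[OF cl[OF X Z] cl[OF Y Z] x k] by simp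
  qed
  have mult': "B (sec_mult M E (\<lambda>_. c) X) Y = sec_mult M E (\<lambda>_. c) (B X Y)"
    if X: "X \<in> sections M E" and Y: "Y \<in> sections M E" for X Y c
  proof (rule section_eq_linearI)
    show "B (sec_mult M E (\<lambda>_. c) X) Y \<in> sections M E" "sec_mult M E (\<lambda>_. c) (B X Y) \<in> sections M E"
      by (intro cl sec_const_mult_section X Y)+
    fix x \<kappa> assume x: "x \<in> mpoints M" and k: "fibre_linear E x \<kappa>"
    show "\<kappa> (B (sec_mult M E (\<lambda>_. c) X) Y x) = \<kappa> (sec_mult M E (\<lambda>_. c) (B X Y) x)"
      using neg[OF sec_const_mult_section[OF X, of c] Y x k] neg[OF X Y x k] mult[OF Y X, of c]
        linear_sec_mult[OF cl[OF X Y] x k] linear_sec_mult[OF cl[OF Y X] x k] by simp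
  qed
  show ?thesis
    unfolding almost_lie_bracket_def
    by (intro conjI ballI allI impI) (assumption | rule cl add' add mult' mult anti leib)+
qed

section \<open>The almost Lie bracket of a foliated bundle\<close>

theorem foliated_imp_pre_lie_algebroid:
  fixes M :: "'a manifold" and A :: "('a, 'b) vbundle"
  assumes fol: "foliated M A \<rho>" and pc: "paracompact_space (mtop M)"
  shows "\<exists>B. pre_lie_algebroid M A \<rho> B"
proof -
  have anch: "anchored_bundle M A \<rho>" using fol by (simp add: foliated_def)
  interpret smooth_vbundle M A by unfold_locales (use anch in \<open>auto simp: anchored_bundle_def\<close>)
  let ?T = "tangent_bundle M"
  interpret T: smooth_vbundle M ?T by (rule vbundle_tangent[OF M])
  have \<rho>: "bundle_morphism M A ?T \<rho>" using anch by (simp add: anchored_bundle_def)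
  note VB = smooth_vbundle_axioms and VT = T.smooth_vbundle_axioms
  define D where "D X f x = snd (\<rho> (X x)) f" for X :: "'a \<Rightarrow> 'b" and f x
  have \<rho>X: "sec_map M \<rho> X \<in> vector_fields M" if "X \<in> sections M A" for X
    by (rule sec_map_section[OF VT VB \<rho> that])
  have D_eq: "D X f x = snd (sec_map M \<rho> X x) f" if "x \<in> mpoints M" for X f x
    using that by (simp add: D_def sec_map_def)
  have linD: "fibre_linear A x (\<lambda>a. snd (\<rho> a) f)" if "x \<in> mpoints M" for x f
    by (rule fibre_linear_compose[OF \<rho> that]) (simp add: fibre_linear_def tangent_bundle_simps)
  have D_smooth: "smooth_fun_on M W (D X f)" if "X \<in> sections M A" "smooth_fun_on M W f" for X W f
    unfolding D_def by (rule sf_section[OF that(1) sf_morphism[OF VT VB \<rho> sf_differential[OF M that(2)]]])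
  obtain K :: "('a set \<times> nat) set" and C s l where
    Ccl: "\<And>k. k \<in> K \<Longrightarrow> closedin (mtop M) (C k)" and s: "\<And>k. k \<in> K \<Longrightarrow> s k \<in> sections M A"
    and l: "\<And>k X. k \<in> K \<Longrightarrow> X \<in> sections M A \<Longrightarrow> smooth_fun_on M (mpoints M) (l k X)"
    and l0: "\<And>k X x. k \<in> K \<Longrightarrow> x \<notin> C k \<Longrightarrow> l k X x = (0 :: real)"
    and l_add: "\<And>k X Y x. k \<in> K \<Longrightarrow> x \<in> mpoints M \<Longrightarrow> X \<in> sections M A \<Longrightarrow> Y \<in> sections M A \<Longrightarrow>
       l k (sec_add M A X Y) x = l k X x + l k Y x"
    and l_mult: "\<And>k f X x. k \<in> K \<Longrightarrow> x \<in> mpoints M \<Longrightarrow> X \<in> sections M A \<Longrightarrow> l k (sec_mult M A f X) x = f x * l k X x"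
    and lf: "\<And>x. x \<in> mpoints M \<Longrightarrow> \<exists>V. openin (mtop M) V \<and> x \<in> V \<and> finite {k \<in> K. C k \<inter> V \<noteq> {}}"
    and expand: "\<And>x X \<kappa> F. x \<in> mpoints M \<Longrightarrow> X \<in> sections M A \<Longrightarrow> fibre_linear A x \<kappa> \<Longrightarrow> finite F \<Longrightarrow> F \<subseteq> K \<Longrightarrow>
       {k \<in> K. x \<in> C k} \<subseteq> F \<Longrightarrow> \<kappa> (X x) = (\<Sum>k\<in>F. l k X x * \<kappa> (s k x))"
    by (rule locally_finite_frame[OF pc]) (rule that)
  have "\<exists>S. S \<in> sections M A \<and> (\<forall>x\<in>mpoints M. \<forall>f. smooth_near M x f \<longrightarrow>
      snd (\<rho> (S x)) f = snd (vf_bracket M (sec_map M \<rho> (s k)) (sec_map M \<rho> (s m)) x) f)"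
    if "k \<in> K" "m \<in> K" for k m
  proof -
    have "vf_bracket M (sec_map M \<rho> (s k)) (sec_map M \<rho> (s m)) \<in> sec_map M \<rho> ` sections M A"
      using fol s[OF that(1)] s[OF that(2)] unfolding foliated_def by blast
    then obtain S where S: "S \<in> sections M A" "vf_bracket M (sec_map M \<rho> (s k)) (sec_map M \<rho> (s m)) = sec_map M \<rho> S" by blast
    then show ?thesis by (intro exI[of _ S]) (auto simp: sec_map_def)
  qed
  then have "\<forall>km\<in>K \<times> K. \<exists>S. S \<in> sections M A \<and> (\<forall>x\<in>mpoints M. \<forall>f. smooth_near M x f \<longrightarrow>
      snd (\<rho> (S x)) f = snd (vf_bracket M (sec_map M \<rho> (s (fst km))) (sec_map M \<rho> (s (snd km))) x) f)"
    by auto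
  from bchoice[OF this] obtain S0 where S0: "\<forall>km\<in>K \<times> K. S0 km \<in> sections M A \<and> (\<forall>x\<in>mpoints M. \<forall>f. smooth_near M x f \<longrightarrow>
      snd (\<rho> (S0 km x)) f = snd (vf_bracket M (sec_map M \<rho> (s (fst km))) (sec_map M \<rho> (s (snd km))) x) f)" ..
  \<comment> \<open>The choices S0 (k, m) and S0 (m, k) are unrelated. Half their difference is
    antisymmetric, and it has the same anchor as S0 (k, m) because the bracket of vector fields is
    antisymmetric.\<close>
  define S where "S k m = sec_add M A (sec_mult M A (\<lambda>_. 1 / 2) (S0 (k, m))) (sec_mult M A (\<lambda>_. - (1 / 2)) (S0 (m, k)))" for k m
  have S: "S k m \<in> sections M A" if "k \<in> K" "m \<in> K" for k m
    unfolding S_def using S0 that by (intro sec_add_section sec_const_mult_section) auto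
  have S_lin: "\<kappa> (S k m x) = 1 / 2 * \<kappa> (S0 (k, m) x) - 1 / 2 * \<kappa> (S0 (m, k) x)"
    if km: "k \<in> K" "m \<in> K" and x: "x \<in> mpoints M" "fibre_linear A x \<kappa>" for k m x \<kappa>
  proof -
    have 0: "S0 (k, m) \<in> sections M A" "S0 (m, k) \<in> sections M A" using S0 km by auto
    show ?thesis
      unfolding S_def linear_sec_add[OF sec_const_mult_section[OF 0(1)] sec_const_mult_section[OF 0(2)] x]
        linear_sec_mult[OF 0(1) x] linear_sec_mult[OF 0(2) x] by simp
  qed
  have S_anti: "\<kappa> (S k m x) = - \<kappa> (S m k x)"
    if "k \<in> K" "m \<in> K" "x \<in> mpoints M" "fibre_linear A x \<kappa>" for k m x \<kappa>
    using S_lin[OF that] S_lin[OF that(2,1,3,4)] by simp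
  have S_anchor: "snd (\<rho> (S k m x)) f = D (s k) (D (s m) f) x - D (s m) (D (s k) f) x"
    if km: "k \<in> K" "m \<in> K" and x: "x \<in> mpoints M" and f: "smooth_near M x f" for k m x f
  proof -
    have "snd (\<rho> (S0 (k, m) x)) f = D (s k) (D (s m) f) x - D (s m) (D (s k) f) x" if km: "k \<in> K" "m \<in> K" for k m
    proof -
      have "snd (\<rho> (S0 (k, m) x)) f = snd (vf_bracket M (sec_map M \<rho> (s k)) (sec_map M \<rho> (s m)) x) f"
        using S0 km x f by auto
      moreover have "D (s k) (D (s m) f) x = snd (sec_map M \<rho> (s k) x) (\<lambda>y. snd (sec_map M \<rho> (s m) y) f)"
        if "k \<in> K" "m \<in> K" for k m
        unfolding D_eq[OF x]
        by (rule vf_apply_global_cong[OF M \<rho>X[OF s[OF that(1)]] x vf_smooth_near[OF M \<rho>X[OF s[OF that(2)]] f]])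
          (simp add: D_eq)
      ultimately show ?thesis using km by (simp add: vf_bracket_apply x f)
    qed
    from S_lin[OF km x linD[OF x, of f]] this[OF km] this[OF km(2,1)] show ?thesis by argo
  qed
  define Kx where "Kx x = {k \<in> K. x \<in> C k}" for x
  have finKx: "finite (Kx x)" if x: "x \<in> mpoints M" for x
  proof -
    obtain V where V: "x \<in> V" "finite {k \<in> K. C k \<inter> V \<noteq> {}}" using lf[OF x] by blast
    have "Kx x \<subseteq> {k \<in> K. C k \<inter> V \<noteq> {}}" using V(1) by (auto simp: Kx_def)
    then show ?thesis using V(2) finite_subset by blast
  qed
  \<comment> \<open>\<open>l k Y\<close> vanishes on the open complement of C k, so its derivatives
    vanish there as well. Hence the derivative terms of the bracket are also supported in the sets C
    k.\<close>
  have Dl0: "D X (l k Y) x = 0" if k: "k \<in> K" "x \<notin> C k" and x: "x \<in> mpoints M"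
    and X: "X \<in> sections M A" and Y: "Y \<in> sections M A" for X Y k x
  proof -
    have "openin (mtop M) (mpoints M - C k)" using Ccl[OF k(1)] by blast
    then have "snd (sec_map M \<rho> X x) (l k Y) = snd (sec_map M \<rho> X x) (\<lambda>_. 0)"
      by (rule vf_apply_cong[OF M \<rho>X[OF X] x smooth_nearI[OF l[OF k(1) Y] x]]) (use x k l0 in auto)
    then show ?thesis
      using tangent_const[OF M x] vf_tangent[OF \<rho>X[OF X] x] by (simp add: D_eq[OF x])
  qed
  \<comment> \<open>The value of \<kappa> on the bracket at x, summed over a finite index set F. By
    \<open>\<Gamma>_indep\<close> it does not depend on F as long as F contains the active indices:
    a fixed F near a point serves smoothness and anchor, while F = Kx x serves pointwise
    identities.\<close>
  define \<Gamma> where "\<Gamma> F X Y \<kappa> x = (\<Sum>k\<in>F. \<Sum>m\<in>F. l k X x * l m Y x * \<kappa> (S k m x))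
      + (\<Sum>m\<in>F. (D X (l m Y) x - D Y (l m X) x) * \<kappa> (s m x))" for F X Y \<kappa> x
  have \<Gamma>_indep: "\<Gamma> F X Y \<kappa> x = \<Gamma> (Kx x) X Y \<kappa> x"
    if F: "finite F" "Kx x \<subseteq> F" "F \<subseteq> K" and x: "x \<in> mpoints M"
      and XY: "X \<in> sections M A" "Y \<in> sections M A" for F X Y \<kappa> x
  proof -
    have out: "k \<in> K" "x \<notin> C k" if "k \<in> F - Kx x" for k using that F(3) by (auto simp: Kx_def)
    have "(\<Sum>k\<in>F. \<Sum>m\<in>F. l k X x * l m Y x * \<kappa> (S k m x)) = (\<Sum>k\<in>Kx x. \<Sum>m\<in>F. l k X x * l m Y x * \<kappa> (S k m x))"
      by (rule sum.mono_neutral_right[OF F(1,2)]) (use l0[OF out] in simp)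
    also have "\<dots> = (\<Sum>k\<in>Kx x. \<Sum>m\<in>Kx x. l k X x * l m Y x * \<kappa> (S k m x))"
      by (intro sum.cong[OF refl] sum.mono_neutral_right[OF F(1,2)]) (use l0[OF out] in simp)
    moreover have "(\<Sum>m\<in>F. (D X (l m Y) x - D Y (l m X) x) * \<kappa> (s m x))
        = (\<Sum>m\<in>Kx x. (D X (l m Y) x - D Y (l m X) x) * \<kappa> (s m x))"
      by (rule sum.mono_neutral_right[OF F(1,2)]) (use Dl0[OF out x XY] Dl0[OF out x XY(2,1)] in simp)
    ultimately show ?thesis by (simp add: \<Gamma>_def)
  qed
  have ex: "\<exists>w. w \<in> fibre A x \<and> (\<forall>\<kappa>. fibre_linear A x \<kappa> \<longrightarrow> \<kappa> w = \<Gamma> (Kx x) X Y \<kappa> x)" if x: "x \<in> mpoints M" for X Y x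
  proof -
    obtain \<psi> where iso: "fibre_iso A x \<psi>" by (rule fibre_iso_ex[OF x])
    have K: "k \<in> K" if "k \<in> Kx x" for k using that by (simp add: Kx_def)
    obtain w1 where w1: "w1 \<in> fibre A x" "\<And>\<kappa>. fibre_linear A x \<kappa> \<Longrightarrow>
      \<kappa> w1 = (\<Sum>km\<in>Kx x \<times> Kx x. l (fst km) X x * l (snd km) Y x * \<kappa> (S (fst km) (snd km) x))"
      by (rule fibre_lincomb[OF iso, of "Kx x \<times> Kx x" "\<lambda>km. S (fst km) (snd km) x" "\<lambda>km. l (fst km) X x * l (snd km) Y x"])
        (use section_fibre[OF S x] K that in auto)
    obtain w2 where w2: "w2 \<in> fibre A x" "\<And>\<kappa>. fibre_linear A x \<kappa> \<Longrightarrow>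
      \<kappa> w2 = (\<Sum>m\<in>Kx x. (D X (l m Y) x - D Y (l m X) x) * \<kappa> (s m x))"
      by (rule fibre_lincomb[OF iso, of "Kx x" "\<lambda>m. s m x" "\<lambda>m. D X (l m Y) x - D Y (l m X) x"])
        (use section_fibre[OF s x] K that in auto)
    have "\<kappa> (badd A w1 w2) = \<Gamma> (Kx x) X Y \<kappa> x" if "fibre_linear A x \<kappa>" for \<kappa>
      using that w1 w2 by (simp add: fibre_linear_def \<Gamma>_def sum.cartesian_product split_beta)
    then show ?thesis using fibre_closed(1)[OF x w1(1) w2(1)] by blast
  qed
  \<comment> \<open>A vector of a fibre is determined by its values under all fibrewise linear
    functionals, so there is only one candidate to choose.\<close>
  define B0 where "B0 X Y x = (SOME w. w \<in> fibre A x \<and> (\<forall>\<kappa>. fibre_linear A x \<kappa> \<longrightarrow> \<kappa> w = \<Gamma> (Kx x) X Y \<kappa> x))" for X Y x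
  have B0: "B0 X Y x \<in> fibre A x" "fibre_linear A x \<kappa> \<Longrightarrow> \<kappa> (B0 X Y x) = \<Gamma> (Kx x) X Y \<kappa> x"
    if "x \<in> mpoints M" for X Y x \<kappa>
    using someI_ex[OF ex[OF that, of X Y], folded B0_def] by blast+
  define B where "B X Y = restrict (B0 X Y) (mpoints M)" for X Y
  have B: "\<kappa> (B X Y x) = \<Gamma> (Kx x) X Y \<kappa> x" if "x \<in> mpoints M" "fibre_linear A x \<kappa>" for X Y x \<kappa>
    using B0(2)[OF that] that(1) by (simp add: B_def)
  have Bs: "B X Y \<in> sections M A" if X: "X \<in> sections M A" and Y: "Y \<in> sections M A" for X Y
  proof (rule sectionI)
    fix x assume x: "x \<in> mpoints M"
    show "B X Y x \<in> fibre A x" using B0(1)[OF x] x by (simp add: B_def)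
    obtain U \<psi> where u: "(U, \<psi>) \<in> btrivs A" "x \<in> U" by (rule triv_cover[OF x])
    note t = triv_local[OF u(1)]
    obtain V where V: "openin (mtop M) V" "x \<in> V" "finite {k \<in> K. C k \<inter> V \<noteq> {}}" using lf[OF x] by blast
    let ?F = "{k \<in> K. C k \<inter> V \<noteq> {}}" and ?O = "U \<inter> V"
    have o: "openin (mtop M) ?O" using lt_open[OF t] V(1) by blast
    have om: "?O \<subseteq> mpoints M" by (rule openin_subset[OF o])
    have "smooth_fun_on M ?O (\<lambda>x. \<psi> (B X Y x) i)" if i: "i < brank A" for i
    proof (rule smooth_fun_on_cong[OF M])
      have sc: "smooth_fun_on M ?O (\<lambda>x. \<psi> (Z x) i)" if "Z \<in> sections M A" for Z
        by (rule smooth_fun_on_subset[OF M sf_section[OF that sf_coord[OF t i]] o]) auto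
      have lO: "smooth_fun_on M ?O (l k Z)" if "k \<in> K" "Z \<in> sections M A" for k Z
        by (rule smooth_fun_on_subset[OF M l[OF that] o om])
      show "smooth_fun_on M ?O (\<lambda>x. \<Gamma> ?F X Y (\<lambda>a. \<psi> a i) x)"
        unfolding \<Gamma>_def
        by (intro smooth_fun_on_add[OF M] smooth_fun_on_sum[OF M o] smooth_fun_on_mult[OF M] smooth_fun_on_diff[OF M]
            sc lO D_smooth X Y S s) auto
      fix y assume y: "y \<in> ?O"
      then have ym: "y \<in> mpoints M" using om by blast
      have "\<Gamma> ?F X Y (\<lambda>a. \<psi> a i) y = \<Gamma> (Kx y) X Y (\<lambda>a. \<psi> a i) y"
        by (rule \<Gamma>_indep[OF V(3) _ _ ym X Y]) (use y in \<open>auto simp: Kx_def\<close>)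
      then show "\<Gamma> ?F X Y (\<lambda>a. \<psi> a i) y = \<psi> (B X Y y) i"
        using B[OF ym fibre_iso_coord_linear[OF lt_iso[OF t]]] y by simp
    qed
    then show "\<exists>U \<psi> V. local_trivialization M A (U, \<psi>) \<and> x \<in> V \<and> V \<subseteq> U \<and>
       openin (mtop M) V \<and> (\<forall>i<brank A. smooth_fun_on M V (\<lambda>x. \<psi> (B X Y x) i))"
      using t u(2) V(2) o by (intro exI[of _ U] exI[of _ \<psi>] exI[of _ ?O]) auto
  qed (simp add: B_def)
  have KK: "k \<in> K" if "k \<in> Kx x" for k x using that by (simp add: Kx_def)
  have D_lin: "D (sec_add M A X Y) f x = D X f x + D Y f x" "D (sec_mult M A g X) f x = g x * D X f x"
    if "X \<in> sections M A" "Y \<in> sections M A" "x \<in> mpoints M" for X Y f g x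
    unfolding D_def using linear_sec_add[OF that linD[OF that(3)]] linear_sec_mult[OF that(1,3) linD[OF that(3)]] by auto
  have alb: "almost_lie_bracket M A \<rho> B"
  proof (rule almost_lie_bracketI[OF VB \<rho> Bs])
    fix X Y assume X: "X \<in> sections M A" and Y: "Y \<in> sections M A"
    show "B X Y = sec_mult M A (\<lambda>_. - 1) (B Y X)"
    proof (rule section_eq_linearI[OF Bs[OF X Y] sec_const_mult_section[OF Bs[OF Y X]]])
      fix x \<kappa> assume x: "x \<in> mpoints M" and k: "fibre_linear A x \<kappa>"
      have "(\<Sum>k\<in>Kx x. \<Sum>m\<in>Kx x. l k X x * l m Y x * \<kappa> (S k m x))
        = (\<Sum>m\<in>Kx x. \<Sum>k\<in>Kx x. l k X x * l m Y x * \<kappa> (S k m x))" by (rule sum.swap)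
      also have "\<dots> = (\<Sum>m\<in>Kx x. \<Sum>k\<in>Kx x. - (l m Y x * l k X x * \<kappa> (S m k x)))"
      proof (intro sum.cong[OF refl])
        fix m j assume "m \<in> Kx x" "j \<in> Kx x"
        then have "\<kappa> (S j m x) = - \<kappa> (S m j x)" using S_anti[OF KK KK x k] by blast
        then show "l j X x * l m Y x * \<kappa> (S j m x) = - (l m Y x * l j X x * \<kappa> (S m j x))" by simp
      qed
      finally have "(\<Sum>k\<in>Kx x. \<Sum>m\<in>Kx x. l k X x * l m Y x * \<kappa> (S k m x))
        = - (\<Sum>m\<in>Kx x. \<Sum>k\<in>Kx x. l m Y x * l k X x * \<kappa> (S m k x))" by (simp add: sum_negf)
      moreover have "(\<Sum>m\<in>Kx x. (D X (l m Y) x - D Y (l m X) x) * \<kappa> (s m x))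
          = - (\<Sum>m\<in>Kx x. (D Y (l m X) x - D X (l m Y) x) * \<kappa> (s m x))"
        by (simp add: sum_negf[symmetric] algebra_simps)
      ultimately have "\<Gamma> (Kx x) X Y \<kappa> x = - \<Gamma> (Kx x) Y X \<kappa> x" by (simp add: \<Gamma>_def)
      then show "\<kappa> (B X Y x) = \<kappa> (sec_mult M A (\<lambda>_. - 1) (B Y X) x)"
        using linear_sec_mult[OF Bs[OF Y X] x k] B[OF x k] by simp
    qed
  next
    fix X Y Z assume X: "X \<in> sections M A" and Y: "Y \<in> sections M A" and Z: "Z \<in> sections M A"
    show "B X (sec_add M A Y Z) = sec_add M A (B X Y) (B X Z)"
    proof (rule section_eq_linearI)
      show "B X (sec_add M A Y Z) \<in> sections M A" "sec_add M A (B X Y) (B X Z) \<in> sections M A"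
        by (intro Bs sec_add_section X Y Z)+
      fix x \<kappa> assume x: "x \<in> mpoints M" and k: "fibre_linear A x \<kappa>"
      have DX: "D X (l m (sec_add M A Y Z)) x = D X (l m Y) x + D X (l m Z) x" if m: "m \<in> Kx x" for m
      proof -
        note n = smooth_nearI[OF l[OF KK[OF m] Y] x] smooth_nearI[OF l[OF KK[OF m] Z] x]
        have "D X (l m (sec_add M A Y Z)) x = D X (\<lambda>y. l m Y y + l m Z y) x"
          unfolding D_eq[OF x]
          by (rule vf_apply_global_cong[OF M \<rho>X[OF X] x smooth_near_add[OF M n]]) (simp add: l_add[OF KK[OF m] _ Y Z])
        then show ?thesis using vf_apply_add(1)[OF M \<rho>X[OF X] x n] by (simp add: D_eq[OF x])
      qed
      have "\<Gamma> (Kx x) X (sec_add M A Y Z) \<kappa> x = \<Gamma> (Kx x) X Y \<kappa> x + \<Gamma> (Kx x) X Z \<kappa> x"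
        unfolding \<Gamma>_def using DX D_lin(1)[OF Y Z x] l_add[OF KK x Y Z]
        by (simp add: sum.distrib[symmetric] algebra_simps)
      then show "\<kappa> (B X (sec_add M A Y Z) x) = \<kappa> (sec_add M A (B X Y) (B X Z) x)"
        using linear_sec_add[OF Bs[OF X Y] Bs[OF X Z] x k] B[OF x k] by simp
    qed
  next
    fix f X Y assume f: "smooth_fun_on M (mpoints M) f" and X: "X \<in> sections M A" and Y: "Y \<in> sections M A"
    have Df: "smooth_fun_on M (mpoints M) (\<lambda>x. snd (\<rho> (X x)) f)"
      using D_smooth[OF X f] unfolding D_def .
    show "B X (sec_mult M A f Y) = sec_add M A (sec_mult M A f (B X Y)) (sec_mult M A (\<lambda>x. snd (\<rho> (X x)) f) Y)"
    proof (rule section_eq_linearI)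
      show "B X (sec_mult M A f Y) \<in> sections M A"
        "sec_add M A (sec_mult M A f (B X Y)) (sec_mult M A (\<lambda>x. snd (\<rho> (X x)) f) Y) \<in> sections M A"
        by (intro Bs sec_add_section sec_mult_section X Y f Df)+
      fix x \<kappa> assume x: "x \<in> mpoints M" and k: "fibre_linear A x \<kappa>"
      have DX: "D X (l m (sec_mult M A f Y)) x = f x * D X (l m Y) x + l m Y x * D X f x" if m: "m \<in> Kx x" for m
      proof -
        note n = smooth_nearI[OF f x] smooth_nearI[OF l[OF KK[OF m] Y] x]
        have "D X (l m (sec_mult M A f Y)) x = D X (\<lambda>y. f y * l m Y y) x"
          unfolding D_eq[OF x]
          by (rule vf_apply_global_cong[OF M \<rho>X[OF X] x smooth_near_mult[OF M n]]) (simp add: l_mult[OF KK[OF m] _ Y])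
        then show ?thesis using vf_apply_add(3)[OF M \<rho>X[OF X] x n] by (simp add: D_eq[OF x])
      qed
      \<comment> \<open>Replacing Y by f Y multiplies every term by f, except that differentiating
        \<open>l m (f Y)\<close> also produces \<open>D X f\<close> times \<open>l m Y\<close>.
        Those extra terms sum to \<open>D X f\<close> times \<kappa> (Y x) by \<open>expand\<close>,
        which is the Leibniz term.\<close>
      have "\<Gamma> (Kx x) X (sec_mult M A f Y) \<kappa> x = f x * \<Gamma> (Kx x) X Y \<kappa> x + (\<Sum>m\<in>Kx x. D X f x * (l m Y x * \<kappa> (s m x)))"
        unfolding \<Gamma>_def using DX D_lin(2)[OF Y Y x] l_mult[OF KK x Y]
        by (simp add: sum.distrib[symmetric] sum_distrib_left algebra_simps)
      also have "(\<Sum>m\<in>Kx x. D X f x * (l m Y x * \<kappa> (s m x))) = D X f x * \<kappa> (Y x)"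
        using expand[OF x Y k finKx[OF x]] by (simp add: sum_distrib_left Kx_def)
      finally show "\<kappa> (B X (sec_mult M A f Y) x)
        = \<kappa> (sec_add M A (sec_mult M A f (B X Y)) (sec_mult M A (\<lambda>x. snd (\<rho> (X x)) f) Y) x)"
        using linear_sec_add[OF sec_mult_section[OF f Bs[OF X Y]] sec_mult_section[OF Df Y] x k]
          linear_sec_mult[OF Bs[OF X Y] x k] linear_sec_mult[OF Y x k] B[OF x k] by (simp add: D_def)
    qed
  qed
  have "sec_map M \<rho> (B X Y) = vf_bracket M (sec_map M \<rho> X) (sec_map M \<rho> Y)"
    if X: "X \<in> sections M A" and Y: "Y \<in> sections M A" for X Y
  proof (rule vf_eqI[OF \<rho>X[OF Bs[OF X Y]] vf_bracket_section[OF M \<rho>X[OF X] \<rho>X[OF Y]]])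
    fix x f assume x: "x \<in> mpoints M" and f: "smooth_near M x f"
    obtain V where V: "openin (mtop M) V" "x \<in> V" "finite {k \<in> K. C k \<inter> V \<noteq> {}}" using lf[OF x] by blast
    let ?F = "{k \<in> K. C k \<inter> V \<noteq> {}}"
    have FK: "k \<in> K" if "k \<in> ?F" for k using that by blast
    have Vm: "V \<subseteq> mpoints M" by (rule openin_subset[OF V(1)])
    \<comment> \<open>The finite family ?F expands Y at all points of V, not only at x, so the outer
      field may differentiate the expansion term by term.\<close>
    have dd: "snd (sec_map M \<rho> X x) (\<lambda>y. snd (sec_map M \<rho> Y y) f)
        = (\<Sum>k\<in>?F. \<Sum>m\<in>?F. l k X x * l m Y x * D (s k) (D (s m) f) x) + (\<Sum>m\<in>?F. D X (l m Y) x * D (s m) f x)"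
      if X: "X \<in> sections M A" and Y: "Y \<in> sections M A" for X Y
    proof -
      have n1: "smooth_near M x (l m Y)" if "m \<in> ?F" for m by (rule smooth_nearI[OF l[OF FK[OF that] Y] x])
      have n2: "smooth_near M x (D (s m) f)" if "m \<in> ?F" for m
        using f D_smooth[OF s[OF FK[OF that]]] unfolding smooth_near_def by blast
      have "snd (sec_map M \<rho> X x) (\<lambda>y. snd (sec_map M \<rho> Y y) f) = snd (sec_map M \<rho> X x) (\<lambda>y. \<Sum>m\<in>?F. l m Y y * D (s m) f y)"
      proof (rule vf_apply_cong[OF M \<rho>X[OF X] x vf_smooth_near[OF M \<rho>X[OF Y] f] V(1,2)])
        fix y assume y: "y \<in> V"
        then have ym: "y \<in> mpoints M" using Vm by blast
        have "snd (\<rho> (Y y)) f = (\<Sum>m\<in>?F. l m Y y * snd (\<rho> (s m y)) f)"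
          by (rule expand[OF ym Y linD[OF ym] V(3)]) (use y in auto)
        then show "snd (sec_map M \<rho> Y y) f = (\<Sum>m\<in>?F. l m Y y * D (s m) f y)"
          using ym by (simp add: D_def sec_map_def)
      qed
      also have "\<dots> = (\<Sum>m\<in>?F. snd (sec_map M \<rho> X x) (\<lambda>y. l m Y y * D (s m) f y))"
        by (rule tangent_sum[OF M x conjunct2[OF vf_tangent[OF \<rho>X[OF X] x]]]) (rule smooth_near_mult[OF M n1 n2])
      also have "\<dots> = (\<Sum>m\<in>?F. (\<Sum>k\<in>?F. l k X x * l m Y x * D (s k) (D (s m) f) x) + D X (l m Y) x * D (s m) f x)"
      proof (rule sum.cong[OF refl])
        fix m assume m: "m \<in> ?F"
        have "D X (D (s m) f) x = (\<Sum>k\<in>?F. l k X x * D (s k) (D (s m) f) x)"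
          unfolding D_def[of X] D_def[of "s _" "D (s m) f"]
          by (rule expand[OF x X linD[OF x] V(3)]) (use V(2) in auto)
        then show "snd (sec_map M \<rho> X x) (\<lambda>y. l m Y y * D (s m) f y)
          = (\<Sum>k\<in>?F. l k X x * l m Y x * D (s k) (D (s m) f) x) + D X (l m Y) x * D (s m) f x"
          using vf_apply_add(3)[OF M \<rho>X[OF X] x n1[OF m] n2[OF m]] by (simp add: D_eq[OF x] sum_distrib_left algebra_simps)
      qed
      also have "\<dots> = (\<Sum>k\<in>?F. \<Sum>m\<in>?F. l k X x * l m Y x * D (s k) (D (s m) f) x) + (\<Sum>m\<in>?F. D X (l m Y) x * D (s m) f x)"
        by (simp add: sum.distrib) (rule sum.swap)
      finally show ?thesis .
    qed
    have "snd (vf_bracket M (sec_map M \<rho> X) (sec_map M \<rho> Y) x) f =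
      (\<Sum>k\<in>?F. \<Sum>m\<in>?F. l k X x * l m Y x * D (s k) (D (s m) f) x) - (\<Sum>k\<in>?F. \<Sum>m\<in>?F. l k Y x * l m X x * D (s k) (D (s m) f) x)
      + ((\<Sum>m\<in>?F. D X (l m Y) x * D (s m) f x) - (\<Sum>m\<in>?F. D Y (l m X) x * D (s m) f x))"
      by (simp add: vf_bracket_apply x f dd[OF X Y] dd[OF Y X])
    \<comment> \<open>Renaming the indices matches the coefficients of both double sums, and their
      difference then contains the brackets of the anchored s k and s m, which
      \<open>S_anchor\<close> replaces by S k m.\<close>
    also have "(\<Sum>k\<in>?F. \<Sum>m\<in>?F. l k Y x * l m X x * D (s k) (D (s m) f) x) = (\<Sum>k\<in>?F. \<Sum>m\<in>?F. l k X x * l m Y x * D (s m) (D (s k) f) x)"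
      by (subst sum.swap) (simp add: mult.commute)
    finally have "snd (vf_bracket M (sec_map M \<rho> X) (sec_map M \<rho> Y) x) f =
      (\<Sum>k\<in>?F. \<Sum>m\<in>?F. l k X x * l m Y x * (D (s k) (D (s m) f) x - D (s m) (D (s k) f) x))
      + (\<Sum>m\<in>?F. (D X (l m Y) x - D Y (l m X) x) * D (s m) f x)"
      by (simp add: sum_subtractf[symmetric] right_diff_distrib left_diff_distrib)
    also have "\<dots> = \<Gamma> ?F X Y (\<lambda>a. snd (\<rho> a) f) x"
    proof -
      have DS: "D (s m) f x = snd (\<rho> (s m x)) f" for m by (simp add: D_def)
      show ?thesis unfolding \<Gamma>_def using S_anchor[OF FK FK x f] by (simp add: DS)
    qed
    also have "\<dots> = \<Gamma> (Kx x) X Y (\<lambda>a. snd (\<rho> a) f) x"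
      by (rule \<Gamma>_indep[OF V(3) _ _ x X Y]) (use V(2) in \<open>auto simp: Kx_def\<close>)
    also have "\<dots> = snd (\<rho> (B X Y x)) f" using B[OF x linD[OF x]] by simp
    finally show "snd (sec_map M \<rho> (B X Y) x) f = snd (vf_bracket M (sec_map M \<rho> X) (sec_map M \<rho> Y) x) f"
      using x by (simp add: sec_map_def)
  qed
  then have "pre_lie_algebroid M A \<rho> B" using anch alb by (simp add: pre_lie_algebroid_def)
  then show ?thesis by (intro exI[of "\<lambda>B. pre_lie_algebroid M A \<rho> B" B])
qed

lemma pre_lie_algebroid_imp_foliated:
  assumes "pre_lie_algebroid M A \<rho> B"
  shows "foliated M A \<rho>"
  unfolding foliated_def
proof (intro conjI ballI)
  show "anchored_bundle M A \<rho>" using assms by (simp add: pre_lie_algebroid_def)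
  fix V W assume "V \<in> sec_map M \<rho> ` sections M A" "W \<in> sec_map M \<rho> ` sections M A"
  then obtain X Y where XY: "X \<in> sections M A" "Y \<in> sections M A" "V = sec_map M \<rho> X" "W = sec_map M \<rho> Y" by blast
  have "almost_lie_bracket M A \<rho> B" and
    b: "\<forall>X\<in>sections M A. \<forall>Y\<in>sections M A. sec_map M \<rho> (B X Y) = vf_bracket M (sec_map M \<rho> X) (sec_map M \<rho> Y)"
    using assms unfolding pre_lie_algebroid_def by blast+
  then have "\<forall>X\<in>sections M A. \<forall>Y\<in>sections M A. B X Y \<in> sections M A"
    unfolding almost_lie_bracket_def by (elim conjE)
  with b XY have "vf_bracket M V W = sec_map M \<rho> (B X Y)" "B X Y \<in> sections M A" by simp_all
  then show "vf_bracket M V W \<in> sec_map M \<rho> ` sections M A" by blast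
qed

subsection \<open>Quotient bundles\<close>

text \<open>A linear map between these spaces is continuous, each component being a finite sum of
  multiples of coordinates, and the inverse is linear too. So the bijection is a homeomorphism and
  invariance of dimension applies.\<close>

lemma linear_bij_Rn_dim:
  assumes bij: "bij_betw g (Rn m) (Rn n)"
    and add: "\<And>p q. p \<in> Rn m \<Longrightarrow> q \<in> Rn m \<Longrightarrow> g (\<lambda>i. p i + q i) = (\<lambda>i. g p i + g q i)"
    and scale: "\<And>c p. p \<in> Rn m \<Longrightarrow> g (\<lambda>i. c * p i) = (\<lambda>i. c * g p i)"
  shows "m = n"
proof -
  have cont: "continuous_map (Euclidean_space m) (Euclidean_space n) g"
    if g: "g ` Rn m \<subseteq> Rn n" and add: "\<And>p q. p \<in> Rn m \<Longrightarrow> q \<in> Rn m \<Longrightarrow> g (\<lambda>i. p i + q i) = (\<lambda>i. g p i + g q i)"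
      and scale: "\<And>c p. p \<in> Rn m \<Longrightarrow> g (\<lambda>i. c * p i) = (\<lambda>i. c * g p i)" for m n g
  proof -
    have ex: "g p i = (\<Sum>j<m. p j * g (unit_vec j) i)" if "p \<in> Rn m" for p i
      by (rule linear_on_Rn[where L = "\<lambda>p. g p i"]) (use add scale that in auto)
    have "continuous_on (Rn m) (\<lambda>p. \<Sum>j<m. p j * g (unit_vec j) i)" for i
      by (intro continuous_on_sum continuous_on_mult continuous_on_coord continuous_on_const)
    then have "continuous_on (Rn m) (\<lambda>p. g p i)" for i
      using ex by (simp cong: continuous_on_cong)
    then have "continuous_on (Rn m) g" by (rule continuous_on_coordinatewise_then_product)
    then show ?thesis
      using g cm_Euclidean_space_iff_continuous_on[of m "Rn m" n g] by (auto simp: Int_absorb)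
  qed
  let ?h = "inv_into (Rn m) g"
  have gi: "g ` Rn m = Rn n" "inj_on g (Rn m)" using bij by (auto simp: bij_betw_def)
  have h: "?h p \<in> Rn m" "g (?h p) = p" if "p \<in> Rn n" for p
  proof -
    have "p \<in> g ` Rn m" using gi(1) that by simp
    then show "?h p \<in> Rn m" "g (?h p) = p" by (rule inv_into_into, rule f_inv_into_f)
  qed
  have inj: "p = q" if "g p = g q" "p \<in> Rn m" "q \<in> Rn m" for p q using gi(2) that by (simp add: inj_on_def)
  have hadd: "?h (\<lambda>i. p i + q i) = (\<lambda>i. ?h p i + ?h q i)" if "p \<in> Rn n" "q \<in> Rn n" for p q
  proof (rule inj)
    have pq: "(\<lambda>i. p i + q i) \<in> Rn n" using that by (simp add: Rn_iff)
    show "g (?h (\<lambda>i. p i + q i)) = g (\<lambda>i. ?h p i + ?h q i)"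
      using h[OF pq] h[OF that(1)] h[OF that(2)] by (simp add: add)
    show "?h (\<lambda>i. p i + q i) \<in> Rn m" by (rule h(1)[OF pq])
    show "(\<lambda>i. ?h p i + ?h q i) \<in> Rn m" using h(1)[OF that(1)] h(1)[OF that(2)] by (simp add: Rn_iff)
  qed
  have hscale: "?h (\<lambda>i. c * p i) = (\<lambda>i. c * ?h p i)" if "p \<in> Rn n" for c p
  proof (rule inj)
    have cp: "(\<lambda>i. c * p i) \<in> Rn n" using that by (simp add: Rn_iff)
    show "g (?h (\<lambda>i. c * p i)) = g (\<lambda>i. c * ?h p i)"
      using h[OF cp] h[OF that] by (simp add: scale)
    show "?h (\<lambda>i. c * p i) \<in> Rn m" by (rule h(1)[OF cp])
    show "(\<lambda>i. c * ?h p i) \<in> Rn m" using h(1)[OF that] by (simp add: Rn_iff)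
  qed
  have "continuous_map (Euclidean_space m) (Euclidean_space n) g"
    by (rule cont[OF _ add scale]) (simp add: gi(1))
  moreover have "continuous_map (Euclidean_space n) (Euclidean_space m) ?h"
    by (rule cont[OF _ hadd hscale]) (use h(1) in blast)
  ultimately have "homeomorphic_maps (Euclidean_space m) (Euclidean_space n) g ?h"
    unfolding homeomorphic_maps_def using h(2) inv_into_f_f[OF gi(2)] by simp
  then have "Euclidean_space m homeomorphic_space Euclidean_space n"
    unfolding homeomorphic_space_def by blast
  then show ?thesis by (simp add: invariance_of_dimension_Euclidean_space)
qed

text \<open>\<open>quotient_bundle\<close> contains the rank as a definite description. The
  assumption \<open>rank\<close> evaluates it, and \<open>subbundle_rank_kernel\<close> supplies it
  for the kernel over a leaf.\<close>

locale quotient_vbundle = smooth_vbundle M E for M :: "'a manifold" and E :: "('a, 'b) vbundle" +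
  fixes K :: "'b set" and k :: nat
  assumes sub: "subbundle_of_rank M E K k" and rank: "subbundle_rank M E K = k"
begin

abbreviation Q where "Q \<equiv> quotient_bundle M E K"
abbreviation q where "q \<equiv> bcoset E K"

definition quot_triv :: "('b \<Rightarrow> nat \<Rightarrow> real) \<Rightarrow> 'b set \<Rightarrow> nat \<Rightarrow> real" where
  "quot_triv \<psi> C i = the_elem ((\<lambda>a. \<psi> a (k + i)) ` C)"

lemma k_le: "k \<le> brank E"
  using sub by (simp add: subbundle_of_rank_def)

lemma brank_Q: "brank Q = brank E - k"
  by (simp add: quotient_bundle_def rank)

lemma btrivs_Q: "btrivs Q = (\<lambda>(U, \<psi>). (U, quot_triv \<psi>)) ` {t. adapted_trivialization M E K k t}"
  by (simp add: quotient_bundle_def rank quot_triv_def[abs_def])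

lemma adapted_cover:
  assumes "x \<in> mpoints M"
  obtains U \<psi> where "x \<in> U" "adapted_trivialization M E K k (U, \<psi>)"
  using assms sub unfolding subbundle_of_rank_def by blast

lemma adaptedD:
  assumes "adapted_trivialization M E K k (U, \<psi>)"
  shows "local_trivialization M E (U, \<psi>)"
    "\<And>x a. x \<in> U \<Longrightarrow> a \<in> fibre E x \<Longrightarrow> a \<in> K \<longleftrightarrow> (\<forall>i\<ge>k. \<psi> a i = 0)"
proof -
  show t: "local_trivialization M E (U, \<psi>)"
    using assms by (simp add: adapted_trivialization_def)
  fix x a assume x: "x \<in> U" and a: "a \<in> fibre E x"
  have img: "\<psi> ` (K \<inter> fibre E x) = Rn k" using assms x by (simp add: adapted_trivialization_def)
  have inj: "inj_on \<psi> (fibre E x)" using lt_iso[OF t x] by (simp add: fibre_iso_def bij_betw_def)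
  show "a \<in> K \<longleftrightarrow> (\<forall>i\<ge>k. \<psi> a i = 0)"
  proof
    assume "a \<in> K"
    then have "\<psi> a \<in> Rn k" using a img by blast
    then show "\<forall>i\<ge>k. \<psi> a i = 0" by (simp add: Rn_iff)
  next
    assume "\<forall>i\<ge>k. \<psi> a i = 0"
    then have "\<psi> a \<in> \<psi> ` (K \<inter> fibre E x)" unfolding img by (simp add: Rn_iff)
    then obtain b where b: "b \<in> K" "b \<in> fibre E x" "\<psi> a = \<psi> b" by blast
    then show "a \<in> K" using inj_onD[OF inj b(3) a b(2)] by simp
  qed
qed

text \<open>In an adapted trivialization membership in K means that the coordinates from k on
  vanish, so a coset consists of the vectors sharing these coordinates. The remaining facts on
  cosets are read off from this description.\<close>

lemma q_eq:
  assumes t: "adapted_trivialization M E K k (U, \<psi>)" and x: "x \<in> U" and a: "a \<in> fibre E x"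
  shows "q a = {b \<in> fibre E x. \<forall>i\<ge>k. \<psi> b i = \<psi> a i}"
proof -
  note iso = lt_iso[OF adaptedD(1)[OF t] x]
  have pa: "bproj E a = x" by (rule bproj_fibre[OF a])
  show ?thesis
  proof
    show "q a \<subseteq> {b \<in> fibre E x. \<forall>i\<ge>k. \<psi> b i = \<psi> a i}"
      using iso a adaptedD(2)[OF t x] by (auto simp: bcoset_def pa fibre_iso_def)
    show "{b \<in> fibre E x. \<forall>i\<ge>k. \<psi> b i = \<psi> a i} \<subseteq> q a"
    proof
      fix b assume "b \<in> {b \<in> fibre E x. \<forall>i\<ge>k. \<psi> b i = \<psi> a i}"
      then have b: "b \<in> fibre E x" "\<And>i. i \<ge> k \<Longrightarrow> \<psi> b i = \<psi> a i" by auto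
      have "(\<lambda>i. \<psi> b i - \<psi> a i) \<in> Rn (brank E)"
        using fibre_iso_coord_0[OF iso b(1)] fibre_iso_coord_0[OF iso a] by (simp add: Rn_iff)
      then obtain c where c: "c \<in> fibre E x" "\<psi> c = (\<lambda>i. \<psi> b i - \<psi> a i)" using fibre_iso_obtain[OF iso] by metis
      have "c \<in> K" using adaptedD(2)[OF t x c(1)] c(2) b(2) by simp
      moreover have "b = badd E a c"
        using iso a c b(1) by (intro fibre_iso_eqI[OF iso]) (auto simp: fibre_iso_def)
      ultimately show "b \<in> q a" using c(1) by (auto simp: bcoset_def pa)
    qed
  qed
qed

lemma self_in_q:
  assumes "a \<in> fibre E x"
  shows "a \<in> q a"
proof -
  obtain U \<psi> where "x \<in> U" "adapted_trivialization M E K k (U, \<psi>)"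
    by (rule adapted_cover[OF fibre_nonempty_base[OF assms]])
  then show ?thesis using q_eq assms by simp
qed

lemma q_eq_of_mem:
  assumes a: "a \<in> fibre E x" and b: "b \<in> q a"
  shows "b \<in> fibre E x" "q b = q a"
proof -
  obtain U \<psi> where t: "x \<in> U" "adapted_trivialization M E K k (U, \<psi>)"
    by (rule adapted_cover[OF fibre_nonempty_base[OF a]])
  show b': "b \<in> fibre E x" using b unfolding q_eq[OF t(2,1) a] by blast
  show "q b = q a" using b unfolding q_eq[OF t(2,1) a] q_eq[OF t(2,1) b'] by auto
qed

lemma the_elem_q:
  assumes a: "a \<in> fibre E x" and c: "\<And>b. b \<in> q a \<Longrightarrow> f b = f a"
  shows "the_elem (f ` q a) = f a"
proof -
  have "f b \<in> {f a}" if "b \<in> q a" for b using c[OF that] by simp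
  then have "f ` q a \<subseteq> {f a}" by (rule image_subsetI)
  moreover have "f a \<in> f ` q a" using self_in_q[OF a] by (rule imageI)
  ultimately have "f ` q a = {f a}" by blast
  then show ?thesis by simp
qed

lemma bproj_q: "a \<in> fibre E x \<Longrightarrow> bproj Q (q a) = x"
  using the_elem_q[of a x "bproj E"] q_eq_of_mem(1) bproj_fibre by (simp add: quotient_bundle_def)

lemma fibre_Q: "fibre Q x = q ` fibre E x"
proof
  show "fibre Q x \<subseteq> q ` fibre E x"
  proof
    fix C assume C: "C \<in> fibre Q x"
    then obtain a where a: "a \<in> btotal E" "C = q a" by (auto simp: fibre_def quotient_bundle_def)
    then have "a \<in> fibre E (bproj E a)" by (simp add: fibre_def)
    moreover from bproj_q[OF this] have "bproj E a = x" using C a(2) by (simp add: fibre_def)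
    ultimately show "C \<in> q ` fibre E x" using a(2) by blast
  qed
  show "q ` fibre E x \<subseteq> fibre Q x"
    using bproj_q by (auto simp: fibre_def quotient_bundle_def)
qed

lemma btotal_Q: "btotal Q = q ` btotal E"
  by (simp add: quotient_bundle_def)

lemma badd_q:
  assumes a: "a \<in> fibre E x" and b: "b \<in> fibre E x"
  shows "badd Q (q a) (q b) = q (badd E a b)"
proof -
  obtain U \<psi> where t: "x \<in> U" "adapted_trivialization M E K k (U, \<psi>)"
    by (rule adapted_cover[OF fibre_nonempty_base[OF a]])
  note iso = lt_iso[OF adaptedD(1)[OF t(2)] t(1)] and qe = q_eq[OF t(2,1)]
  have ab: "badd E c d \<in> fibre E x" "\<psi> (badd E c d) = (\<lambda>i. \<psi> c i + \<psi> d i)" if "c \<in> fibre E x" "d \<in> fibre E x" for c d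
    using iso that by (auto simp: fibre_iso_def)
  have "q (badd E c d) = q (badd E a b)" if c: "c \<in> q a" and d: "d \<in> q b" for c d
  proof -
    have cd: "c \<in> fibre E x" "d \<in> fibre E x" using q_eq_of_mem(1) a b c d by blast+
    have "\<forall>i\<ge>k. \<psi> c i = \<psi> a i" "\<forall>i\<ge>k. \<psi> d i = \<psi> b i" using c d unfolding qe[OF a] qe[OF b] by auto
    then show ?thesis unfolding qe[OF ab(1)[OF cd]] qe[OF ab(1)[OF a b]] by (auto simp: ab cd a b)
  qed
  then have "(\<Union>c\<in>q a. \<Union>d\<in>q b. q (badd E c d)) = q (badd E a b)"
    using self_in_q[OF a] self_in_q[OF b] by blast
  then show ?thesis by (simp add: quotient_bundle_def)
qed

lemma bscale_q:
  assumes a: "a \<in> fibre E x"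
  shows "bscale Q c (q a) = q (bscale E c a)"
proof -
  obtain U \<psi> where t: "x \<in> U" "adapted_trivialization M E K k (U, \<psi>)"
    by (rule adapted_cover[OF fibre_nonempty_base[OF a]])
  note iso = lt_iso[OF adaptedD(1)[OF t(2)] t(1)] and qe = q_eq[OF t(2,1)]
  have sc: "bscale E c d \<in> fibre E x" "\<psi> (bscale E c d) = (\<lambda>i. c * \<psi> d i)" if "d \<in> fibre E x" for d
    using iso that by (auto simp: fibre_iso_def)
  have "q (bscale E c d) = q (bscale E c a)" if d: "d \<in> q a" for d
  proof -
    have d': "d \<in> fibre E x" using q_eq_of_mem(1) a d by blast
    have "\<forall>i\<ge>k. \<psi> d i = \<psi> a i" using d unfolding qe[OF a] by auto
    then show ?thesis unfolding qe[OF sc(1)[OF d']] qe[OF sc(1)[OF a]] by (auto simp: sc d' a)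
  qed
  then have "(\<Union>d\<in>q a. q (bscale E c d)) = q (bscale E c a)" using self_in_q[OF a] by blast
  then show ?thesis by (simp add: quotient_bundle_def)
qed

lemma quot_triv_q:
  assumes t: "adapted_trivialization M E K k (U, \<psi>)" and x: "x \<in> U" and a: "a \<in> fibre E x"
  shows "quot_triv \<psi> (q a) = (\<lambda>i. \<psi> a (k + i))"
  unfolding quot_triv_def by (rule ext, rule the_elem_q[OF a]) (auto simp: q_eq[OF t x a])

lemma fibre_iso_quot_triv:
  assumes t: "adapted_trivialization M E K k (U, \<psi>)" and x: "x \<in> U"
  shows "fibre_iso Q x (quot_triv \<psi>)"
proof -
  note iso = lt_iso[OF adaptedD(1)[OF t] x] and qt = quot_triv_q[OF t x]
  have ops: "badd E c d \<in> fibre E x" "\<psi> (badd E c d) = (\<lambda>i. \<psi> c i + \<psi> d i)"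
    "bscale E r c \<in> fibre E x" "\<psi> (bscale E r c) = (\<lambda>i. r * \<psi> c i)"
    if "c \<in> fibre E x" "d \<in> fibre E x" for c d r
    using iso that by (auto simp: fibre_iso_def)
  have "inj_on (quot_triv \<psi>) (fibre Q x)"
  proof (rule inj_onI)
    fix C D assume "C \<in> fibre Q x" "D \<in> fibre Q x" and eq: "quot_triv \<psi> C = quot_triv \<psi> D"
    then obtain a b where ab: "a \<in> fibre E x" "C = q a" "b \<in> fibre E x" "D = q b" by (auto simp: fibre_Q)
    have "\<psi> a i = \<psi> b i" if "k \<le> i" for i
      using fun_cong[OF eq, of "i - k"] that by (simp add: ab qt)
    then show "C = D" unfolding ab(2,4) q_eq[OF t x ab(1)] q_eq[OF t x ab(3)] by auto
  qed
  moreover have "quot_triv \<psi> ` fibre Q x = Rn (brank Q)"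
  proof
    show "quot_triv \<psi> ` fibre Q x \<subseteq> Rn (brank Q)"
      using fibre_iso_coord_0[OF iso] k_le by (auto simp: fibre_Q qt Rn_iff brank_Q)
    show "Rn (brank Q) \<subseteq> quot_triv \<psi> ` fibre Q x"
    proof
      fix p assume p: "p \<in> Rn (brank Q)"
      have "(\<lambda>i. if k \<le> i then p (i - k) else 0) \<in> Rn (brank E)"
        using p k_le by (auto simp: Rn_iff brank_Q)
      then obtain a where a: "a \<in> fibre E x" "\<psi> a = (\<lambda>i. if k \<le> i then p (i - k) else 0)"
        using fibre_iso_obtain[OF iso] by metis
      then have "quot_triv \<psi> (q a) = p" by (simp add: qt)
      then show "p \<in> quot_triv \<psi> ` fibre Q x" using a(1) unfolding fibre_Q by blast
    qed
  qed
  ultimately show ?thesis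
    unfolding fibre_iso_def bij_betw_def by (auto simp: fibre_Q badd_q bscale_q qt ops)
qed

lemma frame_quot_triv:
  assumes t: "adapted_trivialization M E K k (U, \<psi>)" and x: "x \<in> U" and j: "j < brank Q"
  shows "frame Q (quot_triv \<psi>) j x = q (frame E \<psi> (k + j) x)"
proof -
  note iso = lt_iso[OF adaptedD(1)[OF t] x] and qt = quot_triv_q[OF t x] and isoQ = fibre_iso_quot_triv[OF t x]
  have kj: "k + j < brank E" using j by (simp add: brank_Q)
  note f = frame_mem[OF iso kj]
  show ?thesis
    by (rule fibre_iso_eqI[OF isoQ frame_mem[OF isoQ j]])
      (use f in \<open>auto simp: fibre_Q coord_frame[OF isoQ j] qt coord_frame[OF iso kj] unit_vec_def\<close>)
qed

lemma fibre_linear_Q: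
  assumes x: "x \<in> mpoints M"
  shows "fibre_linear Q x \<kappa> \<longleftrightarrow> fibre_linear E x (\<lambda>a. \<kappa> (q a))"
  unfolding fibre_linear_def fibre_Q ball_simps by (metis (mono_tags, lifting) badd_q bscale_q)

lemma adapted_lt_quot:
  assumes t: "adapted_trivialization M E K k (U, \<psi>)"
  shows "local_trivialization M Q (U, quot_triv \<psi>)"
proof -
  have rep: "smooth_matrix_rep M Q Q (\<lambda>a. a) (U, quot_triv \<psi>) (V, quot_triv \<xi>)"
    if t: "adapted_trivialization M E K k (U, \<psi>)" and v: "adapted_trivialization M E K k (V, \<xi>)" for U \<psi> V \<xi>
  proof (subst smooth_matrix_rep_iff[OF M])
    show "fibre_iso Q x (quot_triv \<psi>)" if "x \<in> U \<inter> V" for x using fibre_iso_quot_triv[OF t] that by blast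
    show "fibre_linear Q x (\<lambda>a. quot_triv \<xi> a i)" if "x \<in> U \<inter> V" for x i
      using fibre_iso_coord_linear[OF fibre_iso_quot_triv[OF v]] that by blast
    show "\<forall>i<brank Q. \<forall>j<brank Q. smooth_fun_on M (U \<inter> V) (\<lambda>x. quot_triv \<xi> (frame Q (quot_triv \<psi>) j x) i)"
    proof (intro allI impI)
      fix i j assume ij: "i < brank Q" "j < brank Q"
      have ij': "k + i < brank E" "k + j < brank E" using ij by (auto simp: brank_Q)
      note lt = adaptedD(1)[OF t] and lv = adaptedD(1)[OF v]
      show "smooth_fun_on M (U \<inter> V) (\<lambda>x. quot_triv \<xi> (frame Q (quot_triv \<psi>) j x) i)"
      proof (rule smooth_fun_on_cong[OF M sf_frame[OF sf_coord[OF lv ij'(1)] lt ij'(2)]])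
        fix x assume x: "x \<in> U \<inter> V"
        show "\<xi> (frame E \<psi> (k + j) x) (k + i) = quot_triv \<xi> (frame Q (quot_triv \<psi>) j x) i"
          using x frame_quot_triv[OF t _ ij(2)] quot_triv_q[OF v _ frame_mem[OF lt_iso[OF lt] ij'(2)]] by auto
      qed
    qed
  qed
  have "\<forall>s\<in>btrivs Q. smooth_matrix_rep M Q Q (\<lambda>a. a) (U, quot_triv \<psi>) s \<and> smooth_matrix_rep M Q Q (\<lambda>a. a) s (U, quot_triv \<psi>)"
    using rep t unfolding btrivs_Q by auto
  then show ?thesis
    using fibre_iso_quot_triv[OF t] lt_open[OF adaptedD(1)[OF t]]
    unfolding local_trivialization_def fibre_iso_def by auto
qed

lemma vbundle_Q: "smooth_vbundle M Q"
proof (unfold_locales, rule M)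
  have "(\<Union>(U, \<psi>)\<in>btrivs Q. U) = mpoints M"
  proof
    show "(\<Union>(U, \<psi>)\<in>btrivs Q. U) \<subseteq> mpoints M"
      using openin_subset[OF lt_open[OF adaptedD(1)]] by (auto simp: btrivs_Q)
    show "mpoints M \<subseteq> (\<Union>(U, \<psi>)\<in>btrivs Q. U)"
    proof
      fix x assume "x \<in> mpoints M"
      then obtain U \<psi> where "x \<in> U" "adapted_trivialization M E K k (U, \<psi>)" by (rule adapted_cover)
      then show "x \<in> (\<Union>(U, \<psi>)\<in>btrivs Q. U)" by (force simp: btrivs_Q)
    qed
  qed
  moreover have "bproj Q ` btotal Q \<subseteq> mpoints M"
  proof -
    have "bproj Q (q a) \<in> mpoints M" if "a \<in> btotal E" for a
    proof -
      have "a \<in> fibre E (bproj E a)" using that by (simp add: fibre_def)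
      then show ?thesis using bproj_q fibre_nonempty_base by metis
    qed
    then show ?thesis by (auto simp: btotal_Q)
  qed
  ultimately show "vector_bundle M Q"
    unfolding vector_bundle_def using adapted_lt_quot fibre_closed
    by (auto simp: btrivs_Q fibre_Q badd_q bscale_q)
qed

text \<open>From left to right, the coset map has smooth components in adapted trivializations; from
  right to left, the frames of the quotient are the images of the last frame vectors of E.
  Smoothness on the quotient is checked on E from here on.\<close>

lemma sf_Q_iff: "smooth_functional M Q W \<kappa> \<longleftrightarrow> smooth_functional M E W (\<lambda>a. \<kappa> (q a))"
proof
  assume k: "smooth_functional M Q W \<kappa>"
  show "smooth_functional M E W (\<lambda>a. \<kappa> (q a))"
  proof (rule sf_pull[OF vbundle_Q smooth_vbundle_axioms k])
    show "q a \<in> fibre Q x" if "a \<in> fibre E x" for x a using that by (simp add: fibre_Q)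
    fix x assume "x \<in> W"
    then have "x \<in> mpoints M" using smooth_functionalD(1)[OF k] openin_subset by blast
    then obtain U \<psi> where t: "x \<in> U" "adapted_trivialization M E K k (U, \<psi>)" by (rule adapted_cover)
    have "smooth_functional M E U (\<lambda>a. quot_triv \<psi> (q a) i)" if "i < brank Q" for i
      by (rule sf_cong[OF sf_coord[OF adaptedD(1)[OF t(2)], of "k + i"]])
        (use that in \<open>auto simp: brank_Q quot_triv_q[OF t(2)]\<close>)
    then show "\<exists>U \<psi> V. local_trivialization M Q (U, \<psi>) \<and> x \<in> U \<and> x \<in> V \<and>
       openin (mtop M) V \<and> (\<forall>i<brank Q. smooth_functional M E V (\<lambda>a. \<psi> (q a) i))"
      using adapted_lt_quot[OF t(2)] t(1) lt_open[OF adaptedD(1)[OF t(2)]] by blast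
  qed
next
  assume k: "smooth_functional M E W (\<lambda>a. \<kappa> (q a))"
  show "smooth_functional M Q W \<kappa>"
  proof (rule smooth_functionalI[OF smooth_functionalD(1)[OF k]])
    show "fibre_linear Q x \<kappa>" if "x \<in> W" for x
      using fibre_linear_Q smooth_functionalD(2)[OF k that] sf_open_sub[OF k] that by blast
    fix U \<xi> j assume "(U, \<xi>) \<in> btrivs Q" and j: "j < brank Q"
    then obtain \<psi> where t: "adapted_trivialization M E K k (U, \<psi>)" and \<xi>: "\<xi> = quot_triv \<psi>" by (auto simp: btrivs_Q)
    have kj: "k + j < brank E" using j by (simp add: brank_Q)
    show "smooth_fun_on M (U \<inter> W) (\<lambda>x. \<kappa> (frame Q \<xi> j x))"
      by (rule smooth_fun_on_cong[OF M sf_frame[OF k adaptedD(1)[OF t] kj]]) (simp add: \<xi> frame_quot_triv[OF t _ j])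
  qed
qed

lemma q_section:
  assumes X: "X \<in> sections M E"
  shows "(\<lambda>x\<in>mpoints M. q (X x)) \<in> sections M Q"
proof -
  interpret Q: smooth_vbundle M Q by (rule vbundle_Q)
  show ?thesis
  proof (rule Q.sectionI)
    fix x assume x: "x \<in> mpoints M"
    show "(\<lambda>x\<in>mpoints M. q (X x)) x \<in> fibre Q x" using section_fibre[OF X x] x by (simp add: fibre_Q)
    obtain U \<psi> where t: "x \<in> U" "adapted_trivialization M E K k (U, \<psi>)" by (rule adapted_cover[OF x])
    note lt = adapted_lt_quot[OF t(2)]
    have Um: "U \<subseteq> mpoints M" using Q.lt_open[OF lt] openin_subset by blast
    have "smooth_fun_on M U (\<lambda>y. quot_triv \<psi> ((\<lambda>x\<in>mpoints M. q (X x)) y) i)" if "i < brank Q" for i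
      by (rule smooth_fun_on_cong[OF M sf_section[OF X iffD1[OF sf_Q_iff Q.sf_coord[OF lt that]]]]) (use Um in auto)
    then show "\<exists>U \<psi> V. local_trivialization M Q (U, \<psi>) \<and> x \<in> V \<and> V \<subseteq> U \<and>
       openin (mtop M) V \<and> (\<forall>i<brank Q. smooth_fun_on M V (\<lambda>y. \<psi> ((\<lambda>x\<in>mpoints M. q (X x)) y) i))"
      using lt t(1) Q.lt_open[OF lt] by blast
  qed simp
qed

end

subsection \<open>Restriction to immersed submanifolds\<close>

lemma fibre_restrict: "fibre (restrict_bundle E N) x = (if x \<in> mpoints N then fibre E x else {})"
  by (auto simp: fibre_def restrict_bundle_def)

lemma restrict_bundle_simps:
  "badd (restrict_bundle E N) = badd E" "bscale (restrict_bundle E N) = bscale E"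
  "bproj (restrict_bundle E N) = bproj E" "brank (restrict_bundle E N) = brank E"
  "btrivs (restrict_bundle E N) = (\<lambda>(U, \<psi>). (U \<inter> mpoints N, \<psi>)) ` btrivs E"
  by (simp_all add: restrict_bundle_def)

lemma fibre_linear_restrict: "x \<in> mpoints N \<Longrightarrow> fibre_linear (restrict_bundle E N) x = fibre_linear E x"
  and fibre_iso_restrict: "x \<in> mpoints N \<Longrightarrow> fibre_iso (restrict_bundle E N) x = fibre_iso E x"
  and frame_restrict: "x \<in> mpoints N \<Longrightarrow> frame (restrict_bundle E N) \<psi> j x = frame E \<psi> j x"
  by (auto simp: fun_eq_iff fibre_linear_def fibre_iso_def frame_def restrict_bundle_simps fibre_restrict)

locale restricted_vbundle = smooth_vbundle M E for M :: "'a manifold" and E :: "('a, 'b) vbundle" +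
  fixes N :: "'a manifold"
  assumes N: "smooth_manifold N" and NM: "mpoints N \<subseteq> mpoints M" and incl: "smooth_map N M (\<lambda>x. x)"
begin

lemma smooth_fun_restrict:
  assumes "smooth_fun_on M W f"
  shows "smooth_fun_on N (W \<inter> mpoints N) f"
proof -
  have "{x \<in> mpoints N. x \<in> W} = W \<inter> mpoints N" by blast
  then show ?thesis using smooth_fun_on_pullback[OF N M incl assms] by simp
qed

text \<open>Continuity of the inclusion, read off from the domain of the restriction of a constant
  function.\<close>

lemma open_restrict: "openin (mtop M) W \<Longrightarrow> openin (mtop N) (W \<inter> mpoints N)"
  using smooth_fun_on_open[OF smooth_fun_restrict[OF smooth_fun_on_const[OF M]]] .

lemma lt_restrict:
  assumes t: "local_trivialization M E (U, \<psi>)"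
  shows "local_trivialization N (restrict_bundle E N) (U \<inter> mpoints N, \<psi>)"
proof -
  let ?R = "restrict_bundle E N"
  have rep: "smooth_matrix_rep N ?R ?R (\<lambda>a. a) (U \<inter> mpoints N, \<psi>) (V \<inter> mpoints N, \<xi>)"
    if t: "local_trivialization M E (U, \<psi>)" and v: "local_trivialization M E (V, \<xi>)" for U \<psi> V \<xi>
  proof (subst smooth_matrix_rep_iff[OF N])
    show "fibre_iso ?R x \<psi>" if "x \<in> (U \<inter> mpoints N) \<inter> (V \<inter> mpoints N)" for x
      using lt_iso[OF t] that by (simp add: fibre_iso_restrict)
    show "fibre_linear ?R x (\<lambda>a. \<xi> a i)" if "x \<in> (U \<inter> mpoints N) \<inter> (V \<inter> mpoints N)" for x i
      using fibre_iso_coord_linear[OF lt_iso[OF v]] that by (simp add: fibre_linear_restrict)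
    show "\<forall>i<brank ?R. \<forall>j<brank ?R. smooth_fun_on N (U \<inter> mpoints N \<inter> (V \<inter> mpoints N)) (\<lambda>x. \<xi> (frame ?R \<psi> j x) i)"
    proof (intro allI impI)
      fix i j assume ij: "i < brank ?R" "j < brank ?R"
      have "smooth_fun_on N ((U \<inter> V) \<inter> mpoints N) (\<lambda>x. \<xi> (frame E \<psi> j x) i)"
        using ij by (intro smooth_fun_restrict sf_frame[OF sf_coord[OF v] t]) (simp_all add: restrict_bundle_simps)
      then have "smooth_fun_on N ((U \<inter> V) \<inter> mpoints N) (\<lambda>x. \<xi> (frame ?R \<psi> j x) i)"
        by (rule smooth_fun_on_cong[OF N]) (simp add: frame_restrict)
      moreover have "U \<inter> mpoints N \<inter> (V \<inter> mpoints N) = (U \<inter> V) \<inter> mpoints N" by blast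
      ultimately show "smooth_fun_on N (U \<inter> mpoints N \<inter> (V \<inter> mpoints N)) (\<lambda>x. \<xi> (frame ?R \<psi> j x) i)" by simp
    qed
  qed
  have "\<forall>s\<in>btrivs ?R. smooth_matrix_rep N ?R ?R (\<lambda>a. a) (U \<inter> mpoints N, \<psi>) s \<and> smooth_matrix_rep N ?R ?R (\<lambda>a. a) s (U \<inter> mpoints N, \<psi>)"
    using rep[OF t triv_local] rep[OF triv_local t] by (auto simp: restrict_bundle_simps)
  moreover have "fibre_iso ?R x \<psi>" if "x \<in> U \<inter> mpoints N" for x
    using lt_iso[OF t] that by (simp add: fibre_iso_restrict)
  ultimately show ?thesis
    using open_restrict[OF lt_open[OF t]] unfolding local_trivialization_def fibre_iso_def by auto
qed

lemma vbundle_restrict: "smooth_vbundle N (restrict_bundle E N)"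
proof (unfold_locales, rule N)
  let ?R = "restrict_bundle E N"
  have "(\<Union>(U, \<psi>)\<in>btrivs ?R. U) = mpoints N"
  proof
    show "(\<Union>(U, \<psi>)\<in>btrivs ?R. U) \<subseteq> mpoints N" by (auto simp: restrict_bundle_simps)
    show "mpoints N \<subseteq> (\<Union>(U, \<psi>)\<in>btrivs ?R. U)"
    proof
      fix x assume x: "x \<in> mpoints N"
      then have "x \<in> mpoints M" using NM by blast
      then obtain U \<psi> where "(U, \<psi>) \<in> btrivs E" "x \<in> U" by (rule triv_cover)
      then show "x \<in> (\<Union>(U, \<psi>)\<in>btrivs ?R. U)"
        using x by (intro UN_I[of "(U \<inter> mpoints N, \<psi>)"]) (auto simp: restrict_bundle_simps)
    qed
  qed
  moreover have "bproj ?R ` btotal ?R \<subseteq> mpoints N" by (auto simp: restrict_bundle_def)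
  moreover have "\<forall>t\<in>btrivs ?R. local_trivialization N ?R t"
    using lt_restrict[OF triv_local] by (auto simp: restrict_bundle_simps)
  ultimately show "vector_bundle N ?R"
    unfolding vector_bundle_def using fibre_closed NM by (auto simp: fibre_restrict restrict_bundle_simps)
qed

lemma sf_restrict:
  assumes k: "smooth_functional M E W \<kappa>"
  shows "smooth_functional N (restrict_bundle E N) (W \<inter> mpoints N) \<kappa>"
proof (rule smooth_functionalI[OF open_restrict[OF smooth_functionalD(1)[OF k]]])
  let ?R = "restrict_bundle E N"
  show "fibre_linear ?R x \<kappa>" if "x \<in> W \<inter> mpoints N" for x
    using smooth_functionalD(2)[OF k] that by (simp add: fibre_linear_restrict)
  fix U' \<psi> j assume "(U', \<psi>) \<in> btrivs ?R" and j: "j < brank ?R"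
  then obtain U where u: "(U, \<psi>) \<in> btrivs E" and U': "U' = U \<inter> mpoints N" by (auto simp: restrict_bundle_simps)
  have "smooth_fun_on N ((U \<inter> W) \<inter> mpoints N) (\<lambda>x. \<kappa> (frame E \<psi> j x))"
    using j by (intro smooth_fun_restrict smooth_functionalD(3)[OF k u]) (simp add: restrict_bundle_simps)
  then have "smooth_fun_on N ((U \<inter> W) \<inter> mpoints N) (\<lambda>x. \<kappa> (frame ?R \<psi> j x))"
    by (rule smooth_fun_on_cong[OF N]) (simp add: frame_restrict)
  moreover have "U' \<inter> (W \<inter> mpoints N) = (U \<inter> W) \<inter> mpoints N" using U' by blast
  ultimately show "smooth_fun_on N (U' \<inter> (W \<inter> mpoints N)) (\<lambda>x. \<kappa> (frame ?R \<psi> j x))" by simp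
qed

lemma section_restrict:
  assumes X: "X \<in> sections M E"
  shows "restrict X (mpoints N) \<in> sections N (restrict_bundle E N)"
proof -
  interpret R: smooth_vbundle N "restrict_bundle E N" by (rule vbundle_restrict)
  show ?thesis
  proof (rule R.sectionI)
    fix x assume x: "x \<in> mpoints N"
    show "restrict X (mpoints N) x \<in> fibre (restrict_bundle E N) x"
      using section_fibre[OF X] x NM by (auto simp: fibre_restrict)
    obtain U \<psi> where u: "(U, \<psi>) \<in> btrivs E" "x \<in> U" using triv_cover x NM by blast
    note t = triv_local[OF u(1)]
    have "smooth_fun_on N (U \<inter> mpoints N) (\<lambda>x. \<psi> (restrict X (mpoints N) x) i)" if "i < brank E" for i
      by (rule smooth_fun_on_cong[OF N smooth_fun_restrict[OF sf_section[OF X sf_coord[OF t that]]]]) simp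
    then show "\<exists>U \<psi> V. local_trivialization N (restrict_bundle E N) (U, \<psi>) \<and> x \<in> V \<and> V \<subseteq> U \<and>
       openin (mtop N) V \<and> (\<forall>i<brank (restrict_bundle E N). smooth_fun_on N V (\<lambda>y. \<psi> (restrict X (mpoints N) y) i))"
      using lt_restrict[OF t] u x open_restrict[OF lt_open[OF t]]
      by (intro exI[of _ "U \<inter> mpoints N"] exI[of _ \<psi>]) (auto simp: restrict_bundle_simps)
  qed simp
qed

end

subsection \<open>Transport of the bracket of vector fields\<close>

lemma sec_map_add:
  assumes F: "smooth_vbundle M F" and h: "bundle_morphism M F E h" and "X \<in> sections M F" "Y \<in> sections M F"
  shows "sec_map M h (sec_add M F X Y) = sec_add M E (sec_map M h X) (sec_map M h Y)"
  using smooth_vbundle.section_fibre[OF F assms(3)] smooth_vbundle.section_fibre[OF F assms(4)] bundle_morphismD(2)[OF h]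
  by (auto simp: sec_map_def sec_add_def fun_eq_iff)

lemma sec_map_mult:
  assumes F: "smooth_vbundle M F" and h: "bundle_morphism M F E h" and "X \<in> sections M F"
  shows "sec_map M h (sec_mult M F f X) = sec_mult M E f (sec_map M h X)"
  using smooth_vbundle.section_fibre[OF F assms(3)] bundle_morphismD(3)[OF h]
  by (auto simp: sec_map_def sec_mult_def fun_eq_iff)

lemma almost_lie_bracketD:
  assumes "almost_lie_bracket M E \<rho> B"
  shows "\<And>X Y. X \<in> sections M E \<Longrightarrow> Y \<in> sections M E \<Longrightarrow> B X Y \<in> sections M E"
    "\<And>X Y Z. X \<in> sections M E \<Longrightarrow> Y \<in> sections M E \<Longrightarrow> Z \<in> sections M E \<Longrightarrow>
      B X (sec_add M E Y Z) = sec_add M E (B X Y) (B X Z)"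
    "\<And>X Y. X \<in> sections M E \<Longrightarrow> Y \<in> sections M E \<Longrightarrow> B X Y = sec_mult M E (\<lambda>_. - 1) (B Y X)"
    "\<And>f X Y. smooth_fun_on M (mpoints M) f \<Longrightarrow> X \<in> sections M E \<Longrightarrow> Y \<in> sections M E \<Longrightarrow>
      B X (sec_mult M E f Y) = sec_add M E (sec_mult M E f (B X Y)) (sec_mult M E (\<lambda>x. snd (\<rho> (X x)) f) Y)"
proof -
  note a = assms[unfolded almost_lie_bracket_def]
  note c = conjunct1[OF a] conjunct1[OF conjunct2[OF a]]
    conjunct1[OF conjunct2[OF conjunct2[OF conjunct2[OF a]]]]
    conjunct2[OF conjunct2[OF conjunct2[OF conjunct2[OF a]]]]
  show "\<And>X Y. X \<in> sections M E \<Longrightarrow> Y \<in> sections M E \<Longrightarrow> B X Y \<in> sections M E"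
    by (rule c(1)[rule_format])
  show "\<And>X Y Z. X \<in> sections M E \<Longrightarrow> Y \<in> sections M E \<Longrightarrow> Z \<in> sections M E \<Longrightarrow>
      B X (sec_add M E Y Z) = sec_add M E (B X Y) (B X Z)"
    by (rule c(2)[rule_format, THEN conjunct2])
  show "\<And>X Y. X \<in> sections M E \<Longrightarrow> Y \<in> sections M E \<Longrightarrow> B X Y = sec_mult M E (\<lambda>_. - 1) (B Y X)"
    by (rule c(3)[rule_format])
  show "\<And>f X Y. smooth_fun_on M (mpoints M) f \<Longrightarrow> X \<in> sections M E \<Longrightarrow> Y \<in> sections M E \<Longrightarrow>
      B X (sec_mult M E f Y) = sec_add M E (sec_mult M E f (B X Y)) (sec_mult M E (\<lambda>x. snd (\<rho> (X x)) f) Y)"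
    by (rule c(4)[rule_format])
qed

text \<open>Since \<open>sec_map M h\<close> is bijective on sections and compatible with sums and
  multiples, every identity for brackets of vector fields pulls back. The derivative in the Leibniz
  rule becomes the one along h, so h is the anchor.\<close>

lemma transport_vf_bracket:
  fixes M :: "'a manifold" and E :: "('a, 'b) vbundle"
  assumes VE: "smooth_vbundle M E" and iso: "bundle_isomorphism M E (tangent_bundle M) h"
  defines "B \<equiv> \<lambda>X Y. sec_map M (inv_into (btotal E) h) (vf_bracket M (sec_map M h X) (sec_map M h Y))"
  shows "lie_bracket M E h B"
    "lie_algebra_isomorphism M E B (tangent_bundle M) (vf_bracket M) (sec_map M h)"
    "\<And>X Y. X \<in> sections M E \<Longrightarrow> Y \<in> sections M E \<Longrightarrow> sec_map M h (B X Y) = vf_bracket M (sec_map M h X) (sec_map M h Y)"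
proof -
  interpret smooth_vbundle M E by (rule VE)
  let ?T = "tangent_bundle M" and ?h' = "inv_into (btotal E) h"
  let ?H = "sec_map M h" and ?H' = "sec_map M ?h'"
  interpret T: smooth_vbundle M ?T by (rule vbundle_tangent[OF M])
  note VT = T.smooth_vbundle_axioms
  have h: "bundle_morphism M E ?T h" and h': "bundle_morphism M ?T E ?h'" and bij: "bij_betw h (btotal E) (btotal ?T)"
    using iso by (simp_all add: bundle_isomorphism_def)
  have H: "?H X \<in> vector_fields M" if "X \<in> sections M E" for X by (rule sec_map_section[OF VT VE h that])
  have H': "?H' V \<in> sections M E" if "V \<in> vector_fields M" for V by (rule sec_map_section[OF VE VT h' that])
  have tot: "a \<in> btotal F" if "a \<in> fibre F x" for F :: "('a, 'z) vbundle" and a x using that by (simp add: fibre_def)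
  have HH': "?H (?H' V) = V" if V: "V \<in> vector_fields M" for V
  proof (rule T.section_eqI[OF H[OF H'[OF V]] V])
    fix x assume x: "x \<in> mpoints M"
    have "V x \<in> h ` btotal E" using tot[OF T.section_fibre[OF V x]] bij by (simp add: bij_betw_def)
    then show "?H (?H' V) x = V x" using x by (simp add: sec_map_def f_inv_into_f)
  qed
  have H'H: "?H' (?H X) = X" if X: "X \<in> sections M E" for X
  proof (rule section_eqI[OF H'[OF H[OF X]] X])
    fix x assume x: "x \<in> mpoints M"
    show "?H' (?H X) x = X x"
      using x tot[OF section_fibre[OF X x]] bij by (simp add: sec_map_def bij_betw_def inv_into_f_f)
  qed
  have br: "vf_bracket M (?H X) (?H Y) \<in> vector_fields M" if "X \<in> sections M E" "Y \<in> sections M E" for X Y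
    by (rule vf_bracket_section[OF M H[OF that(1)] H[OF that(2)]])
  have Bs: "B X Y \<in> sections M E" if "X \<in> sections M E" "Y \<in> sections M E" for X Y
    unfolding B_def by (rule H'[OF br[OF that]])
  show HB: "?H (B X Y) = vf_bracket M (?H X) (?H Y)" if "X \<in> sections M E" "Y \<in> sections M E" for X Y
    unfolding B_def by (rule HH'[OF br[OF that]])
  have alb: "almost_lie_bracket M E h B"
  proof (rule almost_lie_bracketI[OF VE h Bs])
    fix X Y assume X: "X \<in> sections M E" and Y: "Y \<in> sections M E"
    show "B X Y = sec_mult M E (\<lambda>_. - 1) (B Y X)"
      unfolding B_def by (subst vf_bracket_antisym[OF M H[OF X] H[OF Y]], rule sec_map_mult[OF VT h' br[OF Y X]])
  next
    fix X Y Z assume X: "X \<in> sections M E" and Y: "Y \<in> sections M E" and Z: "Z \<in> sections M E"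
    show "B X (sec_add M E Y Z) = sec_add M E (B X Y) (B X Z)"
      unfolding B_def sec_map_add[OF VE h Y Z] vf_bracket_add_right[OF M H[OF X] H[OF Y] H[OF Z]]
      by (rule sec_map_add[OF VT h' br[OF X Y] br[OF X Z]])
  next
    fix f X Y assume f: "smooth_fun_on M (mpoints M) f" and X: "X \<in> sections M E" and Y: "Y \<in> sections M E"
    have s: "sec_mult M ?T f (vf_bracket M (?H X) (?H Y)) \<in> vector_fields M"
      "sec_mult M ?T (\<lambda>x. snd (?H X x) f) (?H Y) \<in> vector_fields M"
      by (intro T.sec_mult_section f br X Y H vf_smooth[OF M])+
    have "sec_mult M E (\<lambda>x. snd (?H X x) f) Y = sec_mult M E (\<lambda>x. snd (h (X x)) f) Y"
      by (auto simp: sec_mult_def sec_map_def)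
    then show "B X (sec_mult M E f Y) = sec_add M E (sec_mult M E f (B X Y)) (sec_mult M E (\<lambda>x. snd (h (X x)) f) Y)"
      unfolding B_def sec_map_mult[OF VE h Y] vf_bracket_leibniz[OF M H[OF X] H[OF Y] f]
        sec_map_add[OF VT h' s] sec_map_mult[OF VT h' br[OF X Y]] sec_map_mult[OF VT h' H[OF Y]] H'H[OF Y]
      by simp
  qed
  have zero: "?H' (sec_zero M ?T) = sec_zero M E"
  proof (rule section_eq_linearI[OF H'[OF sec_zero_section[OF VT]] sec_zero_section[OF VE]])
    fix x \<kappa> assume x: "x \<in> mpoints M" and k: "fibre_linear E x \<kappa>"
    obtain \<psi> where i: "fibre_iso E x \<psi>" by (rule fibre_iso_ex[OF x])
    obtain \<xi> where j: "fibre_iso ?T x \<xi>" by (rule T.fibre_iso_ex[OF x])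
    show "\<kappa> (?H' (sec_zero M ?T) x) = \<kappa> (sec_zero M E x)"
      using fibre_linear_bzero[OF i k] fibre_linear_bzero[OF j fibre_linear_compose[OF h' x k]] x
      by (simp add: sec_map_def sec_zero_def)
  qed
  have "sec_add M E (B X (B Y Z)) (sec_add M E (B Y (B Z X)) (B Z (B X Y))) = sec_zero M E"
    if X: "X \<in> sections M E" and Y: "Y \<in> sections M E" and Z: "Z \<in> sections M E" for X Y Z
  proof -
    have BB: "B X (B Y Z) = ?H' (vf_bracket M (?H X) (vf_bracket M (?H Y) (?H Z)))"
      if "X \<in> sections M E" "Y \<in> sections M E" "Z \<in> sections M E" for X Y Z
      by (subst HB[OF that(2,3), symmetric]) (simp only: B_def)
    have b: "vf_bracket M (?H X) (vf_bracket M (?H Y) (?H Z)) \<in> vector_fields M"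
      if "X \<in> sections M E" "Y \<in> sections M E" "Z \<in> sections M E" for X Y Z
      by (intro vf_bracket_section[OF M] H that)
    show ?thesis
      unfolding BB[OF X Y Z] BB[OF Y Z X] BB[OF Z X Y]
        sec_map_add[OF VT h' b[OF Y Z X] b[OF Z X Y], symmetric]
        sec_map_add[OF VT h' b[OF X Y Z] T.sec_add_section[OF b[OF Y Z X] b[OF Z X Y]], symmetric]
        vf_bracket_jacobi[OF M H[OF X] H[OF Y] H[OF Z]] by (rule zero)
  qed
  then show "lie_bracket M E h B" using alb by (simp add: lie_bracket_def)
  have "bij_betw ?H (sections M E) (vector_fields M)"
    by (rule bij_betw_byWitness[where f' = ?H']) (use H H' H'H HH' in auto)
  then show "lie_algebra_isomorphism M E B ?T (vf_bracket M) ?H"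
    unfolding lie_algebra_isomorphism_def using HB sec_map_add[OF VE h] sec_map_mult[OF VE h] by blast
qed

subsection \<open>Almost Lie brackets are determined by a local frame\<close>

text \<open>D is defined on global sections, while the expansion of X holds over W only.
  Multiplication by a bump function b supported in W turns it into a global identity for b X with
  coefficients b f j, and D (b X) = D X because b x0 = 1.\<close>

lemma (in smooth_vbundle) tensorial_local:
  fixes D :: "('a \<Rightarrow> 'b) \<Rightarrow> real" and e :: "nat \<Rightarrow> 'a \<Rightarrow> 'b"
  assumes add: "\<And>X Y. X \<in> sections M E \<Longrightarrow> Y \<in> sections M E \<Longrightarrow> D (sec_add M E X Y) = D X + D Y"
    and mult: "\<And>f X. smooth_fun_on M (mpoints M) f \<Longrightarrow> X \<in> sections M E \<Longrightarrow> D (sec_mult M E f X) = f x0 * D X"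
    and e: "\<And>j. j < p \<Longrightarrow> e j \<in> sections M E" and X: "X \<in> sections M E"
    and W: "openin (mtop M) W" "x0 \<in> W" and f: "\<And>j. j < p \<Longrightarrow> smooth_fun_on M W (f j)"
    and eq: "\<And>x \<kappa>. x \<in> W \<Longrightarrow> fibre_linear E x \<kappa> \<Longrightarrow> \<kappa> (X x) = (\<Sum>j<p. f j x * \<kappa> (e j x))"
  shows "D X = (\<Sum>j<p. f j x0 * D (e j))"
proof -
  obtain b :: "'a \<Rightarrow> real" and C V where b: "smooth_fun_on M (mpoints M) b" "closedin (mtop M) C"
    "C \<subseteq> W" "\<And>y. y \<notin> C \<Longrightarrow> b y = 0" "x0 \<in> V" "\<And>y. y \<in> V \<Longrightarrow> b y = 1"
    by (rule manifold_bump[OF M W]) (rule that)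
  have Wm: "W \<subseteq> mpoints M" by (rule openin_subset[OF W(1)])
  define F where "F j y = (if y \<in> W then b y * f j y else 0)" for j y
  have F: "smooth_fun_on M (mpoints M) (F j)" if "j < p" for j
    unfolding F_def
    by (rule smooth_fun_extend[OF M _ b(2,3)])
      (use b(4) smooth_fun_on_mult[OF M smooth_fun_on_subset[OF M b(1) W(1) Wm] f[OF that]] in auto)
  have zs: "sec_zero M E \<in> sections M E" by (rule sec_zero_section[OF smooth_vbundle_axioms])
  have zl: "\<kappa> (sec_zero M E x) = 0" if xk: "x \<in> mpoints M" "fibre_linear E x \<kappa>" for x \<kappa>
  proof -
    obtain \<psi> where "fibre_iso E x \<psi>" by (rule fibre_iso_ex[OF xk(1)])
    from fibre_linear_bzero[OF this xk(2)] show ?thesis using xk(1) by (simp add: sec_zero_def)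
  qed
  have c0: "smooth_fun_on M (mpoints M) (\<lambda>_. 0)" by (rule smooth_fun_on_const[OF M]) simp
  have "sec_mult M E (\<lambda>_. 0) (sec_zero M E) = sec_zero M E"
  proof (rule section_eq_linearI[OF sec_mult_section[OF c0 zs] zs])
    fix x \<kappa> assume "x \<in> mpoints M" "fibre_linear E x \<kappa>"
    then show "\<kappa> (sec_mult M E (\<lambda>_. 0) (sec_zero M E) x) = \<kappa> (sec_zero M E x)"
      using linear_sec_mult[OF zs, of x \<kappa> "\<lambda>_. 0"] zl[of x \<kappa>] by simp
  qed
  then have Dz: "D (sec_zero M E) = 0" using mult[OF c0 zs] by simp
  have "n \<le> p \<Longrightarrow> \<exists>Z. Z \<in> sections M E \<and> D Z = (\<Sum>j<n. F j x0 * D (e j)) \<and>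
      (\<forall>x\<in>mpoints M. \<forall>\<kappa>. fibre_linear E x \<kappa> \<longrightarrow> \<kappa> (Z x) = (\<Sum>j<n. F j x * \<kappa> (e j x)))" for n
  proof (induction n)
    case 0
    then show ?case using zs Dz zl by (intro exI[of _ "sec_zero M E"]) simp
  next
    case (Suc n)
    then obtain Z where Z: "Z \<in> sections M E" "D Z = (\<Sum>j<n. F j x0 * D (e j))"
      "\<forall>x\<in>mpoints M. \<forall>\<kappa>. fibre_linear E x \<kappa> \<longrightarrow> \<kappa> (Z x) = (\<Sum>j<n. F j x * \<kappa> (e j x))" by auto
    have n: "n < p" using Suc.prems by simp
    note Fe = sec_mult_section[OF F[OF n] e[OF n]]
    show ?case
      using sec_add_section[OF Z(1) Fe] add[OF Z(1) Fe] mult[OF F[OF n] e[OF n]] Z(2,3)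
        linear_sec_add[OF Z(1) Fe] linear_sec_mult[OF e[OF n]]
      by (intro exI[of _ "sec_add M E Z (sec_mult M E (F n) (e n))"]) simp
  qed
  from this[OF order_refl] obtain Z where Z: "Z \<in> sections M E" "D Z = (\<Sum>j<p. F j x0 * D (e j))"
    "\<And>x \<kappa>. x \<in> mpoints M \<Longrightarrow> fibre_linear E x \<kappa> \<Longrightarrow> \<kappa> (Z x) = (\<Sum>j<p. F j x * \<kappa> (e j x))" by blast
  have "sec_mult M E b X = Z"
  proof (rule section_eq_linearI[OF sec_mult_section[OF b(1) X] Z(1)])
    fix x \<kappa> assume x: "x \<in> mpoints M" and k: "fibre_linear E x \<kappa>"
    have "b x * \<kappa> (X x) = (\<Sum>j<p. F j x * \<kappa> (e j x))"
    proof (cases "x \<in> W")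
      case True
      then show ?thesis by (simp add: F_def eq[OF True k] sum_distrib_left mult.assoc)
    next
      case False
      then show ?thesis using b(3,4) by (auto simp: F_def)
    qed
    then show "\<kappa> (sec_mult M E b X x) = \<kappa> (Z x)"
      using linear_sec_mult[OF X x k] Z(3)[OF x k] by simp
  qed
  moreover have "b x0 = 1" by (rule b(6)[OF b(5)])
  ultimately have "D X = D Z" using mult[OF b(1) X] by simp
  also have "\<dots> = (\<Sum>j<p. f j x0 * D (e j))" using Z(2) W(2) \<open>b x0 = 1\<close> by (simp add: F_def)
  finally show ?thesis .
qed

text \<open>The derivative term of the Leibniz rule depends on the anchor alone and is the same for
  both brackets. Their difference is therefore linear over smooth functions, so at x0 it is
  determined by its values on generators near x0.\<close>

lemma (in smooth_vbundle) almost_lie_brackets_agree: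
  fixes e :: "nat \<Rightarrow> 'a \<Rightarrow> 'b"
  assumes B: "almost_lie_bracket M E h B1" "almost_lie_bracket M E h B2"
    and e: "\<And>j. j < p \<Longrightarrow> e j \<in> sections M E"
    and agree: "\<And>i j. i < p \<Longrightarrow> j < p \<Longrightarrow> B1 (e i) (e j) x0 = B2 (e i) (e j) x0"
    and X: "X \<in> sections M E" and Y: "Y \<in> sections M E"
    and W: "openin (mtop M) W" "x0 \<in> W"
    and f: "\<And>j. j < p \<Longrightarrow> smooth_fun_on M W (f j)" and g: "\<And>j. j < p \<Longrightarrow> smooth_fun_on M W (g j)"
    and eqX: "\<And>x \<kappa>. x \<in> W \<Longrightarrow> fibre_linear E x \<kappa> \<Longrightarrow> \<kappa> (X x) = (\<Sum>j<p. f j x * \<kappa> (e j x))"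
    and eqY: "\<And>x \<kappa>. x \<in> W \<Longrightarrow> fibre_linear E x \<kappa> \<Longrightarrow> \<kappa> (Y x) = (\<Sum>j<p. g j x * \<kappa> (e j x))"
  shows "B1 X Y x0 = B2 X Y x0"
proof -
  have x0: "x0 \<in> mpoints M" using W openin_subset by blast
  obtain \<psi> where iso: "fibre_iso E x0 \<psi>" by (rule fibre_iso_ex[OF x0])
  have cl: "B X Y \<in> sections M E" if "almost_lie_bracket M E h B" "X \<in> sections M E" "Y \<in> sections M E" for B X Y
    by (rule almost_lie_bracketD(1)[OF that])
  show ?thesis
  proof (rule fibre_iso_eqI[OF iso section_fibre[OF cl[OF B(1) X Y] x0] section_fibre[OF cl[OF B(2) X Y] x0]])
    fix i
    define \<kappa> where "\<kappa> a = \<psi> a i" for a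
    have k: "fibre_linear E x0 \<kappa>" unfolding \<kappa>_def by (rule fibre_iso_coord_linear[OF iso])
    define d where "d X Y = \<kappa> (B1 X Y x0) - \<kappa> (B2 X Y x0)" for X Y
    have add: "\<kappa> (B X (sec_add M E Y Z) x0) = \<kappa> (B X Y x0) + \<kappa> (B X Z x0)"
      and mult: "smooth_fun_on M (mpoints M) c \<Longrightarrow>
        \<kappa> (B X (sec_mult M E c Y) x0) = c x0 * \<kappa> (B X Y x0) + snd (h (X x0)) c * \<kappa> (Y x0)"
      and anti: "\<kappa> (B X Y x0) = - \<kappa> (B Y X x0)"
      if b: "almost_lie_bracket M E h B" and X: "X \<in> sections M E" and Y: "Y \<in> sections M E" and Z: "Z \<in> sections M E"
      for B X Y Z c
    proof -
      note c = cl[OF b]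
      have "B X (sec_add M E Y Z) = sec_add M E (B X Y) (B X Z)"
        by (rule almost_lie_bracketD(2)[OF b X Y Z])
      then show "\<kappa> (B X (sec_add M E Y Z) x0) = \<kappa> (B X Y x0) + \<kappa> (B X Z x0)"
        using linear_sec_add[OF c[OF X Y] c[OF X Z] x0 k] by simp
      have "B X Y = sec_mult M E (\<lambda>_. - 1) (B Y X)"
        by (rule almost_lie_bracketD(3)[OF b X Y])
      then show "\<kappa> (B X Y x0) = - \<kappa> (B Y X x0)"
        using linear_sec_mult[OF c[OF Y X] x0 k, of "\<lambda>_. - 1"] by simp
      show "\<kappa> (B X (sec_mult M E c Y) x0) = c x0 * \<kappa> (B X Y x0) + snd (h (X x0)) c * \<kappa> (Y x0)"
        if cs: "smooth_fun_on M (mpoints M) c"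
      proof -
        have "B X (sec_mult M E c Y) = sec_add M E (sec_mult M E c (B X Y)) (sec_mult M E (\<lambda>x. snd (h (X x)) c) Y)"
          by (rule almost_lie_bracketD(4)[OF b cs X Y])
        then have "B X (sec_mult M E c Y) x0 = badd E (sec_mult M E c (B X Y) x0) (sec_mult M E (\<lambda>x. snd (h (X x)) c) Y x0)"
          using x0 by (simp add: sec_add_def)
        moreover have "sec_mult M E (\<lambda>x. snd (h (X x)) c) Y x0 \<in> fibre E x0"
          using fibre_closed(2)[OF x0 section_fibre[OF Y x0]] x0 by (simp add: sec_mult_def)
        ultimately show ?thesis
          using k section_fibre[OF sec_mult_section[OF cs c[OF X Y]] x0]
            linear_sec_mult[OF c[OF X Y] x0 k] linear_sec_mult[OF Y x0 k]
          by (simp add: fibre_linear_def)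
      qed
    qed
    have d_add: "d X (sec_add M E Y Z) = d X Y + d X Z"
      if X: "X \<in> sections M E" and Y: "Y \<in> sections M E" and Z: "Z \<in> sections M E" for X Y Z
      using add[OF B(1) X Y Z] add[OF B(2) X Y Z] by (simp add: d_def)
    have d_mult: "d X (sec_mult M E c Y) = c x0 * d X Y"
      if X: "X \<in> sections M E" and c: "smooth_fun_on M (mpoints M) c" and Y: "Y \<in> sections M E" for X Y c
      using mult[OF B(1) X Y Y c] mult[OF B(2) X Y Y c] by (simp add: d_def right_diff_distrib)
    have d_anti: "d X Y = - d Y X" if X: "X \<in> sections M E" and Y: "Y \<in> sections M E" for X Y
      using anti[OF B(1) X Y Y] anti[OF B(2) X Y Y] by (simp add: d_def)
    have right: "d Z Y = (\<Sum>j<p. g j x0 * d Z (e j))" if Z: "Z \<in> sections M E" for Z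
      by (rule tensorial_local[where D = "d Z" and e = e and W = W and f = g])
        (rule d_add[OF Z] d_mult[OF Z] e Y W g eqY | assumption)+
    \<comment> \<open>Antisymmetry moves the first argument into the second, where tensoriality is
      available.\<close>
    have left: "d X Z = (\<Sum>j<p. f j x0 * d (e j) Z)" if Z: "Z \<in> sections M E" for Z
    proof -
      have "d Z X = (\<Sum>j<p. f j x0 * d Z (e j))"
        by (rule tensorial_local[where D = "d Z" and e = e and W = W and f = f])
        (rule d_add[OF Z] d_mult[OF Z] e X W f eqX | assumption)+
      moreover have "f j x0 * d Z (e j) = - (f j x0 * d (e j) Z)" if "j < p" for j
        using d_anti[OF Z e[OF that]] by simp
      then have "(\<Sum>j<p. f j x0 * d Z (e j)) = - (\<Sum>j<p. f j x0 * d (e j) Z)" by (simp add: sum_negf)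
      ultimately show ?thesis using d_anti[OF X Z] by simp
    qed
    have "d (e j) Y = 0" if j: "j < p" for j
      using right[OF e[OF j]] agree[OF j] by (simp add: d_def)
    then have "d X Y = 0" using left[OF Y] by simp
    then show "\<psi> (B1 X Y x0) i = \<psi> (B2 X Y x0) i" by (simp add: d_def \<kappa>_def)
  qed
qed

subsection \<open>The data induced on an integral manifold\<close>

lemma tangent_map_incl:
  "tangent_inclusion N M a = (fst a, \<lambda>f. if smooth_near M (fst a) f then snd a f else 0)"
  by (simp add: tangent_map_def split_beta)

lemma bzero_tangent:
  assumes M: "smooth_manifold M" and x: "x \<in> mpoints M"
  shows "bzero (tangent_bundle M) x = (x, \<lambda>_. 0)"
proof -
  interpret T: smooth_vbundle M "tangent_bundle M" by (rule vbundle_tangent[OF M])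
  obtain \<psi> where iso: "fibre_iso (tangent_bundle M) x \<psi>" by (rule T.fibre_iso_ex[OF x])
  have "fst (bzero (tangent_bundle M) x) = x"
    using fibre_iso_bzero(1)[OF iso] x by (auto simp: fibre_tangent_bundle)
  moreover have "snd (bzero (tangent_bundle M) x) f = 0" for f
    by (rule fibre_linear_bzero[OF iso, where \<kappa> = "\<lambda>a. snd a f"]) (simp add: fibre_linear_def tangent_bundle_simps)
  ultimately show ?thesis by (simp add: prod_eq_iff fun_eq_iff)
qed

locale integral_leaf = smooth_vbundle M A for M :: "'a manifold" and A :: "('a, 'b) vbundle" +
  fixes \<rho> :: "'b \<Rightarrow> 'a \<times> (('a \<Rightarrow> real) \<Rightarrow> real)" and N :: "'a manifold"
  assumes \<rho>: "bundle_morphism M A (tangent_bundle M) \<rho>"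
    and int: "integral_manifold M (anchor_distribution A \<rho>) N"
begin

abbreviation "TM \<equiv> tangent_bundle M"
abbreviation "TN \<equiv> tangent_bundle N"
abbreviation "A\<^sub>N \<equiv> restrict_bundle A N"
abbreviation "K\<^sub>N \<equiv> leaf_kernel M A \<rho> N"
abbreviation "\<iota> \<equiv> tangent_inclusion N M"
abbreviation "r \<equiv> brank A"
abbreviation "n \<equiv> mdim N"

text \<open>The lift of \<open>\<rho>\<close> through the inclusion of \<open>TN\<close>. It exists
  and is unique over N because the inclusion is injective and its image at x is the image of the
  fibre of A.\<close>

definition \<sigma> :: "'b \<Rightarrow> 'a \<times> (('a \<Rightarrow> real) \<Rightarrow> real)" where
  "\<sigma> a = inv_into (btotal TN) \<iota> (\<rho> a)"

lemma N: "smooth_manifold N" and NM: "mpoints N \<subseteq> mpoints M" and N_ne: "mpoints N \<noteq> {}"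
  and incl: "smooth_map N M (\<lambda>x. x)"
  using int by (simp_all add: integral_manifold_def immersion_def)

lemma \<iota>_image: "x \<in> mpoints N \<Longrightarrow> \<iota> ` fibre TN x = \<rho> ` fibre A x"
  using int by (simp add: integral_manifold_def anchor_distribution_def)

lemma VT: "smooth_vbundle M TM" and VN: "smooth_vbundle N TN"
  using vbundle_tangent M N by blast+

lemma restricted_A: "restricted_vbundle M A N" and restricted_TM: "restricted_vbundle M TM N"
proof -
  show "restricted_vbundle M A N" by unfold_locales (rule N NM incl)+
  interpret T: smooth_vbundle M TM by (rule VT)
  show "restricted_vbundle M TM N" by unfold_locales (rule N NM incl)+
qed

lemma VA: "smooth_vbundle N A\<^sub>N"
  by (rule restricted_vbundle.vbundle_restrict[OF restricted_A])

lemma VR: "smooth_vbundle N (restrict_bundle TM N)"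
  by (rule restricted_vbundle.vbundle_restrict[OF restricted_TM])

lemma fibre_A: "x \<in> mpoints N \<Longrightarrow> fibre A\<^sub>N x = fibre A x"
  by (simp add: fibre_restrict)

lemma \<rho>_fibre: "x \<in> mpoints N \<Longrightarrow> a \<in> fibre A x \<Longrightarrow> \<rho> a \<in> fibre TM x"
  using bundle_morphismD(1)[OF \<rho>] NM by blast

lemma \<iota>_inj: "inj_on \<iota> (btotal TN)"
proof (rule inj_onI)
  fix a b assume a: "a \<in> btotal TN" and b: "b \<in> btotal TN" and eq: "\<iota> a = \<iota> b"
  have f: "fst a = fst b" using eq by (simp add: tangent_map_incl)
  have am: "fst a \<in> mpoints N" using a by (auto simp: tangent_bundle_simps)
  have ab: "a \<in> fibre TN (fst a)" "b \<in> fibre TN (fst a)"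
    using a b by (simp_all add: fibre_def tangent_bundle_simps f)
  have "inj_on \<iota> (fibre TN (fst a))" using int am by (simp add: integral_manifold_def immersion_def)
  from inj_onD[OF this eq ab] show "a = b" .
qed

lemma fibre_total: "a \<in> fibre E x \<Longrightarrow> a \<in> btotal E"
  by (simp add: fibre_def)

lemma \<sigma>_fibre: "\<sigma> a \<in> fibre TN x" and \<iota>_\<sigma>: "\<iota> (\<sigma> a) = \<rho> a"
  if x: "x \<in> mpoints N" and a: "a \<in> fibre A x"
proof -
  obtain t where t: "t \<in> fibre TN x" "\<iota> t = \<rho> a" using \<iota>_image[OF x] a by (metis imageE imageI)
  have "\<sigma> a = t" unfolding \<sigma>_def t(2)[symmetric] by (rule inv_into_f_f[OF \<iota>_inj fibre_total[OF t(1)]])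
  then show "\<sigma> a \<in> fibre TN x" "\<iota> (\<sigma> a) = \<rho> a" using t by auto
qed

lemma \<sigma>_surj:
  assumes x: "x \<in> mpoints N" and t: "t \<in> fibre TN x"
  obtains a where "a \<in> fibre A x" "\<sigma> a = t"
proof -
  have "\<iota> t \<in> \<rho> ` fibre A x" using \<iota>_image[OF x] t by blast
  then obtain a where a: "a \<in> fibre A x" "\<rho> a = \<iota> t" by (metis imageE)
  have "\<sigma> a = t" unfolding \<sigma>_def a(2) by (rule inv_into_f_f[OF \<iota>_inj fibre_total[OF t]])
  then show ?thesis using that a(1) by blast
qed

lemma snd_\<sigma>:
  assumes x: "x \<in> mpoints N" and a: "a \<in> fibre A x" and f: "smooth_near M x f"
  shows "snd (\<sigma> a) f = snd (\<rho> a) f"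
proof -
  have "fst (\<sigma> a) = x" using \<sigma>_fibre[OF x a] x by (auto simp: fibre_tangent_bundle)
  then show ?thesis using \<iota>_\<sigma>[OF x a] f by (simp add: tangent_map_incl prod_eq_iff fun_eq_iff) metis
qed

lemma smooth_fun_restrict: "smooth_fun_on M W f \<Longrightarrow> smooth_fun_on N (W \<inter> mpoints N) f"
  by (rule restricted_vbundle.smooth_fun_restrict[OF restricted_A])

lemma sf_restrict: "smooth_functional M A W \<kappa> \<Longrightarrow> smooth_functional N A\<^sub>N (W \<inter> mpoints N) \<kappa>"
  by (rule restricted_vbundle.sf_restrict[OF restricted_A])

text \<open>The coordinates of \<open>M\<close> separate tangent vectors of \<open>N\<close>, so some of them give a trivialization of
  \<open>TN\<close>, in which \<open>\<sigma>\<close> has the smooth components of \<open>\<rho>\<close>.\<close>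

lemma sf_\<sigma>:
  assumes k: "smooth_functional N TN W \<kappa>"
  shows "smooth_functional N A\<^sub>N W (\<lambda>a. \<kappa> (\<sigma> a))"
proof (rule sf_pull[OF VN VA k])
  interpret TN: smooth_vbundle N TN by (rule VN)
  interpret AN: smooth_vbundle N A\<^sub>N by (rule VA)
  have W: "W \<subseteq> mpoints N" by (rule TN.sf_open_sub[OF k])
  show "\<sigma> a \<in> fibre TN x" if "x \<in> W" "a \<in> fibre A\<^sub>N x" for x a
  proof -
    have "x \<in> mpoints N" using that W by blast
    then show ?thesis using \<sigma>_fibre fibre_A that(2) by blast
  qed
  fix x assume "x \<in> W"
  then have x: "x \<in> mpoints N" using W by blast
  then have xM: "x \<in> mpoints M" using NM by blast
  obtain V y where c: "(V, y) \<in> mcharts M" "x \<in> V" by (rule chart_cover[OF M xM])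
  let ?V = "V \<inter> mpoints N"
  \<comment> \<open>The differentials of the coordinates of M near x, as functions on tangent
    vectors of N. They separate these vectors because N is immersed.\<close>
  define \<Lambda> where "\<Lambda> = {(\<lambda>a :: 'a \<times> (('a \<Rightarrow> real) \<Rightarrow> real). snd a (\<lambda>q. y q j)) | j. j < mdim M}"
  have L: "smooth_functional N TN ?V \<kappa>'" if l: "\<kappa>' \<in> \<Lambda>" for \<kappa>'
  proof -
    obtain j where "\<kappa>' = (\<lambda>a. snd a (\<lambda>q. y q j))" using l by (auto simp: \<Lambda>_def)
    then show ?thesis
      using sf_differential[OF N smooth_fun_restrict[OF smooth_fun_on_chart_coord[OF M c(1), of j]]] by simp
  qed
  have xV: "x \<in> ?V" using c x by blast
  obtain U \<psi> where u: "local_trivialization N TN (U, \<psi>)" "x \<in> U" "\<And>i. i < brank TN \<Longrightarrow> (\<lambda>a. \<psi> a i) \<in> \<Lambda>"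
  proof (rule TN.exchange_separating[OF x L xV])
    fix a b assume a: "a \<in> fibre TN x" and b: "b \<in> fibre TN x" and eq: "\<And>\<kappa>'. \<kappa>' \<in> \<Lambda> \<Longrightarrow> \<kappa>' a = \<kappa>' b"
    have ab: "fst a = x" "fst b = x" using a b x by (auto simp: fibre_tangent_bundle)
    have sub: "\<rho> ` fibre A x \<subseteq> fibre TM x" using \<rho>_fibre[OF x] by (rule image_subsetI)
    have "\<iota> a \<in> fibre TM x" "\<iota> b \<in> fibre TM x"
      by (rule subsetD[OF sub imageI[OF a, of \<iota>, unfolded \<iota>_image[OF x]]])
        (rule subsetD[OF sub imageI[OF b, of \<iota>, unfolded \<iota>_image[OF x]]])
    moreover have "tangent_triv M y (\<iota> a) i = tangent_triv M y (\<iota> b) i" if "i < brank TM" for i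
    proof -
      have i: "i < mdim M" using that by (simp add: tangent_bundle_simps)
      then have "(\<lambda>a. snd a (\<lambda>q. y q i)) \<in> \<Lambda>" by (auto simp: \<Lambda>_def)
      from eq[OF this] show ?thesis
        using i ab smooth_near_chart_coord[OF M c, of i] by (simp add: tangent_triv_def tangent_map_incl)
    qed
    ultimately have "\<iota> a = \<iota> b" by (rule fibre_iso_eqI[OF fibre_iso_tangent_triv[OF M c]])
    then show "a = b" by (rule inj_onD[OF \<iota>_inj _ fibre_total[OF a] fibre_total[OF b]])
  qed (assumption, rule that)
  have "smooth_functional N A\<^sub>N ?V (\<lambda>a. \<psi> (\<sigma> a) i)" if i: "i < brank TN" for i
  proof -
    obtain j where j: "(\<lambda>a. \<psi> a i) = (\<lambda>a. snd a (\<lambda>q. y q j))" using u(3)[OF i] by (auto simp: \<Lambda>_def)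
    have "smooth_functional N A\<^sub>N ?V (\<lambda>a. snd (\<rho> a) (\<lambda>q. y q j))"
      by (rule sf_restrict[OF sf_morphism[OF VT smooth_vbundle_axioms \<rho> sf_differential[OF M smooth_fun_on_chart_coord[OF M c(1)]]]])
    then show ?thesis
    proof (rule AN.sf_cong)
      fix z a assume z: "z \<in> ?V" and a: "a \<in> fibre A\<^sub>N z"
      have "a \<in> fibre A z" using a z fibre_A by blast
      then show "snd (\<rho> a) (\<lambda>q. y q j) = \<psi> (\<sigma> a) i"
        using snd_\<sigma>[of z a "\<lambda>q. y q j"] z smooth_near_chart_coord[OF M c(1)] fun_cong[OF j, of "\<sigma> a"] by simp
    qed
  qed
  moreover have "openin (mtop N) ?V"
    by (rule restricted_vbundle.open_restrict[OF restricted_A chartD(1)[OF M c(1)]])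
  ultimately show "\<exists>U \<psi> V. local_trivialization N TN (U, \<psi>) \<and> x \<in> U \<and> x \<in> V \<and>
       openin (mtop N) V \<and> (\<forall>i<brank TN. smooth_functional N A\<^sub>N V (\<lambda>a. \<psi> (\<sigma> a) i))"
    using u(1,2) xV by blast
qed

section \<open>The kernel as a subbundle over the leaf\<close>

lemma kernel_iff:
  assumes x: "x \<in> mpoints N" and a: "a \<in> fibre A x"
  shows "a \<in> K\<^sub>N \<longleftrightarrow> \<rho> a = (x, \<lambda>_. 0)" "a \<in> K\<^sub>N \<longleftrightarrow> \<sigma> a = (x, \<lambda>_. 0)"
proof -
  have xM: "x \<in> mpoints M" using x NM by blast
  show 1: "a \<in> K\<^sub>N \<longleftrightarrow> \<rho> a = (x, \<lambda>_. 0)"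
    using x a bproj_fibre[OF a] fibre_total[OF a]
    by (simp add: leaf_kernel_def morphism_kernel_def restrict_bundle_def bzero_tangent[OF M xM])
  have z: "(x, \<lambda>_. 0) \<in> fibre TN x" using x by (simp add: fibre_tangent_bundle tangent_space_def)
  have "\<iota> (x, \<lambda>_. 0) = (x, \<lambda>_. 0)" by (auto simp: tangent_map_incl)
  then have "\<rho> a = (x, \<lambda>_. 0) \<longleftrightarrow> \<iota> (\<sigma> a) = \<iota> (x, \<lambda>_. 0)" using \<iota>_\<sigma>[OF x a] by simp
  also have "\<dots> \<longleftrightarrow> \<sigma> a = (x, \<lambda>_. 0)"
    using inj_on_eq_iff[OF \<iota>_inj fibre_total[OF \<sigma>_fibre[OF x a]] fibre_total[OF z]] .
  finally show "a \<in> K\<^sub>N \<longleftrightarrow> \<sigma> a = (x, \<lambda>_. 0)" using 1 by simp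
qed

text \<open>The components of \<open>\<sigma>\<close> are independent at x0 because
  \<open>\<sigma>\<close> is onto: preimages of the frame vectors of \<open>TN\<close> are dual to
  them. They occupy the last n slots, in reverse order, so the kernel is described by the first r -
  n coordinates. Besides existence, the explicit last coordinates are used again in
  \<open>q_eq_iff\<close> and for the inverse of the anchor.\<close>

lemma adapted_ex:
  assumes c: "(W, \<phi>) \<in> mcharts N" "x0 \<in> W"
  obtains U \<psi> where "n \<le> r" "x0 \<in> U" "U \<subseteq> W" "adapted_trivialization N A\<^sub>N K\<^sub>N (r - n) (U, \<psi>)"
    "\<And>i a. i < n \<Longrightarrow> \<psi> a (r - 1 - i) = snd (\<sigma> a) (\<lambda>y. \<phi> y i)"
proof -
  interpret TN: smooth_vbundle N TN by (rule VN)
  interpret AN: smooth_vbundle N A\<^sub>N by (rule VA)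
  note cD = chartD[OF N c(1)]
  have Wm: "W \<subseteq> mpoints N" by (rule cD(5))
  have x0: "x0 \<in> mpoints N" using Wm c(2) by blast
  have sf: "smooth_functional N A\<^sub>N W (\<lambda>a. snd (\<sigma> a) (\<lambda>y. \<phi> y i))" for i
    by (rule sf_\<sigma>[OF sf_differential[OF N smooth_fun_on_chart_coord[OF N c(1)]]])
  have surj: "\<exists>a\<in>fibre A\<^sub>N x0. \<forall>i<n. snd (\<sigma> a) (\<lambda>y. \<phi> y i) = unit_vec s i" if s: "s < n" for s
  proof -
    note iso = fibre_iso_tangent_triv[OF N c]
    have s': "s < brank TN" using s by (simp add: tangent_bundle_simps)
    obtain a where a: "a \<in> fibre A x0" "\<sigma> a = frame TN (tangent_triv N \<phi>) s x0"
      by (rule \<sigma>_surj[OF x0 frame_mem[OF iso s']])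
    have "snd (\<sigma> a) (\<lambda>y. \<phi> y i) = unit_vec s i" if "i < n" for i
      using fun_cong[OF coord_frame[OF iso s'], of i] that unfolding a(2) by (simp add: tangent_triv_def split_beta)
    then show ?thesis using a(1) fibre_A[OF x0] by blast
  qed
  obtain U \<psi> where u: "n \<le> brank A\<^sub>N" "local_trivialization N A\<^sub>N (U, \<psi>)" "x0 \<in> U" "U \<subseteq> W"
    "\<And>i a. i < n \<Longrightarrow> \<psi> a (brank A\<^sub>N - 1 - i) = snd (\<sigma> a) (\<lambda>y. \<phi> y i)"
    by (rule AN.exchange_independent[OF x0 sf c(2) cD(1) surj]) (assumption, rule that)
  have u1: "n \<le> r" and u5: "\<psi> a (r - 1 - i) = snd (\<sigma> a) (\<lambda>y. \<phi> y i)" if "i < n" for i a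
    using u(1) u(5)[OF that] by (simp_all add: restrict_bundle_simps)
  have u1: "n \<le> r" using u(1) by (simp add: restrict_bundle_simps)
  have "\<psi> ` (K\<^sub>N \<inter> fibre A\<^sub>N x) = Rn (r - n)" if xU: "x \<in> U" for x
  proof -
    have xW: "x \<in> W" and x: "x \<in> mpoints N" using xU u(4) Wm by blast+
    note iso = AN.lt_iso[OF u(2) xU]
    have ker: "a \<in> K\<^sub>N \<longleftrightarrow> \<psi> a \<in> Rn (r - n)" if a: "a \<in> fibre A\<^sub>N x" for a
    proof -
      have a': "a \<in> fibre A x" using a fibre_A[OF x] by blast
      have s: "\<sigma> a \<in> fibre TN x" by (rule \<sigma>_fibre[OF x a'])
      have z: "(x, \<lambda>_. 0) \<in> fibre TN x" using x by (simp add: fibre_tangent_bundle tangent_space_def)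
      have "\<sigma> a = (x, \<lambda>_. 0) \<longleftrightarrow> (\<forall>i<n. snd (\<sigma> a) (\<lambda>y. \<phi> y i) = 0)"
      proof
        assume "\<forall>i<n. snd (\<sigma> a) (\<lambda>y. \<phi> y i) = 0"
        then show "\<sigma> a = (x, \<lambda>_. 0)"
          by (intro fibre_iso_eqI[OF fibre_iso_tangent_triv[OF N c(1) xW] s z])
            (simp add: tangent_triv_def split_beta tangent_bundle_simps)
      qed simp
      also have "\<dots> \<longleftrightarrow> (\<forall>i<n. \<psi> a (r - 1 - i) = 0)" using u5 by simp
      also have "\<dots> \<longleftrightarrow> (\<forall>j\<ge>r - n. \<psi> a j = 0)"
      proof
        assume h: "\<forall>i<n. \<psi> a (r - 1 - i) = 0"
        show "\<forall>j\<ge>r - n. \<psi> a j = 0"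
        proof (intro allI impI)
          fix j assume j: "r - n \<le> j"
          show "\<psi> a j = 0"
          proof (cases "j < r")
            case True
            then have "r - 1 - j < n" "r - 1 - (r - 1 - j) = j" using j by auto
            then show ?thesis using h by metis
          next
            case False
            then show ?thesis using fibre_iso_coord_0[OF iso a] by (simp add: restrict_bundle_simps)
          qed
        qed
      next
        assume "\<forall>j\<ge>r - n. \<psi> a j = 0"
        then show "\<forall>i<n. \<psi> a (r - 1 - i) = 0" by auto
      qed
      finally show ?thesis using kernel_iff(2)[OF x a'] by (simp add: Rn_iff)
    qed
    have "Rn (r - n) \<subseteq> \<psi> ` fibre A\<^sub>N x"
      using iso by (auto simp: fibre_iso_def bij_betw_def restrict_bundle_simps Rn_iff)
    then show ?thesis using ker by blast
  qed
  then have "adapted_trivialization N A\<^sub>N K\<^sub>N (r - n) (U, \<psi>)"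
    using u(2) by (simp add: adapted_trivialization_def)
  then show ?thesis by (rule that[OF u1 u(3,4) _ u5])
qed

lemma n_le_r: "n \<le> r"
proof -
  obtain x where x: "x \<in> mpoints N" using N_ne by blast
  obtain W \<phi> where c: "(W, \<phi>) \<in> mcharts N" "x \<in> W" by (rule chart_cover[OF N x])
  show ?thesis by (rule adapted_ex[OF c])
qed

lemma subbundle_of_rank_kernel: "subbundle_of_rank N A\<^sub>N K\<^sub>N (r - n)"
  unfolding subbundle_of_rank_def
proof (intro conjI ballI)
  show "vector_bundle N A\<^sub>N" using VA by (simp add: smooth_vbundle_def)
  show "K\<^sub>N \<subseteq> btotal A\<^sub>N" by (auto simp: leaf_kernel_def)
  show "r - n \<le> brank A\<^sub>N" by (simp add: restrict_bundle_simps)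
  fix x assume x: "x \<in> mpoints N"
  obtain W \<phi> where c: "(W, \<phi>) \<in> mcharts N" "x \<in> W" by (rule chart_cover[OF N x])
  obtain U \<psi> where "x \<in> U" "adapted_trivialization N A\<^sub>N K\<^sub>N (r - n) (U, \<psi>)" by (rule adapted_ex[OF c])
  then show "\<exists>U \<psi>. x \<in> U \<and> adapted_trivialization N A\<^sub>N K\<^sub>N (r - n) (U, \<psi>)" by blast
qed

text \<open>At one point of N two adapted trivializations carry the same kernel onto
  \<open>Rn k\<close> and onto \<open>Rn (r - n)\<close>. The change between them is a linear
  bijection, so k = r - n.\<close>

lemma subbundle_rank_kernel: "subbundle_rank N A\<^sub>N K\<^sub>N = r - n"
  unfolding subbundle_rank_def
proof (rule the_equality[of "\<lambda>k. subbundle_of_rank N A\<^sub>N K\<^sub>N k", OF subbundle_of_rank_kernel])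
  interpret AN: smooth_vbundle N A\<^sub>N by (rule VA)
  fix k assume k: "subbundle_of_rank N A\<^sub>N K\<^sub>N k"
  obtain x where x: "x \<in> mpoints N" using N_ne by blast
  obtain U \<psi> where u: "x \<in> U" "adapted_trivialization N A\<^sub>N K\<^sub>N k (U, \<psi>)"
    using k x unfolding subbundle_of_rank_def by blast
  obtain V \<xi> where v: "x \<in> V" "adapted_trivialization N A\<^sub>N K\<^sub>N (r - n) (V, \<xi>)"
    using subbundle_of_rank_kernel x unfolding subbundle_of_rank_def by blast
  have iu: "fibre_iso A\<^sub>N x \<psi>" and iv: "fibre_iso A\<^sub>N x \<xi>"
    using u v AN.lt_iso by (auto simp: adapted_trivialization_def)
  let ?F = "K\<^sub>N \<inter> fibre A\<^sub>N x"
  have bu: "bij_betw \<psi> ?F (Rn k)" and bv: "bij_betw \<xi> ?F (Rn (r - n))"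
    using u v iu iv unfolding adapted_trivialization_def fibre_iso_def bij_betw_def
    by (auto intro: inj_on_subset)
  let ?g = "inv_into ?F \<psi>"
  have g: "?g p \<in> ?F" "\<psi> (?g p) = p" if "p \<in> Rn k" for p
  proof -
    have "p \<in> \<psi> ` ?F" using that bij_betw_imp_surj_on[OF bu] by simp
    then show "?g p \<in> ?F" "\<psi> (?g p) = p" by (rule inv_into_into, rule f_inv_into_f)
  qed
  have bij: "bij_betw (\<lambda>p. \<xi> (?g p)) (Rn k) (Rn (r - n))"
    using bij_betw_trans[OF bij_betw_inv_into[OF bu] bv] by (simp add: o_def)
  have inj: "a = b" if "\<psi> a = \<psi> b" "a \<in> fibre A\<^sub>N x" "b \<in> fibre A\<^sub>N x" for a b
    using iu that unfolding fibre_iso_def bij_betw_def inj_on_def by blast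
  have ops: "badd A\<^sub>N a b \<in> fibre A\<^sub>N x" "\<psi> (badd A\<^sub>N a b) = (\<lambda>i. \<psi> a i + \<psi> b i)" "\<xi> (badd A\<^sub>N a b) = (\<lambda>i. \<xi> a i + \<xi> b i)"
    "bscale A\<^sub>N c a \<in> fibre A\<^sub>N x" "\<psi> (bscale A\<^sub>N c a) = (\<lambda>i. c * \<psi> a i)" "\<xi> (bscale A\<^sub>N c a) = (\<lambda>i. c * \<xi> a i)"
    if "a \<in> fibre A\<^sub>N x" "b \<in> fibre A\<^sub>N x" for a b c
    using iu iv that by (simp_all add: fibre_iso_def)
  show "k = r - n"
  proof (rule linear_bij_Rn_dim[OF bij])
    fix p q assume p: "p \<in> Rn k" and q: "q \<in> Rn k"
    have pq: "(\<lambda>i. p i + q i) \<in> Rn k" using p q by (simp add: Rn_iff)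
    have f: "?g p \<in> fibre A\<^sub>N x" "?g q \<in> fibre A\<^sub>N x" "?g (\<lambda>i. p i + q i) \<in> fibre A\<^sub>N x"
      using g(1)[OF p] g(1)[OF q] g(1)[OF pq] by blast+
    have "?g (\<lambda>i. p i + q i) = badd A\<^sub>N (?g p) (?g q)"
      by (rule inj[OF _ f(3) ops(1)[OF f(1,2)]]) (simp add: ops(2)[OF f(1,2)] g(2)[OF p] g(2)[OF q] g(2)[OF pq])
    then show "\<xi> (?g (\<lambda>i. p i + q i)) = (\<lambda>i. \<xi> (?g p) i + \<xi> (?g q) i)"
      by (simp add: ops(3)[OF f(1,2)])
  next
    fix c p assume p: "p \<in> Rn k"
    have cp: "(\<lambda>i. c * p i) \<in> Rn k" using p by (simp add: Rn_iff)
    have f: "?g p \<in> fibre A\<^sub>N x" "?g (\<lambda>i. c * p i) \<in> fibre A\<^sub>N x"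
      using g(1)[OF p] g(1)[OF cp] by blast+
    have "?g (\<lambda>i. c * p i) = bscale A\<^sub>N c (?g p)"
      by (rule inj[OF _ f(2) ops(4)[OF f(1,1)]]) (simp add: ops(5)[OF f(1,1)] g(2)[OF p] g(2)[OF cp])
    then show "\<xi> (?g (\<lambda>i. c * p i)) = (\<lambda>i. c * \<xi> (?g p) i)"
      by (simp add: ops(6)[OF f(1,1)])
  qed
qed

section \<open>The quotient bundle over the leaf and its anchor\<close>

sublocale Q: quotient_vbundle N A\<^sub>N K\<^sub>N "r - n"
proof -
  interpret AN: smooth_vbundle N A\<^sub>N by (rule VA)
  show "quotient_vbundle N A\<^sub>N K\<^sub>N (r - n)"
    by unfold_locales (rule subbundle_of_rank_kernel subbundle_rank_kernel)+
qed

abbreviation "Q\<^sub>N \<equiv> quotient_bundle N A\<^sub>N K\<^sub>N"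
abbreviation "q\<^sub>N \<equiv> bcoset A\<^sub>N K\<^sub>N"
abbreviation "\<rho>\<^sub>N \<equiv> leaf_anchor M \<rho> N"

lemma brank_Q: "brank Q\<^sub>N = n"
  using Q.brank_Q n_le_r by (simp add: restrict_bundle_simps)

lemma \<rho>_q_const:
  assumes x: "x \<in> mpoints N" and a: "a \<in> fibre A\<^sub>N x" and b: "b \<in> q\<^sub>N a"
  shows "\<rho> b = \<rho> a"
proof -
  have a': "a \<in> fibre A x" using a fibre_A[OF x] by blast
  obtain c where c: "c \<in> K\<^sub>N" "c \<in> fibre A\<^sub>N x" "b = badd A a c"
    using b Q.bproj_fibre[OF a] by (auto simp: bcoset_def restrict_bundle_simps)
  have c': "c \<in> fibre A x" using c(2) fibre_A[OF x] by blast
  have "\<rho> c = (x, \<lambda>_. 0)" using kernel_iff(1)[OF x c'] c(1) by blast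
  then have "\<rho> b = (fst (\<rho> a), \<lambda>f. snd (\<rho> a) f)"
    using bundle_morphismD(2)[OF \<rho> _ a' c'] x NM c(3) by (auto simp: tangent_bundle_simps)
  then show ?thesis by simp
qed

lemma quotient_map_q: "x \<in> mpoints N \<Longrightarrow> a \<in> fibre A\<^sub>N x \<Longrightarrow> quotient_map_of \<rho> (q\<^sub>N a) = \<rho> a"
  unfolding quotient_map_of_def by (rule Q.the_elem_q) (use \<rho>_q_const in auto)

lemma anchor_q: "x \<in> mpoints N \<Longrightarrow> a \<in> fibre A\<^sub>N x \<Longrightarrow> \<rho>\<^sub>N (q\<^sub>N a) = \<sigma> a"
  by (simp add: leaf_anchor_def quotient_map_q \<sigma>_def)

text \<open>In the trivialization of \<open>adapted_ex\<close> the last n coordinates of a are the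
  components of \<sigma> a, and they determine the coset of a.\<close>

lemma q_eq_iff:
  assumes x: "x \<in> mpoints N" and a: "a \<in> fibre A\<^sub>N x" and b: "b \<in> fibre A\<^sub>N x"
  shows "q\<^sub>N a = q\<^sub>N b \<longleftrightarrow> \<sigma> a = \<sigma> b"
proof
  assume "q\<^sub>N a = q\<^sub>N b"
  then show "\<sigma> a = \<sigma> b" using anchor_q[OF x a] anchor_q[OF x b] by simp
next
  assume eq: "\<sigma> a = \<sigma> b"
  obtain W \<phi> where c: "(W, \<phi>) \<in> mcharts N" "x \<in> W" by (rule chart_cover[OF N x])
  obtain U \<psi> where u: "x \<in> U" "adapted_trivialization N A\<^sub>N K\<^sub>N (r - n) (U, \<psi>)"
    "\<And>i a. i < n \<Longrightarrow> \<psi> a (r - 1 - i) = snd (\<sigma> a) (\<lambda>y. \<phi> y i)" by (rule adapted_ex[OF c]) (rule that)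
  note iso = Q.lt_iso[OF Q.adaptedD(1)[OF u(2)] u(1)]
  have "\<psi> a j = \<psi> b j" if j: "r - n \<le> j" for j
  proof (cases "j < r")
    case True
    then have "r - 1 - j < n" "r - 1 - (r - 1 - j) = j" using j by auto
    then show ?thesis using u(3)[of "r - 1 - j" a] u(3)[of "r - 1 - j" b] eq by simp
  next
    case False
    then show ?thesis using fibre_iso_coord_0[OF iso a] fibre_iso_coord_0[OF iso b] by (simp add: restrict_bundle_simps)
  qed
  then show "q\<^sub>N a = q\<^sub>N b" unfolding Q.q_eq[OF u(2,1) a] Q.q_eq[OF u(2,1) b] by auto
qed

lemma anchor_fibre: "x \<in> mpoints N \<Longrightarrow> C \<in> fibre Q\<^sub>N x \<Longrightarrow> \<rho>\<^sub>N C \<in> fibre TN x"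
  using anchor_q \<sigma>_fibre fibre_A by (auto simp: Q.fibre_Q)

lemma btotal_base: "a \<in> btotal A\<^sub>N \<Longrightarrow> a \<in> fibre A\<^sub>N (bproj A a) \<and> bproj A a \<in> mpoints N"
  by (simp add: restrict_bundle_def fibre_def)

lemma anchor_bij: "bij_betw \<rho>\<^sub>N (btotal Q\<^sub>N) (btotal TN)"
proof -
  have "inj_on \<rho>\<^sub>N (btotal Q\<^sub>N)"
  proof (rule inj_onI)
    fix C D assume "C \<in> btotal Q\<^sub>N" "D \<in> btotal Q\<^sub>N" and eq: "\<rho>\<^sub>N C = \<rho>\<^sub>N D"
    then obtain a b where ab: "a \<in> btotal A\<^sub>N" "C = q\<^sub>N a" "b \<in> btotal A\<^sub>N" "D = q\<^sub>N b" by (auto simp: Q.btotal_Q)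
    let ?x = "bproj A a" and ?y = "bproj A b"
    have x: "a \<in> fibre A\<^sub>N ?x" "?x \<in> mpoints N" and y: "b \<in> fibre A\<^sub>N ?y" "?y \<in> mpoints N"
      using btotal_base ab by auto
    \<comment> \<open>\<open>\<sigma>\<close> covers the identity, so equal anchors already force
      equal base points.\<close>
    have fst: "fst (\<sigma> c) = bproj A c" if c: "c \<in> fibre A\<^sub>N (bproj A c)" "bproj A c \<in> mpoints N" for c
      using \<sigma>_fibre[OF c(2)] c(1) c(2) unfolding fibre_A[OF c(2)] fibre_tangent_bundle
      by (metis mem_Times_iff singletonD)
    have "\<sigma> a = \<sigma> b" using eq unfolding ab(2,4) anchor_q[OF x(2,1)] anchor_q[OF y(2,1)] .
    moreover have "fst (\<sigma> a) = ?x" "fst (\<sigma> b) = ?y" by (rule fst[OF x], rule fst[OF y])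
    ultimately show "C = D" using q_eq_iff[OF x(2,1), of b] y(1) ab by simp
  qed
  moreover have "\<rho>\<^sub>N ` btotal Q\<^sub>N = btotal TN"
  proof
    show "\<rho>\<^sub>N ` btotal Q\<^sub>N \<subseteq> btotal TN"
    proof
      fix t assume "t \<in> \<rho>\<^sub>N ` btotal Q\<^sub>N"
      then obtain a where a: "a \<in> btotal A\<^sub>N" "t = \<rho>\<^sub>N (q\<^sub>N a)" by (auto simp: Q.btotal_Q)
      then have "t \<in> fibre TN (bproj A a)"
        using btotal_base[OF a(1)] anchor_fibre[of "bproj A a" "q\<^sub>N a"] by (simp add: Q.fibre_Q)
      then show "t \<in> btotal TN" by (rule fibre_total)
    qed
    show "btotal TN \<subseteq> \<rho>\<^sub>N ` btotal Q\<^sub>N"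
    proof
      fix t assume t: "t \<in> btotal TN"
      then have x: "fst t \<in> mpoints N" "t \<in> fibre TN (fst t)" by (auto simp: fibre_def tangent_bundle_simps)
      obtain a where a: "a \<in> fibre A (fst t)" "\<sigma> a = t" by (rule \<sigma>_surj[OF x])
      have a': "a \<in> fibre A\<^sub>N (fst t)" using a fibre_A[OF x(1)] by blast
      have "t = \<rho>\<^sub>N (q\<^sub>N a)" using anchor_q[OF x(1) a'] a(2) by simp
      then show "t \<in> \<rho>\<^sub>N ` btotal Q\<^sub>N" using fibre_total[OF a'] by (auto simp: Q.btotal_Q)
    qed
  qed
  ultimately show ?thesis by (simp add: bij_betw_def)
qed

lemma anchor_morphism: "bundle_morphism N Q\<^sub>N TN \<rho>\<^sub>N"
proof (rule bundle_morphismI[OF VN Q.vbundle_Q anchor_fibre])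
  interpret TN: smooth_vbundle N TN by (rule VN)
  fix V \<xi> i assume v: "(V, \<xi>) \<in> btrivs TN" and i: "i < brank TN"
  note t = TN.triv_local[OF v]
  have Vm: "V \<subseteq> mpoints N" using TN.lt_open[OF t] openin_subset by blast
  have "smooth_functional N A\<^sub>N V (\<lambda>a. \<xi> (\<rho>\<^sub>N (q\<^sub>N a)) i)"
    by (rule Q.sf_cong[OF sf_\<sigma>[OF TN.sf_coord[OF t i]]]) (use Vm anchor_q in auto)
  then show "smooth_functional N Q\<^sub>N V (\<lambda>a. \<xi> (\<rho>\<^sub>N a) i)" by (simp add: Q.sf_Q_iff)
qed

text \<open>In the quotient trivialization obtained from \<open>adapted_ex\<close> the inverse has
  the simplest possible components: up to the order of the indices they are the components of the
  tangent vector in the chart \<phi>.\<close>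

lemma anchor_inverse_morphism: "bundle_morphism N TN Q\<^sub>N (inv_into (btotal Q\<^sub>N) \<rho>\<^sub>N)"
proof -
  interpret TN: smooth_vbundle N TN by (rule VN)
  interpret QV: smooth_vbundle N Q\<^sub>N by (rule Q.vbundle_Q)
  let ?h = "inv_into (btotal Q\<^sub>N) \<rho>\<^sub>N"
  have h: "\<exists>a\<in>fibre A\<^sub>N x. ?h t = q\<^sub>N a \<and> \<sigma> a = t" if x: "x \<in> mpoints N" and t: "t \<in> fibre TN x" for x t
  proof -
    obtain a where a: "a \<in> fibre A x" "\<sigma> a = t" by (rule \<sigma>_surj[OF x t])
    have a': "a \<in> fibre A\<^sub>N x" using a fibre_A[OF x] by blast
    have "?h (\<rho>\<^sub>N (q\<^sub>N a)) = q\<^sub>N a"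
      using anchor_bij fibre_total[OF a'] by (intro inv_into_f_f) (auto simp: bij_betw_def Q.btotal_Q)
    then show ?thesis using anchor_q[OF x a'] a(2) a' by auto
  qed
  have hf: "?h t \<in> fibre Q\<^sub>N x" if "x \<in> mpoints N" "t \<in> fibre TN x" for x t
    using h[OF that] by (auto simp: Q.fibre_Q)
  show ?thesis
  proof (rule bundle_morphismI[OF Q.vbundle_Q VN hf])
    fix V \<xi> i assume v: "(V, \<xi>) \<in> btrivs Q\<^sub>N" and i: "i < brank Q\<^sub>N"
    note t = QV.triv_local[OF v]
    have Vm: "V \<subseteq> mpoints N" using QV.lt_open[OF t] openin_subset by blast
    show "smooth_functional N TN V (\<lambda>a. \<xi> (?h a) i)"
    proof (rule sf_pull[OF Q.vbundle_Q VN QV.sf_coord[OF t i]])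
      show "?h a \<in> fibre Q\<^sub>N x" if "x \<in> V" "a \<in> fibre TN x" for x a using hf that Vm by blast
      fix x assume "x \<in> V"
      then have x: "x \<in> mpoints N" using Vm by blast
      obtain W \<phi> where c: "(W, \<phi>) \<in> mcharts N" "x \<in> W" by (rule chart_cover[OF N x])
      obtain U \<psi> where u: "x \<in> U" "U \<subseteq> W" "adapted_trivialization N A\<^sub>N K\<^sub>N (r - n) (U, \<psi>)"
        "\<And>i a. i < n \<Longrightarrow> \<psi> a (r - 1 - i) = snd (\<sigma> a) (\<lambda>y. \<phi> y i)" by (rule adapted_ex[OF c]) (rule that)
      note lt = Q.adapted_lt_quot[OF u(3)]
      have U: "openin (mtop N) U" by (rule QV.lt_open[OF lt])
      have Um: "U \<subseteq> mpoints N" by (rule openin_subset[OF U])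
      have "smooth_functional N TN U (\<lambda>a. Q.quot_triv \<psi> (?h a) j)" if j: "j < brank Q\<^sub>N" for j
      proof (rule TN.sf_cong)
        have j': "j < n" using j brank_Q by simp
        \<comment> \<open>Counted from the end, as in \<open>adapted_ex\<close>, the slot r - n + j
          has number n - 1 - j.\<close>
        then have e: "r - n + j = r - 1 - (n - 1 - j)" "n - 1 - j < n" using n_le_r by auto
        show "smooth_functional N TN U (\<lambda>a. snd a (\<lambda>y. \<phi> y (n - 1 - j)))"
          by (rule sf_differential[OF N smooth_fun_on_subset[OF N smooth_fun_on_chart_coord[OF N c(1)] U u(2)]])
        fix z a assume z: "z \<in> U" and a: "a \<in> fibre TN z"
        then have "z \<in> mpoints N" using Um by blast
        from h[OF this a] obtain b where b: "b \<in> fibre A\<^sub>N z" "?h a = q\<^sub>N b" "\<sigma> b = a" by blast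
        show "snd a (\<lambda>y. \<phi> y (n - 1 - j)) = Q.quot_triv \<psi> (?h a) j"
          unfolding b(2) Q.quot_triv_q[OF u(3) z b(1)] e(1) u(4)[OF e(2)] b(3) ..
      qed
      then show "\<exists>U \<psi> V. local_trivialization N Q\<^sub>N (U, \<psi>) \<and> x \<in> U \<and> x \<in> V \<and>
         openin (mtop N) V \<and> (\<forall>i<brank Q\<^sub>N. smooth_functional N TN V (\<lambda>a. \<psi> (?h a) i))"
        using lt u(1) U by blast
    qed
  qed
qed

lemma anchor_iso: "bundle_isomorphism N Q\<^sub>N TN \<rho>\<^sub>N"
  unfolding bundle_isomorphism_def using anchor_bij anchor_morphism anchor_inverse_morphism by blast

lemma quotient_map_morphism: "bundle_morphism N Q\<^sub>N (restrict_bundle TM N) (quotient_map_of \<rho>)"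
proof (rule bundle_morphismI[OF VR Q.vbundle_Q])
  interpret TM: smooth_vbundle M TM by (rule VT)
  show "quotient_map_of \<rho> C \<in> fibre (restrict_bundle TM N) x" if "x \<in> mpoints N" "C \<in> fibre Q\<^sub>N x" for x C
    using that quotient_map_q \<rho>_fibre by (auto simp: Q.fibre_Q fibre_restrict)
  fix V' \<xi> i assume "(V', \<xi>) \<in> btrivs (restrict_bundle TM N)" and i: "i < brank (restrict_bundle TM N)"
  then obtain V where v: "(V, \<xi>) \<in> btrivs TM" and V': "V' = V \<inter> mpoints N" by (auto simp: restrict_bundle_simps)
  have i: "i < brank TM" using i by (simp add: restrict_bundle_simps)
  have "smooth_functional N A\<^sub>N V' (\<lambda>a. \<xi> (\<rho> a) i)"
    unfolding V' by (rule sf_restrict[OF sf_morphism[OF VT smooth_vbundle_axioms \<rho> TM.sf_coord[OF TM.triv_local[OF v] i]]])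
  then have "smooth_functional N A\<^sub>N V' (\<lambda>a. \<xi> (quotient_map_of \<rho> (q\<^sub>N a)) i)"
    by (rule Q.sf_cong) (use V' quotient_map_q in auto)
  then show "smooth_functional N Q\<^sub>N V' (\<lambda>a. \<xi> (quotient_map_of \<rho> a) i)" by (simp add: Q.sf_Q_iff)
qed

lemma quotient_map_image: "quotient_map_of \<rho> ` btotal Q\<^sub>N = \<iota> ` btotal TN"
proof -
  have "quotient_map_of \<rho> C = \<iota> (\<rho>\<^sub>N C)" if C: "C \<in> btotal Q\<^sub>N" for C
  proof -
    obtain a where a: "a \<in> btotal A\<^sub>N" "C = q\<^sub>N a" using C by (auto simp: Q.btotal_Q)
    have x: "bproj A a \<in> mpoints N" "a \<in> fibre A\<^sub>N (bproj A a)" using btotal_base[OF a(1)] by auto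
    show ?thesis
      unfolding a(2) quotient_map_q[OF x] anchor_q[OF x] using \<iota>_\<sigma>[OF x(1)] x(2) fibre_A[OF x(1)] by simp
  qed
  then have "quotient_map_of \<rho> ` btotal Q\<^sub>N = \<iota> ` \<rho>\<^sub>N ` btotal Q\<^sub>N" by (simp add: image_image)
  then show ?thesis using anchor_bij by (simp add: bij_betw_def)
qed

section \<open>The bracket induced on the quotient\<close>

lemma anchored_Q: "anchored_bundle N Q\<^sub>N \<rho>\<^sub>N"
  using N Q.vbundle_Q anchor_morphism by (simp add: anchored_bundle_def smooth_vbundle_def)

definition B\<^sub>N where
  "B\<^sub>N X Y = sec_map N (inv_into (btotal Q\<^sub>N) \<rho>\<^sub>N) (vf_bracket N (sec_map N \<rho>\<^sub>N X) (sec_map N \<rho>\<^sub>N Y))"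

lemma B\<^sub>N: "lie_bracket N Q\<^sub>N \<rho>\<^sub>N B\<^sub>N"
    "lie_algebra_isomorphism N Q\<^sub>N B\<^sub>N TN (vf_bracket N) (sec_map N \<rho>\<^sub>N)"
    "X \<in> sections N Q\<^sub>N \<Longrightarrow> Y \<in> sections N Q\<^sub>N \<Longrightarrow>
      sec_map N \<rho>\<^sub>N (B\<^sub>N X Y) = vf_bracket N (sec_map N \<rho>\<^sub>N X) (sec_map N \<rho>\<^sub>N Y)"
  using transport_vf_bracket[OF Q.vbundle_Q anchor_iso] unfolding B\<^sub>N_def[abs_def] by blast+

text \<open>The two vector fields are related by the inclusion over W. Functions are defined on the
  whole type, so the same f serves on M and on N and its restriction to N is silent.\<close>

lemma related_apply:
  assumes X: "X \<in> sections N Q\<^sub>N" and X': "X' \<in> sections M A" and W: "openin (mtop N) W"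
    and eq: "\<And>y. y \<in> W \<Longrightarrow> X y = q\<^sub>N (X' y)" and x: "x \<in> W" and f: "smooth_near M x f"
  shows "snd (sec_map N \<rho>\<^sub>N X x) f = snd (sec_map M \<rho> X' x) f"
proof -
  have xN: "x \<in> mpoints N" using x W openin_subset by blast
  then have xM: "x \<in> mpoints M" using NM by blast
  have X'x: "X' x \<in> fibre A x" by (rule section_fibre[OF X' xM])
  then have "\<rho>\<^sub>N (X x) = \<sigma> (X' x)" using eq[OF x] anchor_q[OF xN] fibre_A[OF xN] by simp
  then show ?thesis using snd_\<sigma>[OF xN X'x f] xN xM by (simp add: sec_map_def)
qed

lemma smooth_near_restrict: "x \<in> mpoints N \<Longrightarrow> smooth_near M x f \<Longrightarrow> smooth_near N x f"
  using smooth_fun_restrict unfolding smooth_near_def by blast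

text \<open>Brackets of vector fields related by an immersion are related. This compares the two
  values after applying \<open>\<iota>\<close> and \<open>\<rho>\<^sub>N\<close>, both of which are
  injective.\<close>

lemma induces_B\<^sub>N:
  assumes B: "pre_lie_algebroid M A \<rho> B"
  shows "induces_bracket M A \<rho> N B B\<^sub>N"
  unfolding induces_bracket_def Let_def leaf_quotient_def
proof (intro ballI allI impI)
  fix X Y X' Y' W x
  assume X: "X \<in> sections N Q\<^sub>N" and Y: "Y \<in> sections N Q\<^sub>N" and X': "X' \<in> sections M A" and Y': "Y' \<in> sections M A"
    and W: "openin (mtop N) W" and eq: "\<forall>x\<in>W. X x = q\<^sub>N (X' x) \<and> Y x = q\<^sub>N (Y' x)" and x: "x \<in> W"
  have xN: "x \<in> mpoints N" using x W openin_subset by blast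
  then have xM: "x \<in> mpoints M" using NM by blast
  have alb: "almost_lie_bracket M A \<rho> B"
    and br: "\<forall>X\<in>sections M A. \<forall>Y\<in>sections M A. sec_map M \<rho> (B X Y) = vf_bracket M (sec_map M \<rho> X) (sec_map M \<rho> Y)"
    using B unfolding pre_lie_algebroid_def by blast+
  have BXY: "B X' Y' \<in> sections M A" by (rule almost_lie_bracketD(1)[OF alb X' Y'])
  have fA: "B X' Y' x \<in> fibre A x" by (rule section_fibre[OF BXY xM])
  then have fAN: "B X' Y' x \<in> fibre A\<^sub>N x" using fibre_A[OF xN] by simp
  have cl: "B\<^sub>N X Y \<in> sections N Q\<^sub>N"
    using B\<^sub>N(1) almost_lie_bracketD(1)[OF _ X Y] unfolding lie_bracket_def by blast
  have bf: "B\<^sub>N X Y x \<in> fibre Q\<^sub>N x" by (rule smooth_vbundle.section_fibre[OF Q.vbundle_Q cl xN])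
  have vX: "sec_map N \<rho>\<^sub>N X \<in> vector_fields N" and vY: "sec_map N \<rho>\<^sub>N Y \<in> vector_fields N"
    by (rule sec_map_section[OF VN Q.vbundle_Q anchor_morphism X], rule sec_map_section[OF VN Q.vbundle_Q anchor_morphism Y])
  have wX: "sec_map M \<rho> X' \<in> vector_fields M" and wY: "sec_map M \<rho> Y' \<in> vector_fields M"
    by (rule sec_map_section[OF VT smooth_vbundle_axioms \<rho> X'], rule sec_map_section[OF VT smooth_vbundle_axioms \<rho> Y'])
  \<comment> \<open>Relatedness is used twice. For the inner derivative it is available only where
    the sections correspond and f is smooth, hence the open set
    \<open>W \<inter> (O' \<inter> mpoints N)\<close>; the outer one is taken at x itself, applied
    to a function again smooth near x on M.\<close>
  have two: "snd (sec_map N \<rho>\<^sub>N X x) (\<lambda>y. snd (sec_map N \<rho>\<^sub>N Y y) f) = snd (sec_map M \<rho> X' x) (\<lambda>y. snd (sec_map M \<rho> Y' y) f)"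
    if X: "X \<in> sections N Q\<^sub>N" and Y: "Y \<in> sections N Q\<^sub>N" and X': "X' \<in> sections M A" and Y': "Y' \<in> sections M A"
      and eqX: "\<And>x. x \<in> W \<Longrightarrow> X x = q\<^sub>N (X' x)" and eqY: "\<And>x. x \<in> W \<Longrightarrow> Y x = q\<^sub>N (Y' x)" and f: "smooth_near M x f"
    for X Y X' Y' f
  proof -
    have vX: "sec_map N \<rho>\<^sub>N X \<in> vector_fields N" and vY: "sec_map N \<rho>\<^sub>N Y \<in> vector_fields N"
      by (rule sec_map_section[OF VN Q.vbundle_Q anchor_morphism X], rule sec_map_section[OF VN Q.vbundle_Q anchor_morphism Y])
    have wY: "sec_map M \<rho> Y' \<in> vector_fields M"
      by (rule sec_map_section[OF VT smooth_vbundle_axioms \<rho> Y'])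
    obtain O' where O': "x \<in> O'" "smooth_fun_on M O' f" "openin (mtop M) O'" using smooth_near_obtain[OF f] .
    have o: "openin (mtop N) (W \<inter> (O' \<inter> mpoints N))"
      by (rule openin_Int[OF W restricted_vbundle.open_restrict[OF restricted_A O'(3)]])
    have "snd (sec_map N \<rho>\<^sub>N X x) (\<lambda>y. snd (sec_map N \<rho>\<^sub>N Y y) f) = snd (sec_map N \<rho>\<^sub>N X x) (\<lambda>y. snd (sec_map M \<rho> Y' y) f)"
    proof (rule vf_apply_cong[OF N vX xN vf_smooth_near[OF N vY smooth_near_restrict[OF xN f]] o])
      show "x \<in> W \<inter> (O' \<inter> mpoints N)" using x O'(1) xN by blast
      show "snd (sec_map N \<rho>\<^sub>N Y y) f = snd (sec_map M \<rho> Y' y) f" if "y \<in> W \<inter> (O' \<inter> mpoints N)" for y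
        by (rule related_apply[OF Y Y' W eqY _ smooth_nearI[OF O'(2)]]) (use that in auto)
    qed
    also have "\<dots> = snd (sec_map M \<rho> X' x) (\<lambda>y. snd (sec_map M \<rho> Y' y) f)"
      by (rule related_apply[OF X X' W eqX x vf_smooth_near[OF M wY f]])
    finally show ?thesis .
  qed
  have "snd (\<rho>\<^sub>N (B\<^sub>N X Y x)) f = snd (\<rho> (B X' Y' x)) f" if f: "smooth_near M x f" for f
  proof -
    have "snd (\<rho>\<^sub>N (B\<^sub>N X Y x)) f = snd (vf_bracket N (sec_map N \<rho>\<^sub>N X) (sec_map N \<rho>\<^sub>N Y) x) f"
      using fun_cong[OF B\<^sub>N(3)[OF X Y], of x] xN by (simp add: sec_map_def)
    also have "\<dots> = snd (vf_bracket M (sec_map M \<rho> X') (sec_map M \<rho> Y') x) f"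
      unfolding vf_bracket_apply[OF xN smooth_near_restrict[OF xN f]] vf_bracket_apply[OF xM f]
      using two[OF X Y X' Y' _ _ f] two[OF Y X Y' X' _ _ f] eq by simp
    also have "\<dots> = snd (sec_map M \<rho> (B X' Y') x) f" using br X' Y' by simp
    finally show ?thesis using xM by (simp add: sec_map_def)
  qed
  moreover have fst: "fst (\<rho>\<^sub>N (B\<^sub>N X Y x)) = x" "fst (\<rho> (B X' Y' x)) = x" "snd (\<rho> (B X' Y' x)) \<in> tangent_space M x"
    using anchor_fibre[OF xN bf] \<rho>_fibre[OF xN fA] xN xM by (auto simp: fibre_tangent_bundle)
  \<comment> \<open>On functions not smooth near x both sides are 0: on the left by definition of
    \<open>\<iota>\<close>, on the right because tangent vectors vanish there.\<close>
  ultimately have "\<iota> (\<rho>\<^sub>N (B\<^sub>N X Y x)) = \<rho> (B X' Y' x)"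
    using tangentD(1)[OF fst(3)] by (simp add: tangent_map_incl prod_eq_iff fun_eq_iff)
  also have "\<dots> = \<iota> (\<rho>\<^sub>N (q\<^sub>N (B X' Y' x)))" using anchor_q[OF xN fAN] \<iota>_\<sigma>[OF xN fA] by simp
  finally have "\<rho>\<^sub>N (B\<^sub>N X Y x) = \<rho>\<^sub>N (q\<^sub>N (B X' Y' x))"
    by (rule inj_onD[OF \<iota>_inj])
      (use fibre_total[OF anchor_fibre[OF xN bf]] fibre_total[OF anchor_fibre[OF xN]] fAN in \<open>auto simp: Q.fibre_Q\<close>)
  then show "B\<^sub>N X Y x = q\<^sub>N (B X' Y' x)"
    by (rule inj_onD[OF bij_betw_imp_inj_on[OF anchor_bij]])
      (use fibre_total[OF bf] fibre_total[OF fAN] in \<open>auto simp: Q.btotal_Q\<close>)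
qed

text \<open>The r sections s j of A generate the sections of the quotient near x0, though they need
  not project to independent ones. A section X of the quotient lifts through the last n frame
  vectors of an adapted trivialization, and these are expanded in a frame of A, which the s j equal
  where b = 1. The set V is chosen before X, so two sections can be expanded over the same
  V.\<close>

lemma sections_Q_local_frame:
  assumes x0: "x0 \<in> mpoints N"
  obtains s V where "\<And>j. j < r \<Longrightarrow> s j \<in> sections M A" "openin (mtop N) V" "x0 \<in> V"
    "\<And>X. X \<in> sections N Q\<^sub>N \<Longrightarrow> \<exists>f. (\<forall>j<r. smooth_fun_on N V (f j)) \<and>
       (\<forall>x\<in>V. \<forall>\<kappa>. fibre_linear Q\<^sub>N x \<kappa> \<longrightarrow> \<kappa> (X x) = (\<Sum>j<r. f j x * \<kappa> (q\<^sub>N (s j x))))"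
proof -
  interpret QV: smooth_vbundle N Q\<^sub>N by (rule Q.vbundle_Q)
  have xM: "x0 \<in> mpoints M" using x0 NM by blast
  obtain U \<xi> where u: "(U, \<xi>) \<in> btrivs A" "x0 \<in> U" by (rule triv_cover[OF xM])
  note t = triv_local[OF u(1)]
  obtain b :: "'a \<Rightarrow> real" and C V where b: "smooth_fun_on M (mpoints M) b" "closedin (mtop M) C"
    "C \<subseteq> U" "\<And>y. y \<notin> C \<Longrightarrow> b y = 0" "openin (mtop M) V" "x0 \<in> V" "V \<subseteq> C" "\<And>y. y \<in> V \<Longrightarrow> b y = 1"
    by (rule manifold_bump[OF M lt_open[OF t] u(2)]) (rule that)
  have "\<exists>s. s \<in> sections M A \<and> (\<forall>x\<in>U. \<forall>\<kappa>. fibre_linear A x \<kappa> \<longrightarrow> \<kappa> (s x) = b x * \<kappa> (frame A \<xi> j x))"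
    if j: "j < r" for j
  proof -
    obtain s where "s \<in> sections M A"
      "\<And>x \<kappa>. x \<in> U \<Longrightarrow> fibre_linear A x \<kappa> \<Longrightarrow> \<kappa> (s x) = b x * \<kappa> (frame A \<xi> j x)"
      by (rule frame_section[OF t j b(1-3) b(4)]) (assumption, rule that)
    then show ?thesis by blast
  qed
  then have "\<forall>j\<in>{..<r}. \<exists>s. s \<in> sections M A \<and> (\<forall>x\<in>U. \<forall>\<kappa>. fibre_linear A x \<kappa> \<longrightarrow> \<kappa> (s x) = b x * \<kappa> (frame A \<xi> j x))"
    by blast
  from bchoice[OF this] obtain s where s: "\<And>j. j < r \<Longrightarrow> s j \<in> sections M A"
    "\<And>j x \<kappa>. j < r \<Longrightarrow> x \<in> U \<Longrightarrow> fibre_linear A x \<kappa> \<Longrightarrow> \<kappa> (s j x) = b x * \<kappa> (frame A \<xi> j x)" by blast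
  obtain P \<psi> where p: "x0 \<in> P" "adapted_trivialization N A\<^sub>N K\<^sub>N (r - n) (P, \<psi>)" by (rule Q.adapted_cover[OF x0])
  note lt = Q.adaptedD(1)[OF p(2)] and ltQ = Q.adapted_lt_quot[OF p(2)]
  note tN = restricted_vbundle.lt_restrict[OF restricted_A t]
  let ?V = "P \<inter> (V \<inter> mpoints N)" and ?UN = "U \<inter> mpoints N"
  have Vo: "openin (mtop N) ?V"
    by (rule openin_Int[OF Q.lt_open[OF lt] restricted_vbundle.open_restrict[OF restricted_A b(5)]])
  have VU: "?V \<subseteq> ?UN" "?V \<subseteq> P" using b(3,7) by auto
  have kn: "r - n + i < brank A\<^sub>N" if "i < brank Q\<^sub>N" for i
    using that brank_Q n_le_r by (simp add: restrict_bundle_simps)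
  show thesis
  proof (rule that[OF s(1) Vo])
    show "x0 \<in> ?V" using p b x0 by blast
    fix X assume X: "X \<in> sections N Q\<^sub>N"
    \<comment> \<open>The coordinates of X in the quotient frame, multiplied by the matrix that
      expresses the lifted frame vectors in the frame of A.\<close>
    define f where "f j x = (\<Sum>i<brank Q\<^sub>N. Q.quot_triv \<psi> (X x) i * \<xi> (frame A\<^sub>N \<psi> (r - n + i) x) j)" for j x
    have fs: "smooth_fun_on N ?V (f j)" if j: "j < r" for j
      unfolding f_def
    proof (intro smooth_fun_on_sum[OF N Vo] smooth_fun_on_mult[OF N])
      fix i assume "i \<in> {..<brank Q\<^sub>N}"
      then have i: "i < brank Q\<^sub>N" by simp
      have j': "j < brank A\<^sub>N" using j by (simp add: restrict_bundle_simps)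
      show "smooth_fun_on N ?V (\<lambda>x. Q.quot_triv \<psi> (X x) i)"
        by (rule smooth_fun_on_subset[OF N QV.sf_section[OF X QV.sf_coord[OF ltQ i]] Vo VU(2)])
      show "smooth_fun_on N ?V (\<lambda>x. \<xi> (frame A\<^sub>N \<psi> (r - n + i) x) j)"
        by (rule smooth_fun_on_subset[OF N Q.sf_frame[OF Q.sf_coord[OF tN j'] lt kn[OF i]] Vo]) (use VU in blast)
    qed
    have "\<kappa> (X x) = (\<Sum>j<r. f j x * \<kappa> (q\<^sub>N (s j x)))" if x: "x \<in> ?V" and k: "fibre_linear Q\<^sub>N x \<kappa>" for x \<kappa>
    proof -
      have xU: "x \<in> U" "x \<in> ?UN" and xP: "x \<in> P" and xV: "x \<in> V" and xN: "x \<in> mpoints N" using x VU by auto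
      have kq: "fibre_linear A\<^sub>N x (\<lambda>a. \<kappa> (q\<^sub>N a))" using Q.fibre_linear_Q[OF xN] k by blast
      have sq: "\<kappa> (q\<^sub>N (s j x)) = \<kappa> (q\<^sub>N (frame A\<^sub>N \<xi> j x))" if j: "j < r" for j
        using s(2)[OF j xU(1), of "\<lambda>a. \<kappa> (q\<^sub>N a)"] kq b(8)[OF xV]
        by (simp add: fibre_linear_restrict[OF xN] frame_restrict[OF xN])
      have "\<kappa> (X x) = (\<Sum>i<brank Q\<^sub>N. Q.quot_triv \<psi> (X x) i * \<kappa> (frame Q\<^sub>N (Q.quot_triv \<psi>) i x))"
        by (rule fibre_linear_expand[OF QV.lt_iso[OF ltQ xP] k QV.section_fibre[OF X xN]])
      also have "\<dots> = (\<Sum>i<brank Q\<^sub>N. Q.quot_triv \<psi> (X x) i * (\<Sum>j<r. \<xi> (frame A\<^sub>N \<psi> (r - n + i) x) j * \<kappa> (q\<^sub>N (s j x))))"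
      proof (rule sum.cong[OF refl])
        fix i assume "i \<in> {..<brank Q\<^sub>N}"
        then have i: "i < brank Q\<^sub>N" by simp
        have "\<kappa> (q\<^sub>N (frame A\<^sub>N \<psi> (r - n + i) x)) = (\<Sum>j<brank A\<^sub>N. \<xi> (frame A\<^sub>N \<psi> (r - n + i) x) j * \<kappa> (q\<^sub>N (frame A\<^sub>N \<xi> j x)))"
          by (rule fibre_linear_expand[OF Q.lt_iso[OF tN xU(2)] kq frame_mem[OF Q.lt_iso[OF lt xP] kn[OF i]]])
        also have "\<dots> = (\<Sum>j<r. \<xi> (frame A\<^sub>N \<psi> (r - n + i) x) j * \<kappa> (q\<^sub>N (s j x)))"
          by (rule sum.cong) (simp_all add: restrict_bundle_simps sq)
        finally show "Q.quot_triv \<psi> (X x) i * \<kappa> (frame Q\<^sub>N (Q.quot_triv \<psi>) i x) =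
          Q.quot_triv \<psi> (X x) i * (\<Sum>j<r. \<xi> (frame A\<^sub>N \<psi> (r - n + i) x) j * \<kappa> (q\<^sub>N (s j x)))"
          by (simp add: Q.frame_quot_triv[OF p(2) xP i])
      qed
      also have "\<dots> = (\<Sum>j<r. f j x * \<kappa> (q\<^sub>N (s j x)))"
        unfolding f_def sum_distrib_left sum_distrib_right by (subst sum.swap) (simp add: mult.assoc)
      finally show ?thesis .
    qed
    with fs show "\<exists>f. (\<forall>j<r. smooth_fun_on N ?V (f j)) \<and>
       (\<forall>x\<in>?V. \<forall>\<kappa>. fibre_linear Q\<^sub>N x \<kappa> \<longrightarrow> \<kappa> (X x) = (\<Sum>j<r. f j x * \<kappa> (q\<^sub>N (s j x))))"
      by (intro exI[of _ f]) blast
  qed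
qed

text \<open>The condition \<open>induces_bracket\<close>, taken with W all of N, fixes both brackets
  on the projections e j of sections over M. As these generate near each point with coefficients
  smooth on N, tensoriality of the difference gives equality, and no function or section over N has
  to be extended to M.\<close>

lemma induced_unique:
  assumes B: "almost_lie_bracket N Q\<^sub>N \<rho>\<^sub>N B1" "almost_lie_bracket N Q\<^sub>N \<rho>\<^sub>N B2"
    and ind: "induces_bracket M A \<rho> N B B1" "induces_bracket M A \<rho> N B B2"
    and X: "X \<in> sections N Q\<^sub>N" and Y: "Y \<in> sections N Q\<^sub>N"
  shows "B1 X Y = B2 X Y"
proof -
  interpret QV: smooth_vbundle N Q\<^sub>N by (rule Q.vbundle_Q)
  show ?thesis
  proof (rule QV.section_eqI[OF almost_lie_bracketD(1)[OF B(1) X Y] almost_lie_bracketD(1)[OF B(2) X Y]])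
    fix x0 assume x0: "x0 \<in> mpoints N"
    obtain s V where s: "\<And>j. j < r \<Longrightarrow> s j \<in> sections M A" and V: "openin (mtop N) V" "x0 \<in> V"
      and loc: "\<And>X. X \<in> sections N Q\<^sub>N \<Longrightarrow> \<exists>f. (\<forall>j<r. smooth_fun_on N V (f j)) \<and>
       (\<forall>x\<in>V. \<forall>\<kappa>. fibre_linear Q\<^sub>N x \<kappa> \<longrightarrow> \<kappa> (X x) = (\<Sum>j<r. f j x * \<kappa> (q\<^sub>N (s j x))))"
      by (rule sections_Q_local_frame[OF x0]) (rule that)
    have Vm: "V \<subseteq> mpoints N" by (rule openin_subset[OF V(1)])
    define e where "e j = (\<lambda>x\<in>mpoints N. q\<^sub>N (s j x))" for j
    have e: "e j \<in> sections N Q\<^sub>N" if j: "j < r" for j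
    proof -
      have "(\<lambda>x\<in>mpoints N. q\<^sub>N (restrict (s j) (mpoints N) x)) \<in> sections N Q\<^sub>N"
        by (rule Q.q_section[OF restricted_vbundle.section_restrict[OF restricted_A s[OF j]]])
      moreover have "(\<lambda>x\<in>mpoints N. q\<^sub>N (restrict (s j) (mpoints N) x)) = e j"
        unfolding e_def by (rule restrict_ext) simp
      ultimately show ?thesis by simp
    qed
    have val: "B' (e i) (e j) x0 = q\<^sub>N (B (s i) (s j) x0)"
      if ind: "induces_bracket M A \<rho> N B B'" and ij: "i < r" "j < r" for B' i j
    proof -
      have top: "openin (mtop N) (mpoints N)" by simp
      have "\<forall>x\<in>mpoints N. e i x = q\<^sub>N (s i x) \<and> e j x = q\<^sub>N (s j x)" by (simp add: e_def)
      from ind[unfolded induces_bracket_def Let_def leaf_quotient_def, rule_format, OF e[OF ij(1)] e[OF ij(2)] s[OF ij(1)] s[OF ij(2)] top this[rule_format] x0]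
      show ?thesis .
    qed
    obtain f where f: "\<forall>j<r. smooth_fun_on N V (f j)"
      "\<forall>x\<in>V. \<forall>\<kappa>. fibre_linear Q\<^sub>N x \<kappa> \<longrightarrow> \<kappa> (X x) = (\<Sum>j<r. f j x * \<kappa> (q\<^sub>N (s j x)))" using loc[OF X] by blast
    obtain g where g: "\<forall>j<r. smooth_fun_on N V (g j)"
      "\<forall>x\<in>V. \<forall>\<kappa>. fibre_linear Q\<^sub>N x \<kappa> \<longrightarrow> \<kappa> (Y x) = (\<Sum>j<r. g j x * \<kappa> (q\<^sub>N (s j x)))" using loc[OF Y] by blast
    show "B1 X Y x0 = B2 X Y x0"
    proof (rule QV.almost_lie_brackets_agree[where p = r and e = e and W = V and f = f and g = g, OF B])
      show "B1 (e i) (e j) x0 = B2 (e i) (e j) x0" if "i < r" "j < r" for i j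
        using val[OF ind(1) that] val[OF ind(2) that] by simp
      show "\<kappa> (X x) = (\<Sum>j<r. f j x * \<kappa> (e j x))" "\<kappa> (Y x) = (\<Sum>j<r. g j x * \<kappa> (e j x))"
        if "x \<in> V" "fibre_linear Q\<^sub>N x \<kappa>" for x \<kappa>
        using f(2) g(2) that Vm by (auto simp: e_def)
    qed (use e X Y V f(1) g(1) in auto)
  qed
qed

end

theorem proposition3p2p2:
  fixes M :: "'a manifold" and A :: "('a, 'b) vbundle"
    and \<rho> :: "'b \<Rightarrow> 'a \<times> (('a \<Rightarrow> real) \<Rightarrow> real)"
  assumes "smooth_manifold M" and "connected_space (mtop M)" and "paracompact_space (mtop M)"
    and "anchored_bundle M A \<rho>"
  shows "(foliated M A \<rho> \<longleftrightarrow> (\<exists>B. pre_lie_algebroid M A \<rho> B)) \<and>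
    (foliated M A \<rho> \<longrightarrow> (\<forall>N. leaf M (anchor_distribution A \<rho>) N \<longrightarrow>
      (let A\<^sub>N = restrict_bundle A N;
           K\<^sub>N = leaf_kernel M A \<rho> N;
           Q\<^sub>N = leaf_quotient M A \<rho> N;
           \<rho>\<^sub>N = leaf_anchor M \<rho> N
       in subbundle N A\<^sub>N K\<^sub>N \<and>
          (\<forall>a\<in>btotal A\<^sub>N. quotient_map_of \<rho> (bcoset A\<^sub>N K\<^sub>N a) = \<rho> a) \<and>
          bundle_morphism N Q\<^sub>N (restrict_bundle (tangent_bundle M) N) (quotient_map_of \<rho>) \<and>
          quotient_map_of \<rho> ` btotal Q\<^sub>N = tangent_inclusion N M ` btotal (tangent_bundle N) \<and>
          bundle_isomorphism N Q\<^sub>N (tangent_bundle N) \<rho>\<^sub>N \<and>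
          anchored_bundle N Q\<^sub>N \<rho>\<^sub>N \<and>
          (\<exists>B\<^sub>N. lie_bracket N Q\<^sub>N \<rho>\<^sub>N B\<^sub>N \<and>
             (\<forall>B. pre_lie_algebroid M A \<rho> B \<longrightarrow>
                induces_bracket M A \<rho> N B B\<^sub>N \<and>
                (\<forall>B'. almost_lie_bracket N Q\<^sub>N \<rho>\<^sub>N B' \<and> induces_bracket M A \<rho> N B B' \<longrightarrow>
                   (\<forall>X\<in>sections N Q\<^sub>N. \<forall>Y\<in>sections N Q\<^sub>N. B' X Y = B\<^sub>N X Y))) \<and>
             lie_algebra_isomorphism N Q\<^sub>N B\<^sub>N (tangent_bundle N) (vf_bracket N)
               (sec_map N \<rho>\<^sub>N)))))"
proof (intro conjI impI allI)
  show "foliated M A \<rho> \<longleftrightarrow> (\<exists>B. pre_lie_algebroid M A \<rho> B)"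
    using foliated_imp_pre_lie_algebroid[OF _ assms(3)] pre_lie_algebroid_imp_foliated by blast
next
  fix N assume leaf: "leaf M (anchor_distribution A \<rho>) N"
  interpret integral_leaf M A \<rho> N
    by unfold_locales (use assms leaf in \<open>auto simp: anchored_bundle_def leaf_def\<close>)
  have alb: "almost_lie_bracket N Q\<^sub>N \<rho>\<^sub>N B\<^sub>N" using B\<^sub>N(1) by (simp add: lie_bracket_def)
  have qm: "\<forall>a\<in>btotal A\<^sub>N. quotient_map_of \<rho> (q\<^sub>N a) = \<rho> a"
    using btotal_base quotient_map_q by blast
  have sub: "subbundle N A\<^sub>N K\<^sub>N" unfolding subbundle_def using subbundle_of_rank_kernel by blast
  have br: "\<forall>B. pre_lie_algebroid M A \<rho> B \<longrightarrow> induces_bracket M A \<rho> N B B\<^sub>N \<and>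
      (\<forall>B'. almost_lie_bracket N Q\<^sub>N \<rho>\<^sub>N B' \<and> induces_bracket M A \<rho> N B B' \<longrightarrow>
         (\<forall>X\<in>sections N Q\<^sub>N. \<forall>Y\<in>sections N Q\<^sub>N. B' X Y = B\<^sub>N X Y))"
  proof (intro allI impI conjI ballI)
    fix B B' X Y
    assume B: "pre_lie_algebroid M A \<rho> B"
    show ind: "induces_bracket M A \<rho> N B B\<^sub>N" by (rule induces_B\<^sub>N[OF B])
    assume "almost_lie_bracket N Q\<^sub>N \<rho>\<^sub>N B' \<and> induces_bracket M A \<rho> N B B'"
      and XY: "X \<in> sections N Q\<^sub>N" "Y \<in> sections N Q\<^sub>N"
    then show "B' X Y = B\<^sub>N X Y" using induced_unique[OF _ alb _ ind XY] by simp
  qed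
  show "let A\<^sub>N = restrict_bundle A N;
           K\<^sub>N = leaf_kernel M A \<rho> N;
           Q\<^sub>N = leaf_quotient M A \<rho> N;
           \<rho>\<^sub>N = leaf_anchor M \<rho> N
       in subbundle N A\<^sub>N K\<^sub>N \<and>
          (\<forall>a\<in>btotal A\<^sub>N. quotient_map_of \<rho> (bcoset A\<^sub>N K\<^sub>N a) = \<rho> a) \<and>
          bundle_morphism N Q\<^sub>N (restrict_bundle (tangent_bundle M) N) (quotient_map_of \<rho>) \<and>
          quotient_map_of \<rho> ` btotal Q\<^sub>N = tangent_inclusion N M ` btotal (tangent_bundle N) \<and>
          bundle_isomorphism N Q\<^sub>N (tangent_bundle N) \<rho>\<^sub>N \<and>
          anchored_bundle N Q\<^sub>N \<rho>\<^sub>N \<and>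
          (\<exists>B\<^sub>N. lie_bracket N Q\<^sub>N \<rho>\<^sub>N B\<^sub>N \<and>
             (\<forall>B. pre_lie_algebroid M A \<rho> B \<longrightarrow>
                induces_bracket M A \<rho> N B B\<^sub>N \<and>
                (\<forall>B'. almost_lie_bracket N Q\<^sub>N \<rho>\<^sub>N B' \<and> induces_bracket M A \<rho> N B B' \<longrightarrow>
                   (\<forall>X\<in>sections N Q\<^sub>N. \<forall>Y\<in>sections N Q\<^sub>N. B' X Y = B\<^sub>N X Y))) \<and>
             lie_algebra_isomorphism N Q\<^sub>N B\<^sub>N (tangent_bundle N) (vf_bracket N)
               (sec_map N \<rho>\<^sub>N))"
    unfolding Let_def leaf_quotient_def
    by (intro conjI exI[of _ B\<^sub>N] sub qm quotient_map_morphism quotient_map_image anchor_iso anchored_Q B\<^sub>N(1,2) br)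
qed

end
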